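(* Let $k$ be an algebraically closed field of characteristic zero, let $\mathfrak g$ be a finite dimensional simple Lie superalgebra over $k$, and let $\sigma_1,\sigma_2$ be automorphisms of $\mathfrak g$ of finite order. Let $\mathrm F$ be the (finite) group of $k$-points of the quotient of the algebraic group $\mathbf{Aut}\,\mathfrak g$ by its connected component of the identity, and let $\ \bar{}:\mathbf{Aut}\,\mathfrak g(k)\to\mathrm F$ be the canonical surjective group homomorphism. The following two conditions are equivalent: (i) $L(\mathfrak g,\sigma_1)$ and $L(\mathfrak g,\sigma_2)$ are isomorphic as $k$-Lie superalgebras; (ii) $\bar\sigma_1$ is conjugate in $\mathrm F$ to either $\bar\sigma_2$ or $\bar\sigma_2^{-1}$.
   Context: Automorphisms of a Lie superalgebra $\mathfrak g=\mathfrak g_{\bar0}\oplus\mathfrak g_{\bar1}$ are linear bracket preserving bijections that stabilize $\mathfrak g_{\bar0}$ and $\mathfrak g_{\bar1}$; isomorphisms also preserve the $\mathbb Z_2$-grading. $\mathbf{Aut}\,\mathfrak g$ is the affine $k$-group sending a commutative associative unital $k$-algebra $A$ to the group of automorphisms of the $A$-Lie superalgebra $\mathfrak g\otimes_kA$. Fix a compatible family $(\zeta_m)_{m\ge1}$ of primitive $m$-th roots of unity in $k$ (so $\zeta_{lm}^l=\zeta_m$). Let $\sigma$ be an automorphism of $\mathfrak g$ with $\sigma^m=1$. Put $\mathfrak g_{i}^{\sigma}=\{x\in\mathfrak g:\sigma(x)=\zeta_m^ix\}$ for $i\in\mathbb Z$ (depending only on $i$ mod $m$). The loop algebra is the $k$-Lie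 superalgebra $$L(\mathfrak g,\sigma)=\bigoplus_{i\in\mathbb Z}\mathfrak g_i^{\sigma}\otimes z^i\subset\mathfrak g\otimes_kk[z^{\pm1}],$$ with bracket $[x\otimes z^i,y\otimes z^j]=[x,y]\otimes z^{i+j}$ and $\mathbb Z_2$-grading inherited from $\mathfrak g$. Up to isomorphism it does not depend on the choice of the period $m$. *)

theory Defs
  imports
    "HOL-Library.Z2"
    "HOL-Library.Poly_Mapping"
    "HOL-Computational_Algebra.Polynomial"
    "HOL-Algebra.Bij"
    "HOL-Algebra.Coset"
    "HOL-Analysis.Abstract_Topology_2"
begin

section \<open>Lie superalgebras\<close>

text \<open>
  The underlying space of a superalgebra is a subspace \<open>carrier L\<close> of the vector space that
  \<open>scal L\<close> defines on the type \<^typ>\<open>'a\<close>; \<open>brkt L\<close> is only relevant on that subspace.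
  The two homogeneous components are indexed by \<^typ>\<open>bit\<close>, the field with two elements.
\<close>

record ('k, 'a) superalgebra = "'a partial_object" +
  scal :: "'k \<Rightarrow> 'a \<Rightarrow> 'a"
  brkt :: "'a \<Rightarrow> 'a \<Rightarrow> 'a"
  part :: "bit \<Rightarrow> 'a set"

definition koszul_sign :: "bit \<Rightarrow> bit \<Rightarrow> 'k::ring_1" where
  "koszul_sign p q = (if p * q = 1 then - 1 else 1)"

locale lie_superalgebra = vector_space "scal L"
  for L :: "('k::field, 'a::ab_group_add) superalgebra" (structure) +
  assumes subspace_part: "subspace (part L p)"
    and part_Int: "part L 0 \<inter> part L 1 = {0}"
    and part_sum: "carrier L = {x + y | x y. x \<in> part L 0 \<and> y \<in> part L 1}"
    and brkt_part: "x \<in> part L p \<Longrightarrow> y \<in> part L q \<Longrightarrow> brkt L x y \<in> part L (p + q)"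
    and brkt_add_left: "\<lbrakk>x \<in> carrier L; y \<in> carrier L; z \<in> carrier L\<rbrakk>
          \<Longrightarrow> brkt L (x + y) z = brkt L x z + brkt L y z"
    and brkt_add_right: "\<lbrakk>x \<in> carrier L; y \<in> carrier L; z \<in> carrier L\<rbrakk>
          \<Longrightarrow> brkt L x (y + z) = brkt L x y + brkt L x z"
    and brkt_scal_left: "\<lbrakk>x \<in> carrier L; y \<in> carrier L\<rbrakk>
          \<Longrightarrow> brkt L (scal L c x) y = scal L c (brkt L x y)"
    and brkt_scal_right: "\<lbrakk>x \<in> carrier L; y \<in> carrier L\<rbrakk>
          \<Longrightarrow> brkt L x (scal L c y) = scal L c (brkt L x y)"
    and skew: "\<lbrakk>x \<in> part L p; y \<in> part L q\<rbrakk>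
          \<Longrightarrow> brkt L x y = - scal L (koszul_sign p q) (brkt L y x)"
    and jacobi: "\<lbrakk>x \<in> part L p; y \<in> part L q; z \<in> part L r\<rbrakk>
          \<Longrightarrow> brkt L x (brkt L y z)
            = brkt L (brkt L x y) z + scal L (koszul_sign p q) (brkt L y (brkt L x z))"
begin

definition finite_dim :: bool where
  "finite_dim \<longleftrightarrow> (\<exists>B. finite B \<and> span B = carrier L)"

definition graded_ideal :: "'a set \<Rightarrow> bool" where
  "graded_ideal I \<longleftrightarrow> subspace I
     \<and> I = {x + y | x y. x \<in> I \<inter> part L 0 \<and> y \<in> I \<inter> part L 1}
     \<and> (\<forall>x\<in>carrier L. \<forall>y\<in>I. brkt L x y \<in> I \<and> brkt L y x \<in> I)"

end

locale simple_lie_superalgebra = lie_superalgebra +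
  assumes nonabelian: "\<exists>x\<in>carrier L. \<exists>y\<in>carrier L. brkt L x y \<noteq> 0"
    and simple: "graded_ideal I \<Longrightarrow> I = {0} \<or> I = carrier L"

definition sa_iso :: "('k, 'a::plus) superalgebra \<Rightarrow> ('k, 'b::plus) superalgebra \<Rightarrow> ('a \<Rightarrow> 'b) set"
  where "sa_iso L M = {f. bij_betw f (carrier L) (carrier M)
     \<and> (\<forall>x\<in>carrier L. \<forall>y\<in>carrier L. f (x + y) = f x + f y)
     \<and> (\<forall>c. \<forall>x\<in>carrier L. f (scal L c x) = scal M c (f x))
     \<and> (\<forall>x\<in>carrier L. \<forall>y\<in>carrier L. f (brkt L x y) = brkt M (f x) (f y))
     \<and> (\<forall>p. f ` part L p = part M p)}"

definition sa_isomorphic :: "('k, 'a::plus) superalgebra \<Rightarrow> ('k, 'b::plus) superalgebra \<Rightarrow> bool"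
  where "sa_isomorphic L M \<longleftrightarrow> sa_iso L M \<noteq> {}"


section \<open>The automorphism group and its group of components\<close>

definition sa_auto :: "('k, 'a::plus) superalgebra \<Rightarrow> ('a \<Rightarrow> 'a) set" where
  "sa_auto L = Bij (carrier L) \<inter> sa_iso L L"

definition Aut :: "('k, 'a::plus) superalgebra \<Rightarrow> ('a \<Rightarrow> 'a) monoid" where
  "Aut L = BijGroup (carrier L) \<lparr>carrier := sa_auto L\<rparr>"

definition functionals :: "('k::comm_ring_1, 'a::plus) superalgebra \<Rightarrow> ('a \<Rightarrow> 'k) set" where
  "functionals L = {l. (\<forall>x\<in>carrier L. \<forall>y\<in>carrier L. l (x + y) = l x + l y)
     \<and> (\<forall>c. \<forall>x\<in>carrier L. l (scal L c x) = c * l x)}"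

text \<open>
  The polynomial functions in the matrix entries of an endomorphism, without a choice of basis:
  the functions \<open>f \<mapsto> l (f x)\<close> are the linear combinations of matrix entries.
\<close>

inductive_set polyfuns :: "('k::comm_ring_1, 'a::plus) superalgebra \<Rightarrow> (('a \<Rightarrow> 'a) \<Rightarrow> 'k) set"
  for L :: "('k, 'a) superalgebra"
where
  const: "(\<lambda>f. c) \<in> polyfuns L"
| coord: "\<lbrakk>l \<in> functionals L; x \<in> carrier L\<rbrakk> \<Longrightarrow> (\<lambda>f. l (f x)) \<in> polyfuns L"
| add: "\<lbrakk>p \<in> polyfuns L; q \<in> polyfuns L\<rbrakk> \<Longrightarrow> (\<lambda>f. p f + q f) \<in> polyfuns L"
| mult: "\<lbrakk>p \<in> polyfuns L; q \<in> polyfuns L\<rbrakk> \<Longrightarrow> (\<lambda>f. p f * q f) \<in> polyfuns L"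

text \<open>
  Over an algebraically closed field of characteristic zero the affine group scheme of
  automorphisms is a smooth group variety and may be identified with its group of rational points
  \<open>Aut L\<close> with the Zariski topology. This topology is generated by the principal open sets;
  the inverse of the determinant would add no further ones.
\<close>

definition zariski :: "('k::comm_ring_1, 'a::plus) superalgebra \<Rightarrow> ('a \<Rightarrow> 'a) topology" where
  "zariski L = topology_generated_by {{f \<in> carrier (Aut L). p f \<noteq> 0} | p. p \<in> polyfuns L}"

definition Aut0 :: "('k::comm_ring_1, 'a::plus) superalgebra \<Rightarrow> ('a \<Rightarrow> 'a) set" where
  "Aut0 L = connected_component_of_set (zariski L) \<one>\<^bsub>Aut L\<^esub>"

definition comp_group :: "('k::comm_ring_1, 'a::plus) superalgebra \<Rightarrow> ('a \<Rightarrow> 'a) set monoid" where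
  "comp_group L = Aut L Mod Aut0 L"

definition comp_class :: "('k::comm_ring_1, 'a::plus) superalgebra \<Rightarrow> ('a \<Rightarrow> 'a) \<Rightarrow> ('a \<Rightarrow> 'a) set"
  where "comp_class L \<sigma> = Aut0 L #>\<^bsub>Aut L\<^esub> \<sigma>"

definition conjugate_in :: "('a, 'b) monoid_scheme \<Rightarrow> 'a \<Rightarrow> 'a \<Rightarrow> bool" where
  "conjugate_in G a b \<longleftrightarrow> (\<exists>h\<in>carrier G. a = h \<otimes>\<^bsub>G\<^esub> b \<otimes>\<^bsub>G\<^esub> inv\<^bsub>G\<^esub> h)"


section \<open>Loop algebras\<close>

definition compatible_roots :: "(nat \<Rightarrow> 'k::field) \<Rightarrow> bool" where
  "compatible_roots \<zeta> \<longleftrightarrow>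
     (\<forall>m\<ge>1. \<zeta> m ^ m = 1 \<and> (\<forall>j. 0 < j \<and> j < m \<longrightarrow> \<zeta> m ^ j \<noteq> 1))
     \<and> (\<forall>l\<ge>1. \<forall>m\<ge>1. \<zeta> (l * m) ^ l = \<zeta> m)"

definition eigen :: "(nat \<Rightarrow> 'k::field) \<Rightarrow> ('k, 'a) superalgebra \<Rightarrow> ('a \<Rightarrow> 'a) \<Rightarrow> nat \<Rightarrow> int \<Rightarrow> 'a set"
  where "eigen \<zeta> L \<sigma> m i = {x \<in> carrier L. \<sigma> x = scal L (\<zeta> m powi i) x}"

text \<open>
  The tensor product of \<open>L\<close> with the Laurent polynomials consists of the finitely supported
  functions from the integers to \<open>L\<close>; the tensor of \<open>x\<close> with the \<open>i\<close>-th power of the variable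
  is \<open>Poly_Mapping.single i x\<close>.
\<close>

definition loop_algebra :: "(nat \<Rightarrow> 'k::field) \<Rightarrow> ('k, 'a::ab_group_add) superalgebra \<Rightarrow> ('a \<Rightarrow> 'a) \<Rightarrow> nat
    \<Rightarrow> ('k, int \<Rightarrow>\<^sub>0 'a) superalgebra"
  where "loop_algebra \<zeta> L \<sigma> m =
    \<lparr>carrier = {u. \<forall>i. Poly_Mapping.lookup u i \<in> eigen \<zeta> L \<sigma> m i},
     scal = (\<lambda>c. Poly_Mapping.map (scal L c)),
     brkt = (\<lambda>u v. \<Sum>i\<in>Poly_Mapping.keys u. \<Sum>j\<in>Poly_Mapping.keys v.
               Poly_Mapping.single (i + j) (brkt L (Poly_Mapping.lookup u i) (Poly_Mapping.lookup v j))),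
     part = (\<lambda>p. {u. \<forall>i. Poly_Mapping.lookup u i \<in> eigen \<zeta> L \<sigma> m i \<inter> part L p})\<rparr>"

end

theory Submission
  imports
    Defs
    "HOL-Library.Function_Algebras"
    "HOL-Computational_Algebra.Formal_Power_Series"
    "HOL-Computational_Algebra.Polynomial_FPS"
begin

text \<open>
  Evaluate a loop at a point \<open>a\<close> of the punctured line. As \<open>L\<close> is simple, the centroid of a loop
  algebra consists of Laurent polynomials, so an isomorphism of loop algebras induces automorphisms
  \<open>ph a\<close> of \<open>L\<close> that depend on \<open>a\<close> as a Laurent polynomial. Rotating \<open>a\<close> by a root of unity shows that
  they intertwine the first automorphism with the second one or its inverse; as the punctured line is
  connected, \<open>ph\<close> and its rotation lie in one component.

  Conversely, for \<open>s\<close> of finite order the conjugates of the products of \<open>s\<close> with a maximal torus and with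
  unipotent elements of its centraliser form a family with surjective differential, whose image therefore
  contains an open set. Hence two such families in one component meet. Retracting eigenvalues onto roots
  of unity removes the unipotent parts and makes the torus parts finite order; a change of the loop variable
  by weights of the torus absorbs these.
\<close>

section \<open>Commutative algebra inside a ring type\<close>

text \<open>The field is an abstract algebraically closed field of characteristic zero, so neither
  an analytic exponential nor an inverse function theorem is at hand. Curves are therefore rational,
  with formal Taylor series, and a surjective differential means that each even derivation is the
  velocity of such a curve. That derivations exhaust the tangent directions is seen modulo the
  square of the maximal ideal; leading forms and Krull's theorem then turn vanishing along curves
  into vanishing on a neighbourhood. The differential need not be surjective at \<open>s\<close>
  itself, since the centraliser of \<open>s\<close> may exceed that of \<open>s\<close> together
  with the torus. The base point is \<open>s\<close> times a torus element of finite order that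
  separates all weights. Its centraliser is spanned by central toral and by nilpotent derivations,
  and both kinds integrate algebraically. Two families that meet in \<open>x\<close> are compared
  through a function of \<open>x\<close> alone: the retraction onto roots of unity, applied to the
  eigenvalues of \<open>x\<close>, can be computed in either family, and both computations give the
  same linear map.\<close>

definition subrng :: "'r::comm_ring_1 set => bool" where
 "subrng S \<longleftrightarrow> 0 : S & 1 : S & (ALL a:S. ALL b:S. a + b : S & a * b : S & - a : S)"

definition ideal_in :: "'r::comm_ring_1 set => 'r set => bool" where
 "ideal_in S I \<longleftrightarrow> I <= S & 0 : I & (ALL a:I. ALL b:I. a + b : I) & (ALL s:S. ALL a:I. s * a : I)"

definition gen_ideal :: "'r::comm_ring_1 set => 'r set => 'r set" where
 "gen_ideal S F = {SUM f:F. s f * f | s. ALL f:F. s f : S}"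

definition noeth :: "'r::comm_ring_1 set => bool" where
 "noeth S \<longleftrightarrow> subrng S
  & (ALL I. ideal_in S I --> (EX F. finite F & F <= I & I <= gen_ideal S F))"

text \<open>Known as \<open>S[x]\<close>. The element \<open>x\<close> may satisfy relations over
  \<open>S\<close>, so this is a quotient of a polynomial ring and not necessarily a free
  one.\<close>

definition adj :: "'r::comm_ring_1 set => 'r => 'r set" where
 "adj S x = {poly p x | p. ALL i. coeff p i : S}"

lemma subrngD:
 assumes "subrng S"
 shows "0 : S" "1 : S" "a : S ==> b : S ==> a + b : S" "a : S ==> b : S ==> a * b : S"
  "a : S ==> - a : S" "a : S ==> b : S ==> a - b : S"
 using assms unfolding subrng_def by (auto simp: diff_conv_add_uminus simp del: add_uminus_conv_diff)

lemma subrng_sum: "subrng S ==> (!!i. i : I ==> f i : S) ==> sum f I : S" by (induction I rule: infinite_finite_induct) (auto simp: subrngD)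

lemma subrng_prod: "subrng S ==> (!!i. i : I ==> f i : S) ==> prod f I : S"
 by (induction I rule: infinite_finite_induct) (auto simp: subrngD)

lemma subrng_power: "subrng S ==> a : S ==> a ^ n : S" by (induction n) (auto simp: subrngD)

lemma ideal_inD:
 assumes "ideal_in S I"
 shows "I <= S" "0 : I" "a : I ==> b : I ==> a + b : I" "s : S ==> a : I ==> s * a : I" using assms unfolding ideal_in_def by auto

lemma ideal_in_uminus: "subrng S ==> ideal_in S I ==> a : I ==> - a : I" using ideal_inD(4)[of S I "-1" a] by (auto simp: subrngD)

lemma ideal_in_diff: "subrng S ==> ideal_in S I ==> a : I ==> b : I ==> a - b : I" using ideal_inD(3)[of S I a "-b"] ideal_in_uminus by auto

lemma ideal_in_sum: "ideal_in S I ==> (!!i. i : J ==> f i : I) ==> sum f J : I"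
 by (induction J rule: infinite_finite_induct) (auto simp: ideal_inD)

lemma gen_ideal_subset: "ideal_in S I ==> F <= I ==> gen_ideal S F <= I"
 unfolding gen_ideal_def by (auto intro!: ideal_in_sum intro: ideal_inD(4))

lemma gen_ideal_ideal:
 assumes S: "subrng S" and F: "F <= S"
 shows "ideal_in S (gen_ideal S F)" unfolding ideal_in_def proof (intro conjI ballI)
 show "gen_ideal S F <= S" unfolding gen_ideal_def using F by (auto intro!: subrng_sum[OF S] subrngD(4)[OF S])
 show "0 : gen_ideal S F" unfolding gen_ideal_def using subrngD(1)[OF S] by (auto intro!: exI[of _ "%_. 0"])
next
 fix a b assume "a : gen_ideal S F" "b : gen_ideal S F"
 then obtain s t where "a = (SUM f:F. s f * f)" "b = (SUM f:F. t f * f)" "ALL f:F. s f : S" "ALL f:F. t f : S"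
  unfolding gen_ideal_def by blast
 thus "a + b : gen_ideal S F" unfolding gen_ideal_def using subrngD(3)[OF S]
  by (auto intro!: exI[of _ "%f. s f + t f"] simp: sum.distrib distrib_right)
next
 fix r a assume "r : S" "a : gen_ideal S F"
 then obtain s where "a = (SUM f:F. s f * f)" "ALL f:F. s f : S" unfolding gen_ideal_def by blast
 thus "r * a : gen_ideal S F" unfolding gen_ideal_def using subrngD(4)[OF S] `r : S`
  by (auto intro!: exI[of _ "%f. r * s f"] simp: sum_distrib_left mult.assoc)
qed

lemma gen_ideal_mem:
 assumes S: "subrng S" and F: "finite F" "f : F"
 shows "f : gen_ideal S F" proof -
 have "(SUM g:F. (if g = f then 1 else 0) * g) = (SUM g:F. if g = f then g else 0)" by (intro sum.cong) auto
 also have "... = f" using F by simp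
 finally show ?thesis unfolding gen_ideal_def using subrngD(1,2)[OF S] by (auto intro!: exI[of _ "%g. if g = f then 1 else 0"])
qed

lemma adj_subring:
 assumes S: "subrng S" shows "subrng (adj S x)" unfolding subrng_def proof (intro conjI ballI)
 show "0 : adj S x" unfolding adj_def using subrngD(1)[OF S] by (auto intro!: exI[of _ 0])
 show "1 : adj S x" unfolding adj_def using subrngD(1,2)[OF S] by (auto intro!: exI[of _ 1] simp: one_pCons coeff_pCons split: nat.split)
next
 fix a b assume "a : adj S x" "b : adj S x"
 then obtain p q where pq: "a = poly p x" "b = poly q x" "ALL i. coeff p i : S" "ALL i. coeff q i : S" unfolding adj_def by blast
 show "a + b : adj S x" unfolding adj_def using pq by (auto intro!: exI[of _ "p + q"] subrngD(3)[OF S])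
 show "a * b : adj S x" unfolding adj_def using pq by (auto intro!: exI[of _ "p * q"] subrng_sum[OF S] subrngD(4)[OF S] simp: coeff_mult)
 show "- a : adj S x" unfolding adj_def using pq by (auto intro!: exI[of _ "- p"] subrngD(5)[OF S])
qed

lemma adj_base:
 assumes S: "subrng S" shows "S <= adj S x" proof
 fix a assume "a : S"
 thus "a : adj S x" unfolding adj_def using subrngD(1)[OF S] by (auto intro!: exI[of _ "[:a:]"] simp: coeff_pCons split: nat.split)
qed

lemma adj_gen:
 assumes S: "subrng S" shows "x : adj S x" unfolding adj_def using subrngD(1,2)[OF S]
 by (auto intro!: exI[of _ "[:0,1:]"] simp: coeff_pCons split: nat.split)

lemma adj_least:
 assumes T: "subrng T" and "S <= T" "x : T"
 shows "adj S x <= T" proof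
 fix a assume "a : adj S x"
 then obtain p where p: "a = poly p x" "ALL i. coeff p i : S" unfolding adj_def by blast
 show "a : T" unfolding p(1) poly_altdef using p(2) assms by (intro subrng_sum[OF T] subrngD(4)[OF T] subrng_power[OF T]) auto
qed

lemma noethD: "noeth S ==> subrng S"
 "noeth S ==> ideal_in S I ==> EX F. finite F & F <= I & I <= gen_ideal S F" unfolding noeth_def by auto

lemma noeth_chain:
 fixes I :: "nat => 'r::comm_ring_1 set"
 assumes S: "noeth S" and I: "!!n. ideal_in S (I n)" and mono: "!!n. I n <= I (Suc n)"
 shows "EX n. ALL m. I m <= I n" proof -
 have mono': "I m <= I n" if "m <= n" for m n using mono that by (rule lift_Suc_mono_le)
 have id: "ideal_in S (UN n. I n)" unfolding ideal_in_def proof (intro conjI ballI)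
  fix a b assume "a : (UN n. I n)" "b : (UN n. I n)"
  then obtain m n where "a : I m" "b : I n" by blast
  hence "a : I (max m n)" "b : I (max m n)" using mono'[of m "max m n"] mono'[of n "max m n"] by auto
  thus "a + b : (UN n. I n)" using ideal_inD(3)[OF I, of a "max m n" b] by auto
 next
  fix r a assume "r : S" "a : (UN n. I n)"
  thus "r * a : (UN n. I n)" using ideal_inD(4)[OF I] by auto
 qed (use ideal_inD(1,2)[OF I] in auto)
 obtain F where F: "finite F" "F <= (UN n. I n)" "(UN n. I n) <= gen_ideal S F" using noethD(2)[OF S id] by auto
 have "EX n. F <= I n" using F(1,2) proof (induction F)
  case (insert f F)
  then obtain m n where "f : I m" "F <= I n" by auto
  hence "insert f F <= I (max m n)" using mono'[of m "max m n"] mono'[of n "max m n"] by auto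
  thus ?case by blast
 qed auto
 then obtain n where "F <= I n" by blast
 hence "gen_ideal S F <= I n" by (rule gen_ideal_subset[OF I])
 with F(3) have "ALL m. I m <= I n" by auto
 thus ?thesis ..
qed

lemma degree_diff_less_or_zero:
 fixes p q :: "'r::comm_ring_1 poly"
 assumes "degree q <= degree p" "coeff q (degree p) = coeff p (degree p)"
 shows "degree (p - q) < degree p | p - q = 0" proof -
 have "degree (p - q) <= degree p" using assms(1) by (intro degree_diff_le) auto
 moreover have "coeff (p - q) (degree p) = 0" using assms(2) by simp
 ultimately show ?thesis by (metis leading_coeff_0_iff le_neq_implies_less)
qed

text \<open>Since \<open>x\<close> may satisfy relations, the ideal is pulled back to the set
  \<open>P\<close> of polynomials over \<open>S\<close> with value in \<open>I\<close>. The
  coefficients at place \<open>d\<close> of its members of degree at most \<open>d\<close> form an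
  increasing chain of ideals of \<open>S\<close>; generators of the finitely many ideals up to the
  stationary one lift to generators of \<open>I\<close>.\<close>

lemma hilbert_basis:
 assumes S: "noeth S" shows "noeth (adj S x)" unfolding noeth_def proof (intro conjI allI impI)
 note S' = noethD(1)[OF S]
 show sub: "subrng (adj S x)" using adj_subring S' .
 fix I assume I: "ideal_in (adj S x) I"
 define P where "P = {p. (ALL i. coeff p i : S) & poly p x : I}"
 define L where "L d = {coeff p d | p. p : P & degree p <= d}" for d
 have P_add: "p + q : P" if "p : P" "q : P" for p q using that unfolding P_def by (auto intro: subrngD(3)[OF S'] ideal_inD(3)[OF I])
 have P_mult: "q * p : P" if "p : P" "ALL i. coeff q i : S" for p q proof -
  have "poly q x : adj S x" using that(2) unfolding adj_def by auto
  thus ?thesis using that unfolding P_def by (auto intro!: ideal_inD(4)[OF I] subrng_sum[OF S'] subrngD(4)[OF S'] simp: coeff_mult)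
 qed
 have P_smult: "smult c p : P" if "p : P" "c : S" for p c
  using P_mult[of p "[:c:]"] that subrngD(1)[OF S'] by (auto simp: coeff_pCons split: nat.splits)
 have P_sum: "sum f J : P" if "!!j. j : J ==> f j : P" for f :: "'a => 'a poly" and J using that
  by (induction J rule: infinite_finite_induct)
   (auto simp: P_add, auto simp: P_def subrngD(1)[OF S'] ideal_inD(2)[OF I])
 have P0: "0 : P" unfolding P_def using subrngD(1)[OF S'] ideal_inD(2)[OF I] by auto
 have L_ideal: "ideal_in S (L d)" for d unfolding ideal_in_def proof (intro conjI ballI)
  show "L d <= S" unfolding L_def P_def by auto
  show "0 : L d" unfolding L_def using P0 by (auto intro!: exI[of _ 0])
 next
  fix a b assume "a : L d" "b : L d"
  then obtain p q where "a = coeff p d" "b = coeff q d" "p : P" "q : P" "degree p <= d" "degree q <= d" unfolding L_def by blast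
  thus "a + b : L d" unfolding L_def by (auto intro!: exI[of _ "p + q"] P_add degree_add_le)
 next
  fix s a assume "s : S" "a : L d"
  then obtain p where "a = coeff p d" "p : P" "degree p <= d" unfolding L_def by blast
  thus "s * a : L d" unfolding L_def using `s : S` by (auto intro!: exI[of _ "smult s p"] P_smult degree_smult_le[THEN order_trans])
 qed
 have L_mono: "L d <= L (Suc d)" for d proof
  fix a assume "a : L d"
  then obtain p where p: "a = coeff p d" "p : P" "degree p <= d" unfolding L_def by blast
  have "pCons 0 p : P" using P_mult[OF p(2), of "[:0,1:]"] subrngD(1,2)[OF S'] by (auto simp: coeff_pCons split: nat.splits)
  thus "a : L (Suc d)" unfolding L_def using p by (auto intro!: exI[of _ "pCons 0 p"] simp: degree_pCons_eq_if)
 qed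
 obtain D where D: "!!m. L m <= L D" using noeth_chain[OF S, of L] L_ideal L_mono by blast
 have "ALL d. EX F. finite F & F <= L d & L d <= gen_ideal S F" using noethD(2)[OF S L_ideal] by blast
 then obtain F where F: "!!d. finite (F d)" "!!d. F d <= L d" "!!d. L d <= gen_ideal S (F d)" by metis
 have "ALL d c. EX p. c : F d --> p : P & degree p <= d & coeff p d = c" using F(2) unfolding L_def by blast
 then obtain g where g: "!!d c. c : F d ==> g d c : P & degree (g d c) <= d & coeff (g d c) d = c" by metis
 define E where "E = (UN d<=D. (%c. poly (g d c) x) ` F d)"
 have E: "finite E" "E <= I" unfolding E_def using F(1) g unfolding P_def by auto
 have Eid: "ideal_in (adj S x) (gen_ideal (adj S x) E)" using gen_ideal_ideal[OF sub] E(2) ideal_inD(1)[OF I] by blast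
 have gE: "poly (g d c) x : gen_ideal (adj S x) E" if "d <= D" "c : F d" for d c
  using that by (intro gen_ideal_mem[OF sub E(1)]) (auto simp: E_def)
 have main: "poly p x : gen_ideal (adj S x) E" if "p : P" for p using that proof (induction "degree p" arbitrary: p rule: less_induct)
  case less
  define d where "d = degree p"
  \<comment> \<open>Beyond \<open>D\<close> no new leading coefficients occur, so the generators of
    level \<open>D\<close> suffice there after multiplication by a monomial.\<close>
  define d' where "d' = min d D"
  have "coeff p d : L d" unfolding L_def using less.prems d_def by auto
  hence "coeff p d : L d'" unfolding d'_def using D by (auto simp: min_def)
  then obtain s where s: "coeff p d = (SUM c:F d'. s c * c)" "ALL c:F d'. s c : S" using F(3) unfolding gen_ideal_def by blast
  define q where "q = (SUM c:F d'. monom (s c) (d - d') * g d' c)"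
  have mon: "ALL i. coeff (monom (s c) (d - d')) i : S" if "c : F d'" for c using s(2) that subrngD(1)[OF S'] by (auto simp: coeff_monom)
  have qP: "q : P" unfolding q_def using g mon by (intro P_sum P_mult) auto
  have qE: "poly q x : gen_ideal (adj S x) E" unfolding q_def poly_sum poly_mult
  proof (intro ideal_in_sum[OF Eid] ideal_inD(4)[OF Eid] gE)
   fix c assume "c : F d'"
   thus "poly (monom (s c) (d - d')) x : adj S x" using mon unfolding adj_def by auto
  qed (auto simp: d'_def)
  have deg: "degree q <= d" unfolding q_def proof (intro degree_sum_le F(1))
   fix c assume "c : F d'"
   hence "degree (g d' c) <= d'" using g by auto
   hence "degree (monom (s c) (d - d')) + degree (g d' c) <= (d - d') + d'" by (intro add_mono degree_monom_le)
   thus "degree (monom (s c) (d - d') * g d' c) <= d" using degree_mult_le[of "monom (s c) (d - d')" "g d' c"] by (auto simp: d'_def)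
  qed
  have "coeff q d = (SUM c:F d'. s c * coeff (g d' c) d')" unfolding q_def coeff_sum
   by (intro sum.cong refl) (auto simp: coeff_monom_mult d'_def min_def)
  also have "... = coeff p d" unfolding s(1) using g by (intro sum.cong) auto
  finally have cq: "coeff q d = coeff p d" .
  have r: "p - q : P" using P_add[OF less.prems P_smult[OF qP, of "-1"]] subrngD(2,5)[OF S'] by auto
  have "degree (p - q) < d | p - q = 0" using degree_diff_less_or_zero[of q p] deg cq d_def by auto
  hence "poly (p - q) x : gen_ideal (adj S x) E" using less.hyps[OF _ r] ideal_inD(2)[OF Eid] by (auto simp: d_def)
  hence "poly (p - q) x + poly q x : gen_ideal (adj S x) E" using ideal_inD(3)[OF Eid] qE by blast
  thus ?case by simp
 qed
 have "I <= gen_ideal (adj S x) E" proof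
  fix a assume a: "a : I"
  then obtain p where "a = poly p x" "ALL i. coeff p i : S" using ideal_inD(1)[OF I] unfolding adj_def by blast
  thus "a : gen_ideal (adj S x) E" using main[of p] a unfolding P_def by auto
 qed
 thus "EX F. finite F & F <= I & I <= gen_ideal (adj S x) F" using E by blast
qed

text \<open>Membership in the \<open>k\<close>-th power of the ideal \<open>m\<close> of the ring
  \<open>S\<close>, with \<open>S\<close> itself as the power zero. The inductive form lets
  arguments about powers follow the formation of products and sums.\<close>

inductive in_ipow :: "'r::comm_ring_1 set => 'r set => nat => 'r => bool" for S m where
 base: "a : S ==> in_ipow S m 0 a"
| mult: "in_ipow S m k a ==> b : m ==> in_ipow S m (Suc k) (a * b)"
| add: "in_ipow S m k a ==> in_ipow S m k b ==> in_ipow S m k (a + b)"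

text \<open>Expanding every factor in the generators \<open>F\<close> shows that a power of
  \<open>m\<close> lies in each ideal that contains the monomials of that degree.\<close>

lemma in_ipow_monomials:
 assumes S: "subrng S" and F: "F <= S" and m: "m <= gen_ideal S F" and a: "in_ipow S m k a" and I: "ideal_in S I"
  and mon: "!!e. sum e F = k ==> (PROD x:F. x ^ e x) : I" and fin: "finite F"
 shows "a : I" using a I mon proof (induction arbitrary: I rule: in_ipow.induct)
 case (base a)
 hence "(PROD x:F. x ^ (%_. 0) x) : I" by (intro base(3)) auto
 hence "1 : I" by simp
 thus ?case using ideal_inD(4)[OF base(2,1), of 1] by simp
next
 case (mult k a b)
 \<comment> \<open>The last factor is a combination of \<open>F\<close>, so the induction is run in
   the colon ideal of \<open>I\<close> by \<open>F\<close>, which contains the monomials of one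
   degree less.\<close>
 define I' where "I' = {s : S. ALL x:F. s * x : I}"
 have I': "ideal_in S I'" unfolding ideal_in_def I'_def using subrngD[OF S] ideal_inD(2-4)[OF mult.prems(1)]
  by (auto simp: distrib_right mult.assoc)
 have "a : I'" proof (rule mult.IH[OF I'])
  fix e :: "'a => nat" assume e: "sum e F = k"
  have "(PROD x:F. x ^ e x) * y : I" if "y : F" for y proof -
   have "sum (e(y := Suc (e y))) F = Suc k" using e that fin by (simp add: sum.remove[of F y])
   hence "(PROD x:F. x ^ (e(y := Suc (e y))) x) : I" by (rule mult.prems(2))
   also have "(PROD x:F. x ^ (e(y := Suc (e y))) x) = (PROD x:F. x ^ e x) * y" using that fin by (simp add: prod.remove[of F y] mult_ac)
   finally show ?thesis .
  qed
  thus "(PROD x:F. x ^ e x) : I'" unfolding I'_def using F by (auto intro!: subrng_prod[OF S] subrng_power[OF S])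
 qed
 moreover obtain s where s: "b = (SUM x:F. s x * x)" "ALL x:F. s x : S" using mult.hyps(2) m unfolding gen_ideal_def by blast
 moreover have "a * b = (SUM x:F. s x * (a * x))" unfolding s(1) by (simp add: sum_distrib_left mult.left_commute)
 moreover have "s x * (a * x) : I" if "x : F" for x
  using calculation that unfolding I'_def by (auto intro: ideal_inD(4)[OF mult.prems(1), of "s x"])
 ultimately show ?case by (simp add: ideal_in_sum[OF mult.prems(1)])
next
 case (add k a b)
 thus ?case using ideal_inD(3) by blast
qed

text \<open>
  Take an ideal \<open>Q\<close> maximal with \<open>Q \<inter> S f \<subseteq> m f\<close>. Stabilisation of the colon ideals \<open>(Q : x\<^sup>n)\<close>
  shows that \<open>Q\<close> contains a power of every \<open>x\<close> in \<open>m\<close>, hence a power of \<open>m\<close>, hence \<open>f\<close>.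
\<close>

lemma krull_intersection:
 assumes N: "noeth S" and m: "ideal_in S m" and f: "f : S" and inf: "!!k. in_ipow S m k f"
 shows "EX a:m. f = a * f" proof -
 note S = noethD(1)[OF N]
 define N0 where "N0 = {a * f | a. a : m}"
 define J where "J = {s * f | s. s : S}"
 have N0: "ideal_in S N0" unfolding ideal_in_def proof (intro conjI ballI)
  show "N0 <= S" unfolding N0_def using ideal_inD(1)[OF m] f subrngD(4)[OF S] by auto
  show "0 : N0" unfolding N0_def using ideal_inD(2)[OF m] by (auto intro!: exI[of _ 0])
 next
  fix a b assume "a : N0" "b : N0"
  then obtain a' b' where "a = a' * f" "b = b' * f" "a' : m" "b' : m" unfolding N0_def by blast
  thus "a + b : N0" unfolding N0_def using ideal_inD(3)[OF m] by (auto intro!: exI[of _ "a' + b'"] simp: distrib_right)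
 next
  fix s a assume "s : S" "a : N0"
  then obtain a' where "a = a' * f" "a' : m" unfolding N0_def by blast
  thus "s * a : N0" unfolding N0_def using ideal_inD(4)[OF m] `s : S` by (auto intro!: exI[of _ "s * a'"] simp: mult.assoc)
 qed
 define \<F> where "\<F> = {Q. ideal_in S Q & N0 <= Q & Q \<inter> J <= N0}"
 have "N0 : \<F>" unfolding \<F>_def using N0 by auto
 have "EX M:\<F>. ALL X:\<F>. M <= X --> X = M" proof (rule subset_Zorn_nonempty)
  fix \<C> assume C: "\<C> ~= {}" "subset.chain \<F> \<C>"
  hence id: "ideal_in S Q" "N0 <= Q" "Q \<inter> J <= N0" if "Q : \<C>" for Q using that unfolding subset.chain_def \<F>_def by auto
  have "ideal_in S (\<Union>\<C>)" unfolding ideal_in_def proof (intro conjI ballI)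
   show "\<Union>\<C> <= S" using id(1) ideal_inD(1) by auto
   show "0 : \<Union>\<C>" using C(1) id(1) ideal_inD(2) by blast
  next
   fix a b assume "a : \<Union>\<C>" "b : \<Union>\<C>"
   then obtain P Q where PQ: "a : P" "b : Q" "P : \<C>" "Q : \<C>" by blast
   hence "P <= Q | Q <= P" using C(2) unfolding subset.chain_def by auto
   thus "a + b : \<Union>\<C>" using PQ id(1) ideal_inD(3) by (metis Union_iff subsetD)
  next
   fix s a assume "s : S" "a : \<Union>\<C>"
   thus "s * a : \<Union>\<C>" using id(1) ideal_inD(4) by blast
  qed
  thus "\<Union>\<C> : \<F>" unfolding \<F>_def using C(1) id(2,3) by blast
 qed (use `N0 : \<F>` in auto)
 then obtain Q where Q: "Q : \<F>" "!!X. X : \<F> ==> Q <= X ==> X = Q" by blast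
 hence Qid: "ideal_in S Q" and NQ: "N0 <= Q" and QJ: "Q \<inter> J <= N0" unfolding \<F>_def by auto
 have pow: "EX n. x ^ n : Q" if x: "x : m" for x proof -
  have xS: "x : S" using x ideal_inD(1)[OF m] by auto
  have xnS: "x ^ n : S" for n using subrng_power[OF S xS] .
  define C where "C n = {s : S. s * x ^ n : Q}" for n
  have "ideal_in S (C n)" for n unfolding ideal_in_def C_def using subrngD[OF S] ideal_inD(2-4)[OF Qid]
   by (auto simp: distrib_right mult.assoc)
  moreover have "C n <= C (Suc n)" for n proof
   fix s assume "s : C n"
   hence "s : S" "x * (s * x ^ n) : Q" unfolding C_def using ideal_inD(4)[OF Qid xS] by auto
   thus "s : C (Suc n)" unfolding C_def by (simp add: mult.left_commute)
  qed
  ultimately obtain n where n: "!!m. C m <= C n" using noeth_chain[OF N] by blast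
  define Q' where "Q' = {q + s * x ^ n | q s. q : Q & s : S}"
  have Q': "ideal_in S Q'" unfolding ideal_in_def proof (intro conjI ballI)
   show "Q' <= S" unfolding Q'_def using ideal_inD(1)[OF Qid] xnS subrngD(3,4)[OF S] by auto
   show "0 : Q'" unfolding Q'_def using ideal_inD(2)[OF Qid] subrngD(1)[OF S] by (auto intro!: exI[of _ 0])
  next
   fix a b assume "a : Q'" "b : Q'"
   then obtain q r s t where "a = q + s * x ^ n" "b = r + t * x ^ n" "q : Q" "r : Q" "s : S" "t : S" unfolding Q'_def by blast
   hence "a + b = (q + r) + (s + t) * x ^ n" "q + r : Q" "s + t : S"
    using ideal_inD(3)[OF Qid] subrngD(3)[OF S] by (auto simp: algebra_simps)
   thus "a + b : Q'" unfolding Q'_def by blast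
  next
   fix c a assume "c : S" "a : Q'"
   then obtain q s where "a = q + s * x ^ n" "q : Q" "s : S" unfolding Q'_def by blast
   hence "c * a = c * q + (c * s) * x ^ n" "c * q : Q" "c * s : S"
    using ideal_inD(4)[OF Qid] subrngD(4)[OF S] `c : S` by (auto simp: algebra_simps)
   thus "c * a : Q'" unfolding Q'_def by blast
  qed
  have QQ': "Q <= Q'" proof
   fix q assume "q : Q"
   hence "q = q + 0 * x ^ n" "q : Q" by auto
   thus "q : Q'" unfolding Q'_def using subrngD(1)[OF S] by blast
  qed
  have "Q' \<inter> J <= N0" proof
   fix e assume e: "e : Q' \<inter> J"
   then obtain q s t where qst: "e = q + s * x ^ n" "q : Q" "s : S" "e = t * f" "t : S" unfolding Q'_def J_def by blast
   \<comment> \<open>An element \<open>e\<close> of \<open>J\<close> is a multiple of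
     \<open>f\<close>, so \<open>x * e\<close> already lies in \<open>N0\<close>. This forces
     \<open>s\<close> into the next colon ideal, which by stationarity equals the current
     one.\<close>
   have "x * t : m" using ideal_inD(4)[OF m qst(5) x] by (simp add: mult.commute)
   hence "(x * t) * f : Q" using NQ unfolding N0_def by auto
   hence "x * e : Q" using qst by (simp add: mult.assoc)
   hence "x * e - x * q : Q" using ideal_in_diff[OF S Qid] ideal_inD(4)[OF Qid xS qst(2)] by blast
   hence "s * x ^ Suc n : Q" unfolding qst(1) by (simp add: algebra_simps)
   hence "s : C (Suc n)" unfolding C_def using qst(3) by simp
   hence "s : C n" using n by blast
   hence "e : Q" unfolding qst(1) C_def using ideal_inD(3)[OF Qid qst(2)] by auto
   thus "e : N0" using QJ e by auto
  qed
  hence "Q' : \<F>" unfolding \<F>_def using Q' NQ QQ' by auto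
  hence "Q' = Q" using Q(2) QQ' by auto
  moreover have "0 + 1 * x ^ n : Q'" unfolding Q'_def using ideal_inD(2)[OF Qid] subrngD(2)[OF S] by blast
  ultimately show ?thesis by auto
 qed
 obtain F where F: "finite F" "F <= m" "m <= gen_ideal S F" using noethD(2)[OF N m] by blast
 obtain n where n: "!!x. x : F ==> x ^ n x : Q" using pow F(2) by (metis subsetD)
 have FS: "F <= S" using F(2) ideal_inD(1)[OF m] by auto
 have "f : Q" proof (rule in_ipow_monomials[OF S FS F(3) inf Qid _ F(1)])
  fix e :: "'a => nat" assume e: "sum e F = Suc (sum n F)"
  \<comment> \<open>The degree exceeds the sum of the exponents \<open>n x\<close>, so some
    generator occurs to a power that lies in \<open>Q\<close>.\<close>
  have "EX x:F. n x < e x" proof (rule ccontr)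
   assume "\<not> ?thesis"
   hence "sum e F <= sum n F" by (intro sum_mono) auto
   with e show False by simp
  qed
  then obtain x where x: "x : F" "n x < e x" by blast
  have "(PROD x:F. x ^ e x) = (x ^ (e x - n x) * (PROD y:F - {x}. y ^ e y)) * x ^ n x"
   using x F(1) by (simp add: prod.remove[of F x] mult.assoc[symmetric] power_add[symmetric] mult.commute[of _ "x ^ n x"])
  also have "... : Q" using n[OF x(1)] x FS by (intro ideal_inD(4)[OF Qid] subrngD(4)[OF S] subrng_power[OF S] subrng_prod[OF S]) auto
  finally show "(PROD x:F. x ^ e x) : Q" .
 qed
 moreover have "f : J" unfolding J_def using subrngD(2)[OF S] by (auto intro!: exI[of _ 1])
 ultimately have "f : N0" using QJ by auto
 thus ?thesis unfolding N0_def by blast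
qed

section \<open>Extension of homomorphisms into an algebraically closed field\<close>

definition ring_hom_on :: "'r::comm_ring_1 set => ('r => 'k::comm_ring_1) => bool" where
 "ring_hom_on S ph \<longleftrightarrow> ph 1 = 1 & (ALL a:S. ALL b:S. ph (a + b) = ph a + ph b & ph (a * b) = ph a * ph b)"

definition domain_set :: "'r::comm_ring_1 set => bool" where
 "domain_set S \<longleftrightarrow> (ALL a:S. ALL b:S. a * b = 0 --> a = 0 | b = 0)"

lemma ring_hom_onD:
 assumes "ring_hom_on S ph"
 shows "ph 1 = 1" "a : S ==> b : S ==> ph (a + b) = ph a + ph b" "a : S ==> b : S ==> ph (a * b) = ph a * ph b"
 using assms unfolding ring_hom_on_def by auto

lemma ring_hom_on_zero: "subrng S ==> ring_hom_on S ph ==> ph 0 = 0" using ring_hom_onD(2)[of S ph 0 0] by (auto simp: subrngD)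

lemma ring_hom_on_uminus:
 assumes "subrng S" "ring_hom_on S ph" "a : S" shows "ph (- a) = - ph a" proof -
 have "ph (- a) + ph a = ph (- a + a)" using assms by (subst ring_hom_onD(2)) (auto simp: subrngD)
 also have "... = 0" using ring_hom_on_zero[OF assms(1,2)] by simp
 finally show ?thesis by (simp add: add_eq_0_iff2)
qed

lemma ring_hom_on_diff:
 "subrng S ==> ring_hom_on S ph ==> a : S ==> b : S ==> ph (a - b) = ph a - ph b"
 using ring_hom_onD(2)[of S ph a "- b"] ring_hom_on_uminus[of S ph b] by (auto simp: subrngD)

lemma ring_hom_on_sum:
 "subrng S ==> ring_hom_on S ph ==> (!!i. i : I ==> f i : S) ==> ph (sum f I) = (SUM i:I. ph (f i))"
 by (induction I rule: infinite_finite_induct)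
  (auto simp: ring_hom_on_zero ring_hom_onD(2) subrng_sum)

lemma ring_hom_on_power:
 "subrng S ==> ring_hom_on S ph ==> a : S ==> ph (a ^ n) = ph a ^ n" by (induction n) (auto simp: ring_hom_onD(1,3) subrng_power)

definition coeffs_in :: "'r::comm_ring_1 set => 'r poly => bool" where
 "coeffs_in S p \<longleftrightarrow> (ALL i. coeff p i : S)"

lemma coeffs_inI:
 assumes "subrng S"
 shows "coeffs_in S 0" "coeffs_in S p ==> coeffs_in S q ==> coeffs_in S (p + q)"
  "coeffs_in S p ==> coeffs_in S q ==> coeffs_in S (p - q)"
  "coeffs_in S p ==> coeffs_in S q ==> coeffs_in S (p * q)"
  "c : S ==> coeffs_in S p ==> coeffs_in S (smult c p)"
  "c : S ==> coeffs_in S (monom c n)" "c : S ==> coeffs_in S [:c:]" "coeffs_in S 1" using subrngD[OF assms] unfolding coeffs_in_def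
 by (auto simp: coeff_mult coeff_monom coeff_pCons one_pCons split: nat.split intro!: subrng_sum[OF assms])

lemma coeffs_inD: "coeffs_in S p ==> coeff p i : S" unfolding coeffs_in_def by auto

context
 fixes S :: "'r::comm_ring_1 set" and ph :: "'r => 'k::field"
 assumes S: "subrng S" and ph: "ring_hom_on S ph"
begin

lemma coeff_map_hom: "coeff (map_poly ph p) i = ph (coeff p i)" by (simp add: coeff_map_poly ring_hom_on_zero[OF S ph])

lemma map_hom_add: "coeffs_in S p ==> coeffs_in S q ==> map_poly ph (p + q) = map_poly ph p + map_poly ph q"
 by (rule poly_eqI) (auto simp: coeff_map_hom ring_hom_onD(2)[OF ph] coeffs_inD)

lemma map_hom_diff: "coeffs_in S p ==> coeffs_in S q ==> map_poly ph (p - q) = map_poly ph p - map_poly ph q"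
 by (rule poly_eqI) (auto simp: coeff_map_hom ring_hom_on_diff[OF S ph] coeffs_inD)

lemma map_hom_mult: "coeffs_in S p ==> coeffs_in S q ==> map_poly ph (p * q) = map_poly ph p * map_poly ph q" by (rule poly_eqI)
  (auto simp: coeff_map_hom coeff_mult ring_hom_on_sum[OF S ph] subrngD[OF S] ring_hom_onD(3)[OF ph] coeffs_inD)

lemma map_hom_smult: "c : S ==> coeffs_in S p ==> map_poly ph (smult c p) = smult (ph c) (map_poly ph p)"
 by (rule poly_eqI) (auto simp: coeff_map_hom ring_hom_onD(3)[OF ph] coeffs_inD)

lemma map_hom_const: "map_poly ph [:c:] = [:ph c:]"
 by (rule poly_eqI) (auto simp: coeff_map_hom coeff_pCons ring_hom_on_zero[OF S ph] split: nat.split)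

text \<open>The substitution of \<open>bt\<close> for \<open>b\<close> is well defined as soon as it respects the relations of \<open>b\<close>.\<close>

lemma ring_hom_extend:
 assumes rel: "!!p. coeffs_in S p ==> poly p b = 0 ==> poly (map_poly ph p) bt = 0"
 shows "EX ph'. ring_hom_on (adj S b) ph' & (ALL a:S. ph' a = ph a)
  & (ALL p. coeffs_in S p --> ph' (poly p b) = poly (map_poly ph p) bt)" proof -
 define ph' where "ph' y = poly (map_poly ph (SOME p. coeffs_in S p & poly p b = y)) bt" for y
 have val: "ph' (poly p b) = poly (map_poly ph p) bt" if p: "coeffs_in S p" for p proof -
  define q where "q = (SOME q. coeffs_in S q & poly q b = poly p b)"
  have q: "coeffs_in S q" "poly q b = poly p b" unfolding q_def using someI[of "%q. coeffs_in S q & poly q b = poly p b" p] p by auto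
  have "poly (map_poly ph (q - p)) bt = 0" using p q by (intro rel coeffs_inI[OF S]) auto
  thus ?thesis using p q unfolding ph'_def q_def[symmetric] by (simp add: map_hom_diff)
 qed
 have "ph' a = ph a" if "a : S" for a using val[of "[:a:]"] that by (simp add: coeffs_inI(7)[OF S] map_hom_const)
 moreover have "ring_hom_on (adj S b) ph'" unfolding ring_hom_on_def proof (intro conjI ballI)
  show "ph' 1 = 1" using val[of 1] coeffs_inI(8)[OF S] by (simp add: one_pCons map_hom_const ring_hom_onD(1)[OF ph])
 next
  fix x y assume "x : adj S b" "y : adj S b"
  then obtain p q where pq: "x = poly p b" "y = poly q b" "coeffs_in S p" "coeffs_in S q" unfolding adj_def coeffs_in_def by blast
  show "ph' (x + y) = ph' x + ph' y" using val[of "p + q"] val[of p] val[of q] pq by (simp add: coeffs_inI(2)[OF S] map_hom_add)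
  show "ph' (x * y) = ph' x * ph' y" using val[of "p * q"] val[of p] val[of q] pq by (simp add: coeffs_inI(4)[OF S] map_hom_mult)
 qed
 ultimately show ?thesis using val by blast
qed

end

text \<open>Long division over a ring: each cancellation of a leading term costs one factor of the
  leading coefficient of \<open>mu\<close>. A homomorphism that does not kill this coefficient still
  transports the resulting relation.\<close>

lemma pseudo_division:
 fixes mu p :: "'r::comm_ring_1 poly"
 assumes S: "subrng S" and mu: "coeffs_in S mu" and e: "degree mu > 0" and p: "coeffs_in S p"
 shows "EX s h rh. coeffs_in S h & coeffs_in S rh & degree rh < degree mu
  & smult (lead_coeff mu ^ s) p = mu * h + rh" using p proof (induction "degree p" arbitrary: p rule: less_induct)
 case less
 define a where "a = lead_coeff mu"
 have aS: "a : S" unfolding a_def using mu by (rule coeffs_inD)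
 show ?case proof (cases "degree p < degree mu")
  case True
  moreover have "smult (lead_coeff mu ^ 0) p = mu * 0 + p" by simp
  ultimately show ?thesis using less.prems coeffs_inI(1)[OF S] by blast
 next
  case False
  define d where "d = degree p"
  define g where "g = monom (coeff p d) (d - degree mu)"
  have gS: "coeffs_in S g" unfolding g_def using less.prems by (intro coeffs_inI(6)[OF S] coeffs_inD)
  define q where "q = smult a p - mu * g"
  have qS: "coeffs_in S q" unfolding q_def using gS less.prems aS mu by (intro coeffs_inI[OF S])
  have "degree (mu * g) <= d" unfolding g_def using False degree_mult_le[of mu "monom (coeff p d) (d - degree mu)"]
    degree_monom_le[of "coeff p d" "d - degree mu"] by (auto simp: d_def)
  hence dq: "degree q <= d" unfolding q_def by (intro degree_diff_le) (auto simp: d_def intro: order_trans[OF degree_smult_le])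
  have "coeff (g * mu) d = coeff p d * a" unfolding g_def a_def using False by (simp add: coeff_monom_mult d_def)
  hence "coeff (mu * g) d = a * coeff p d" by (simp add: mult.commute)
  hence "coeff q d = 0" unfolding q_def by simp
  hence "degree q < d | q = 0" using dq by (metis leading_coeff_0_iff le_neq_implies_less)
  hence "degree q < d" using False e d_def by auto
  then obtain s h rh where ih: "coeffs_in S h" "coeffs_in S rh" "degree rh < degree mu"
   "smult (a ^ s) q = mu * h + rh" using less.hyps[OF _ qS] unfolding d_def a_def by blast
  have "smult (a ^ Suc s) p = smult (a ^ s) q + mu * smult (a ^ s) g" unfolding q_def by (simp add: smult_diff_right mult.commute)
  also have "... = mu * (h + smult (a ^ s) g) + rh" unfolding ih(4) by (simp add: algebra_simps)
  finally have *: "smult (a ^ Suc s) p = mu * (h + smult (a ^ s) g) + rh" .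
  have "coeffs_in S (h + smult (a ^ s) g)" using ih gS subrng_power[OF S aS] by (intro coeffs_inI[OF S])
  with * ih(2,3) show ?thesis unfolding a_def by blast
 qed
qed

lemma infinite_UNIV_field_char_0: "infinite (UNIV :: 'k::field_char_0 set)" using infinite_UNIV_char_0 .

lemma adj_iff: "y : adj S b \<longleftrightarrow> (EX p. coeffs_in S p & y = poly p b)" unfolding adj_def coeffs_in_def by auto

text \<open>
  If \<open>b\<close> is algebraic, \<open>mu\<close> is a relation of minimal degree and \<open>rh\<close> an element of the ideal
  \<open>(g, mu)\<close> of minimal degree that does not vanish at \<open>b\<close>; then \<open>rh\<close> is constant.
\<close>

lemma hom_extend_adj:
 fixes S :: "'r::comm_ring_1 set" and b c :: 'r
 assumes S: "subrng S" and dom: "domain_set (adj S b)" and c: "c : adj S b" "c ~= 0"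
 shows "EX r:S. r ~= 0 & (ALL ph :: 'r => 'k::{alg_closed_field, field_char_0}. ring_hom_on S ph & ph r ~= 0
  --> (EX ph'. ring_hom_on (adj S b) ph' & (ALL a:S. ph' a = ph a) & ph' c ~= 0))" proof -
 obtain g where g: "coeffs_in S g" "c = poly g b" using c(1) unfolding adj_iff by blast
 have domD: "x = 0 | y = 0" if "x * y = 0" "x : adj S b" "y : adj S b" for x y using dom that unfolding domain_set_def by blast
 have SA: "a : adj S b" if "a : S" for a using adj_base[OF S] that by auto
 have PA: "poly p b : adj S b" if "coeffs_in S p" for p using that adj_iff by blast
 show ?thesis proof (cases "EX p. coeffs_in S p & p ~= 0 & poly p b = 0")
  case False
  \<comment> \<open>Here \<open>b\<close> is transcendental over \<open>S\<close> and may be sent to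
    any scalar; only the finitely many roots of the image of \<open>g\<close> are excluded.\<close>
  show ?thesis proof (intro bexI conjI allI impI)
   show "lead_coeff g ~= 0" using c(2) g(2) by auto
   show "lead_coeff g : S" using g(1) by (rule coeffs_inD)
  next
   fix ph :: "'r => 'k" assume ph: "ring_hom_on S ph & ph (lead_coeff g) ~= 0"
   hence "coeff (map_poly ph g) (degree g) ~= 0" by (simp add: coeff_map_hom[OF S])
   hence "map_poly ph g ~= 0" by auto
   hence "finite {x. poly (map_poly ph g) x = 0}" by (rule poly_roots_finite)
   then obtain bt where bt: "poly (map_poly ph g) bt ~= 0"
    using infinite_UNIV_field_char_0[where 'k='k] by (metis (mono_tags) finite_subset mem_Collect_eq subsetI)
   have "poly (map_poly ph p) bt = 0" if "coeffs_in S p" "poly p b = 0" for p proof -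
    have "p = 0" using False that by blast
    thus ?thesis by simp
   qed
   then obtain ph' where "ring_hom_on (adj S b) ph'" "ALL a:S. ph' a = ph a"
    "!!p. coeffs_in S p ==> ph' (poly p b) = poly (map_poly ph p) bt" using ring_hom_extend[OF S, of ph b bt] ph by blast
   thus "EX ph'. ring_hom_on (adj S b) ph' & (ALL a:S. ph' a = ph a) & ph' c ~= 0" using g bt by (intro exI[of _ ph']) simp
  qed
 next
  case True
  define e where "e = (LEAST e. EX p. coeffs_in S p & p ~= 0 & poly p b = 0 & degree p = e)"
  have "EX e p. coeffs_in S p & p ~= 0 & poly p b = 0 & degree p = e" using True by auto
  hence "EX p. coeffs_in S p & p ~= 0 & poly p b = 0 & degree p = e" unfolding e_def by (rule LeastI_ex)
  then obtain mu where mu: "coeffs_in S mu" "mu ~= 0" "poly mu b = 0" "degree mu = e" by blast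
  have min_e: "p = 0" if "coeffs_in S p" "poly p b = 0" "degree p < e" for p
   using not_less_Least[of "degree p" "%e. EX p. coeffs_in S p & p ~= 0 & poly p b = 0 & degree p = e"] that
   unfolding e_def[symmetric] by auto
  have e0: "e > 0" proof (rule ccontr)
   assume "\<not> e > 0"
   then obtain z where "mu = [:z:]" using mu(4) degree_eq_zeroE by auto
   thus False using mu(2,3) by auto
  qed
  define a where "a = lead_coeff mu"
  have a: "a : S" "a ~= 0" unfolding a_def using mu(1,2) by (auto intro: coeffs_inD)
  have nz_pow: "x ^ n ~= 0" if "x : S" "x ~= 0" for x n proof (induction n)
   case 0
   thus ?case using that by auto
  next
   case (Suc n)
   thus ?case using domD[of x "x ^ n"] SA that subrng_power[OF S] by auto
  qed
  define Q where "Q rh \<longleftrightarrow> (EX u w. coeffs_in S u & coeffs_in S w & rh = u * g + w * mu) & poly rh b ~= 0" for rh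
  have QS: "coeffs_in S rh" if "Q rh" for rh using that g(1) mu(1) unfolding Q_def by (auto intro!: coeffs_inI[OF S])
  obtain s h r where shr: "coeffs_in S h" "coeffs_in S r" "degree r < degree mu" "smult (a ^ s) g = mu * h + r"
   using pseudo_division[OF S mu(1) _ g(1)] e0 mu(4) unfolding a_def by auto
  have "Q r" proof -
   have "poly (smult (a ^ s) g) b = poly r b" unfolding shr(4) using mu(3) by simp
   moreover have "a ^ s * c ~= 0" using domD[of "a ^ s" c] nz_pow[OF a] c SA[OF subrng_power[OF S a(1)]] by auto
   moreover have r: "r = [:a ^ s:] * g + (- h) * mu" using shr(4) by (simp add: algebra_simps)
   moreover have "coeffs_in S [:a ^ s:]" "coeffs_in S (- h)"
    using coeffs_inI(7)[OF S subrng_power[OF S a(1)]] coeffs_inI(3)[OF S coeffs_inI(1)[OF S] shr(1)] by auto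
   moreover have "poly r b = a ^ s * c" using calculation(1) g(2) by simp
   ultimately show ?thesis unfolding Q_def by metis
  qed
  define d where "d = (LEAST d. EX rh. Q rh & degree rh = d)"
  have "EX d rh. Q rh & degree rh = d" using `Q r` by auto
  hence "EX rh. Q rh & degree rh = d" unfolding d_def by (rule LeastI_ex)
  then obtain rh where rh: "Q rh" "degree rh = d" by blast
  have min_d: "d <= degree rh'" if "Q rh'" for rh' unfolding d_def using that by (intro Least_le) auto
  have de: "d < e" using min_d[OF `Q r`] shr(3) mu(4) by simp
  have "d = 0" proof (rule ccontr)
   assume "d ~= 0"
   define l where "l = lead_coeff rh"
   have l: "l : S" "l ~= 0" unfolding l_def using QS[OF rh(1)] rh(1) by (auto intro: coeffs_inD simp: Q_def)
   obtain t k r' where tk: "coeffs_in S k" "coeffs_in S r'" "degree r' < degree rh"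
    "smult (l ^ t) mu = rh * k + r'" using pseudo_division[OF S QS[OF rh(1)] _ mu(1)] `d ~= 0` rh(2) unfolding l_def by auto
   have lt: "l ^ t : S" "l ^ t ~= 0" using subrng_power[OF S l(1)] nz_pow[OF l] by auto
   have "poly r' b = 0" proof (rule ccontr)
    assume nz: "poly r' b ~= 0"
    obtain u w where uw: "coeffs_in S u" "coeffs_in S w" "rh = u * g + w * mu" using rh(1) unfolding Q_def by blast
    have "r' = (0 - u * k) * g + ([:l ^ t:] - w * k) * mu" using tk(4) unfolding uw(3) by (simp add: algebra_simps)
    moreover have "coeffs_in S (0 - u * k)" "coeffs_in S ([:l ^ t:] - w * k)"
     using uw tk(1) lt(1) by (auto intro!: coeffs_inI[OF S] simp del: diff_0)
    ultimately have "Q r'" unfolding Q_def using nz by blast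
    thus False using min_d[of r'] tk(3) rh(2) by simp
   qed
   hence "r' = 0" using min_e[of r'] tk(2,3) rh(2) de by simp
   \<comment> \<open>If \<open>rh\<close> had positive degree, the cofactor \<open>k\<close> would
     be a relation for \<open>b\<close> of degree below the minimal one, because \<open>rh\<close>
     does not vanish at \<open>b\<close>.\<close>
   hence eq: "smult (l ^ t) mu = rh * k" using tk(4) by simp
   have "coeff (smult (l ^ t) mu) e ~= 0" using domD[of "l ^ t" a] lt a SA mu(4) unfolding a_def by auto
   hence "k ~= 0" unfolding eq by auto
   have "poly rh b * poly k b = 0" using mu(3) arg_cong[OF eq, of "%p. poly p b"] by simp
   hence "poly k b = 0" using domD[of "poly rh b" "poly k b"] PA[OF QS[OF rh(1)]] PA[OF tk(1)] rh(1) unfolding Q_def by auto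
   have lk: "lead_coeff rh * lead_coeff k ~= 0" using domD[of "lead_coeff rh" "lead_coeff k"] SA QS[OF rh(1)] tk(1) `k ~= 0` l(2)
    unfolding l_def by (auto intro: coeffs_inD)
   hence "degree rh + degree k <= degree (rh * k)" by (intro le_degree) (simp add: coeff_mult_degree_sum)
   moreover have "degree (rh * k) <= e" unfolding eq[symmetric] using mu(4) degree_smult_le[of "l ^ t" mu] by simp
   ultimately have "degree k < e" using `d ~= 0` rh(2) by simp
   thus False using min_e[OF tk(1) `poly k b = 0`] `k ~= 0` by simp
  qed
  then obtain r0 where r0: "rh = [:r0:]" using rh(2) degree_eq_zeroE by auto
  have r0S: "r0 : S" "r0 ~= 0" using coeffs_inD[OF QS[OF rh(1)], of 0] rh(1) unfolding r0 Q_def by auto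
  obtain u w where uw: "coeffs_in S u" "coeffs_in S w" "[:r0:] = u * g + w * mu" using rh(1) unfolding Q_def r0 by blast
  show ?thesis proof (intro bexI conjI allI impI)
   \<comment> \<open>Not killing \<open>a\<close> keeps the image of \<open>mu\<close> nonconstant,
     so that it has a root to which \<open>b\<close> can be sent. Not killing \<open>r0\<close>
     makes the image of \<open>g\<close> nonzero at this root, because \<open>r0\<close> is a
     combination of \<open>g\<close> and \<open>mu\<close>.\<close>
   show "a * r0 ~= 0" using domD[of a r0] a r0S SA by auto
   show "a * r0 : S" using a r0S subrngD(4)[OF S] by auto
  next
   fix ph :: "'r => 'k" assume ph: "ring_hom_on S ph & ph (a * r0) ~= 0"
   note hom = ph[THEN conjunct1]
   have nz: "ph a ~= 0" "ph r0 ~= 0" using ph ring_hom_onD(3)[OF hom a(1) r0S(1)] by auto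
   have "coeff (map_poly ph mu) e ~= 0" using nz(1) mu(4) unfolding a_def by (simp add: coeff_map_hom[OF S hom])
   hence "degree (map_poly ph mu) >= e" by (rule le_degree)
   hence "degree (map_poly ph mu) > 0" using e0 by simp
   then obtain bt where bt: "poly (map_poly ph mu) bt = 0" using alg_closed_imp_poly_has_root by blast
   have "poly (map_poly ph p) bt = 0" if p: "coeffs_in S p" "poly p b = 0" for p proof -
    obtain s h rh' where sh: "coeffs_in S h" "coeffs_in S rh'" "degree rh' < degree mu"
     "smult (a ^ s) p = mu * h + rh'" using pseudo_division[OF S mu(1) _ p(1)] e0 mu(4) unfolding a_def by auto
    have "poly rh' b = 0" using arg_cong[OF sh(4), of "%p. poly p b"] p(2) mu(3) by simp
    hence "rh' = 0" using min_e[OF sh(2)] sh(3) mu(4) by simp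
    hence "map_poly ph (smult (a ^ s) p) = map_poly ph (mu * h)" using sh(4) by simp
    hence "smult (ph a ^ s) (map_poly ph p) = map_poly ph mu * map_poly ph h"
     using map_hom_smult[OF S hom subrng_power[OF S a(1)] p(1)] map_hom_mult[OF S hom mu(1) sh(1)]
     by (simp add: ring_hom_on_power[OF S hom a(1)])
    hence "ph a ^ s * poly (map_poly ph p) bt = 0" using bt by (metis mult_zero_left poly_mult poly_smult)
    thus ?thesis using nz(1) by simp
   qed
   then obtain ph' where ph': "ring_hom_on (adj S b) ph'" "ALL a:S. ph' a = ph a"
    "!!p. coeffs_in S p ==> ph' (poly p b) = poly (map_poly ph p) bt" using ring_hom_extend[OF S hom, of b bt] by blast
   have "map_poly ph [:r0:] = map_poly ph u * map_poly ph g + map_poly ph w * map_poly ph mu"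
    unfolding uw(3) using uw(1,2) g(1) mu(1) by (simp add: map_hom_add[OF S hom] map_hom_mult[OF S hom] coeffs_inI(4)[OF S])
   from arg_cong[OF this, of "%p. poly p bt"]
   have "ph r0 = poly (map_poly ph u) bt * poly (map_poly ph g) bt" using bt by (simp add: map_hom_const[OF S hom])
   hence "ph' c ~= 0" using ph'(3)[OF g(1)] g(2) nz(2) by auto
   thus "EX ph'. ring_hom_on (adj S b) ph' & (ALL a:S. ph' a = ph a) & ph' c ~= 0" using ph'(1,2) by blast
  qed
 qed
qed

primrec adjs :: "'r::comm_ring_1 set => 'r list => 'r set" where
 "adjs S [] = S"
| "adjs S (b # bs) = adjs (adj S b) bs"

lemma subring_adjs: "subrng S ==> subrng (adjs S bs)" by (induction bs arbitrary: S) (auto simp: adj_subring)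

lemma adjs_base: "subrng S ==> S <= adjs S bs" proof (induction bs arbitrary: S)
 case (Cons b bs)
 thus ?case using adj_base[OF Cons.prems, of b] Cons.IH[OF adj_subring[OF Cons.prems], of b] by auto
qed auto

lemma adjs_gen: "subrng S ==> b : set bs ==> b : adjs S bs" proof (induction bs arbitrary: S)
 case (Cons c bs)
 thus ?case using adj_gen[OF Cons.prems(1), of c] adjs_base[OF adj_subring[OF Cons.prems(1), of c], of bs]
   Cons.IH[OF adj_subring[OF Cons.prems(1)]] by auto
qed auto

lemma adjs_least:
 "subrng T ==> S <= T ==> set bs <= T ==> adjs S bs <= T" by (induction bs arbitrary: S) (auto simp: adj_least)

lemma noeth_adjs: "noeth S ==> noeth (adjs S bs)" by (induction bs arbitrary: S) (auto simp: hilbert_basis)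

lemma domain_set_subset: "domain_set T ==> S <= T ==> domain_set S" unfolding domain_set_def by blast

text \<open>The algebraic core of Chevalley's theorem on images. Generators are adjoined one at a
  time, and the element whose nonvanishing permits one extension becomes the element to be kept
  nonzero in the preceding one.\<close>

lemma hom_extend_adjs:
 fixes S :: "'r::comm_ring_1 set"
 assumes "subrng S" "domain_set (adjs S bs)"
  "c : adjs S bs" "c ~= 0"
 shows "EX r:S. r ~= 0 & (ALL ph :: 'r => 'k::{alg_closed_field, field_char_0}. ring_hom_on S ph & ph r ~= 0
  --> (EX ph'. ring_hom_on (adjs S bs) ph' & (ALL a:S. ph' a = ph a) & ph' c ~= 0))" using assms proof (induction bs arbitrary: S)
 case Nil
 thus ?case by auto
next
 case (Cons b bs)
 define R where "R = adj S b"
 have R: "subrng R" unfolding R_def using adj_subring[OF Cons.prems(1)] .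
 have SR: "S <= R" unfolding R_def using adj_base[OF Cons.prems(1)] .
 obtain r1 where r1: "r1 : R" "r1 ~= 0" "!!ph :: 'r => 'k. ring_hom_on R ph ==> ph r1 ~= 0 ==>
   (EX ph'. ring_hom_on (adjs R bs) ph' & (ALL a:R. ph' a = ph a) & ph' c ~= 0)" using Cons.IH[OF R] Cons.prems unfolding R_def by auto
 have "domain_set R" using domain_set_subset[OF Cons.prems(2)] adjs_base[OF R, of bs] unfolding R_def by auto
 then obtain r where r: "r : S" "r ~= 0" "!!ph :: 'r => 'k. ring_hom_on S ph ==> ph r ~= 0 ==>
   (EX ph'. ring_hom_on R ph' & (ALL a:S. ph' a = ph a) & ph' r1 ~= 0)"
  using hom_extend_adj[OF Cons.prems(1), of b r1] r1(1,2) unfolding R_def by auto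
 show ?case proof (intro bexI conjI allI impI)
  fix ph :: "'r => 'k" assume "ring_hom_on S ph & ph r ~= 0"
  then obtain ph1 where ph1: "ring_hom_on R ph1" "ALL a:S. ph1 a = ph a" "ph1 r1 ~= 0" using r(3) by blast
  then obtain ph2 where "ring_hom_on (adjs R bs) ph2" "ALL a:R. ph2 a = ph1 a" "ph2 c ~= 0" using r1(3) by blast
  thus "EX ph'. ring_hom_on (adjs S (b # bs)) ph' & (ALL a:S. ph' a = ph a) & ph' c ~= 0"
   using ph1(2) SR unfolding R_def by (intro exI[of _ ph2]) auto
 qed (use r in auto)
qed

section \<open>Generalised eigenspaces\<close>

locale fd_lie_superalgebra = lie_superalgebra L
 for L :: "('k::{alg_closed_field,field_char_0}, 'a::ab_group_add) superalgebra" (structure) +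
 assumes fd: "finite_dim"
begin

abbreviation "V \<equiv> carrier L"
abbreviation "sc \<equiv> scal L"

lemma subspace_V: "subspace V" unfolding part_sum using subspace_sums[OF subspace_part[of 0] subspace_part[of 1]] by simp

lemma V_0 [simp]: "0 : V" and V_add [simp]: "x : V ==> y : V ==> x + y : V" and V_scale [simp]: "x : V ==> sc c x : V"
 and V_diff [simp]: "x : V ==> y : V ==> x - y : V" and V_neg [simp]: "x : V ==> - x : V"
 and V_sum: "(!!i. i : I ==> f i : V) ==> sum f I : V"
 using subspace_V by (auto intro: subspace_0 subspace_add subspace_scale subspace_diff subspace_neg subspace_sum)

definition "B = (SOME B. finite B & independent B & span B = V)"

lemma B: "finite B" "independent B" "span B = V" proof -
 obtain A where A: "finite A" "span A = V" using fd unfolding finite_dim_def by blast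
 obtain C where C: "C <= A" "independent C" "A <= span C" using maximal_independent_subset by blast
 have "span C = V" using span_mono[OF C(1)] span_minimal[OF C(3) subspace_span] A(2) by auto
 hence "EX B. finite B & independent B & span B = V" using A(1) C(1,2) finite_subset by blast
 from someI_ex[OF this] show "finite B" "independent B" "span B = V" unfolding B_def by auto
qed

text \<open>Only the values on \<open>V\<close> enter, so equality of endomorphisms is stated
  pointwise on \<open>V\<close> until maps are normalised by \<open>ext0\<close>.\<close>

definition lin :: "('a => 'a) => bool" where
 "lin T \<longleftrightarrow> (ALL x:V. T x : V) & (ALL x:V. ALL y:V. T (x + y) = T x + T y) & (ALL c. ALL x:V. T (sc c x) = sc c (T x))"

lemma linD:
 assumes "lin T"
 shows "x : V ==> T x : V" "x : V ==> y : V ==> T (x + y) = T x + T y" "x : V ==> T (sc c x) = sc c (T x)"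
  and lin_0: "T 0 = 0" and lin_neg: "x : V ==> T (- x) = - T x" and lin_diff: "x : V ==> y : V ==> T (x - y) = T x - T y" proof -
 show add: "x : V ==> y : V ==> T (x + y) = T x + T y" for x y using assms unfolding lin_def by blast
 show "x : V ==> T x : V" "x : V ==> T (sc c x) = sc c (T x)" using assms unfolding lin_def by auto
 show T0: "T 0 = 0" using add[of 0 0] by simp
 show neg: "T (- x) = - T x" if "x : V" for x using add[of x "- x"] that T0 by (simp add: eq_neg_iff_add_eq_0 add.commute)
 show "T (x - y) = T x - T y" if "x : V" "y : V" using add[of x "- y"] neg[of y] that by simp
qed

lemma lin_sum: "lin T ==> (!!i. i : I ==> f i : V) ==> T (sum f I) = (SUM i:I. T (f i))"
 by (induction I rule: infinite_finite_induct) (auto simp: lin_0 linD V_sum)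

lemma lin_comp: "lin S ==> lin T ==> lin (%x. S (T x))" unfolding lin_def by auto

lemma lin_funpow: "lin T ==> lin (T ^^ n)" by (induction n) (auto simp: lin_def)

lemma lin_scaleT: "lin T ==> lin (%x. sc c (T x))" unfolding lin_def by (auto simp: scale_right_distrib)

lemma lin_addT: "lin S ==> lin T ==> lin (%x. S x + T x)" unfolding lin_def by (auto simp: scale_right_distrib)

lemma lin_diffT: "lin S ==> lin T ==> lin (%x. S x - T x)" unfolding lin_def by (auto simp: scale_right_diff_distrib)

lemma lin_zeroT: "lin (%x. 0)" unfolding lin_def by auto

lemma lin_idT: "lin (%x. x)" unfolding lin_def by auto

lemma lin_sumT: "(!!i. i : I ==> lin (T i)) ==> lin (%x. SUM i:I. T i x)"
 by (induction I rule: infinite_finite_induct) (auto simp: lin_zeroT intro: lin_addT)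

lemma lin_cong: "lin S ==> (!!x. x : V ==> T x = S x) ==> lin T" unfolding lin_def by auto

definition shift :: "('a => 'a) => 'k => 'a => 'a" where
 "shift T mu x = T x - sc mu x"

definition gen :: "('a => 'a) => 'k => 'a set" where
 "gen T mu = {x : V. EX n. (shift T mu ^^ n) x = 0}"

lemma lin_shift: "lin T ==> lin (shift T mu)" unfolding shift_def[abs_def] by (intro lin_diffT lin_scaleT lin_idT)

lemma gen_V: "x : gen T mu ==> x : V" unfolding gen_def by auto

lemma funpow_vanish: "lin T ==> (T ^^ n) x = 0 ==> n <= m ==> (T ^^ m) x = 0"
 using lin_0[OF lin_funpow, of T "m - n"] funpow_add[of "m - n" n T] by auto

lemma gen_I: "x : V ==> (shift T mu ^^ n) x = 0 ==> x : gen T mu" unfolding gen_def by auto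

lemma gen_0: "lin T ==> 0 : gen T mu" by (rule gen_I[where n = 0]) auto

lemma gen_add:
 assumes T: "lin T" and "x : gen T mu" "y : gen T mu" shows "x + y : gen T mu" proof -
 obtain m n where mn: "(shift T mu ^^ m) x = 0" "(shift T mu ^^ n) y = 0" "x : V" "y : V" using assms unfolding gen_def by blast
 show ?thesis using mn funpow_vanish[OF lin_shift[OF T] mn(1), of "max m n"] funpow_vanish[OF lin_shift[OF T] mn(2), of "max m n"]
  by (intro gen_I[where n = "max m n"]) (auto simp: linD(2)[OF lin_funpow[OF lin_shift[OF T]]])
qed

lemma gen_commute:
 assumes T: "lin T" and S: "lin S" and comm: "!!x. x : V ==> S (T x) = T (S x)" and x: "x : gen T mu"
 shows "S x : gen T mu" proof -
 obtain n where n: "(shift T mu ^^ n) x = 0" "x : V" using x unfolding gen_def by blast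
 have "S ((shift T mu ^^ n) x) = (shift T mu ^^ n) (S x)" if "x : V" for x using that proof (induction n arbitrary: x)
  case (Suc n)
  hence "S (shift T mu ((shift T mu ^^ n) x)) = shift T mu (S ((shift T mu ^^ n) x))"
   using linD(1)[OF lin_funpow[OF lin_shift[OF T]]] linD[OF T] comm by (simp add: shift_def lin_diff[OF S] linD[OF S])
  with Suc show ?case by simp
 qed auto
 from this[OF n(2)] have "(shift T mu ^^ n) (S x) = 0" using n(1) lin_0[OF S] by simp
 thus ?thesis using n(2) linD(1)[OF S] by (intro gen_I) auto
qed

lemma gen_scale: "lin T ==> x : gen T mu ==> sc c x : gen T mu"
 by (rule gen_commute[where S = "sc c"]) (auto simp: linD lin_scaleT[OF lin_idT])

lemma gen_shift: "lin T ==> x : gen T mu ==> shift T nu x : gen T mu"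
 by (rule gen_commute[where S = "shift T nu"]) (auto simp: lin_shift shift_def linD lin_diff)

lemma gen_sum: "lin T ==> (!!i. i : I ==> f i : gen T mu) ==> sum f I : gen T mu"
 by (induction I rule: infinite_finite_induct) (auto simp: gen_0 gen_add)

lemma gen_eigen:
 assumes "lin T" "x : V" "T x = sc mu x" shows "x : gen T mu"
 by (rule gen_I[where n = 1]) (use assms in \<open>auto simp: shift_def\<close>)

lemma shift_inj_gen:
 assumes T: "lin T" and z: "z : gen T mu" and eq: "shift T nu z = 0" and ne: "mu ~= nu"
 shows "z = 0" proof -
 obtain n where n: "(shift T mu ^^ n) z = 0" "z : V" using z unfolding gen_def by blast
 have "(shift T mu ^^ n) z = sc ((nu - mu) ^ n) z" proof (induction n)
  case (Suc n)
  have "shift T mu (sc c z) = sc (nu - mu) (sc c z)" for c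
   using eq n(2) by (simp add: shift_def linD[OF T] scale_left_diff_distrib algebra_simps)
  with Suc show ?case by simp
 qed auto
 with n ne show ?thesis by simp
qed

lemma shift_funpow_inj_gen:
 assumes T: "lin T" and z: "z : gen T mu" and eq: "(shift T nu ^^ n) z = 0" and ne: "mu ~= nu"
 shows "z = 0" using z eq proof (induction n arbitrary: z)
 case (Suc n)
 hence "shift T nu z = 0" using Suc.IH[of "shift T nu z"] gen_shift[OF T] by (simp add: funpow_swap1)
 thus ?case using shift_inj_gen[OF T Suc.prems(1) _ ne] by simp
qed auto

text \<open>A power of the shift by \<open>nu\<close> kills the component at \<open>nu\<close> and
  is injective on the other generalised eigenspaces, so the remaining components vanish by
  induction.\<close>

lemma gen_indep:
 assumes T: "lin T" and fin: "finite S" and y: "!!mu. mu : S ==> y mu : gen T mu" and 0: "(SUM mu:S. y mu) = 0"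
 shows "mu : S ==> y mu = 0" using fin y 0 proof (induction S arbitrary: y mu rule: finite_induct)
 case (insert nu S)
 obtain n where n: "(shift T nu ^^ n) (y nu) = 0" using insert.prems(2)[of nu] unfolding gen_def by auto
 have lin_n: "lin (shift T nu ^^ n)" by (intro lin_funpow lin_shift T)
 have V: "y mu : V" if "mu : insert nu S" for mu using insert.prems(2)[OF that] gen_V by auto
 have G: "(shift T nu ^^ n) x : gen T mu" if "x : gen T mu" for x mu using that by (induction n) (auto simp: gen_shift T)
 have "(shift T nu ^^ n) (SUM mu:insert nu S. y mu) = 0" unfolding insert.prems(3) using lin_0[OF lin_n] .
 hence "(SUM mu:insert nu S. (shift T nu ^^ n) (y mu)) = 0" using lin_sum[OF lin_n, of "insert nu S" y] V by simp
 hence "(SUM mu:S. (shift T nu ^^ n) (y mu)) = 0" using insert.hyps n by simp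
 hence "(shift T nu ^^ n) (y mu) = 0" if "mu : S" for mu
  using insert.IH[of mu "%mu. (shift T nu ^^ n) (y mu)"] that G insert.prems(2) by auto
 hence S0: "y mu = 0" if "mu : S" for mu using shift_funpow_inj_gen[OF T insert.prems(2)[of mu], of n nu] that insert.hyps by auto
 hence "y nu = 0" using insert.prems(3) insert.hyps by simp
 with S0 insert.prems(1) show ?case by auto
qed auto

lemma shift_surj_gen:
 assumes T: "lin T" and y: "y : gen T nu" and ne: "mu ~= nu"
 shows "EX z:gen T nu. shift T mu z = y" proof -
 obtain n where n: "(shift T nu ^^ n) y = 0" "y : V" using y unfolding gen_def by blast
 thus ?thesis proof (induction n arbitrary: y)
  case 0
  thus ?case using gen_0[OF T] lin_0[OF lin_shift[OF T]] by auto
 next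
  case (Suc n)
  have "(shift T nu ^^ n) (shift T nu y) = 0" "shift T nu y : V" using Suc.prems linD(1)[OF lin_shift[OF T]] by (auto simp: funpow_swap1)
  from Suc.IH[OF this] obtain z' where z': "z' : gen T nu" "shift T mu z' = shift T nu y" by blast
  \<comment> \<open>Shifting by \<open>mu\<close> is shifting by \<open>nu\<close> plus the scalar
    \<open>nu - mu\<close>. Correcting \<open>y\<close> by a solution \<open>z'\<close> for
    \<open>shift T nu y\<close>, which is killed one step earlier, leaves exactly this multiple of
    \<open>y\<close>.\<close>
  define z where "z = sc (1 / (nu - mu)) (y - z')"
  have yg: "y : gen T nu" using Suc.prems gen_I by blast
  have V: "y : V" "z' : V" using Suc.prems gen_V z' by auto
  have Tz: "T z' = T y - sc nu y + sc mu z'" using z'(2) by (simp add: shift_def diff_eq_eq)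
  have "y - z' = y + sc (-1) z'" by simp
  hence "y - z' : gen T nu" using gen_add[OF T yg gen_scale[OF T z'(1), of "-1"]] by simp
  hence "z : gen T nu" unfolding z_def by (rule gen_scale[OF T])
  moreover have "shift T mu (y - z') = sc (nu - mu) y"
   using V by (simp add: shift_def lin_diff[OF T] Tz scale_right_diff_distrib scale_left_diff_distrib)
  hence "shift T mu z = y" unfolding z_def using V ne by (simp add: linD(3)[OF lin_shift[OF T]])
  ultimately show ?case by blast
 qed
qed

section \<open>Decomposition into generalised eigenspaces\<close>

abbreviation "gspan T \<equiv> span (UN mu. gen T mu)"

text \<open>The shift by \<open>mu\<close> is onto on every generalised eigenspace except its own.
  Hence \<open>shift T mu z\<close> can be solved up to an error in \<open>gen T mu\<close>, and a
  vector whose shift lies in that space lies in it.\<close>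

lemma gspan_shift:
 assumes T: "lin T" and z: "z : V" and s: "shift T mu z : gspan T"
 shows "z : gspan T" proof -
 have "EX w:gspan T. w : V & s - shift T mu w : gen T mu" if "s : gspan T" for s using that proof (induction rule: span_induct_alt)
  case base
  show ?case using gen_0[OF T] lin_0[OF lin_shift[OF T]] by (intro bexI[of _ 0]) (auto simp: span_zero)
 next
  case (step c x s)
  then obtain nu w where x: "x : gen T nu" and w: "w : gspan T" "w : V" "s - shift T mu w : gen T mu" by blast
  show ?case proof (cases "nu = mu")
   case True
   thus ?thesis using w gen_add[OF T gen_scale[OF T] w(3)] x by (intro bexI[OF _ w(1)]) (auto simp: add_diff_eq[symmetric])
  next
   case False
   then obtain w' where w': "w' : gen T nu" "shift T mu w' = x" using shift_surj_gen[OF T x, of mu] by metis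
   have "sc c w' + w : gspan T" using span_add[OF span_scale[OF span_base] w(1)] w'(1) by blast
   thus ?thesis using w w' gen_V[OF w'(1)] by (intro bexI[of _ "sc c w' + w"]) (auto simp: linD[OF lin_shift[OF T]])
  qed
 qed
 from this[OF s] obtain w where w: "w : gspan T" "w : V" "shift T mu z - shift T mu w : gen T mu" by blast
 hence "shift T mu (z - w) : gen T mu" using z by (simp add: lin_diff[OF lin_shift[OF T]])
 then obtain n where "(shift T mu ^^ n) (shift T mu (z - w)) = 0" unfolding gen_def by blast
 hence "z - w : gen T mu" using z w by (intro gen_I[where n = "Suc n"]) (auto simp: funpow_swap1)
 hence "(z - w) + w : gspan T" using span_add[OF span_base w(1)] by blast
 thus ?thesis by simp
qed

text \<open>The polynomial \<open>p\<close> in the operator \<open>T\<close>, applied to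
  \<open>x\<close> by Horner's scheme.\<close>

definition pact :: "('a => 'a) => 'k poly => 'a => 'a" where
 "pact T p x = fold_coeffs (%c z. sc c x + T z) p 0"

lemma pact_0 [simp]: "pact T 0 x = 0" by (simp add: pact_def)

lemma pact_pCons: "lin T ==> pact T (pCons c p) x = sc c x + T (pact T p x)" by (cases "p = 0 & c = 0") (auto simp: pact_def lin_0)

lemma pact_V: "lin T ==> x : V ==> pact T p x : V" by (induction p) (auto simp: pact_pCons linD)

lemma pact_add: "lin T ==> x : V ==> pact T (p + q) x = pact T p x + pact T q x"
 by (induction p q rule: poly_induct2) (auto simp: pact_pCons linD pact_V scale_left_distrib algebra_simps)

lemma pact_smult: "lin T ==> x : V ==> pact T (smult c p) x = sc c (pact T p x)"
 by (induction p) (auto simp: pact_pCons linD pact_V scale_right_distrib)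

lemma pact_monom: "lin T ==> x : V ==> pact T (monom c n) x = sc c ((T ^^ n) x)"
 by (induction n) (auto simp: monom_Suc monom_0 pact_pCons linD linD(1)[OF lin_funpow] lin_0)

lemma pact_sum: "lin T ==> x : V ==> pact T (sum p I) x = (SUM i:I. pact T (p i) x)"
 by (induction I rule: infinite_finite_induct) (auto simp: pact_add)

lemma pact_root: "lin T ==> x : V ==> pact T ([:-mu, 1:] * p) x = shift T mu (pact T p x)" proof -
 assume T: "lin T" and x: "x : V"
 have eq: "[:-mu, 1:] * p = smult (-mu) p + pCons 0 p" by simp
 show ?thesis unfolding eq pact_add[OF T x] pact_smult[OF T x] pact_pCons[OF T] shift_def by simp
qed

text \<open>Algebraic closure splits \<open>p\<close> into linear factors, which are stripped one at
  a time by \<open>gspan_shift\<close> until a nonzero constant remains.\<close>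

lemma pact_gspan:
 assumes T: "lin T" and x: "x : V"
 shows "p ~= 0 ==> pact T p x : gspan T ==> x : gspan T" proof (induction "degree p" arbitrary: p)
 case 0
 then obtain c where c: "p = [:c:]" "c ~= 0" using degree_eq_zeroE by (metis pCons_0_0)
 hence "sc (1 / c) (pact T p x) : gspan T" using 0 span_scale by blast
 thus ?case using c by (simp add: pact_pCons[OF T] lin_0[OF T])
next
 case (Suc n)
 then obtain mu where "poly p mu = 0" using alg_closed_imp_poly_has_root[of p] by auto
 then obtain q where q: "p = [:-mu, 1:] * q" by (auto simp: poly_eq_0_iff_dvd)
 have "q ~= 0" using Suc.prems q by auto
 have "degree p = Suc (degree q)" unfolding q using `q ~= 0` by (subst degree_mult_eq) auto
 have "pact T q x : gspan T" using Suc.prems(2) gspan_shift[OF T pact_V[OF T x]] unfolding q pact_root[OF T x] by blast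
 thus ?case using Suc.hyps `q ~= 0` `degree p = Suc (degree q)` by auto
qed

text \<open>Linear dependence among the iterates of \<open>x\<close>. A repeated iterate is treated
  separately, since the set of iterates is then smaller; the bound on the degree later yields a
  uniform bound for nilpotency.\<close>

lemma exists_annihilator:
 assumes T: "lin T" and x: "x : V"
 shows "EX p. p ~= 0 & degree p <= card B & pact T p x = 0" proof -
 define n where "n = card B"
 have iter: "(T ^^ i) x : V" for i using linD(1)[OF lin_funpow[OF T] x] .
 show ?thesis proof (cases "inj_on (%i. (T ^^ i) x) {..n}")
  case False
  then obtain i j where ij: "i < j" "j <= n" "(T ^^ i) x = (T ^^ j) x" unfolding inj_on_def by (metis atMost_iff nat_neq_iff)
  let ?p = "monom 1 i + monom (-1::'k) j"
  have "coeff ?p i = 1" using ij(1) by simp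
  hence "?p ~= 0" by (metis coeff_0 zero_neq_one)
  moreover have "pact T ?p x = 0" using ij(3) x T by (simp add: pact_add pact_monom)
  moreover have "degree ?p <= n" using ij(1,2) degree_monom_le[of "1::'k" i] degree_monom_le[of "-1::'k" j] by (intro degree_add_le) auto
  ultimately show ?thesis unfolding n_def by blast
 next
  case True
  let ?A = "(%i. (T ^^ i) x) ` {..n}"
  have "card ?A = Suc n" using card_image[OF True] by simp
  moreover have "?A <= span B" using iter B(3) by auto
  ultimately have "dependent ?A" using independent_span_bound[OF B(1), of ?A] unfolding n_def by fastforce
  then obtain u v where u: "v : ?A" "u v ~= 0" "(SUM v:?A. sc (u v) v) = 0" using dependent_finite[of ?A] by auto
  define p where "p = (SUM i<=n. monom (u ((T ^^ i) x)) i)"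
  have "coeff p i = u ((T ^^ i) x)" if "i <= n" for i unfolding p_def using that by (simp add: coeff_sum coeff_monom)
  hence "p ~= 0" using u(1,2) by (metis (no_types, lifting) atMost_iff coeff_0 imageE)
  moreover have "pact T p x = (SUM i<=n. sc (u ((T ^^ i) x)) ((T ^^ i) x))" unfolding p_def using x T by (simp add: pact_sum pact_monom)
  hence "pact T p x = 0" using u(3) by (simp add: sum.reindex[OF True])
  moreover have "degree p <= n" unfolding p_def by (intro degree_sum_le) (auto intro: degree_monom_le[THEN order_trans])
  ultimately show ?thesis unfolding n_def by blast
 qed
qed

lemma gen_decomp: "lin T ==> x : V ==> x : gspan T" using exists_annihilator[of T x] pact_gspan[of T x] span_zero by metis

definition eigs :: "('a => 'a) => 'k set" where
 "eigs T = {mu. EX x:gen T mu. x ~= 0}"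

lemma gen_not_eigs: "x : gen T mu ==> mu ~: eigs T ==> x = 0" unfolding eigs_def by auto

lemma finite_eigs:
 assumes T: "lin T" shows "finite (eigs T)" proof (rule ccontr)
 assume "infinite (eigs T)"
 then obtain S where S: "finite S" "card S = Suc (card B)" "S <= eigs T" using infinite_arbitrarily_large by metis
 have "ALL mu:S. EX x. x : gen T mu & x ~= 0" using S(3) unfolding eigs_def by blast
 from bchoice[OF this] obtain y where y: "!!mu. mu : S ==> y mu : gen T mu & y mu ~= 0" by blast
 have inj: "inj_on y S" proof (rule inj_onI)
  fix mu nu assume m: "mu : S" "nu : S" "y mu = y nu"
  then obtain n where "(shift T nu ^^ n) (y mu) = 0" using y[OF m(2)] unfolding gen_def by auto
  thus "mu = nu" using shift_funpow_inj_gen[OF T, of "y mu" mu n nu] y[OF m(1)] by blast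
 qed
 have "independent (y ` S)" proof (rule independent_if_scalars_zero)
  fix f x assume 0: "(SUM x:y ` S. sc (f x) x) = 0" and x: "x : y ` S"
  hence "(SUM mu:S. sc (f (y mu)) (y mu)) = 0" by (simp add: sum.reindex[OF inj])
  hence "sc (f (y mu)) (y mu) = 0" if "mu : S" for mu
   using gen_indep[OF T S(1), of "%mu. sc (f (y mu)) (y mu)"] gen_scale[OF T] y that by blast
  thus "f x = 0" using x y by auto
 qed (use S(1) in simp)
 moreover have "y ` S <= span B" using y gen_V B(3) by blast
 ultimately show False using independent_span_bound[OF B(1)] S(2) card_image[OF inj] by fastforce
qed

text \<open>The projection onto \<open>gen T mu\<close> along the other generalised eigenspaces. A
  decomposition of \<open>x\<close> is chosen and its component read off; independence of these
  spaces makes the choice unique.\<close>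

definition gp :: "('a => 'a) => 'k => 'a => 'a" where
 "gp T mu x = (SOME y. (ALL mu. y mu : gen T mu) & x = (SUM mu:eigs T. y mu)) mu"

lemma gp:
 assumes T: "lin T" and x: "x : V"
 shows gp_gen: "gp T mu x : gen T mu" and gp_sum: "(SUM mu:eigs T. gp T mu x) = x" proof -
 have "EX y. (ALL mu. y mu : gen T mu) & x = (SUM mu:eigs T. y mu)" using gen_decomp[OF T x] proof (induction rule: span_induct_alt)
  case base
  show ?case using gen_0[OF T] by (intro exI[of _ "%_. 0"]) simp
 next
  case (step c u v)
  then obtain nu y where u: "u : gen T nu" and y: "ALL mu. y mu : gen T mu" "v = (SUM mu:eigs T. y mu)" by blast
  have "sc c u = (SUM mu:eigs T. if mu = nu then sc c u else 0)" using finite_eigs[OF T] gen_not_eigs[OF u] by auto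
  hence "sc c u + v = (SUM mu:eigs T. (if mu = nu then sc c u else 0) + y mu)" unfolding y(2) sum.distrib by simp
  moreover have "ALL mu. (if mu = nu then sc c u else 0) + y mu : gen T mu"
   using y(1) u gen_0[OF T] gen_scale[OF T] by (intro allI gen_add[OF T]) auto
  ultimately show ?case by (intro exI[of _ "%mu. (if mu = nu then sc c u else 0) + y mu"] conjI)
 qed
 from someI_ex[OF this] show "gp T mu x : gen T mu" "(SUM mu:eigs T. gp T mu x) = x" unfolding gp_def by auto
qed

lemma gp_V: "lin T ==> x : V ==> gp T mu x : V" using gp_gen gen_V by blast

lemma gp_unique:
 assumes T: "lin T" and S: "finite S" "!!mu. y mu : gen T mu" "x = (SUM mu:S. y mu)"
 shows "gp T mu x = (if mu : S then y mu else 0)" proof -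
 have x: "x : V" unfolding S(3) using S(2) gen_V by (intro V_sum) blast
 let ?z = "%mu. gp T mu x + sc (-1) (if mu : S then y mu else 0)"
 let ?U = "insert mu (eigs T \<union> S)"
 have fin: "finite ?U" using S(1) finite_eigs[OF T] by auto
 have g: "?z mu : gen T mu" for mu using gp_gen[OF T x] S(2) gen_0[OF T] by (intro gen_add[OF T] gen_scale[OF T]) auto
 have "(SUM mu:?U. gp T mu x) = (SUM mu:eigs T. gp T mu x)"
  using fin gen_not_eigs[OF gp_gen[OF T x]] by (intro sum.mono_neutral_right) auto
 moreover have "(SUM mu:?U. if mu : S then y mu else 0) = (SUM mu:S. y mu)" using fin by (intro sum.mono_neutral_cong_right) auto
 ultimately have "(SUM mu:?U. ?z mu) = 0" unfolding sum.distrib scale_sum_right[symmetric] using gp_sum[OF T x] S(3) by simp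
 hence "?z mu = 0" using gen_indep[OF T fin, of ?z mu] g by blast
 thus ?thesis by (simp add: scale_minus_left eq_neg_iff_add_eq_0[symmetric] del: scale_minus_left) auto
qed

lemma gp_on_gen: "lin T ==> x : gen T mu ==> gp T nu x = (if nu = mu then x else 0)"
 using gp_unique[of T "{mu}" "%nu. if nu = mu then x else 0" x nu] gen_0 by auto

lemma gp_commute:
 assumes T: "lin T" and S: "lin S" and comm: "!!x. x : V ==> S (T x) = T (S x)" and x: "x : V"
 shows "gp T mu (S x) = S (gp T mu x)" proof -
 have "S x = S (SUM mu:eigs T. gp T mu x)" using gp_sum[OF T x] by simp
 also have "... = (SUM mu:eigs T. S (gp T mu x))" using gp_V[OF T x] by (intro lin_sum[OF S])
 finally have "gp T mu (S x) = (if mu : eigs T then S (gp T mu x) else 0)"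
  by (intro gp_unique[OF T finite_eigs[OF T]] gen_commute[OF T S comm] gp_gen[OF T x])
 thus ?thesis using gen_not_eigs[OF gp_gen[OF T x]] lin_0[OF S] by auto
qed

lemma gp_lin: assumes T: "lin T" shows "lin (gp T mu)" unfolding lin_def proof (intro conjI ballI allI)
 fix x y assume xy: "x : V" "y : V"
 have "x + y = (SUM mu:eigs T. gp T mu x + gp T mu y)" unfolding sum.distrib using gp_sum[OF T] xy by simp
 hence "gp T mu (x + y) = (if mu : eigs T then gp T mu x + gp T mu y else 0)"
  using xy by (intro gp_unique[OF T finite_eigs[OF T]] gen_add[OF T] gp_gen[OF T])
 thus "gp T mu (x + y) = gp T mu x + gp T mu y" using gen_not_eigs[OF gp_gen[OF T]] xy by auto
next
 fix c x assume x: "x : V"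
 show "gp T mu (sc c x) = sc c (gp T mu x)"
  by (rule gp_commute[OF T _ _ x]) (auto simp: lin_def scale_right_distrib linD[OF T] mult.commute)
qed (use gp_V[OF T] in auto)

text \<open>A functional calculus that sees eigenvalues only: on \<open>gen T mu\<close> it is the
  scalar \<open>g mu\<close>. The identity function gives the semisimple part of
  \<open>T\<close>.\<close>

definition fcalc :: "('a => 'a) => ('k => 'k) => 'a => 'a" where
 "fcalc T g x = (SUM mu:eigs T. sc (g mu) (gp T mu x))"

lemma fcalc_lin: "lin T ==> lin (fcalc T g)" unfolding fcalc_def[abs_def] by (intro lin_sumT lin_scaleT gp_lin)

lemma fcalc_gen:
 assumes T: "lin T" and x: "x : gen T mu"
 shows "fcalc T g x = sc (g mu) x" proof -
 have "fcalc T g x = (SUM nu:eigs T. if nu = mu then sc (g mu) x else 0)"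
  unfolding fcalc_def by (intro sum.cong) (auto simp: gp_on_gen[OF T x])
 thus ?thesis using finite_eigs[OF T] gen_not_eigs[OF x] by auto
qed

lemma fcalc_commute:
 assumes T: "lin T" and S: "lin S" and comm: "!!x. x : V ==> S (T x) = T (S x)" and x: "x : V"
 shows "fcalc T g (S x) = S (fcalc T g x)" unfolding fcalc_def using gp_V[OF T x]
 by (simp add: gp_commute[OF T S comm x] lin_sum[OF S] linD[OF S])

lemma gen_induct [consumes 2, case_names gen add]:
 assumes T: "lin T" and x: "x : V" and gen: "!!mu x. x : gen T mu ==> P x" and add: "!!x y. x : V ==> y : V ==> P x ==> P y ==> P (x + y)"
 shows "P x" proof -
 have "P (SUM mu:S. gp T mu x)" if "finite S" for S using that proof (induction S rule: finite_induct)
  case empty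
  thus ?case using gen[OF gen_0[OF T]] by simp
 next
  case (insert mu S)
  thus ?case using add gen[OF gp_gen[OF T x]] gp_V[OF T x] V_sum[of S] by simp
 qed
 from this[OF finite_eigs[OF T]] show ?thesis using gp_sum[OF T x] by simp
qed

end

section \<open>Even derivations and automorphisms\<close>

context fd_lie_superalgebra
begin

abbreviation "br \<equiv> brkt L"

lemma part_V: "x : part L p ==> x : V" proof -
 assume x: "x : part L p"
 have "0 : part L 0" "0 : part L 1" using subspace_part subspace_0 by blast+
 moreover have "p = 0 | p = 1" by (cases p) auto
 moreover have "x = x + 0" "x = 0 + x" by auto
 ultimately show "x : V" unfolding part_sum using x by blast
qed

text \<open>The projection onto the even part. A linear map preserves parity exactly when it
  commutes with \<open>pr\<close>, which is how evenness is encoded below.\<close>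

definition "pr x = (SOME u. u : part L 0 & (EX v:part L 1. x = u + v))"

lemma pr_ex:
 assumes "x : V" shows "pr x : part L 0" "x - pr x : part L 1" proof -
 have "EX u. u : part L 0 & (EX v:part L 1. x = u + v)" using assms unfolding part_sum by blast
 from someI_ex[OF this] have "pr x : part L 0 & (EX v:part L 1. x = pr x + v)" unfolding pr_def .
 then obtain v where "pr x : part L 0" "v : part L 1" "x = pr x + v" by blast
 thus "pr x : part L 0" "x - pr x : part L 1" by (simp, metis add_diff_cancel_left')
qed

lemma pr_unique:
 assumes "u : part L 0" "v : part L 1" shows "pr (u + v) = u" proof -
 have x: "u + v : V" using assms part_V by simp
 have "pr (u + v) - u : part L 0" using pr_ex(1)[OF x] assms(1) subspace_part subspace_diff by blast
 moreover have "v - (u + v - pr (u + v)) : part L 1" using pr_ex(2)[OF x] assms(2) subspace_part subspace_diff by blast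
 moreover have "v - (u + v - pr (u + v)) = pr (u + v) - u" by simp
 ultimately have "pr (u + v) - u : part L 0 \<inter> part L 1" by simp
 thus ?thesis using part_Int by simp
qed

lemma pr_V: "x : V ==> pr x : V" using pr_ex(1) part_V by blast

lemma pr_lin: "lin pr" unfolding lin_def proof (intro conjI ballI allI)
 fix x y assume xy: "x : V" "y : V"
 have "pr ((pr x + pr y) + ((x - pr x) + (y - pr y))) = pr x + pr y" using xy pr_ex subspace_part subspace_add by (intro pr_unique) blast+
 thus "pr (x + y) = pr x + pr y" by (simp add: algebra_simps)
next
 fix c x assume x: "x : V"
 have "pr (sc c (pr x) + sc c (x - pr x)) = sc c (pr x)" using x pr_ex subspace_part subspace_scale by (intro pr_unique) blast+
 thus "pr (sc c x) = sc c (pr x)" by (simp add: scale_right_distrib[symmetric])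
qed (use pr_V in auto)

lemma part_0_iff: "x : part L 0 \<longleftrightarrow> x : V & pr x = x"
 using pr_ex(1)[of x] pr_unique[of x 0] part_V subspace_part subspace_0 by fastforce

lemma part_1_iff: "x : part L 1 \<longleftrightarrow> x : V & pr x = 0"
 using pr_ex(2)[of x] pr_unique[of 0 x] part_V subspace_part subspace_0 by fastforce

definition even :: "('a => 'a) => bool" where
 "even T \<longleftrightarrow> (ALL x:V. T (pr x) = pr (T x))"

lemma even_part:
 assumes "lin T" "even T" "x : part L p" shows "T x : part L p" proof -
 have "p = 0 | p = 1" by (cases p) auto
 thus ?thesis using assms part_0_iff part_1_iff linD(1)[OF assms(1)] lin_0[OF assms(1)] unfolding even_def by metis
qed

lemma evenI:
 assumes T: "lin T" and "!!p x. x : part L p ==> T x : part L p" shows "even T" unfolding even_def proof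
 fix x assume x: "x : V"
 have "T x = T (pr x + (x - pr x))" by simp
 also have "... = T (pr x) + T (x - pr x)" using x pr_V by (intro linD(2)[OF T]) auto
 finally show "T (pr x) = pr (T x)" using pr_unique[OF assms(2)[OF pr_ex(1)[OF x]] assms(2)[OF pr_ex(2)[OF x]]] by simp
qed

lemma br_V: assumes "x : V" "y : V" shows "br x y : V" proof -
 have "br x y = br (pr x + (x - pr x)) (pr y + (y - pr y))" by simp
 also have "... = (br (pr x) (pr y) + br (pr x) (y - pr y)) + (br (x - pr x) (pr y) + br (x - pr x) (y - pr y))"
  using assms pr_V brkt_add_left[of "pr x" "x - pr x" "pr y + (y - pr y)"]
   brkt_add_right[of "pr x" "pr y" "y - pr y"] brkt_add_right[of "x - pr x" "pr y" "y - pr y"] by simp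
 also have "... : V" using brkt_part pr_ex assms part_V by (intro V_add) blast+
 finally show ?thesis .
qed

lemma br_lin_left: "y : V ==> lin (%x. br x y)" and br_lin_right: "y : V ==> lin (br y)"
 unfolding lin_def by (auto simp: br_V brkt_add_left brkt_add_right brkt_scal_left brkt_scal_right)

lemmas br_0_left = lin_0[OF br_lin_left] and br_0_right = lin_0[OF br_lin_right] and br_diff_left = lin_diff[OF br_lin_left]
 and br_diff_right = lin_diff[OF br_lin_right] and br_sum_left = lin_sum[OF br_lin_left] and br_sum_right = lin_sum[OF br_lin_right]

definition der :: "('a => 'a) => bool" where
 "der X \<longleftrightarrow> lin X & even X & (ALL x:V. ALL y:V. X (br x y) = br (X x) y + br x (X y))"

definition aut :: "('a => 'a) => bool" where
 "aut f \<longleftrightarrow> lin f & even f & (ALL x:V. ALL y:V. f (br x y) = br (f x) (f y)) & bij_betw f V V"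

lemma derD: "der X ==> lin X" "der X ==> even X"
 "der X ==> x : V ==> y : V ==> X (br x y) = br (X x) y + br x (X y)" unfolding der_def by auto

lemma autD: "aut f ==> lin f" "aut f ==> even f"
 "aut f ==> x : V ==> y : V ==> f (br x y) = br (f x) (f y)" "aut f ==> bij_betw f V V" unfolding aut_def by auto

lemma even_comp: "lin S ==> lin T ==> even S ==> even T ==> even (%x. S (T x))" unfolding even_def using linD(1) by auto

lemma even_funpow: "lin T ==> even T ==> even (T ^^ n)" proof (induction n)
 case (Suc n)
 thus ?case using even_comp[of T "T ^^ n"] lin_funpow by (simp add: comp_def)
qed (auto simp: even_def)

lemma even_add: "lin S ==> lin T ==> even S ==> even T ==> even (%x. S x + T x)" unfolding even_def using linD[OF pr_lin] linD(1) by auto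

lemma even_scale: "lin T ==> even T ==> even (%x. sc c (T x))" unfolding even_def using linD[OF pr_lin] linD(1) by auto

lemma even_zero: "even (%x. 0)" unfolding even_def using lin_0[OF pr_lin] by auto

lemma even_id: "even (%x. x)" unfolding even_def by auto

lemma even_sum: "(!!i. i : I ==> lin (T i) & even (T i)) ==> even (%x. SUM i:I. T i x)" proof (induction I rule: infinite_finite_induct)
 case (insert i I)
 thus ?case using even_add[of "T i" "%x. SUM i:I. T i x"] lin_sumT[of I T] by simp
qed (auto simp: even_zero)

lemma even_fcalc: "lin T ==> even T ==> even (fcalc T g)" unfolding even_def using fcalc_commute[of T pr] pr_lin by auto

lemma der_cong: "der X ==> (!!x. x : V ==> Y x = X x) ==> der Y"
 unfolding der_def even_def using lin_cong[of X Y] linD(1)[of X] br_V pr_V by auto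

lemma aut_cong: "aut f ==> (!!x. x : V ==> g x = f x) ==> aut g"
 unfolding aut_def even_def using lin_cong[of f g] linD(1)[of f] br_V pr_V bij_betw_cong[of V f g V] by auto

lemma der_scale: "der X ==> der (%x. sc c (X x))" using linD(1)[of X] unfolding der_def
 by (auto simp: lin_scaleT even_scale brkt_scal_left brkt_scal_right scale_right_distrib)

lemma der_add: "der X ==> der Y ==> der (%x. X x + Y x)" using linD(1)[of X] linD(1)[of Y] unfolding der_def
 by (auto simp: lin_addT even_add brkt_add_left brkt_add_right algebra_simps)

lemma der_zero: "der (%x. 0)" unfolding der_def by (auto simp: lin_zeroT even_zero br_0_left br_0_right)

text \<open>By the Leibniz rule the shift by \<open>mu + nu\<close> of a bracket is the sum of the
  brackets with one entry shifted; after \<open>i + j\<close> applications each term has an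
  annihilated entry.\<close>

lemma gen_br_der:
 assumes X: "der X" and x: "x : gen X mu" and y: "y : gen X nu"
 shows "br x y : gen X (mu + nu)" proof -
 note T = derD(1)[OF X]
 obtain i j where ij: "(shift X mu ^^ i) x = 0" "(shift X nu ^^ j) y = 0" "x : V" "y : V" using x y unfolding gen_def by blast
 have "(shift X (mu + nu) ^^ n) (br x y) = 0"
  if "(shift X mu ^^ i) x = 0" "(shift X nu ^^ j) y = 0" "x : V" "y : V" "i + j = n" for i j n x y using that
 proof (induction n arbitrary: i j x y)
  case 0
  thus ?case by (simp add: br_0_left)
 next
  case (Suc n)
  note lin_s = lin_shift[OF T]
  have V: "shift X mu x : V" "shift X nu y : V" using Suc.prems linD(1)[OF lin_s] by auto
  have eq: "shift X (mu + nu) (br x y) = br (shift X mu x) y + br x (shift X nu y)"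
   using Suc.prems(3,4) by (simp add: shift_def derD(3)[OF X] br_diff_left br_diff_right linD(1)[OF T]
     brkt_scal_left brkt_scal_right scale_left_distrib)
  have 1: "(shift X (mu + nu) ^^ n) (br (shift X mu x) y) = 0" proof (cases i)
   case 0
   hence "x = 0" using Suc.prems(1) by simp
   thus ?thesis using Suc.prems(4) lin_0[OF lin_s] lin_0[OF lin_funpow[OF lin_s]] by (simp add: br_0_left)
  next
   case (Suc i')
   thus ?thesis using Suc.IH[of i' "shift X mu x" j y] Suc.prems V by (auto simp: funpow_swap1)
  qed
  have 2: "(shift X (mu + nu) ^^ n) (br x (shift X nu y)) = 0" proof (cases j)
   case 0
   hence "y = 0" using Suc.prems(2) by simp
   thus ?thesis using Suc.prems(3) lin_0[OF lin_s] lin_0[OF lin_funpow[OF lin_s]] by (simp add: br_0_right)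
  next
   case (Suc j')
   thus ?thesis using Suc.IH[of i x j' "shift X nu y"] Suc.prems V by (auto simp: funpow_swap1)
  qed
  have "(shift X (mu + nu) ^^ Suc n) (br x y) = (shift X (mu + nu) ^^ n) (shift X (mu + nu) (br x y))" by (simp add: funpow_swap1)
  also have "... = 0" unfolding eq using 1 2 V Suc.prems(3,4) by (simp add: linD(2)[OF lin_funpow[OF lin_s]] br_V)
  finally show ?case .
 qed
 from this[OF ij refl] show ?thesis using ij br_V by (intro gen_I) auto
qed

text \<open>Brackets add eigenvalues, so a function of the eigenvalues gives a derivation as soon as
  it is additive. The identity yields the semisimple part, rational coordinates yield integral
  derivations.\<close>

lemma fcalc_der:
 assumes X: "der X" and g: "!!mu nu. g (mu + nu) = g mu + g nu"
 shows "der (fcalc X g)" unfolding der_def proof (intro conjI ballI)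
 note T = derD(1)[OF X]
 show l: "lin (fcalc X g)" by (rule fcalc_lin[OF T])
 show "even (fcalc X g)" by (rule even_fcalc[OF T derD(2)[OF X]])
 fix x y assume x: "x : V" and y: "y : V"
 show "fcalc X g (br x y) = br (fcalc X g x) y + br x (fcalc X g y)" using T x y proof (induction x arbitrary: y rule: gen_induct)
  case (gen mu x)
  have xV: "x : V" using gen gen_V by blast
  show ?case using T gen.prems(1) proof (induction y rule: gen_induct)
   case (gen nu y)
   thus ?case using fcalc_gen[OF T gen_br_der[OF X `x : gen X mu` gen]] fcalc_gen[OF T `x : gen X mu`] fcalc_gen[OF T gen]
     xV gen_V[OF gen] by (simp add: g brkt_scal_left brkt_scal_right scale_left_distrib)
  next
   case (add y z)
   thus ?case using xV linD[OF l] by (simp add: brkt_add_right br_V algebra_simps)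
  qed
 next
  case (add x z)
  thus ?case using linD[OF l] by (simp add: brkt_add_left br_V algebra_simps)
 qed
qed

definition nilp :: "('a => 'a) => bool" where
 "nilp X \<longleftrightarrow> (EX n. ALL x:V. (X ^^ n) x = 0)"

lemma nilpI:
 assumes T: "lin X" and loc: "!!x. x : V ==> EX n. (X ^^ n) x = 0"
 shows "nilp X" proof -
 have "ALL b:B. EX n. (X ^^ n) b = 0" using loc span_superset[of B] B(3) by auto
 then obtain n where n: "!!b. b : B ==> (X ^^ n b) b = 0" by metis
 define N where "N = (SUM b:B. n b)"
 have N: "(X ^^ N) b = 0" if "b : B" for b
  using that n B(1) by (intro funpow_vanish[OF T n[OF that]]) (auto simp: N_def intro: member_le_sum)
 have "(X ^^ N) x = 0" if "x : V" for x proof -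
  have "x : span B" using that B(3) by simp
  then obtain c where c: "x = (SUM b:B. sc (c b) b)" unfolding span_finite[OF B(1)] by blast
  have BV: "b : B ==> b : V" for b using B(3) span_superset by blast
  have "(X ^^ N) x = (SUM b:B. (X ^^ N) (sc (c b) b))" unfolding c using BV by (intro lin_sum[OF lin_funpow[OF T]]) auto
  also have "... = 0" using N BV by (intro sum.neutral) (auto simp: linD(3)[OF lin_funpow[OF T]])
  finally show ?thesis .
 qed
 thus ?thesis unfolding nilp_def by blast
qed

text \<open>On \<open>gen X mu\<close> the difference acts as the shift by \<open>mu\<close>, which
  is locally nilpotent there.\<close>

lemma nilp_jordan:
 assumes T: "lin X" shows "nilp (%x. X x - fcalc X (%mu. mu) x)" proof (rule nilpI)
 let ?N = "%x. X x - fcalc X (%mu. mu) x"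
 show lN: "lin ?N" by (intro lin_diffT T fcalc_lin)
 fix x assume "x : V"
 with T show "EX n. (?N ^^ n) x = 0" proof (induction rule: gen_induct)
  case (gen mu x)
  have "(?N ^^ n) x = (shift X mu ^^ n) x & (shift X mu ^^ n) x : gen X mu" for n proof (induction n)
   case (Suc n)
   thus ?case using gen_shift[OF T] fcalc_gen[OF T, of _ mu] by (auto simp: shift_def)
  qed (use gen in auto)
  thus ?case using gen unfolding gen_def by auto
 next
  case (add x y)
  then obtain m n where mn: "(?N ^^ m) x = 0" "(?N ^^ n) y = 0" by blast
  show ?case using add(1,2) funpow_vanish[OF lN mn(1), of "m + n"] funpow_vanish[OF lN mn(2), of "m + n"] by (intro exI[of _ "m + n"]) (simp add: linD(2)[OF lin_funpow[OF lN]])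
 qed
qed

subsection \<open>Exponentials of nilpotent derivations\<close>

lemma der_leibniz:
 assumes X: "der X" and xy: "x : V" "y : V"
 shows "(X ^^ n) (br x y) = (SUM i<=n. sc (of_nat (n choose i)) (br ((X ^^ i) x) ((X ^^ (n - i)) y)))" proof (induction n)
 case (Suc n)
 note T = derD(1)[OF X]
 have pV: "(X ^^ i) z : V" if "z : V" for i z using linD(1)[OF lin_funpow[OF T]] that by blast
 define F where "F i j = br ((X ^^ i) x) ((X ^^ j) y)" for i j
 have FV: "F i j : V" for i j unfolding F_def using pV xy br_V by blast
 have XF: "X (F i j) = F (Suc i) j + F i (Suc j)" for i j unfolding F_def using derD(3)[OF X pV[OF xy(1)] pV[OF xy(2)]] by simp
 have "(X ^^ Suc n) (br x y) = X (SUM i<=n. sc (of_nat (n choose i)) (F i (n - i)))" using Suc unfolding F_def by simp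
 also have "... = (SUM i<=n. sc (of_nat (n choose i)) (F (Suc i) (n - i) + F i (Suc (n - i))))"
  using FV by (simp add: lin_sum[OF T] linD(3)[OF T] XF)
 also have "... = (SUM i<=n. sc (of_nat (n choose i)) (F (Suc i) (n - i))) + (SUM i<=n. sc (of_nat (n choose i)) (F i (Suc n - i)))"
  unfolding scale_right_distrib sum.distrib by (auto intro!: arg_cong2[where f = "(+)"] sum.cong simp: Suc_diff_le)
 also have "(SUM i<=n. sc (of_nat (n choose i)) (F i (Suc n - i)))
   = F 0 (Suc n) + (SUM i<=n. sc (of_nat (n choose Suc i)) (F (Suc i) (n - i)))" proof -
  have "(SUM i<=n. sc (of_nat (n choose i)) (F i (Suc n - i))) = (SUM i<=Suc n. sc (of_nat (n choose i)) (F i (Suc n - i)))" by simp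
  also have "... = F 0 (Suc n) + (SUM i<=n. sc (of_nat (n choose Suc i)) (F (Suc i) (n - i)))" by (subst sum.atMost_Suc_shift) simp
  finally show ?thesis .
 qed
 also have "(SUM i<=n. sc (of_nat (n choose i)) (F (Suc i) (n - i)))
   + (F 0 (Suc n) + (SUM i<=n. sc (of_nat (n choose Suc i)) (F (Suc i) (n - i))))
   = F 0 (Suc n) + (SUM i<=n. sc (of_nat (Suc n choose Suc i)) (F (Suc i) (n - i)))"
  by (simp add: scale_left_distrib sum.distrib algebra_simps)
 also have "... = (SUM i<=Suc n. sc (of_nat (Suc n choose i)) (F i (Suc n - i)))" by (subst sum.atMost_Suc_shift) simp
 finally show ?case unfolding F_def .
qed simp

text \<open>A truncated exponential series, equal to the exponential once \<open>X ^^ N\<close>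
  vanishes.\<close>

definition expo :: "nat => ('a => 'a) => 'a => 'a" where
 "expo N X x = (SUM i<N. sc (1 / fact i) ((X ^^ i) x))"

lemma lin_expo: "lin X ==> lin (expo N X)" unfolding expo_def[abs_def] by (intro lin_sumT lin_scaleT lin_funpow)

lemma even_expo: "lin X ==> even X ==> even (expo N X)" unfolding expo_def[abs_def]
 by (intro even_sum conjI even_scale lin_scaleT lin_funpow even_funpow) auto

lemma expo_mono:
 assumes T: "lin X" and N: "!!x. x : V ==> (X ^^ N) x = 0" and "N <= M" "x : V"
 shows "expo M X x = expo N X x" unfolding expo_def using assms(3,4) funpow_vanish[OF T N[OF assms(4)]]
 by (intro sum.mono_neutral_right) auto

text \<open>Reordering for a Cauchy product: all nonzero terms lie in a square of side
  \<open>N\<close>, which is contained in the triangle of side \<open>2 * N\<close>.\<close>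

lemma sum_square_triangle:
 fixes f :: "nat => nat => 'a"
 assumes "!!i j. i >= N | j >= N ==> f i j = 0"
 shows "(SUM i<N. SUM j<N. f i j) = (SUM n<2*N. SUM i<=n. f i (n - i))" proof -
 have "(SUM i<N. SUM j<N. f i j) = (SUM (i,j):{..<N} \<times> {..<N}. f i j)" by (simp add: sum.cartesian_product)
 also have "... = (SUM (i,j):{(i,j). i + j < 2*N}. f i j)" proof (rule sum.mono_neutral_left)
  show "finite {(i, j). i + j < 2 * N}" by (rule finite_subset[of _ "{..<2*N} \<times> {..<2*N}"]) auto
  show "ALL i:{(i, j). i + j < 2 * N} - {..<N} \<times> {..<N}. (case i of (i, j) => f i j) = 0"
   using assms by (auto simp: not_less[symmetric])
 qed auto
 also have "... = (SUM n<2*N. SUM i<=n. f i (n - i))" by (rule sum.triangle_reindex)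
 finally show ?thesis .
qed

lemma expo_br:
 assumes X: "der X" and N: "!!x. x : V ==> (X ^^ N) x = 0" and xy: "x : V" "y : V"
 shows "expo N X (br x y) = br (expo N X x) (expo N X y)" proof -
 note T = derD(1)[OF X]
 have pV: "(X ^^ i) z : V" if "z : V" for i z using linD(1)[OF lin_funpow[OF T]] that by blast
 have z: "(X ^^ i) z = 0" if "z : V" "i >= N" for i z using funpow_vanish[OF T N[OF that(1)] that(2)] .
 define f where "f i j = br (sc (1 / fact i) ((X ^^ i) x)) (sc (1 / fact j) ((X ^^ j) y))" for i j
 have f0: "f i j = 0" if "i >= N | j >= N" for i j
  using that z[OF xy(1), of i] z[OF xy(2), of j] xy pV by (auto simp: f_def br_0_left br_0_right)
 have fn: "f i (n - i) = sc (of_nat (n choose i) / fact n) (br ((X ^^ i) x) ((X ^^ (n - i)) y))" if "i <= n" for i n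
  using that pV xy by (simp add: f_def brkt_scal_left brkt_scal_right binomial_fact)
 have "br (expo N X x) (expo N X y) = (SUM i<N. br (sc (1 / fact i) ((X ^^ i) x)) (expo N X y))"
  unfolding expo_def[of N X x] using pV xy linD(1)[OF lin_expo[OF T]] by (intro br_sum_left) auto
 also have "... = (SUM i<N. SUM j<N. f i j)" unfolding f_def expo_def[of N X y] using pV xy by (intro sum.cong refl br_sum_right) auto
 also have "... = (SUM n<2*N. SUM i<=n. f i (n - i))" using f0 by (rule sum_square_triangle)
 also have "... = (SUM n<2*N. sc (1 / fact n) ((X ^^ n) (br x y)))"
  unfolding der_leibniz[OF X xy] scale_sum_right by (intro sum.cong refl) (auto simp: fn)
 also have "... = expo (2*N) X (br x y)" unfolding expo_def ..
 also have "... = expo N X (br x y)" using expo_mono[OF T N, of "2*N"] br_V xy by simp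
 finally show ?thesis ..
qed

lemma funpow_neg:
 assumes "lin X" "x : V" shows "((%x. - X x) ^^ n) x = sc ((-1) ^ n) ((X ^^ n) x)" using assms linD(1)[OF lin_funpow[OF assms(1)]]
 by (induction n) (auto simp: linD(3)[OF assms(1)])

lemma expo_inverse:
 assumes T: "lin X" and N: "!!x. x : V ==> (X ^^ N) x = 0" and x: "x : V" and "N > 0"
 shows "expo N X (expo N (%x. - X x) x) = x" proof -
 have pV: "(X ^^ i) z : V" if "z : V" for i z using linD(1)[OF lin_funpow[OF T]] that by blast
 have z: "(X ^^ i) z = 0" if "z : V" "i >= N" for i z using funpow_vanish[OF T N[OF that(1)] that(2)] .
 define f where "f i j = sc (1 / fact i * ((-1) ^ j / fact j)) ((X ^^ (i + j)) x)" for i j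
 have fn: "f i (n - i) = sc (1 / fact n * ((-1) ^ (n - i) * of_nat (n choose i))) ((X ^^ n) x)" if "i <= n" for i n
  using that by (simp add: f_def binomial_fact)
 have "expo N X (expo N (%x. - X x) x) = (SUM i<N. sc (1 / fact i) ((X ^^ i) (SUM j<N. sc ((-1) ^ j / fact j) ((X ^^ j) x))))"
  unfolding expo_def using x by (simp add: funpow_neg[OF T])
 also have "... = (SUM i<N. SUM j<N. f i j)"
  using pV x by (simp add: f_def lin_sum[OF lin_funpow[OF T]] linD(3)[OF lin_funpow[OF T]] scale_sum_right funpow_add)
 also have "... = (SUM n<2*N. SUM i<=n. f i (n - i))" using z[OF x] by (intro sum_square_triangle) (auto simp: f_def)
 also have "... = (SUM n<2*N. sc (1 / fact n * (SUM i<=n. (-1) ^ (n - i) * of_nat (n choose i))) ((X ^^ n) x))"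
  unfolding sum_distrib_left scale_sum_left by (intro sum.cong refl) (auto simp: fn)
 also have "... = (SUM n<2*N. if n = 0 then x else 0)" proof (intro sum.cong refl)
  fix n :: nat
  have "(SUM i<=n. (-1) ^ (n - i) * of_nat (n choose i)) = (1 + (-1::'k)) ^ n"
   unfolding binomial_ring by (intro sum.cong) (auto simp: mult_ac)
  thus "sc (1 / fact n * (SUM i<=n. (-1) ^ (n - i) * of_nat (n choose i))) ((X ^^ n) x) = (if n = 0 then x else 0)" by (cases n) auto
 qed
 also have "... = x" using assms(4) by simp
 finally show ?thesis .
qed

text \<open>Let \<open>m\<close> be the exact order at \<open>x\<close>. If it exceeded the
  dimension, an annihilating polynomial of degree at most the dimension would have its lowest
  nonzero coefficient at some \<open>k < m\<close>, and applying \<open>X\<close> another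
  \<open>m - 1 - k\<close> times would isolate the nonzero vector
  \<open>(X ^^ (m - 1)) x\<close>.\<close>

lemma nilp_bound:
 assumes T: "lin X" and X: "nilp X" and x: "x : V"
 shows "(X ^^ card B) x = 0" proof (rule ccontr)
 assume nz: "(X ^^ card B) x ~= 0"
 obtain N where N: "(X ^^ N) x = 0" using X x unfolding nilp_def by blast
 define m where "m = (LEAST m. (X ^^ m) x = 0)"
 have m0: "(X ^^ m) x = 0" unfolding m_def using N by (rule LeastI)
 have mB: "card B < m" using nz m0 funpow_vanish[OF T m0] by (meson not_le)
 have mmin: "(X ^^ i) x ~= 0" if "i < m" for i using not_less_Least that unfolding m_def by blast
 obtain p where p: "p ~= 0" "degree p <= card B" "pact X p x = 0" using exists_annihilator[OF T x] by blast
 define k where "k = (LEAST k. coeff p k ~= 0)"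
 have "EX k. coeff p k ~= 0" using p(1) by (metis leading_coeff_0_iff)
 hence k: "coeff p k ~= 0" unfolding k_def by (rule LeastI_ex)
 have kmin: "coeff p i = 0" if "i < k" for i using not_less_Least that unfolding k_def by blast
 have kd: "k <= degree p" using k by (rule le_degree)
 have pV: "(X ^^ i) x : V" for i using linD(1)[OF lin_funpow[OF T] x] .
 have "pact X p x = (SUM i<=degree p. sc (coeff p i) ((X ^^ i) x))"
  using arg_cong[OF poly_as_sum_of_monoms[of p], of "%p. pact X p x"] x T by (simp add: pact_sum pact_monom)
 hence "0 = (X ^^ (m - 1 - k)) (SUM i<=degree p. sc (coeff p i) ((X ^^ i) x))" using p(3) lin_0[OF lin_funpow[OF T]] by simp
 also have "... = (SUM i<=degree p. sc (coeff p i) ((X ^^ (m - 1 - k + i)) x))"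
  using pV by (simp add: lin_sum[OF lin_funpow[OF T]] linD(3)[OF lin_funpow[OF T]] funpow_add)
 also have "... = (SUM i<=degree p. if i = k then sc (coeff p k) ((X ^^ (m - 1)) x) else 0)" proof (intro sum.cong refl)
  fix i assume "i : {..degree p}"
  consider "i < k" | "i = k" | "i > k" by linarith
  thus "sc (coeff p i) ((X ^^ (m - 1 - k + i)) x) = (if i = k then sc (coeff p k) ((X ^^ (m - 1)) x) else 0)" proof cases
   case 3
   hence "m <= m - 1 - k + i" using kd p(2) mB by linarith
   thus ?thesis using funpow_vanish[OF T m0] 3 by simp
  qed (use kmin kd p(2) mB in auto)
 qed
 also have "... = sc (coeff p k) ((X ^^ (m - 1)) x)" using kd by simp
 finally have "(X ^^ (m - 1)) x = 0" using k by simp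
 thus False using mmin[of "m - 1"] mB by simp
qed

end

section \<open>Rational coordinates of finitely many scalars\<close>

lemma sum_fun_apply: "(SUM i:I. f i) x = (SUM i:I. f i x :: 'b::comm_monoid_add)" by (induction I rule: infinite_finite_induct) auto

lemma common_denominator:
 assumes "finite R" shows "EX M::int. M > 0 & (ALL r:R. EX n. of_int M * r = (of_int n :: rat))" using assms
proof (induction R rule: finite_induct)
 case empty
 thus ?case by (intro exI[of _ 1]) auto
next
 case (insert r R)
 then obtain M where M: "M > 0" "ALL r:R. EX n. of_int M * r = (of_int n :: rat)" by blast
 obtain a b where ab: "r = of_int a / of_int b" "b > 0" by (metis quotient_of_div quotient_of_denom_pos surj_pair)
 have "of_int (M * b) * r = of_int (M * a)" using ab by simp
 moreover have "EX n. of_int (M * b) * q = (of_int n :: rat)" if "q : R" for q proof -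
  obtain n where "of_int M * q = (of_int n :: rat)" using M(2) `q : R` by blast
  hence "of_int (M * b) * q = (of_int (n * b) :: rat)" by (simp add: mult_ac)
  thus ?thesis by blast
 qed
 ultimately have "ALL q:insert r R. EX n. of_int (M * b) * q = (of_int n :: rat)" by blast
 moreover have "M * b > 0" using M(1) ab(2) by simp
 ultimately show ?case by blast
qed

text \<open>The field is viewed as a rational vector space. Each coordinate with respect to a basis
  is additive on the whole field, and a common denominator makes the coordinates of the finitely
  many elements of \<open>S\<close> integral.\<close>

lemma rational_coordinates:
 fixes S :: "'k::field_char_0 set"
 assumes S: "finite S"
 shows "EX E (g :: 'k => 'k => 'k) c. finite E & (ALL bt mu nu. g bt (mu + nu) = g bt mu + g bt nu)
  & (ALL bt:E. ALL mu:S. EX n. g bt mu = of_int n) & (ALL mu:S. mu = (SUM bt:E. c bt * g bt mu))" proof -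
 interpret qv: vector_space "%(q::rat) (x::'k). of_rat q * x" by unfold_locales (auto simp: algebra_simps of_rat_add of_rat_mult)
 define Q where "Q = qv.extend_basis {}"
 have Q: "qv.independent Q" "qv.span Q = UNIV" unfolding Q_def using qv.independent_extend_basis[OF qv.independent_empty]
   qv.span_extend_basis[OF qv.independent_empty] by auto
 define r where "r mu bt = qv.representation Q mu bt" for mu bt
 define E where "E = (UN mu:S. {bt. r mu bt ~= 0})"
 have E: "finite E" unfolding E_def r_def using S qv.finite_representation by auto
 define R where "R = (%(mu, bt). r mu bt) ` (S \<times> E)"
 have "finite R" unfolding R_def using S E by simp
 then obtain M where M: "M > 0" "ALL r:R. EX n. of_int M * r = (of_int n :: rat)" using common_denominator by blast
 have M0: "(of_int M :: 'k) ~= 0" using M(1) by simp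
 define g where "g bt mu = (of_int M * of_rat (r mu bt) :: 'k)" for bt mu
 have "g bt (mu + nu) = g bt mu + g bt nu" for bt mu nu
  unfolding g_def r_def using Q by (simp add: qv.representation_add of_rat_add distrib_left)
 moreover have "EX n. g bt mu = of_int n" if "bt : E" "mu : S" for bt mu proof -
  have "r mu bt : R" unfolding R_def using that by auto
  then obtain n where "of_int M * r mu bt = (of_int n :: rat)" using M(2) by blast
  hence "of_rat (of_int M * r mu bt) = (of_rat (of_int n) :: 'k)" by simp
  thus ?thesis unfolding g_def by (auto simp: of_rat_mult)
 qed
 moreover have "mu = (SUM bt:E. (bt / of_int M) * g bt mu)" if "mu : S" for mu proof -
  have "mu = (SUM bt | r mu bt ~= 0. of_rat (r mu bt) * bt)" unfolding r_def using Q by (subst qv.sum_nonzero_representation_eq) auto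
  also have "... = (SUM bt:E. of_rat (r mu bt) * bt)" using E that by (intro sum.mono_neutral_left) (auto simp: E_def)
  also have "... = (SUM bt:E. (bt / of_int M) * g bt mu)" unfolding g_def using M0 by (intro sum.cong) auto
  finally show ?thesis .
 qed
 ultimately show ?thesis using E by (intro exI[of _ E] exI[of _ g] exI[of _ "%bt. bt / of_int M"]) blast
qed

context fd_lie_superalgebra
begin

lemma aut_of_inverse:
 assumes "lin f" "even f" "!!x y. x : V ==> y : V ==> f (br x y) = br (f x) (f y)"
  and "!!x. x : V ==> g x : V" "!!x. x : V ==> f (g x) = x" "!!x. x : V ==> g (f x) = x"
 shows "aut f" unfolding aut_def using assms linD(1)[OF assms(1)] by (auto intro!: bij_betw_byWitness[of V g])

lemma expo_inverse':
 assumes T: "lin X" and N: "!!x. x : V ==> (X ^^ N) x = 0" and x: "x : V" and "N > 0"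
 shows "expo N (%x. - X x) (expo N X x) = x" proof -
 have l: "lin (%x. - X x)" using lin_scaleT[OF T, of "-1"] by simp
 have "((%x. - X x) ^^ N) x = 0" if "x : V" for x using N[OF that] by (simp add: funpow_neg[OF T that])
 from expo_inverse[OF l this x `N > 0`] show ?thesis by simp
qed

lemma expo_aut:
 assumes X: "der X" and N: "!!x. x : V ==> (X ^^ N) x = 0" and "N > 0"
 shows "aut (expo N X)" proof (rule aut_of_inverse[where g = "expo N (%x. - X x)"])
 note T = derD(1)[OF X]
 have l: "lin (%x. - X x)" using lin_scaleT[OF T, of "-1"] by simp
 show "expo N (%x. - X x) x : V" if "x : V" for x using linD(1)[OF lin_expo[OF l] that] .
qed (use assms derD[OF X] lin_expo even_expo expo_br expo_inverse expo_inverse' in auto)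

subsection \<open>Derivations with integral eigenvalues\<close>

definition wt :: "('a => 'a) => int => 'a set" where
 "wt H n = {x : V. H x = sc (of_int n) x}"

text \<open>Diagonalisable derivations with integer eigenvalues, that is, generators of actions of
  the multiplicative group by automorphisms.\<close>

definition intss :: "('a => 'a) => bool" where
 "intss H \<longleftrightarrow> der H & V <= span (UN n. wt H n)"

lemma wt_V: "x : wt H n ==> x : V" unfolding wt_def by auto

lemma intssD: "intss H ==> der H" "intss H ==> lin H" unfolding intss_def der_def by auto

lemma wt_scale: "lin H ==> x : wt H n ==> sc c x : wt H n" unfolding wt_def by (auto simp: linD mult.commute)

lemma span_induct_V:
 assumes U: "V <= span U" "U <= V" and sc: "!!c x. x : U ==> sc c x : U" and x: "x : V"
  and P: "P 0" "!!x. x : U ==> P x" "!!x y. x : V ==> y : V ==> P x ==> P y ==> P (x + y)"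
 shows "P x" proof -
 have "x : span U" using U x by auto
 hence "x : V & P x" by (induction rule: span_induct_alt) (use U sc P in auto)
 thus ?thesis ..
qed

lemma intss_induct [consumes 2, case_names wt add]:
 assumes H: "intss H" and x: "x : V" and P: "!!n x. x : wt H n ==> P x" "!!x y. x : V ==> y : V ==> P x ==> P y ==> P (x + y)"
 shows "P x" proof (rule span_induct_V[of "UN n. wt H n"])
 show "P 0" using P(1)[of 0 0] lin_0[OF intssD(2)[OF H]] unfolding wt_def by auto
 show "sc c x : (UN n. wt H n)" if "x : (UN n. wt H n)" for c x using that wt_scale[OF intssD(2)[OF H]] by blast
qed (use assms wt_V in \<open>auto simp: intss_def\<close>)

lemma wt_gen: "lin H ==> x : wt H n ==> x : gen H (of_int n)" unfolding wt_def by (auto intro: gen_eigen)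

lemma intss_gen:
 assumes H: "intss H" and x: "x : gen H mu"
 shows "H x = sc mu x" "x = 0 | (EX n. mu = of_int n)" proof -
 note T = intssD(2)[OF H]
 have "x : V" using x gen_V by blast
 have "H (gp H mu z) = sc mu (gp H mu z) & (gp H mu z = 0 | (EX n. mu = of_int n))" if "z : V" for z using H that
 proof (induction rule: intss_induct)
  case (wt n z)
  thus ?case using gp_on_gen[OF T wt_gen[OF T wt], of mu] lin_0[OF T] unfolding wt_def by auto
 next
  case (add y z)
  thus ?case using gp_V[OF T] by (auto simp: linD[OF gp_lin[OF T]] linD[OF T] scale_right_distrib)
 qed
 from this[OF `x : V`] show "H x = sc mu x" "x = 0 | (EX n. mu = of_int n)" using gp_on_gen[OF T x, of mu] by auto
qed

lemma intss_gen_wt: "intss H ==> x : gen H mu ==> EX n. x : wt H n"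
 using intss_gen[of H x mu] gen_V[of x H mu] lin_0[OF intssD(2)[of H]] unfolding wt_def by auto

lemma wt_br:
 assumes "der H" "x : wt H m" "y : wt H n" shows "br x y : wt H (m + n)" using assms br_V unfolding wt_def
 by (auto simp: derD(3) brkt_scal_left brkt_scal_right scale_left_distrib)

definition toint :: "'k => int" where
 "toint mu = (THE n. mu = of_int n)"

lemma toint [simp]: "toint (of_int n) = n" unfolding toint_def by auto

text \<open>The scalar \<open>a\<close> acting through the one-parameter torus generated by
  \<open>H\<close>: vectors of weight \<open>n\<close> are multiplied by the \<open>n\<close>-th
  power of \<open>a\<close>.\<close>

definition tor :: "('a => 'a) => 'k => 'a => 'a" where
 "tor H a = fcalc H (%mu. a powi toint mu)"

lemma tor_wt: "lin H ==> x : wt H n ==> tor H a x = sc (a powi n) x" unfolding tor_def using fcalc_gen[OF _ wt_gen, of H x n] by simp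

lemma tor_lin: "lin H ==> lin (tor H a)" unfolding tor_def by (rule fcalc_lin)

lemma tor_mult:
 assumes H: "intss H" and x: "x : V" shows "tor H a (tor H b x) = tor H (a * b) x" using H x proof (induction rule: intss_induct)
 case (wt n x)
 thus ?case using tor_wt[OF intssD(2)[OF H]] wt_V linD(3)[OF tor_lin[OF intssD(2)[OF H]]]
  by (simp add: power_int_mult_distrib mult.commute)
next
 case (add x y)
 thus ?case using linD[OF tor_lin[OF intssD(2)[OF H]]] by simp
qed

lemma tor_1:
 assumes H: "intss H" and x: "x : V" shows "tor H 1 x = x" using H x
 by (induction rule: intss_induct) (use tor_wt[OF intssD(2)[OF H]] linD[OF tor_lin[OF intssD(2)[OF H]]] in auto)

lemma tor_aut:
 assumes H: "intss H" and a: "a ~= 0" shows "aut (tor H a)" proof (rule aut_of_inverse[where g = "tor H (1 / a)"])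
 note T = intssD(2)[OF H]
 show l: "lin (tor H a)" by (rule tor_lin[OF T])
 show "even (tor H a)" unfolding tor_def by (rule even_fcalc[OF T derD(2)[OF intssD(1)[OF H]]])
 show "tor H (1 / a) x : V" if "x : V" for x using linD(1)[OF tor_lin[OF T] that] .
 show "tor H a (tor H (1 / a) x) = x" "tor H (1 / a) (tor H a x) = x" if "x : V" for x
  using that a by (simp_all add: tor_mult[OF H] tor_1[OF H])
 fix x y assume x: "x : V" and y: "y : V"
 show "tor H a (br x y) = br (tor H a x) (tor H a y)" using H x y proof (induction x arbitrary: y rule: intss_induct)
  case (wt m x)
  note x = wt(1)
  show ?case using H wt.prems proof (induction y rule: intss_induct)
   case (wt n y)
   thus ?case using tor_wt[OF T x] tor_wt[OF T wt] tor_wt[OF T wt_br[OF intssD(1)[OF H] x wt]] wt_V[OF x] wt_V[OF wt] a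
    by (simp add: brkt_scal_left brkt_scal_right power_int_add mult.commute)
  next
   case (add y z)
   thus ?case using wt_V[OF x] linD[OF l] by (simp add: brkt_add_right br_V)
  qed
 next
  case (add x z)
  thus ?case using linD[OF l] by (simp add: brkt_add_left br_V)
 qed
qed

lemma tor_commute:
 assumes "lin H" "lin S" "!!x. x : V ==> S (H x) = H (S x)" "x : V"
 shows "tor H a (S x) = S (tor H a x)" unfolding tor_def using assms by (rule fcalc_commute)

lemma fcalc_intss:
 assumes X: "der X" and g: "!!mu nu. g (mu + nu) = g mu + g nu" and int: "!!mu. mu : eigs X ==> EX n. g mu = of_int n"
 shows "intss (fcalc X g)" unfolding intss_def proof (intro conjI subsetI)
 note T = derD(1)[OF X]
 show "der (fcalc X g)" using X g by (rule fcalc_der)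
 fix x assume "x : V"
 with T show "x : span (UN n. wt (fcalc X g) n)" proof (induction rule: gen_induct)
  case (gen mu x)
  show ?case proof (cases "x = 0")
   case False
   then obtain n where n: "g mu = of_int n" using int gen_not_eigs[OF gen] by blast
   have "x : wt (fcalc X g) n" unfolding wt_def using fcalc_gen[OF T gen, of g] n gen_V[OF gen] by auto
   thus ?thesis by (intro span_base) auto
  qed (simp add: span_zero)
 qed (rule span_add)
qed

lemma joint_wt_span:
 assumes H: "intss H" and K: "intss K" and comm: "!!x. x : V ==> H (K x) = K (H x)"
 shows "V <= span (\<Union>m n. wt H m \<inter> wt K n)" proof
 fix x assume "x : V"
 with H show "x : span (\<Union>m n. wt H m \<inter> wt K n)" proof (induction rule: intss_induct)
  case (wt m x)
  note TH = intssD(2)[OF H] and TK = intssD(2)[OF K]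
  have x: "x : V" "H x = sc (of_int m) x" using wt unfolding wt_def by auto
  have "gp K mu x : span (\<Union>m n. wt H m \<inter> wt K n)" for mu proof -
   obtain n where n: "gp K mu x : wt K n" using intss_gen_wt[OF K gp_gen[OF TK x(1)]] by blast
   have "H (gp K mu x) = gp K mu (H x)" using gp_commute[OF TK TH _ x(1)] comm by simp
   hence "gp K mu x : wt H m" unfolding wt_def x(2) using gp_V[OF TK x(1)] linD(3)[OF gp_lin[OF TK] x(1)] by simp
   with n show ?thesis by (intro span_base) auto
  qed
  hence "(SUM mu:eigs K. gp K mu x) : span (\<Union>m n. wt H m \<inter> wt K n)" by (intro span_sum)
  thus ?case using gp_sum[OF TK x(1)] by simp
 qed (rule span_add)
qed

lemma intss_comb:
 assumes H: "intss H" and K: "intss K" and comm: "!!x. x : V ==> H (K x) = K (H x)"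
 shows "intss (%x. sc (of_int a) (H x) + sc (of_int b) (K x))" (is "intss ?T") unfolding intss_def proof (intro conjI)
 show "der ?T" by (intro der_add der_scale intssD(1) H K)
 have "(\<Union>m n. wt H m \<inter> wt K n) <= (UN n. wt ?T n)" proof
  fix x assume "x : (\<Union>m n. wt H m \<inter> wt K n)"
  then obtain m n where "x : wt H m" "x : wt K n" by blast
  hence "x : wt ?T (a * m + b * n)" unfolding wt_def by (auto simp: scale_left_distrib)
  thus "x : (UN n. wt ?T n)" by blast
 qed
 thus "V <= span (UN n. wt ?T n)" using joint_wt_span[OF H K comm] span_mono by blast
qed

lemma intss_zero: "intss (%x. 0)" proof -
 have "V <= wt (%x. 0) 0" unfolding wt_def by auto
 hence "V <= span (UN n. wt (%x. 0) n)" using span_superset by blast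
 thus ?thesis unfolding intss_def using der_zero by simp
qed

subsection \<open>The space of derivations\<close>

sublocale fv: vector_space "%(c::'k) (X :: 'a => 'a) x. sc c (X x)"
 by unfold_locales (auto simp: fun_eq_iff scale_right_distrib scale_left_distrib)

definition crd :: "'a => 'a => 'k" where
 "crd b x = representation B x b"

lemma B_V: "b : B ==> b : V" using B(3) span_superset by blast

lemma crd_sum: "x : V ==> (SUM b:B. sc (crd b x) b) = x" unfolding crd_def using sum_representation_eq[OF B(2) _ B(1), of x] B(3) by auto

lemma crd_add: "x : V ==> y : V ==> crd b (x + y) = crd b x + crd b y" unfolding crd_def using representation_add[OF B(2)] B(3) by simp

lemma crd_scale: "x : V ==> crd b (sc c x) = c * crd b x" unfolding crd_def using representation_scale[OF B(2)] B(3) by simp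

lemma crd_sum': "(!!i. i : I ==> f i : V) ==> crd b (sum f I) = (SUM i:I. crd b (f i))"
 unfolding crd_def using representation_sum[OF B(2), of I f] B(3) by simp

lemma crd_diff: "x : V ==> y : V ==> crd b (x - y) = crd b x - crd b y" unfolding crd_def using representation_diff[OF B(2)] B(3) by simp

lemma lin_expand: "lin T ==> x : V ==> T x = (SUM b:B. sc (crd b x) (T b))"
 using lin_sum[of T B "%b. sc (crd b x) b"] crd_sum[of x] B_V linD(3)[of T] by simp

text \<open>Normalising maps to vanish off \<open>V\<close> turns equality on \<open>V\<close> into
  equality of functions. Derivations then form a finite dimensional subspace of the space of all
  maps, to which dimension arguments apply.\<close>

definition ext0 :: "('a => 'a) => 'a => 'a" where
 "ext0 X = (%x. if x : V then X x else 0)"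

definition endo :: "('a => 'a) set" where
 "endo = {X. lin X & (ALL x. x ~: V --> X x = 0)}"

definition dset :: "('a => 'a) set" where
 "dset = {X. der X & (ALL x. x ~: V --> X x = 0)}"

definition emat :: "'a => 'a => 'a => 'a" where
 "emat b c = ext0 (%x. sc (crd b x) c)"

lemma dset_endo: "dset <= endo" unfolding dset_def endo_def der_def by auto

lemma fun_eqI0: "X : endo ==> Y : endo ==> (!!x. x : V ==> X x = Y x) ==> X = Y"
 unfolding endo_def by (rule ext) (metis (mono_tags, lifting) mem_Collect_eq)

lemma ext0_dset: "der X ==> ext0 X : dset" unfolding dset_def using der_cong[of X "ext0 X"] by (auto simp: ext0_def)

lemma subspace_dset: "fv.subspace dset" unfolding fv.subspace_def dset_def
 by (auto simp: der_scale der_add plus_fun_def zero_fun_def der_zero)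

lemma endo_expand:
 assumes X: "X : endo"
 shows "X = (SUM (b,c):B\<times>B. (%x. sc (crd c (X b)) (emat b c x)))" proof
 fix x
 have T: "lin X" using X unfolding endo_def by auto
 show "X x = (SUM (b,c):B\<times>B. (%x. sc (crd c (X b)) (emat b c x))) x" proof (cases "x : V")
  case True
  have "X x = (SUM b:B. sc (crd b x) (SUM c:B. sc (crd c (X b)) c))" using lin_expand[OF T True] crd_sum linD(1)[OF T] B_V by simp
  also have "... = (SUM b:B. SUM c:B. sc (crd c (X b)) (emat b c x))"
   using True by (simp add: emat_def ext0_def scale_sum_right mult.commute)
  also have "... = (SUM (b,c):B\<times>B. sc (crd c (X b)) (emat b c x))" by (rule sum.cartesian_product)
  finally show ?thesis by (simp add: sum_fun_apply split_beta)
 next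
  case False
  thus ?thesis using X by (auto simp: sum_fun_apply split_beta emat_def ext0_def endo_def)
 qed
qed

lemma endo_span: "endo <= fv.span ((%(b,c). emat b c) ` (B \<times> B))" proof
 fix X assume X: "X : endo"
 have "(SUM (b,c):B\<times>B. (%x. sc (crd c (X b)) (emat b c x))) : fv.span ((%(b,c). emat b c) ` (B \<times> B))"
  by (intro fv.span_sum) (clarsimp, rule fv.span_scale, rule fv.span_base, blast)
 thus "X : fv.span ((%(b,c). emat b c) ` (B \<times> B))" using endo_expand[OF X] by simp
qed

lemma endo_indep_finite: "fv.independent A ==> A <= endo ==> finite A"
 using fv.independent_span_bound[of "(%(b,c). emat b c) ` (B \<times> B)" A] endo_span B(1) by auto

lemma endo_subspace_eq:
 assumes "fv.subspace P" "P <= Q" "Q <= endo" "fv.dim Q <= fv.dim P"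
 shows "P = Q" proof -
 obtain C where C: "C <= P" "fv.independent C" "P <= fv.span C" "card C = fv.dim P" using fv.basis_exists by blast
 have "C <= Q" using C(1) assms(2) by auto
 from fv.maximal_independent_subset_extend[OF this C(2)]
 obtain D where D: "C <= D" "D <= Q" "fv.independent D" "Q <= fv.span D" by blast
 have fin: "finite D" using endo_indep_finite[OF D(3)] D(2) assms(3) by auto
 have "card D = fv.dim Q" using fv.basis_card_eq_dim[OF D(2,4,3)] .
 hence "C = D" using card_seteq[OF fin D(1)] C(4) assms(4) by simp
 hence "Q <= fv.span P" using D(4) fv.span_mono[OF C(1)] by auto
 moreover have "fv.span P = P" using assms(1) fv.span_eq_iff by blast
 ultimately show ?thesis using assms(2) by auto
qed

definition comm :: "('a => 'a) => ('a => 'a) => bool" where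
 "comm S T \<longleftrightarrow> (ALL x:V. S (T x) = T (S x))"

text \<open>The semisimple part of \<open>X\<close> is a combination of integral ones, by coordinates of the eigenvalues over the rationals.\<close>

lemma jordan_derivation:
 assumes X: "X : dset"
 shows "EX N:dset. nilp N & (ALL x:V. N x = X x - fcalc X (%mu. mu) x) & (ALL S. lin S --> comm S X --> comm S N)
  & X - N : fv.span {Y:dset. intss Y & (ALL S. lin S --> comm S X --> comm S Y)}" proof -
 have dX: "der X" using X unfolding dset_def by auto
 note T = derD(1)[OF dX]
 obtain E g c where E: "finite E" "!!bt mu nu. g bt (mu + nu) = g bt mu + (g bt nu :: 'k)"
  "!!bt mu. bt : E ==> mu : eigs X ==> EX n. g bt mu = of_int n" "!!mu. mu : eigs X ==> mu = (SUM bt:(E::'k set). c bt * g bt mu)"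
  using rational_coordinates[OF finite_eigs[OF T]] by metis
 define U where "U = {Y:dset. intss Y & (ALL S. lin S --> comm S X --> comm S Y)}"
 define F where "F g = ext0 (fcalc X g)" for g
 have F_comm: "comm S (F g)" if "lin S" "comm S X" for S g
  using that fcalc_commute[OF T, of S] linD(1)[of S] unfolding comm_def F_def ext0_def by auto
 have gU: "F (g bt) : U" if "bt : E" for bt proof -
  have d: "der (fcalc X (g bt))" by (rule fcalc_der[OF dX E(2)])
  have "intss (fcalc X (g bt))" using fcalc_intss[OF dX E(2) E(3)[OF that]] .
  hence "intss (F (g bt))" unfolding intss_def wt_def F_def using der_cong[OF d, of "ext0 (fcalc X (g bt))"]
   by (auto simp: ext0_def cong: conj_cong)
  thus ?thesis unfolding U_def using F_comm ext0_dset[OF d] unfolding F_def by auto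
 qed
 define N where "N = X - F (%mu. mu)"
 have Fid: "F (%mu. mu) : dset" unfolding F_def by (intro ext0_dset fcalc_der dX) simp
 have NX: "N x = X x - fcalc X (%mu. mu) x" if "x : V" for x unfolding N_def F_def ext0_def using that by simp
 have Nd: "N : dset" unfolding N_def using fv.subspace_diff[OF subspace_dset X Fid] .
 have "nilp N" proof -
  have "(N ^^ n) x = ((%x. X x - fcalc X (%mu. mu) x) ^^ n) x" if "x : V" for n x proof (induction n)
   case (Suc n)
   have "((%x. X x - fcalc X (%mu. mu) x) ^^ n) x : V" using linD(1)[OF lin_funpow[OF lin_diffT[OF T fcalc_lin[OF T]]] that] .
   thus ?case using Suc NX by simp
  qed simp
  thus ?thesis using nilp_jordan[OF T] unfolding nilp_def by simp
 qed
 moreover have "comm S N" if "lin S" "comm S X" for S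
  using that F_comm[OF that, of "%mu. mu"] linD(1)[OF T] linD(1)[OF derD(1), of "F (%mu. mu)"] Fid lin_diff[of S]
  unfolding comm_def N_def dset_def by auto
 moreover have "X - N : fv.span U" proof -
  \<comment> \<open>Each eigenvalue is the combination of its integral coordinates
    \<open>g bt mu\<close> with coefficients \<open>c bt\<close>; interchanging the two sums writes
    the semisimple part as the same combination of integral derivations.\<close>
  have "X - N = (SUM bt:E. (%x. sc (c bt) (F (g bt) x)))" proof
   fix x
   show "(X - N) x = (SUM bt:E. (%x. sc (c bt) (F (g bt) x))) x" proof (cases "x : V")
    case True
    have "fcalc X (%mu. mu) x = (SUM mu:eigs X. sc (SUM bt:E. c bt * g bt mu) (gp X mu x))"
     unfolding fcalc_def using E(4) by (intro sum.cong) auto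
    also have "... = (SUM bt:E. SUM mu:eigs X. sc (c bt) (sc (g bt mu) (gp X mu x)))" unfolding scale_sum_left by (subst sum.swap) simp
    also have "... = (SUM bt:E. sc (c bt) (fcalc X (g bt) x))" unfolding fcalc_def scale_sum_right ..
    finally show ?thesis using True by (simp add: N_def F_def ext0_def sum_fun_apply)
   qed (simp add: N_def F_def ext0_def sum_fun_apply)
  qed
  also have "... : fv.span U" using gU by (intro fv.span_sum fv.span_scale fv.span_base)
  finally show ?thesis .
 qed
 ultimately show ?thesis using Nd NX unfolding U_def by blast
qed

end

context fd_lie_superalgebra
begin

subsection \<open>Traces\<close>

definition tr :: "'a set => ('a => 'a) => 'k" where
 "tr C T = (SUM c:C. representation C (T c) c)"

lemma tr_basis_change:
 assumes C: "finite C" "independent C" and D: "finite D" "independent D" and CD: "span C = span D" "span C <= V"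
  and T: "lin T" "!!x. x : span C ==> T x : span C"
 shows "tr C T = tr D T" proof -
 have CV: "c : V" "c : span D" if "c : C" for c using span_base[OF that] CD by auto
 have DV: "d : V" "d : span C" if "d : D" for d using span_base[OF that] CD by auto
 have "representation C (T c) c = (SUM d:D. representation D c d * representation C (T d) c)" if c: "c : C" for c proof -
  have "c = (SUM d:D. sc (representation D c d) d)" using sum_representation_eq[OF D(2) CV(2)[OF c] D(1)] by simp
  hence "T c = T (SUM d:D. sc (representation D c d) d)" by simp
  also have "... = (SUM d:D. sc (representation D c d) (T d))" using DV by (simp add: lin_sum[OF T(1)] linD(3)[OF T(1)])
  finally have "representation C (T c) c = representation C (SUM d:D. sc (representation D c d) (T d)) c" by simp
  also have "... = (SUM d:D. representation C (sc (representation D c d) (T d)) c)"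
   using DV T(2) by (subst representation_sum[OF C(2)]) (auto intro: span_scale)
  also have "... = (SUM d:D. representation D c d * representation C (T d) c)"
   using DV T(2) by (intro sum.cong refl) (simp add: representation_scale[OF C(2)])
  finally show ?thesis .
 qed
 hence "tr C T = (SUM c:C. SUM d:D. representation D c d * representation C (T d) c)" unfolding tr_def by (intro sum.cong) auto
 also have "... = (SUM d:D. SUM c:C. representation C (T d) c * representation D c d)" by (subst sum.swap) (simp add: mult.commute)
 also have "... = tr D T" unfolding tr_def proof (intro sum.cong refl)
  fix d assume d: "d : D"
  have Td: "T d : span C" using DV(2)[OF d] T(2) by blast
  have "T d = (SUM c:C. sc (representation C (T d) c) c)" using sum_representation_eq[OF C(2) Td C(1)] by simp
  hence "representation D (T d) d = representation D (SUM c:C. sc (representation C (T d) c) c) d" by simp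
  also have "... = (SUM c:C. representation D (sc (representation C (T d) c) c) d)"
   using CV by (subst representation_sum[OF D(2)]) (auto intro: span_scale)
  also have "... = (SUM c:C. representation C (T d) c * representation D c d)"
   using CV by (intro sum.cong refl) (simp add: representation_scale[OF D(2)])
  finally show "(SUM c:C. representation C (T d) c * representation D c d) = representation D (T d) d" ..
 qed
 finally show ?thesis .
qed

text \<open>A basis adapted to the kernels of the powers of \<open>T\<close> makes \<open>T\<close>
  strictly triangular, so every diagonal coefficient vanishes; the trace does not depend on the
  basis.\<close>

lemma tr_nilp:
 assumes C: "finite C" "independent C" "span C <= V" and T: "lin T" "!!x. x : span C ==> T x : span C" and nil: "nilp T"
 shows "tr C T = 0" proof -
 define K where "K n = {x : span C. (T ^^ n) x = 0}" for n
 have TK: "T x : K n" if "x : K (Suc n)" for x n using that T(2) unfolding K_def by (auto simp: funpow_swap1)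
 have KK: "K n <= K (Suc n)" for n unfolding K_def using lin_0[OF T(1)] by auto
 have "EX D<=K n. independent D & K n <= span D & (ALL d:D. representation D (T d) d = 0)" for n proof (induction n)
  case 0
  have "K 0 = {0}" unfolding K_def using span_zero by auto
  thus ?case using independent_empty by (intro exI[of _ "{}"]) auto
 next
  case (Suc n)
  then obtain D where D: "D <= K n" "independent D" "K n <= span D" "ALL d:D. representation D (T d) d = 0" by blast
  obtain D' where D': "D <= D'" "D' <= K (Suc n)" "independent D'" "K (Suc n) <= span D'"
   using maximal_independent_subset_extend[of D "K (Suc n)"] D(1,2) KK[of n] by auto
  have "representation D' (T d) d = 0" if d: "d : D'" for d proof -
   have "T d : span D" using TK d D'(2) D(3) by blast
   hence "representation D' (T d) = representation D (T d)" using representation_extend[OF D'(3) _ D'(1)] by blast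
   thus ?thesis using D(4) representation_ne_zero[of D "T d" d] by (cases "d : D") auto
  qed
  thus ?case using D' by blast
 qed
 moreover obtain n where n: "!!x. x : V ==> (T ^^ n) x = 0" using nil unfolding nilp_def by blast
 ultimately obtain D where D: "D <= K n" "independent D" "K n <= span D" "ALL d:D. representation D (T d) d = 0" by blast
 have "K n = span C" unfolding K_def using n C(3) by auto
 hence "span C = span D" using D(1,3) span_minimal[OF D(1)] subspace_span by (metis subset_antisym)
 moreover have "finite D" using independent_span_bound[OF C(1) D(2)] D(1) unfolding K_def by auto
 ultimately have "tr C T = tr D T" using tr_basis_change[OF C(1,2) _ D(2)] C(3) T by blast
 thus ?thesis unfolding tr_def using D(4) by simp
qed

text \<open>Projecting the equation onto \<open>gen T mu\<close> gives \<open>mu = h\<close>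
  wherever the projection of \<open>x\<close> is nonzero.\<close>

lemma fcalc_id_eigen:
 assumes T: "lin T" and x: "x : V" and eq: "fcalc T (%mu. mu) x = sc h x"
 shows "x : gen T h" proof -
 have z: "gp T mu x = 0" if "mu ~= h" for mu proof -
  have c: "gp T mu (T z) = T (gp T mu z)" if "z : V" for z by (rule gp_commute[OF T T _ that]) simp
  have "gp T mu (fcalc T (%mu. mu) x) = fcalc T (%mu. mu) (gp T mu x)" using fcalc_commute[OF T gp_lin[OF T] c x] by simp
  also have "... = sc mu (gp T mu x)" using fcalc_gen[OF T gp_gen[OF T x]] .
  finally have "sc h (gp T mu x) = sc mu (gp T mu x)" unfolding eq using linD(3)[OF gp_lin[OF T] x] by simp
  thus ?thesis using that by simp
 qed
 have "x = (SUM mu:eigs T. gp T mu x)" using gp_sum[OF T x] by simp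
 also have "... : gen T h" using z gp_gen[OF T x] gen_0[OF T] by (intro gen_sum[OF T]) metis
 finally show ?thesis .
qed

text \<open>On the eigenspace of the semisimple part of \<open>X + Y\<close> for the eigenvalue \<open>h\<close> the trace is both zero and \<open>h\<close> times the dimension.\<close>

lemma nilp_add:
 assumes X: "lin X" "nilp X" and Y: "lin Y" "nilp Y"
  and comm: "comm X (fcalc (%x. X x + Y x) (%mu. mu))" "comm Y (fcalc (%x. X x + Y x) (%mu. mu))"
 shows "nilp (%x. X x + Y x)" proof -
 define W where "W = (%x. X x + Y x)"
 define S where "S = fcalc W (%mu. mu)"
 define N where "N = (%x. W x - S x)"
 have W: "lin W" unfolding W_def by (rule lin_addT[OF X(1) Y(1)])
 have S: "lin S" unfolding S_def by (rule fcalc_lin[OF W])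
 have N: "lin N" "nilp N" unfolding N_def S_def using W S nilp_jordan[OF W] lin_diffT unfolding S_def by auto
 have 0: "h = 0" if h: "h : eigs W" for h proof -
  have sub: "subspace (gen W h)" unfolding subspace_def using gen_0[OF W] gen_add[OF W] gen_scale[OF W] by blast
  have gS: "x : gen W h \<longleftrightarrow> x : V & S x = sc h x" for x
   using fcalc_gen[OF W, of x h] fcalc_id_eigen[OF W] gen_V unfolding S_def by blast
  obtain C where C: "C <= gen W h" "independent C" "gen W h <= span C" using maximal_independent_subset by blast
  have spC: "span C = gen W h" using C(3) span_minimal[OF C(1) sub] by auto
  have CV: "span C <= V" unfolding spC using gen_V by blast
  have fC: "finite C" using independent_span_bound[OF B(1) C(2)] CV B(3) span_superset[of C] by auto
  \<comment> \<open>An operator commuting with the semisimple part \<open>S\<close> preserves its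
    eigenspace \<open>span C\<close>. This is the purpose of the two commutation hypotheses, which
    concern \<open>S\<close> and not the pair \<open>X\<close>, \<open>Y\<close>.\<close>
  have st: "T x : span C" if "lin T" "comm T S" "x : span C" for T x
   using that(3) linD(1)[OF that(1)] linD(3)[OF that(1)] that(2) unfolding spC gS comm_def by metis
  have NS: "comm N S" proof -
   have "S (W x) = W (S x)" if "x : V" for x unfolding S_def by (rule fcalc_commute[OF W W _ that]) simp
   thus ?thesis unfolding comm_def N_def using linD(1)[OF W] linD(1)[OF S] lin_diff[OF S] by auto
  qed
  have t: "tr C X = 0" "tr C Y = 0" "tr C N = 0" using tr_nilp[OF fC C(2) CV] st X Y N comm NS unfolding S_def W_def by blast+
  have "tr C W = tr C X + tr C Y" unfolding tr_def sum.distrib[symmetric] proof (intro sum.cong refl)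
   fix c assume "c : C"
   hence "X c : span C" "Y c : span C" using st[OF X(1)] st[OF Y(1)] comm span_base[of c C] unfolding S_def W_def by auto
   thus "representation C (W c) c = representation C (X c) c + representation C (Y c) c"
    unfolding W_def by (simp add: representation_add[OF C(2)])
  qed
  moreover have "tr C W = (SUM c:C. h) + tr C N" unfolding tr_def sum.distrib[symmetric] proof (intro sum.cong refl)
   fix c assume c: "c : C"
   hence cs: "c : span C" using span_base by blast
   have "N c : span C" using st[OF N(1) NS cs] .
   moreover have "W c = sc h c + N c" using cs unfolding N_def spC gS by simp
   ultimately show "representation C (W c) c = h + representation C (N c) c"
    using cs c by (simp add: representation_add[OF C(2)] span_scale representation_scale[OF C(2)] representation_basis[OF C(2)])
  qed
  \<comment> \<open>In characteristic zero a nonempty basis leaves only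
    \<open>h = 0\<close>.\<close>
  ultimately have "of_nat (card C) * h = 0" using t by simp
  moreover have "C ~= {}" using h spC unfolding eigs_def by auto
  ultimately show ?thesis using fC by simp
 qed
 have "W x = N x" if x: "x : V" for x proof -
  have "S x = (SUM mu:eigs W. sc mu (gp W mu x))" unfolding S_def fcalc_def ..
  also have "... = 0" using 0 by (intro sum.neutral) auto
  finally show ?thesis unfolding N_def by simp
 qed
 moreover have "(W ^^ n) x = (N ^^ n) x" if "x : V" for n x using calculation linD(1)[OF lin_funpow[OF N(1)] that] by (induction n) auto
 ultimately show ?thesis using N(2) unfolding nilp_def W_def[symmetric] by simp
qed

subsection \<open>A maximal torus in a centraliser\<close>

definition cen :: "('a => 'a) => ('a => 'a) => ('a => 'a) set" where
 "cen s H = {X:dset. comm X s & comm X H}"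

lemma comm_sym: "comm S T \<longleftrightarrow> comm T S" unfolding comm_def by auto

lemma comm_add: "lin T ==> lin X ==> lin Y ==> comm X T ==> comm Y T ==> comm (%x. X x + Y x) T"
 unfolding comm_def using linD[of T] linD(1)[of X] linD(1)[of Y] by auto

lemma comm_scale: "lin T ==> lin X ==> comm X T ==> comm (%x. sc c (X x)) T" unfolding comm_def using linD[of T] linD(1)[of X] by auto

lemma dset_lin: "X : dset ==> lin X" and dset_der: "X : dset ==> der X" unfolding dset_def der_def by auto

lemma subspace_comm: "lin T ==> fv.subspace {X:dset. comm X T}" unfolding fv.subspace_def using subspace_dset[unfolded fv.subspace_def]
 by (auto simp: plus_fun_def zero_fun_def comm_add comm_scale dset_lin comm_def[of "%_. 0"] lin_0)

lemma subspace_cen: "lin s ==> lin H ==> fv.subspace (cen s H)" proof -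
 have "cen s H = {X:dset. comm X s} \<inter> {X:dset. comm X H}" unfolding cen_def by auto
 thus "lin s ==> lin H ==> fv.subspace (cen s H)" using fv.subspace_inter[OF subspace_comm[of s] subspace_comm[of H]] by simp
qed

text \<open>The Jordan components commute with everything that commutes with \<open>X\<close>, so
  the decomposition stays inside the centraliser.\<close>

lemma jordan_cen:
 assumes s: "lin s" and H: "lin H" and X: "X : cen s H"
 shows "EX N:cen s H. nilp N & (ALL x:V. N x = X x - fcalc X (%mu. mu) x) & X - N : fv.span {Y:cen s H. intss Y}" proof -
 have Xd: "X : dset" "comm s X" "comm H X" using X comm_sym unfolding cen_def by auto
 obtain N where N: "N : dset" "nilp N" "ALL x:V. N x = X x - fcalc X (%mu. mu) x"
   "ALL S. lin S --> comm S X --> comm S N"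
   "X - N : fv.span {Y:dset. intss Y & (ALL S. lin S --> comm S X --> comm S Y)}" using jordan_derivation[OF Xd(1)] by blast
 have "{Y:dset. intss Y & (ALL S. lin S --> comm S X --> comm S Y)} <= {Y:cen s H. intss Y}"
  using s H Xd comm_sym unfolding cen_def by blast
 hence "X - N : fv.span {Y:cen s H. intss Y}" using N(5) fv.span_mono by blast
 moreover have "N : cen s H" using N(1,4) s H Xd comm_sym unfolding cen_def by blast
 ultimately show ?thesis using N(2,3) by blast
qed

text \<open>For large \<open>M\<close> the number \<open>M * m + n\<close> determines the pair of
  weights \<open>m\<close>, \<open>n\<close>. Both derivations are then functional calculi of the
  combination and commute with whatever commutes with it.\<close>

lemma comm_intss_comb:
 assumes H: "intss H" and Y: "intss Y" and HY: "comm H Y"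
 shows "EX M. ALL X. lin X --> comm X (%x. sc (of_int M) (H x) + Y x) --> comm X H & comm X Y" proof -
 note TH = intssD(2)[OF H] and TY = intssD(2)[OF Y]
 define K where "K = Max (insert 0 ((%mu. \<bar>toint mu\<bar>) ` eigs Y))"
 have fin: "finite (insert 0 ((%mu. \<bar>toint mu\<bar>) ` eigs Y))" using finite_eigs[OF TY] by simp
 have K: "\<bar>n\<bar> <= K" if "x : wt Y n" "x ~= 0" for n x proof -
  have "of_int n : eigs Y" using wt_gen[OF TY that(1)] that(2) unfolding eigs_def by auto
  hence "\<bar>toint (of_int n)\<bar> : insert 0 ((%mu. \<bar>toint mu\<bar>) ` eigs Y)" by blast
  thus ?thesis unfolding K_def using Max_ge[OF fin] by simp
 qed
 \<comment> \<open>The weights of \<open>Y\<close> have absolute value at most \<open>K\<close>, so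
   after adding \<open>K\<close> they lie between \<open>0\<close> and \<open>2 * K\<close>, hence
   below \<open>M\<close>, and integer division recovers \<open>m\<close>.\<close>
 define M where "M = 2 * K + 1"
 define T where "T = (%x. sc (of_int M) (H x) + Y x)"
 define ga gb where "ga mu = (of_int ((toint mu + K) div M) :: 'k)"
  and "gb mu = (of_int (toint mu - M * ((toint mu + K) div M)) :: 'k)" for mu
 have T: "lin T" unfolding T_def by (intro lin_addT lin_scaleT TH TY)
 have comm: "H (Y x) = Y (H x)" if "x : V" for x using HY that unfolding comm_def by auto
 have "fcalc T ga x = H x & fcalc T gb x = Y x" if "x : V" for x proof (rule span_induct_V[OF joint_wt_span[OF H Y comm] _ _ that])
  show "(\<Union>m n. wt H m \<inter> wt Y n) <= V" by (auto simp: wt_def)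
  show "sc c x : (\<Union>m n. wt H m \<inter> wt Y n)" if x: "x : (\<Union>m n. wt H m \<inter> wt Y n)" for c x proof -
   obtain m n where "x : wt H m" "x : wt Y n" using x by blast
   hence "sc c x : wt H m" "sc c x : wt Y n" using wt_scale[OF TH] wt_scale[OF TY] by auto
   thus ?thesis by blast
  qed
  show "fcalc T ga 0 = H 0 & fcalc T gb 0 = Y 0" using lin_0[OF fcalc_lin[OF T]] lin_0[OF TH] lin_0[OF TY] by simp
 next
  fix x assume "x : (\<Union>m n. wt H m \<inter> wt Y n)"
  then obtain m n where mn: "x : wt H m" "x : wt Y n" by blast
  show "fcalc T ga x = H x & fcalc T gb x = Y x" proof (cases "x = 0")
   case True
   thus ?thesis using lin_0[OF fcalc_lin[OF T]] lin_0[OF TH] lin_0[OF TY] by simp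
  next
   case False
   have x: "x : V" "H x = sc (of_int m) x" "Y x = sc (of_int n) x" using mn unfolding wt_def by auto
   have "x : gen T (of_int (M * m + n))" using x by (intro gen_eigen[OF T]) (auto simp: T_def scale_left_distrib)
   note f = fcalc_gen[OF T this]
   have "(M * m + n + K) div M = m" using K[OF mn(2) False] unfolding M_def by (intro int_div_pos_eq[of _ _ _ "n + K"]) auto
   thus ?thesis unfolding f using x by (simp add: ga_def gb_def del: of_int_add of_int_mult)
  qed
 next
  fix x y assume "x : V" "y : V" "fcalc T ga x = H x & fcalc T gb x = Y x" "fcalc T ga y = H y & fcalc T gb y = Y y"
  thus "fcalc T ga (x + y) = H (x + y) & fcalc T gb (x + y) = Y (x + y)" by (simp add: linD[OF fcalc_lin[OF T]] linD[OF TH] linD[OF TY])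
 qed
 hence "comm X H & comm X Y" if "lin X" "comm X T" for X
  using fcalc_commute[OF T that(1)] that linD(1)[OF that(1)] unfolding comm_def by metis
 thus ?thesis unfolding T_def by blast
qed

lemma ext0_eq: "x : V ==> ext0 X x = X x" unfolding ext0_def by simp

lemma comm_cong:
 assumes "!!x. x : V ==> X x = X' x" "!!x. x : V ==> Y x = Y' x" "lin X" "lin Y"
 shows "comm X Y \<longleftrightarrow> comm X' Y'" unfolding comm_def using assms(1,2) linD(1)[OF assms(3)] linD(1)[OF assms(4)] by auto

lemma intss_cong: "intss X ==> (!!x. x : V ==> Y x = X x) ==> intss Y"
 unfolding intss_def wt_def using der_cong[of X Y] by (auto cong: conj_cong)

text \<open>A single generic \<open>H\<close> stands for a maximal torus: it is chosen with
  centraliser of minimal dimension. For an integral semisimple \<open>Y\<close> in that centraliser,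
  a combination of \<open>H\<close> and \<open>Y\<close> has a centraliser inside those of both; by
  minimality it is the same centraliser, so \<open>Y\<close> is central in it.\<close>

theorem maximal_torus:
 assumes s: "lin s"
 shows "EX H:dset. intss H & comm H s & (ALL Y:cen s H. intss Y --> (ALL X:cen s H. comm X Y))" proof -
 define \<H> where "\<H> = {H:dset. intss H & comm H s}"
 have "ext0 (%x. 0) : \<H>" unfolding \<H>_def using ext0_dset[OF der_zero] intss_cong[OF intss_zero, of "ext0 (%x. 0)"] lin_0[OF s]
  by (auto simp: ext0_def comm_def)
 hence "EX H. H : \<H>" by blast
 then obtain H where H: "H : \<H>" "!!K. K : \<H> ==> fv.dim (cen s H) <= fv.dim (cen s K)"
  using ex_has_least_nat[of "%H. H : \<H>" _ "%H. fv.dim (cen s H)"] by blast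
 have Hd: "H : dset" "intss H" "comm H s" using H(1) unfolding \<H>_def by auto
 note TH = intssD(2)[OF Hd(2)]
 have "comm X Y" if Y: "Y : cen s H" "intss Y" and X: "X : cen s H" for X Y proof -
  have Y': "Y : dset" "comm Y s" "comm H Y" using Y comm_sym unfolding cen_def by auto
  note TY = intssD(2)[OF Y(2)]
  obtain M where M: "!!X. lin X ==> comm X (%x. sc (of_int M) (H x) + Y x) ==> comm X H & comm X Y"
   using comm_intss_comb[OF Hd(2) Y(2) Y'(3)] by blast
  define T where "T = (%x. sc (of_int M) (H x) + Y x)"
  have T: "intss T" using intss_comb[OF Hd(2) Y(2), of M 1] Y'(3) unfolding T_def comm_def by simp
  note TT = intssD(2)[OF T]
  have "comm T s" unfolding T_def using Hd(3) Y'(2) by (intro comm_add comm_scale s TH TY lin_scaleT)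
  hence "comm (ext0 T) s" using comm_cong[of T "ext0 T" s s] TT s by (simp add: ext0_eq)
  hence K: "ext0 T : \<H>" unfolding \<H>_def using ext0_dset[OF intssD(1)[OF T]] intss_cong[OF T, of "ext0 T"] by (simp add: ext0_eq)
  have sub: "comm Z H & comm Z Y" if "Z : cen s (ext0 T)" for Z proof -
   have Z: "lin Z" "comm Z (ext0 T)" using that dset_lin unfolding cen_def by auto
   have "lin (ext0 T)" using lin_cong[OF TT] by (simp add: ext0_eq)
   hence "comm Z T" using Z comm_cong[of Z Z "ext0 T" T] by (simp add: ext0_eq)
   thus ?thesis using M[OF Z(1)] unfolding T_def by blast
  qed
  have "cen s (ext0 T) = cen s H" proof (rule endo_subspace_eq)
   show "fv.subspace (cen s (ext0 T))" using s lin_cong[OF TT] by (intro subspace_cen) (auto simp: ext0_eq)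
   show "cen s (ext0 T) <= cen s H" using sub unfolding cen_def by blast
   show "cen s H <= endo" using dset_endo unfolding cen_def by blast
   show "fv.dim (cen s H) <= fv.dim (cen s (ext0 T))" using H(2)[OF K] .
  qed
  thus ?thesis using sub X by blast
 qed
 thus ?thesis using Hd by blast
qed

text \<open>Nilpotent elements are not closed under sums in general. Here the semisimple part of
  \<open>X + Y\<close> is a combination of integral derivations, which are central in the
  centraliser, so \<open>nilp_add\<close> applies.\<close>

lemma nilp_subspace:
 assumes s: "lin s" and H: "lin H" and central: "!!X Y. Y : cen s H ==> intss Y ==> X : cen s H ==> comm X Y"
 shows "fv.subspace {X:cen s H. nilp X}" unfolding fv.subspace_def proof (intro conjI ballI allI)
 note sub = subspace_cen[OF s H]
 show "0 : {X:cen s H. nilp X}" using fv.subspace_0[OF sub] by (auto simp: nilp_def intro!: exI[of _ 1])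
next
 fix X c assume X: "X : {X:cen s H. nilp X}"
 hence T: "lin X" unfolding cen_def using dset_lin by auto
 obtain n where n: "!!x. x : V ==> (X ^^ n) x = 0" using X unfolding nilp_def by auto
 have "((%x. sc c (X x)) ^^ i) x = sc (c ^ i) ((X ^^ i) x)" if "x : V" for x i
  using linD(1)[OF lin_funpow[OF T] that] by (induction i) (auto simp: linD(3)[OF T])
 hence "nilp (%x. sc c (X x))" unfolding nilp_def using n by (intro exI[of _ n]) auto
 moreover have "(%x. sc c (X x)) : cen s H" using X fv.subspace_scale[OF subspace_cen[OF s H]] by auto
 ultimately show "(%x. sc c (X x)) : {X:cen s H. nilp X}" by blast
next
 fix X Y assume X: "X : {X:cen s H. nilp X}" and Y: "Y : {X:cen s H. nilp X}"
 have T: "lin X" "lin Y" using X Y unfolding cen_def using dset_lin by auto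
 have W: "X + Y : cen s H" using X Y fv.subspace_add[OF subspace_cen[OF s H]] by auto
 obtain N where N: "N : cen s H" "ALL x:V. N x = (X + Y) x - fcalc (X + Y) (%mu. mu) x"
  "(X + Y) - N : fv.span {Y:cen s H. intss Y}" using jordan_cen[OF s H W] by blast
 define S where "S = (X + Y) - N"
 have comm: "comm Z (fcalc (%x. X x + Y x) (%mu. mu))" if Z: "Z : cen s H" for Z proof -
  have lZ: "lin Z" using Z dset_lin unfolding cen_def by auto
  have "{Y:cen s H. intss Y} <= {X:dset. comm X Z}" using central Z comm_sym unfolding cen_def by blast
  hence "S : {X:dset. comm X Z}" unfolding S_def using N(3) fv.span_minimal[OF _ subspace_comm[OF lZ]] by blast
  moreover have "S x = fcalc (%x. X x + Y x) (%mu. mu) x" if "x : V" for x unfolding S_def using N(2) that by (simp add: plus_fun_def)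
  ultimately show ?thesis using comm_cong[of S "fcalc (%x. X x + Y x) (%mu. mu)" Z Z] lZ dset_lin comm_sym by blast
 qed
 have "nilp (%x. X x + Y x)" using nilp_add[OF T(1) _ T(2)] comm X Y by blast
 thus "X + Y : {X:cen s H. nilp X}" using W by (simp add: plus_fun_def)
qed

lemma cen_span:
 assumes "lin s" "lin H"
 shows "cen s H <= fv.span ({Y:cen s H. intss Y} \<union> {X:cen s H. nilp X})" proof
 fix X assume X: "X : cen s H"
 obtain N where "N : cen s H" "nilp N" "X - N : fv.span {Y:cen s H. intss Y}" using jordan_cen[OF assms X] by blast
 hence "(X - N) + N : fv.span ({Y:cen s H. intss Y} \<union> {X:cen s H. nilp X})"
  by (intro fv.span_add) (auto intro: fv.span_base set_mp[OF fv.span_mono])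
 thus "X : fv.span ({Y:cen s H. intss Y} \<union> {X:cen s H. nilp X})" by simp
qed

text \<open>Every member of this spanning set integrates to an algebraic one-parameter group, which
  makes curves in all tangent directions available.\<close>

lemma dset_span: "dset <= fv.span {X:dset. intss X | nilp X}" proof
 fix X assume X: "X : dset"
 obtain N where "N : dset" "nilp N"
  "X - N : fv.span {Y:dset. intss Y & (ALL S. lin S --> comm S X --> comm S Y)}" using jordan_derivation[OF X] by blast
 hence "(X - N) + N : fv.span {X:dset. intss X | nilp X}"
  by (intro fv.span_add) (auto intro: fv.span_base set_mp[OF fv.span_mono, rotated])
 thus "X : fv.span {X:dset. intss X | nilp X}" by simp
qed

end

section \<open>Rational expansions along lines\<close>

text \<open>\<open>expands h F\<close>: the function \<open>h\<close> is rational and regular at \<open>0\<close>, with Taylor series \<open>F\<close>.\<close>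

definition expands :: "('k::field_char_0 => 'k) => 'k fps => bool" where
 "expands h F \<longleftrightarrow> (EX q r. poly r 0 ~= 0 & (ALL t. h t * poly r t = poly q t) & F * fps_of_poly r = fps_of_poly q)"

lemma expands_const: "expands (%_. c) (fps_const c)"
 unfolding expands_def by (intro exI[of _ "[:c:]"] exI[of _ 1]) (auto simp: fps_of_poly_const)

lemma expands_add:
 assumes "expands h F" "expands g G" shows "expands (%t. h t + g t) (F + G)" proof -
 obtain q r s u where "poly r 0 ~= 0" "ALL t. h t * poly r t = poly q t" "F * fps_of_poly r = fps_of_poly q"
  "poly u 0 ~= 0" "ALL t. g t * poly u t = poly s t" "G * fps_of_poly u = fps_of_poly s" using assms unfolding expands_def by metis
 thus ?thesis unfolding expands_def by (intro exI[of _ "q * u + s * r"] exI[of _ "r * u"])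
   (auto simp: fps_of_poly_add fps_of_poly_mult algebra_simps)
qed

lemma expands_mult:
 assumes "expands h F" "expands g G" shows "expands (%t. h t * g t) (F * G)" proof -
 obtain q r s u where *: "poly r 0 ~= 0" "!!t. h t * poly r t = poly q t" "F * fps_of_poly r = fps_of_poly q"
  "poly u 0 ~= 0" "!!t. g t * poly u t = poly s t" "G * fps_of_poly u = fps_of_poly s" using assms unfolding expands_def by metis
 have "h t * g t * poly (r * u) t = (h t * poly r t) * (g t * poly u t)" for t by (simp add: mult_ac)
 hence "h t * g t * poly (r * u) t = poly (q * s) t" for t by (simp only: *(2,5) poly_mult)
 moreover have "F * G * fps_of_poly (r * u) = fps_of_poly (q * s)"
  unfolding fps_of_poly_mult *(3)[symmetric] *(6)[symmetric] by (simp add: mult_ac)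
 ultimately show ?thesis unfolding expands_def using *(1,4) by (intro exI[of _ "q * s"] exI[of _ "r * u"]) auto
qed

lemma expands_sum:
 "(!!i. i : I ==> expands (h i) (F i)) ==> expands (%t. SUM i:I. h i t) (SUM i:I. F i)" using expands_const[of 0]
 by (induction I rule: infinite_finite_induct) (auto intro: expands_add)

lemma expands_power: "expands h F ==> expands (%t. h t ^ n) (F ^ n)" using expands_const[of 1] by (induction n) (auto intro: expands_mult)

lemma poly_zero_fun: "(!!t. poly q t = 0) ==> q = (0 :: 'k::field_char_0 poly)" by (metis poly_0 poly_eq_poly_eq_iff ext)

lemma expands_zero:
 assumes "expands (%_. 0) F" shows "F = 0" proof -
 obtain q r where *: "poly r 0 ~= 0" "!!t. poly q t = 0" "F * fps_of_poly r = fps_of_poly q" using assms unfolding expands_def by auto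
 have "q = 0" using poly_zero_fun *(2) by blast
 moreover have "fps_of_poly r ~= 0" using *(1) by auto
 ultimately show ?thesis using *(3) by simp
qed

lemma expands_0: assumes "expands h F" shows "fps_nth F 0 = h 0" proof -
 obtain q r where *: "poly r 0 ~= 0" "!!t. h t * poly r t = poly q t" "F * fps_of_poly r = fps_of_poly q"
  using assms unfolding expands_def by auto
 have "fps_nth (F * fps_of_poly r) 0 = fps_nth F 0 * poly r 0" by (simp add: poly_0_coeff_0)
 moreover have "fps_nth (fps_of_poly q) 0 = poly q 0" by (simp add: poly_0_coeff_0)
 ultimately show ?thesis using *(1) *(2)[of 0] *(3) by (metis mult_right_cancel)
qed

section \<open>Parameter spaces\<close>

text \<open>
  The coordinates are forced to be nonzero by \<open>unz\<close>, so that Laurent polynomials are functions on the full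
  function type and their ring is a domain.
\<close>

definition unz :: "'k::field => 'k" where
 "unz a = (if a = 0 then 1 else a)"

lemma unz: "unz a ~= 0" "unz (unz a) = unz a" "a ~= 0 ==> unz a = a" unfolding unz_def by auto

text \<open>Both identities hold at \<open>0\<close> as well, since the extra factor hides the
  modified value. Hence \<open>unz\<close> of a polynomial satisfies the defining relation of a
  rational function at every point of a line, without exceptions.\<close>

lemma unz_mult: "unz x * x = x * x" "1 / unz x * (x * x) = x" unfolding unz_def by auto

inductive_set laur :: "'i set => (('i => 'k::field) => 'k) set" for I where
 const: "(%_. c) : laur I"
| var: "i : I ==> (%v. unz (v i)) : laur I"
| inv: "i : I ==> (%v. 1 / unz (v i)) : laur I"
| add: "p : laur I ==> q : laur I ==> (%v. p v + q v) : laur I"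
| mult: "p : laur I ==> q : laur I ==> (%v. p v * q v) : laur I"

lemma laur_sum: "(!!j. j : J ==> p j : laur I) ==> (%v. SUM j:J. p j v) : laur I"
 using laur.const[of 0] by (induction J rule: infinite_finite_induct) (auto intro: laur.add)

lemma laur_power: "p : laur I ==> (%v. p v ^ n) : laur I" using laur.const[of 1] by (induction n) (auto intro: laur.mult)

lemma laur_powi: "i : I ==> (%v. unz (v i) powi n) : laur I"
 using laur_power[OF laur.var, of i I "nat n"] laur_power[OF laur.inv, of i I "nat (- n)"]
 by (cases "n >= 0") (auto simp: power_int_def inverse_eq_divide power_one_over)

lemma laur_subring: "subrng (laur I)" unfolding subrng_def proof (intro conjI ballI)
 show "0 : laur I" "1 : laur I" using laur.const[of 0] laur.const[of 1] by (auto simp: zero_fun_def one_fun_def)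
 fix a b :: "('a => 'b) => 'b" assume ab: "a : laur I" "b : laur I"
 show "a + b : laur I" "a * b : laur I" "- a : laur I" using laur.add[OF ab] laur.mult[OF ab] laur.mult[OF laur.const[of "-1"] ab(1)]
  by (auto simp: plus_fun_def times_fun_def fun_Compl_def)
qed

text \<open>On a line a Laurent polynomial is rational, and its denominator is a product of
  coordinates. These are nonzero at both end points because the end points are passed through
  \<open>unz\<close> first.\<close>

lemma laur_line:
 fixes v w :: "'i => 'k::field"
 assumes "p : laur I"
 shows "EX q r. poly r 0 ~= 0 & poly r 1 ~= 0 &
  (ALL t. p (%i. unz (v i) + t * (unz (w i) - unz (v i))) * poly r t = poly q t)" using assms proof (induction rule: laur.induct)
 case (const c)
 show ?case by (intro exI[of _ "[:c:]"] exI[of _ 1]) auto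
next
 case (var i)
 let ?r = "[:unz (v i), unz (w i) - unz (v i):]"
 have "unz (unz (v i) + t * (unz (w i) - unz (v i))) * poly ?r t = poly (?r * ?r) t" for t
  unfolding poly_mult using unz_mult(1)[of "poly ?r t"] by simp
 moreover have "poly ?r 0 ~= 0" "poly ?r 1 ~= 0" using unz(1) by auto
 ultimately show ?case by blast
next
 case (inv i)
 let ?r = "[:unz (v i), unz (w i) - unz (v i):]"
 have "1 / unz (unz (v i) + t * (unz (w i) - unz (v i))) * poly (?r * ?r) t = poly ?r t" for t
  unfolding poly_mult using unz_mult(2)[of "poly ?r t"] by simp
 moreover have "poly (?r * ?r) 0 ~= 0" "poly (?r * ?r) 1 ~= 0" using unz(1) unfolding poly_mult by auto
 ultimately show ?case by blast
next
 case (add p q)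
 from add.IH(1) obtain a b where 1: "poly b 0 ~= 0" "poly b 1 ~= 0"
  "!!t. p (%i. unz (v i) + t * (unz (w i) - unz (v i))) * poly b t = poly a t" by blast
 from add.IH(2) obtain c d where 2: "poly d 0 ~= 0" "poly d 1 ~= 0"
  "!!t. q (%i. unz (v i) + t * (unz (w i) - unz (v i))) * poly d t = poly c t" by blast
 note * = 1(1,2) 2(1,2) 1(3) 2(3)
 have "(x + y) * poly (b * d) t = (x * poly b t) * poly d t + (y * poly d t) * poly b t" for x y t by (simp add: algebra_simps)
 hence "(p (%i. unz (v i) + t * (unz (w i) - unz (v i))) + q (%i. unz (v i) + t * (unz (w i) - unz (v i)))) * poly (b * d) t
   = poly (a * d + c * b) t" for t by (simp only: *(5,6) poly_mult poly_add)
 moreover have "poly (b * d) 0 ~= 0" "poly (b * d) 1 ~= 0" using *(1-4) unfolding poly_mult by auto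
 ultimately show ?case by blast
next
 case (mult p q)
 from mult.IH(1) obtain a b where 1: "poly b 0 ~= 0" "poly b 1 ~= 0"
  "!!t. p (%i. unz (v i) + t * (unz (w i) - unz (v i))) * poly b t = poly a t" by blast
 from mult.IH(2) obtain c d where 2: "poly d 0 ~= 0" "poly d 1 ~= 0"
  "!!t. q (%i. unz (v i) + t * (unz (w i) - unz (v i))) * poly d t = poly c t" by blast
 note * = 1(1,2) 2(1,2) 1(3) 2(3)
 have "(x * y) * poly (b * d) t = (x * poly b t) * (y * poly d t)" for x y t by (simp add: algebra_simps)
 hence "(p (%i. unz (v i) + t * (unz (w i) - unz (v i))) * q (%i. unz (v i) + t * (unz (w i) - unz (v i)))) * poly (b * d) t
   = poly (a * c) t" for t by (simp only: *(5,6) poly_mult)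
 moreover have "poly (b * d) 0 ~= 0" "poly (b * d) 1 ~= 0" using *(1-4) unfolding poly_mult by auto
 ultimately show ?case by blast
qed

lemma laur_unz: "p : laur I ==> p (%i. unz (v i)) = p v" by (induction rule: laur.induct) (auto simp: unz)

text \<open>Restricting both factors to the line joining points where they do not vanish reduces the
  claim to polynomials in one variable.\<close>

lemma laur_domain: "domain_set (laur I :: (('i => 'k::field_char_0) => 'k) set)" unfolding domain_set_def
proof (intro ballI impI, rule ccontr)
 fix a b :: "('i => 'k) => 'k" assume ab: "a : laur I" "b : laur I" "a * b = 0" "\<not> (a = 0 | b = 0)"
 then obtain v w where vw: "a v ~= 0" "b w ~= 0" by (auto simp: fun_eq_iff)
 define l where "l t = (%i. unz (v i) + t * (unz (w i) - unz (v i)))" for t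
 obtain q r where 1: "poly r 0 ~= 0" "!!t. a (l t) * poly r t = poly q t" using laur_line[OF ab(1), of v w] unfolding l_def by blast
 obtain q' r' where 2: "poly r' 1 ~= 0" "!!t. b (l t) * poly r' t = poly q' t" using laur_line[OF ab(2), of v w] unfolding l_def by blast
 note * = 1(1) 2(1) 1(2) 2(2)
 have "poly (q * q') t = 0" for t unfolding poly_mult *(3,4)[symmetric] using fun_cong[OF ab(3), of "l t"] by auto
 hence "q * q' = 0" by (rule poly_zero_fun)
 moreover have "poly q 0 ~= 0" using *(1) *(3)[of 0] vw(1) laur_unz[OF ab(1), of v] unfolding l_def by auto
 moreover have "poly q' 1 ~= 0" using *(2) *(4)[of 1] vw(2) laur_unz[OF ab(2), of w] unfolding l_def by auto
 ultimately show False by auto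
qed

lemma subring_consts: "subrng (range (%(c::'k::comm_ring_1) (_::'x). c))" unfolding subrng_def proof (intro conjI ballI)
 show "0 : range (%(c::'k) (_::'x). c)" "1 : range (%(c::'k) (_::'x). c)" by (auto simp: zero_fun_def one_fun_def)
 fix a b assume "a : range (%(c::'k) (_::'x). c)" "b : range (%(c::'k) (_::'x). c)"
 then obtain c d where "a = (%_. c)" "b = (%_. d)" by blast
 hence "a + b = (%_. c + d)" "a * b = (%_. c * d)" "- a = (%_. - c)" by (auto simp: fun_eq_iff)
 thus "a + b : range (%(c::'k) (_::'x). c)" "a * b : range (%(c::'k) (_::'x). c)"
  "- a : range (%(c::'k) (_::'x). c)" by blast+
qed

lemma noeth_consts: "noeth (range (%(c::'k::field) (_::'x). c))" unfolding noeth_def proof (intro conjI allI impI)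
 let ?K = "range (%(c::'k) (_::'x). c)"
 show "subrng ?K" by (rule subring_consts)
 fix I assume I: "ideal_in ?K I"
 show "EX F. finite F & F <= I & I <= gen_ideal ?K F" proof (cases "I = {0}")
  case True
  thus ?thesis using gen_ideal_mem[OF subring_consts, of "{0}" 0] by (intro exI[of _ "{0}"]) auto
 next
  case False
  then obtain c :: 'k where c: "(%_. c) : I" "(%_::'x. c) ~= 0" using ideal_inD(1,2)[OF I] by blast
  hence c0: "c ~= 0" by (auto simp: zero_fun_def)
  have "a : gen_ideal ?K {%_. c}" if a: "a : I" for a proof -
   obtain d where d: "a = (%_. d)" using a ideal_inD(1)[OF I] by blast
   have "a = (SUM f:{%_. c}. (%_. d / c) * f)" using c0 d by (simp add: fun_eq_iff)
   thus ?thesis unfolding gen_ideal_def by (intro CollectI exI[of _ "%_ _. d / c"]) auto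
  qed
  thus ?thesis using c(1) by (intro exI[of _ "{%_. c}"]) auto
 qed
qed

lemma laur_adjs:
 fixes I :: "'i set"
 assumes "finite I"
 shows "EX bs :: (('i => 'k::field) => 'k) list. laur I = adjs (range (%c _. c)) bs
  & set bs = (%i v. unz (v i)) ` I \<union> (%i v. 1 / unz (v i)) ` I" proof -
 define U :: "(('i => 'k) => 'k) set" where "U = (%i v. unz (v i)) ` I \<union> (%i v. 1 / unz (v i)) ` I"
 have "finite U" unfolding U_def using assms by simp
 from finite_list[OF this] obtain bs where bs: "set bs = U" ..
 let ?K = "range (%c _. c) :: (('i => 'k) => 'k) set"
 have K: "subrng ?K" by (rule subring_consts)
 note S = subring_adjs[OF K, of bs]
 have 1: "p : adjs ?K bs" if "p : laur I" for p using that proof (induction rule: laur.induct)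
  case (add p q)
  thus ?case using subrngD(3)[OF S] by (simp add: plus_fun_def)
 next
  case (mult p q)
  thus ?case using subrngD(4)[OF S] by (simp add: times_fun_def)
 next
  case (const c)
  thus ?case using adjs_base[OF K, of bs] by blast
 qed (intro adjs_gen[OF K], simp add: bs U_def)+
 have 2: "adjs ?K bs <= laur I" proof (rule adjs_least[OF laur_subring])
  show "?K <= laur I" using laur.const by blast
  show "set bs <= laur I" unfolding bs U_def by (intro Un_least image_subsetI laur.var laur.inv)
 qed
 have "laur I = adjs ?K bs" using 1 2 by blast
 thus ?thesis using bs unfolding U_def by (intro exI[of _ bs] conjI)
qed

section \<open>Vanishing of polynomial functions\<close>

text \<open>With the other variables fixed, the sum is a polynomial in the value at
  \<open>y\<close>. Its coefficients collect the exponents with a given entry at \<open>y\<close>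
  and are handled by induction.\<close>

lemma monomials_independent:
 fixes h :: "('x => nat) => 'k::field_char_0"
 assumes "finite X" "finite E" "!!e e'. e : E ==> e' : E ==> (ALL x:X. e x = e' x) ==> e = e'"
  and "!!xi :: 'x => 'k. (SUM e:E. h e * (PROD x:X. xi x ^ e x)) = 0"
 shows "e : E ==> h e = 0" using assms proof (induction X arbitrary: E e rule: finite_induct)
 case empty
 hence "E = {e}" by auto
 thus ?case using empty.prems(4) by simp
next
 case (insert y X)
 define j where "j = e y"
 define E' where "E' = {e':E. e' y = j}"
 show ?case proof (rule insert.IH[of e E'])
  fix xi :: "'x => 'k"
  define M where "M e = (PROD x:X. xi x ^ e x)" for e
  define p where "p = (SUM e:E. monom (h e * M e) (e y))"
  have "poly p t = 0" for t proof -
   have "poly p t = (SUM e:E. h e * (PROD x:insert y X. (xi(y := t)) x ^ e x))" unfolding p_def poly_sum poly_monom M_def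
   proof (intro sum.cong refl)
    fix e
    have "(PROD x:X. (xi(y := t)) x ^ e x) = (PROD x:X. xi x ^ e x)" using insert.hyps by (intro prod.cong) auto
    thus "h e * (PROD x:X. xi x ^ e x) * t ^ e y = h e * (PROD x:insert y X. (xi(y := t)) x ^ e x)"
     using insert.hyps by (simp add: mult_ac)
   qed
   thus ?thesis using insert.prems(4) by simp
  qed
  hence "coeff p j = 0" using poly_zero_fun[of p] by simp
  moreover have "coeff p j = (SUM e:E'. h e * M e)" unfolding p_def coeff_sum coeff_monom E'_def using insert.prems(2)
   by (intro sum.mono_neutral_cong_right) auto
  ultimately show "(SUM e:E'. h e * (PROD x:X. xi x ^ e x)) = 0" unfolding M_def by simp
 qed (use insert.prems in \<open>auto simp: E'_def j_def\<close>)
qed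

section \<open>The automorphism group\<close>

context fd_lie_superalgebra
begin

abbreviation aut_mult (infixl "\<cdot>" 70) where "f \<cdot> g == f \<otimes>\<^bsub>Aut L\<^esub> g"
abbreviation "ginv g == inv\<^bsub>Aut L\<^esub> g"
abbreviation "gone == \<one>\<^bsub>Aut L\<^esub>"

abbreviation "G \<equiv> carrier (Aut L)"

lemma aut_part: assumes f: "aut f" shows "f ` part L p = part L p" proof
 show "f ` part L p <= part L p" using even_part[OF autD(1,2)[OF f]] by blast
 show "part L p <= f ` part L p" proof
  fix y assume y: "y : part L p"
  then obtain x where x: "x : V" "y = f x" using autD(4)[OF f] part_V[OF y] unfolding bij_betw_def by blast
  have inj: "inj_on f V" using autD(4)[OF f] unfolding bij_betw_def by blast
  have e: "f (pr x) = pr y" using autD(2)[OF f] x unfolding even_def by auto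
  have "p = 0 | p = 1" by (cases p) auto
  hence "x : part L p" proof
   assume p: "p = 0"
   hence "f (pr x) = f x" using e y x part_0_iff by auto
   thus ?thesis using inj_onD[OF inj _ pr_V[OF x(1)] x(1)] x part_0_iff p by blast
  next
   assume p: "p = 1"
   hence "f (pr x) = f 0" using e y part_1_iff lin_0[OF autD(1)[OF f]] by auto
   thus ?thesis using inj_onD[OF inj _ pr_V[OF x(1)] V_0] x part_1_iff p by blast
  qed
  thus "y : f ` part L p" using x by blast
 qed
qed

lemma G_iff: "f : G \<longleftrightarrow> f : extensional V & aut f" proof
 assume f: "f : G"
 hence *: "f : extensional V" "bij_betw f V V" "ALL p. f ` part L p = part L p"
  and l: "lin f" "ALL x:V. ALL y:V. f (br x y) = br (f x) (f y)"
  unfolding Aut_def sa_auto_def sa_iso_def Bij_def lin_def by (auto dest: bij_betwE)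
 have "even f" using *(3) l(1) by (intro evenI) auto
 thus "f : extensional V & aut f" using * l unfolding aut_def by blast
next
 assume "f : extensional V & aut f"
 thus "f : G" using aut_part[of f] unfolding Aut_def sa_auto_def sa_iso_def Bij_def aut_def lin_def by auto
qed

lemma G_aut: "f : G ==> aut f" and G_lin: "f : G ==> lin f" and G_V: "f : G ==> x : V ==> f x : V" using G_iff autD(1) linD(1) by blast+

lemma G_eqI: "f : G ==> g : G ==> (!!x. x : V ==> f x = g x) ==> f = g" using G_iff extensionalityI by blast

lemma restrict_G: "aut f ==> restrict f V : G" unfolding G_iff using aut_cong[of f "restrict f V"] by auto

lemma aut_comp: assumes f: "aut f" and g: "aut g" shows "aut (%x. f (g x))" unfolding aut_def proof (intro conjI ballI)
 show "lin (%x. f (g x))" "even (%x. f (g x))" using lin_comp even_comp autD(1,2) f g by blast+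
 show "bij_betw (%x. f (g x)) V V" using bij_betw_trans[OF autD(4)[OF g] autD(4)[OF f]] by (simp add: comp_def)
 show "f (g (br x y)) = br (f (g x)) (f (g y))" if "x : V" "y : V" for x y
  using that autD(3)[OF f] autD(3)[OF g] linD(1)[OF autD(1)[OF g]] by simp
qed

lemma aut_id: "aut (%x. x)" unfolding aut_def using lin_idT even_id by (auto simp: bij_betw_def)

lemma aut_inv_into: assumes f: "aut f" shows "aut (inv_into V f)" proof -
 let ?g = "inv_into V f"
 have b: "bij_betw f V V" by (rule autD(4)[OF f])
 have gV: "?g x : V" and fg: "f (?g x) = x" if "x : V" for x
  using b that bij_betw_inv_into[OF b] bij_betwE bij_betw_inv_into_right[OF b] by blast+
 have gf: "?g (f x) = x" if "x : V" for x using bij_betw_inv_into_left[OF b that] .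
 note lf = linD[OF autD(1)[OF f]]
 have l: "lin ?g" unfolding lin_def proof (intro conjI ballI allI)
  fix x y assume xy: "x : V" "y : V"
  have "f (?g x + ?g y) = x + y" using lf(2)[OF gV gV] fg xy by simp
  thus "?g (x + y) = ?g x + ?g y" using gf[of "?g x + ?g y"] gV xy by simp
 next
  fix c x assume x: "x : V"
  have "f (sc c (?g x)) = sc c x" using lf(3)[OF gV] fg x by simp
  thus "?g (sc c x) = sc c (?g x)" using gf[of "sc c (?g x)"] gV x by simp
 qed (use gV in auto)
 show ?thesis unfolding aut_def proof (intro conjI ballI)
  show "even ?g" unfolding even_def proof
   fix x assume x: "x : V"
   have "f (pr (?g x)) = pr x" using autD(2)[OF f] gV[OF x] fg[OF x] unfolding even_def by simp
   thus "?g (pr x) = pr (?g x)" using gf[of "pr (?g x)"] pr_V gV x by simp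
  qed
  fix x y assume xy: "x : V" "y : V"
  have "f (br (?g x) (?g y)) = br x y" using autD(3)[OF f gV gV] fg xy by simp
  thus "?g (br x y) = br (?g x) (?g y)" using gf[of "br (?g x) (?g y)"] br_V gV xy by simp
 qed (use l bij_betw_inv_into[OF b] in auto)
qed

lemma group_Aut: "group (Aut L)" proof -
 have sub: "subgroup (sa_auto L) (BijGroup V)" proof (rule group.subgroupI[OF group_BijGroup])
  have e: "sa_auto L = G" unfolding Aut_def by simp
  show "sa_auto L <= carrier (BijGroup V)" unfolding sa_auto_def BijGroup_def by auto
  show "sa_auto L ~= {}" using restrict_G[OF aut_id] e by auto
  fix a assume a: "a : sa_auto L"
  hence aB: "a : Bij V" unfolding sa_auto_def by simp
  show "inv\<^bsub>BijGroup V\<^esub> a : sa_auto L" unfolding inv_BijGroup[OF aB] using restrict_G[OF aut_inv_into[OF G_aut]] a e by auto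
  fix b assume b: "b : sa_auto L"
  hence bB: "b : Bij V" unfolding sa_auto_def by simp
  have "a \<otimes>\<^bsub>BijGroup V\<^esub> b = restrict (%x. a (b x)) V" using aB bB by (simp add: BijGroup_def compose_def)
  thus "a \<otimes>\<^bsub>BijGroup V\<^esub> b : sa_auto L" using restrict_G[OF aut_comp[OF G_aut G_aut]] a b e by auto
 qed
 show ?thesis unfolding Aut_def by (rule subgroup.subgroup_is_group[OF sub group_BijGroup])
qed

interpretation AG: group "Aut L" by (rule group_Aut)

lemma Aut_mult: "f : G ==> g : G ==> x : V ==> (f \<cdot> g) x = f (g x)"
 unfolding Aut_def BijGroup_def sa_auto_def by (simp add: compose_def)

lemma Aut_one: "x : V ==> gone x = x" unfolding Aut_def BijGroup_def by simp

lemma Aut_inv: assumes "f : G" "x : V"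
 shows "(ginv f) (f x) = x" "f ((ginv f) x) = x" using Aut_mult[of "ginv f" f x] Aut_mult[of f "ginv f" x] assms Aut_one by auto

section \<open>The ring of regular functions\<close>

definition ret :: "('a => 'a) => 'a => 'a" where
 "ret ph = (if ph : G then ph else gone)"

text \<open>
  Composition with the retraction \<open>ret\<close> realises the quotient ring of functions on the group by functions
  on the full type, so that equality in the quotient is equality of functions.
\<close>

definition reg :: "(('a => 'a) => 'k) set" where
 "reg = (%p ph. p (ret ph)) ` polyfuns L"

lemma ret_G: "ret ph : G" and ret_id: "ph : G ==> ret ph = ph" unfolding ret_def by auto

lemma reg_intros:
 shows reg_const: "(%_. c) : reg" and reg_coord: "l : functionals L ==> x : V ==> (%ph. l (ret ph x)) : reg"
  and reg_add: "f : reg ==> g : reg ==> (%ph. f ph + g ph) : reg" and reg_mult: "f : reg ==> g : reg ==> (%ph. f ph * g ph) : reg" proof -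
 show "(%_. c) : reg" unfolding reg_def using polyfuns.const[of c L] by (intro image_eqI[of _ _ "%_. c"]) auto
 show "l : functionals L ==> x : V ==> (%ph. l (ret ph x)) : reg" unfolding reg_def by (rule image_eqI[OF _ polyfuns.coord]) auto
 show "(%ph. f ph + g ph) : reg" "(%ph. f ph * g ph) : reg" if "f : reg" "g : reg" proof -
  obtain p q where "p : polyfuns L" "q : polyfuns L" "f = (%ph. p (ret ph))" "g = (%ph. q (ret ph))"
   using `f : reg` `g : reg` unfolding reg_def by blast
  thus "(%ph. f ph + g ph) : reg" "(%ph. f ph * g ph) : reg"
   unfolding reg_def by (auto intro: image_eqI[OF _ polyfuns.add] image_eqI[OF _ polyfuns.mult])
 qed
qed

lemma reg_induct [consumes 1, case_names const coord add mult]: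
 assumes f: "f : reg" and "!!c. P (%_. c)" "!!l x. l : functionals L ==> x : V ==> P (%ph. l (ret ph x))"
  "!!f g. f : reg ==> g : reg ==> P f ==> P g ==> P (%ph. f ph + g ph)"
  "!!f g. f : reg ==> g : reg ==> P f ==> P g ==> P (%ph. f ph * g ph)"
 shows "P f" proof -
 obtain p where p: "p : polyfuns L" "f = (%ph. p (ret ph))" using f unfolding reg_def by blast
 have "P (%ph. p (ret ph))" using p(1) by (induction rule: polyfuns.induct) (use assms(2-5) in \<open>auto simp: reg_def\<close>)
 thus ?thesis using p(2) by simp
qed

lemma reg_subring: "subrng reg" unfolding subrng_def proof (intro conjI ballI)
 show "0 : reg" "1 : reg" using reg_const[of 0] reg_const[of 1] by (auto simp: zero_fun_def one_fun_def)
 fix f g assume fg: "f : reg" "g : reg"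
 show "f + g : reg" "f * g : reg" using reg_add[OF fg] reg_mult[OF fg] by (auto simp: plus_fun_def times_fun_def)
 show "- f : reg" using reg_mult[OF reg_const[of "-1"] fg(1)] by (simp add: fun_Compl_def)
qed

lemma crd_functional: "crd b : functionals L" unfolding functionals_def using crd_add crd_scale by auto

lemma functional_sum:
 assumes l: "l : functionals L" and "!!i. i : I ==> f i : V"
 shows "l (sum f I) = (SUM i:I. l (f i))" proof -
 have "l (sc 0 0) = 0 * l 0" using l V_0 unfolding functionals_def by blast
 hence l0: "l 0 = 0" by simp
 show ?thesis using assms(2) proof (induction I rule: infinite_finite_induct)
  case (insert i I)
  thus ?case using l V_sum[of I f] unfolding functionals_def by auto
 qed (auto simp: l0)
qed

lemma functional_expand:
 assumes l: "l : functionals L" and x: "x : V" shows "l x = (SUM b:B. crd b x * l b)" proof -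
 have "l x = l (SUM b:B. sc (crd b x) b)" using crd_sum[OF x] by simp
 also have "... = (SUM b:B. l (sc (crd b x) b))" using B_V by (intro functional_sum[OF l]) auto
 also have "... = (SUM b:B. crd b x * l b)" using l B_V unfolding functionals_def by (intro sum.cong) auto
 finally show ?thesis .
qed

text \<open>The finitely many matrix entries in the basis \<open>B\<close> generate all regular
  functions, which puts Hilbert's basis theorem within reach.\<close>

lemma reg_adjs:
 "EX bs. reg = adjs (range (%c _. c)) bs" proof -
 define U where "U = (%(b, c) ph. crd c (ret ph b)) ` (B \<times> B)"
 have "finite U" unfolding U_def using B(1) by simp
 from finite_list[OF this] obtain bs where bs: "set bs = U" ..
 let ?K = "range (%c _. c) :: (('a => 'a) => 'k) set"
 have K: "subrng ?K" by (rule subring_consts)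
 note S = subring_adjs[OF K, of bs]
 have c: "(%_. c) : adjs ?K bs" for c using adjs_base[OF K, of bs] by blast
 have 1: "p : adjs ?K bs" if "p : reg" for p using that proof (induction rule: reg_induct)
  case (coord l x)
  have "(%ph. l (ret ph x)) = (SUM c:B. SUM b:B. (%_. crd b x * l c) * (%ph. crd c (ret ph b)))" proof
   fix ph
   have R: "lin (ret ph)" using G_lin[OF ret_G] .
   have "l (ret ph x) = (SUM c:B. crd c (ret ph x) * l c)" by (rule functional_expand[OF coord(1) linD(1)[OF R coord(2)]])
   also have "... = (SUM c:B. (SUM b:B. crd b x * crd c (ret ph b)) * l c)" proof (intro sum.cong refl)
    fix c
    have "crd c (ret ph x) = (SUM b:B. crd c (sc (crd b x) (ret ph b)))"
     unfolding lin_expand[OF R coord(2)] using linD(1)[OF R] B_V by (intro crd_sum') auto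
    also have "... = (SUM b:B. crd b x * crd c (ret ph b))" using linD(1)[OF R] B_V by (intro sum.cong refl crd_scale) auto
    finally show "crd c (ret ph x) * l c = (SUM b:B. crd b x * crd c (ret ph b)) * l c" by simp
   qed
   finally show "l (ret ph x) = (SUM c:B. SUM b:B. (%_. crd b x * l c) * (%ph. crd c (ret ph b))) ph"
    by (simp add: sum_fun_apply sum_distrib_left sum_distrib_right mult_ac)
  qed
  also have "... : adjs ?K bs" by (intro subrng_sum[OF S] subrngD(4)[OF S] c adjs_gen[OF K]) (auto simp: bs U_def)
  finally show ?case .
 next
  case (add p q)
  thus ?case using subrngD(3)[OF S] by (simp add: plus_fun_def)
 next
  case (mult p q)
  thus ?case using subrngD(4)[OF S] by (simp add: times_fun_def)
 qed (rule c)
 have 2: "adjs ?K bs <= reg" proof (rule adjs_least[OF reg_subring])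
  show "?K <= reg" using reg_const by blast
  show "set bs <= reg" unfolding bs U_def using reg_coord[OF crd_functional B_V] by (auto simp: split_beta)
 qed
 show ?thesis using 1 2 by (intro exI[of _ bs] subset_antisym subsetI) auto
qed

lemma noeth_reg: "noeth reg" using reg_adjs noeth_adjs[OF noeth_consts] by metis

section \<open>Regular families and curves of endomorphisms\<close>

definition regfam :: "'i set => (('i => 'k) => 'a => 'a) => bool" where
 "regfam I Te \<longleftrightarrow> (ALL v. lin (Te v)) & (ALL x:V. ALL b:B. (%v. crd b (Te v x)) : laur I)"

lemma regfam_const: "lin T ==> regfam I (%v. T)" unfolding regfam_def by (auto intro: laur.const)

lemma crd_comp:
 assumes "lin S" "lin T" "x : V"
 shows "crd c (S (T x)) = (SUM b:B. crd b (T x) * crd c (S b))" proof -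
 have "crd c (S (T x)) = (SUM b:B. crd c (sc (crd b (T x)) (S b)))"
  using assms linD(1) B_V by (subst lin_expand[OF assms(1)]) (auto intro!: crd_sum')
 also have "... = (SUM b:B. crd b (T x) * crd c (S b))" using assms linD(1) B_V by (intro sum.cong refl crd_scale) auto
 finally show ?thesis .
qed

lemma regfam_comp: "regfam I Te ==> regfam I Xi ==> regfam I (%v x. Te v (Xi v x))"
 unfolding regfam_def by (auto simp: lin_comp crd_comp B_V intro!: laur_sum laur.mult)

lemma regfam_scale: "p : laur I ==> regfam I Te ==> regfam I (%v x. sc (p v) (Te v x))"
 unfolding regfam_def using linD(1) by (auto simp: lin_scaleT crd_scale intro!: laur.mult)

lemma regfam_sum: "(!!j. j : J ==> regfam I (Te j)) ==> regfam I (%v x. SUM j:J. Te j v x)"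
 unfolding regfam_def using linD(1) by (auto intro!: lin_sumT laur_sum simp: crd_sum')

lemma regfam_funpow: "regfam I Te ==> regfam I (%v. Te v ^^ n)" proof (induction n)
 case 0
 thus ?case using regfam_const[OF lin_idT] by (simp add: id_def)
next
 case (Suc n)
 thus ?case using regfam_comp[of I Te "%v. Te v ^^ n"] by (simp add: comp_def)
qed

lemma regfam_cong: "regfam I Te ==> (!!v x. x : V ==> Xi v x = Te v x) ==> regfam I Xi"
 unfolding regfam_def using lin_cong[of "Te _" "Xi _"] by auto

lemma regfam_reg:
 assumes Te: "regfam I Te" "!!v. Te v : G" and f: "f : reg"
 shows "(%v. f (Te v)) : laur I" using f proof (induction rule: reg_induct)
 case (coord l x)
 have "l (ret (Te v) x) = (SUM b:B. crd b (Te v x) * l b)" for v using functional_expand[OF coord(1)] G_V Te(2) coord(2) ret_id by simp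
 thus ?case using Te(1) coord(2) unfolding regfam_def by (auto intro!: laur_sum laur.mult laur.const)
qed (auto intro: laur.intros)

text \<open>A curve of endomorphisms with rational matrix entries whose Taylor series begin with
  \<open>c0 + t c1\<close>: the base point \<open>c0\<close> and the velocity
  \<open>c1\<close>.\<close>

definition first_order :: "('k => 'a => 'a) => ('a => 'a) => ('a => 'a) => bool" where
 "first_order c c0 c1 \<longleftrightarrow> (ALL t. lin (c t)) & lin c0 & lin c1 &
  (ALL x:V. ALL b:B. EX F. expands (%t. crd b (c t x)) F & fps_nth F 0 = crd b (c0 x) & fps_nth F 1 = crd b (c1 x))"

lemma first_orderE:
 assumes "first_order c c0 c1"
 obtains P where "!!x b. x : V ==> b : B ==> expands (%t. crd b (c t x)) (P x b) &
  fps_nth (P x b) 0 = crd b (c0 x) & fps_nth (P x b) 1 = crd b (c1 x)" proof -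
 define P where "P x b = (SOME F. expands (%t. crd b (c t x)) F & fps_nth F 0 = crd b (c0 x) & fps_nth F 1 = crd b (c1 x))" for x b
 have "expands (%t. crd b (c t x)) (P x b) & fps_nth (P x b) 0 = crd b (c0 x) & fps_nth (P x b) 1 = crd b (c1 x)"
  if "x : V" "b : B" for x b unfolding P_def by (rule someI_ex) (use assms that in \<open>auto simp: first_order_def\<close>)
 thus ?thesis using that by blast
qed

lemma first_order_const: "lin T ==> first_order (%t. T) T (%x. 0)"
 unfolding first_order_def using lin_zeroT expands_const crd_scale[of 0 _ 0] by fastforce

text \<open>The product rule for curves, read off from the matrix entries.\<close>

lemma first_order_comp:
 assumes "first_order c c0 c1" "first_order d d0 d1"
 shows "first_order (%t x. c t (d t x)) (%x. c0 (d0 x)) (%x. c1 (d0 x) + c0 (d1 x))" unfolding first_order_def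
proof (intro conjI allI ballI)
 have l: "!!t. lin (c t)" "lin c0" "lin c1" "!!t. lin (d t)" "lin d0" "lin d1" using assms unfolding first_order_def by auto
 show "lin (%x. c t (d t x))" "lin (%x. c0 (d0 x))" "lin (%x. c1 (d0 x) + c0 (d1 x))" for t using l by (auto intro: lin_comp lin_addT)
 fix x b assume x: "x : V" and b: "b : B"
 obtain P' where P': "!!x b. x : V ==> b : B ==> expands (%t. crd b (c t x)) (P' x b) &
  fps_nth (P' x b) 0 = crd b (c0 x) & fps_nth (P' x b) 1 = crd b (c1 x)" using first_orderE[OF assms(1)] by blast
 obtain Q' where Q': "!!x b. x : V ==> b : B ==> expands (%t. crd b (d t x)) (Q' x b) &
  fps_nth (Q' x b) 0 = crd b (d0 x) & fps_nth (Q' x b) 1 = crd b (d1 x)" using first_orderE[OF assms(2)] by blast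
 define P Q where "P e = P' e b" and "Q e = Q' x e" for e
 have P: "expands (%t. crd b (c t e)) (P e) & fps_nth (P e) 0 = crd b (c0 e) & fps_nth (P e) 1 = crd b (c1 e)" if "e : B" for e
  unfolding P_def using P'[OF B_V[OF that] b] .
 have Q: "expands (%t. crd e (d t x)) (Q e) & fps_nth (Q e) 0 = crd e (d0 x) & fps_nth (Q e) 1 = crd e (d1 x)" if "e : B" for e
  unfolding Q_def using Q'[OF x that] .
 have "expands (%t. crd b (c t (d t x))) (SUM e:B. Q e * P e)"
  unfolding crd_comp[OF l(1,4) x] using P Q by (intro expands_sum expands_mult) auto
 moreover have "fps_nth (SUM e:B. Q e * P e) 0 = crd b (c0 (d0 x))" unfolding crd_comp[OF l(2,5) x] using P Q by (simp add: fps_sum_nth)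
 moreover have "fps_nth (SUM e:B. Q e * P e) 1 = crd b (c1 (d0 x) + c0 (d1 x))" proof -
  have "crd b (c1 (d0 x) + c0 (d1 x)) = crd b (c1 (d0 x)) + crd b (c0 (d1 x))" using l x linD(1) by (intro crd_add) auto
  also have "... = (SUM e:B. crd e (d0 x) * crd b (c1 e) + crd e (d1 x) * crd b (c0 e))"
   unfolding crd_comp[OF l(3,5) x] crd_comp[OF l(2,6) x] sum.distrib ..
  also have "... = fps_nth (SUM e:B. Q e * P e) 1" unfolding fps_sum_nth using P Q by (intro sum.cong) (auto simp: fps_mult_nth)
  finally show ?thesis ..
 qed
 ultimately show "EX F. expands (%t. crd b (c t (d t x))) F & fps_nth F 0 = crd b (c0 (d0 x))
   & fps_nth F 1 = crd b (c1 (d0 x) + c0 (d1 x))" by blast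
qed

lemma first_order_scale:
 assumes "expands h F" "first_order c c0 c1"
 shows "first_order (%t x. sc (h t) (c t x)) (%x. sc (fps_nth F 0) (c0 x))
  (%x. sc (fps_nth F 1) (c0 x) + sc (fps_nth F 0) (c1 x))" unfolding first_order_def proof (intro conjI allI ballI)
 have l: "!!t. lin (c t)" "lin c0" "lin c1" using assms unfolding first_order_def by auto
 show "lin (%x. sc (h t) (c t x))" "lin (%x. sc (fps_nth F 0) (c0 x))"
  "lin (%x. sc (fps_nth F 1) (c0 x) + sc (fps_nth F 0) (c1 x))" for t using l by (auto intro: lin_scaleT lin_addT)
 fix x b assume x: "x : V" and b: "b : B"
 obtain P where "expands (%t. crd b (c t x)) P" "fps_nth P 0 = crd b (c0 x)" "fps_nth P 1 = crd b (c1 x)"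
  using first_orderE[OF assms(2)] x b by blast
 thus "EX P. expands (%t. crd b (sc (h t) (c t x))) P & fps_nth P 0 = crd b (sc (fps_nth F 0) (c0 x))
   & fps_nth P 1 = crd b (sc (fps_nth F 1) (c0 x) + sc (fps_nth F 0) (c1 x))" using expands_mult[OF assms(1)] l x linD(1)
  by (intro exI[of _ "F * P"]) (auto simp: crd_scale crd_add fps_mult_nth)
qed

lemma first_order_sum:
 assumes "!!j. j : J ==> first_order (c j) (c0 j) (c1 j)"
 shows "first_order (%t x. SUM j:J. c j t x) (%x. SUM j:J. c0 j x) (%x. SUM j:J. c1 j x)" unfolding first_order_def
proof (intro conjI allI ballI)
 have l: "!!j t. j : J ==> lin (c j t)" "!!j. j : J ==> lin (c0 j)" "!!j. j : J ==> lin (c1 j)"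
  using assms unfolding first_order_def by auto
 show "lin (%x. SUM j:J. c j t x)" "lin (%x. SUM j:J. c0 j x)" "lin (%x. SUM j:J. c1 j x)" for t using l by (auto intro: lin_sumT)
 fix x b assume x: "x : V" and b: "b : B"
 have "ALL j:J. EX P. expands (%t. crd b (c j t x)) P & fps_nth P 0 = crd b (c0 j x) & fps_nth P 1 = crd b (c1 j x)"
  using assms x b unfolding first_order_def by simp
 from bchoice[OF this] obtain P where "!!j. j : J ==> expands (%t. crd b (c j t x)) (P j) & fps_nth (P j) 0 = crd b (c0 j x) & fps_nth (P j) 1 = crd b (c1 j x)"
  by blast
 thus "EX P. expands (%t. crd b (SUM j:J. c j t x)) P & fps_nth P 0 = crd b (SUM j:J. c0 j x)
   & fps_nth P 1 = crd b (SUM j:J. c1 j x)"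
  using l x linD(1) by (intro exI[of _ "SUM j:J. P j"]) (auto simp: crd_sum' fps_sum_nth intro: expands_sum)
qed

lemma first_order_cong:
 assumes "first_order c c0 c1" "!!t x. x : V ==> d t x = c t x" "!!x. x : V ==> d0 x = c0 x" "!!x. x : V ==> d1 x = c1 x"
 shows "first_order d d0 d1" using assms(1) lin_cong[of "c _" "d _"] lin_cong[of c0 d0] lin_cong[of c1 d1] assms(2-4)
 unfolding first_order_def by auto

lemma reg_expansion:
 assumes c: "first_order c c0 c1" "!!t. c t : G" and f: "f : reg"
 shows "EX F. expands (%t. f (c t)) F" using f proof (induction rule: reg_induct)
 case (coord l x)
 have "l (ret (c t) x) = (SUM b:B. crd b (c t x) * l b)" for t using functional_expand[OF coord(1)] G_V c(2) coord(2) ret_id by simp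
 moreover obtain P where P: "!!x b. x : V ==> b : B ==> expands (%t. crd b (c t x)) (P x b) &
  fps_nth (P x b) 0 = crd b (c0 x) & fps_nth (P x b) 1 = crd b (c1 x)" using first_orderE[OF c(1)] by blast
 have "expands (%t. SUM b:B. crd b (c t x) * l b) (SUM b:B. P x b * fps_const (l b))"
  using P[OF coord(2)] by (intro expands_sum expands_mult expands_const) auto
 ultimately show ?case by auto
qed (auto intro: expands_const expands_add expands_mult)

end

section \<open>Powers of an ideal and leading forms\<close>

context
 fixes S m :: "'r::comm_ring_1 set"
 assumes S: "subrng S" and m: "ideal_in S m"
begin

lemma in_ipow_mult_S: "in_ipow S m k a ==> s : S ==> in_ipow S m k (s * a)" proof (induction rule: in_ipow.induct)
 case (base a)
 thus ?case using subrngD(4)[OF S] by (intro in_ipow.base)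
next
 case (mult k a b)
 thus ?case using in_ipow.mult[of S m k "s * a" b] by (simp add: mult.assoc)
next
 case (add k a b)
 thus ?case using in_ipow.add by (simp add: distrib_left)
qed

lemma in_ipow_zero: "in_ipow S m k 0" proof (induction k)
 case 0
 thus ?case using subrngD(1)[OF S] by (rule in_ipow.base)
next
 case (Suc k)
 thus ?case using in_ipow.mult[OF Suc ideal_inD(2)[OF m]] by simp
qed

lemma in_ipow_sum: "(!!i. i : I ==> in_ipow S m k (f i)) ==> in_ipow S m k (sum f I)"
 by (induction I rule: infinite_finite_induct) (auto simp: in_ipow_zero intro: in_ipow.add)

lemma in_ipow_mult: "in_ipow S m k b ==> in_ipow S m j a ==> in_ipow S m (j + k) (a * b)" proof (induction rule: in_ipow.induct)
 case (base b)
 thus ?case using in_ipow_mult_S[of j a b] by (simp add: mult.commute)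
next
 case (mult k a' b)
 thus ?case using in_ipow.mult[of S m "j + k" "a * a'" b] by (simp add: mult.assoc)
next
 case (add k a' b)
 thus ?case using in_ipow.add by (simp add: distrib_left)
qed

lemma in_ipow_1: "b : m ==> in_ipow S m 1 b" using in_ipow.mult[OF in_ipow.base, of 1 S b m] subrngD(2)[OF S] by simp

lemma in_ipow_2: "a : m ==> b : m ==> in_ipow S m 2 (a * b)" using in_ipow.mult[OF in_ipow_1, of a b] by (simp add: numeral_2_eq_2)

end

text \<open>One homogeneous polynomial of degree \<open>k\<close> in two guises: with the functions
  \<open>y x\<close> substituted for its variables, and as a function of independent variables
  \<open>xi\<close>. The functions \<open>y x\<close> may satisfy relations, so the second guise
  cannot be recovered from the first and is carried along.\<close>

inductive is_form :: "'x set => ('x => 'p => 'k::comm_ring_1) => nat => ('p => 'k) => (('x => 'k) => 'k) => bool" for D y where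
 zero: "is_form D y k (%_. 0) (%_. 0)"
| const: "is_form D y 0 (%_. c) (%_. c)"
| mult: "is_form D y k g Q ==> x : D ==> is_form D y (Suc k) (%p. c * g p * y x p) (%xi. c * Q xi * xi x)"
| add: "is_form D y k g Q ==> is_form D y k g' Q' ==> is_form D y k (%p. g p + g' p) (%xi. Q xi + Q' xi)"

lemma is_form_sum:
 assumes "!!i. i : I ==> is_form D y k (g i) (Q i)"
 shows "is_form D y k (%p. SUM i:I. g i p) (%xi. SUM i:I. Q i xi)"
 using assms by (induction I rule: infinite_finite_induct) (auto intro: is_form.zero is_form.add)

lemma is_form_monomials:
 assumes D: "finite D" and "is_form D y k g Q"
 shows "EX E h. finite E & (ALL e:E. ALL x. x ~: D --> e x = 0) & g = (%p. SUM e:E. h e * (PROD x:D. y x p ^ e x))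
  & Q = (%xi. SUM e:E. h e * (PROD x:D. xi x ^ e x))" using assms(2) proof (induction rule: is_form.induct)
 case (zero k)
 show ?case by (intro exI[of _ "{}"]) auto
next
 case (const c)
 show ?case by (intro exI[of _ "{%_. 0}"] exI[of _ "%_. c"]) auto
next
 case (mult k g Q x c)
 then obtain E h where E: "finite E" "ALL e:E. ALL x. x ~: D --> e x = 0"
  "g = (%p. SUM e:E. h e * (PROD x:D. y x p ^ e x))" "Q = (%xi. SUM e:E. h e * (PROD x:D. xi x ^ e x))" by blast
 define s where "s e = e(x := Suc (e x))" for e :: "'a => nat"
 define h' where "h' e = c * h (e(x := e x - 1))" for e
 have inj: "inj_on s E" unfolding s_def inj_on_def by (metis fun_upd_eqD fun_upd_triv fun_upd_upd nat.inject)
 have hs: "h' (s e) = c * h e" for e unfolding h'_def s_def by simp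
 have pr: "(PROD z:D. w z ^ s e z) = (PROD z:D. w z ^ e z) * w x" for w :: "'a => 'c" and e
  unfolding s_def using D mult.hyps(2) by (simp add: prod.remove[of D x] mult_ac)
 have "(SUM e:s ` E. h' e * (PROD z:D. w z ^ e z)) = c * (SUM e:E. h e * (PROD z:D. w z ^ e z)) * w x" for w
  unfolding sum.reindex[OF inj] comp_def hs pr by (simp add: sum_distrib_left sum_distrib_right mult_ac)
 thus ?case using E(1,2) mult.hyps(2) unfolding E(3,4) by (intro exI[of _ "s ` E"] exI[of _ h']) (auto simp: s_def)
next
 case (add k g Q g' Q')
 then obtain E h E' h' where E: "finite E" "ALL e:E. ALL x. x ~: D --> e x = 0"
  "g = (%p. SUM e:E. h e * (PROD x:D. y x p ^ e x))" "Q = (%xi. SUM e:E. h e * (PROD x:D. xi x ^ e x))"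
  and E': "finite E'" "ALL e:E'. ALL x. x ~: D --> e x = 0"
  "g' = (%p. SUM e:E'. h' e * (PROD x:D. y x p ^ e x))" "Q' = (%xi. SUM e:E'. h' e * (PROD x:D. xi x ^ e x))" by blast
 define k where "k e = (if e : E then h e else 0) + (if e : E' then h' e else 0)" for e
 have "(SUM e:E \<union> E'. k e * M e) = (SUM e:E. h e * M e) + (SUM e:E'. h' e * M e)" for M :: "('a => nat) => 'c" proof -
  have "(SUM e:E \<union> E'. (if e : E then h e else 0) * M e) = (SUM e:E. h e * M e)"
   using E(1) E'(1) by (intro sum.mono_neutral_cong_right) auto
  moreover have "(SUM e:E \<union> E'. (if e : E' then h' e else 0) * M e) = (SUM e:E'. h' e * M e)"
   using E(1) E'(1) by (intro sum.mono_neutral_cong_right) auto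
  ultimately show ?thesis unfolding k_def distrib_right sum.distrib by (simp only:)
 qed
 thus ?case using E(1,2) E'(1,2) unfolding E(3,4) E'(3,4) by (intro exI[of _ "E \<union> E'"] exI[of _ k]) auto
qed

text \<open>Vanishing at all \<open>xi\<close> kills every coefficient, hence also the substituted
  form.\<close>

lemma is_form_vanish:
 fixes y :: "'x => 'p => 'k::field_char_0"
 assumes D: "finite D" and f: "is_form D y k g Q" and Q: "!!xi. Q xi = 0"
 shows "g = (%_. 0)" proof -
 obtain E h where E: "finite E" "ALL e:E. ALL x. x ~: D --> e x = 0"
  "g = (%p. SUM e:E. h e * (PROD x:D. y x p ^ e x))" "Q = (%xi. SUM e:E. h e * (PROD x:D. xi x ^ e x))"
  using is_form_monomials[OF D f] by blast
 have "h e = 0" if "e : E" for e proof (rule monomials_independent[OF D E(1) _ _ that])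
  show "e = e'" if "e : E" "e' : E" "ALL x:D. e x = e' x" for e e' using that E(2) by (intro ext) metis
  show "(SUM e:E. h e * (PROD x:D. xi x ^ e x)) = 0" for xi using Q[of xi] unfolding E(4) .
 qed
 thus ?thesis unfolding E(3) by simp
qed

text \<open>Along a curve on which each \<open>y x\<close> starts with the linear term
  \<open>xi x\<close> times \<open>t\<close>, a form of degree \<open>k\<close> starts with
  \<open>Q xi\<close> times the \<open>k\<close>-th power of \<open>t\<close>.\<close>

lemma is_form_expansion:
 assumes "is_form D y k g Q" and "!!x. x : D ==> expands (%t. y x (c t)) (fps_X * F x) & fps_nth (F x) 0 = xi x"
 shows "EX P. expands (%t. g (c t)) (fps_X ^ k * P) & fps_nth P 0 = Q xi" using assms(1) proof (induction rule: is_form.induct)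
 case (zero k)
 show ?case using expands_const[of 0] by (intro exI[of _ 0]) simp
next
 case (const c)
 show ?case using expands_const[of c] by (intro exI[of _ "fps_const c"]) simp
next
 case (mult k g Q x a)
 then obtain P where P: "expands (%t. g (c t)) (fps_X ^ k * P)" "fps_nth P 0 = Q xi" by blast
 have "expands (%t. a * g (c t) * y x (c t)) (fps_const a * (fps_X ^ k * P) * (fps_X * F x))"
  using P(1) assms(2)[OF mult.hyps(2)] expands_const by (intro expands_mult) auto
 moreover have "fps_const a * (fps_X ^ k * P) * (fps_X * F x) = fps_X ^ Suc k * (fps_const a * P * F x)" by (simp add: mult_ac)
 ultimately show ?case using P(2) assms(2)[OF mult.hyps(2)] by (intro exI[of _ "fps_const a * P * F x"]) simp
next
 case (add k g Q g' Q')
 then obtain P P' where P: "expands (%t. g (c t)) (fps_X ^ k * P)" "fps_nth P 0 = Q xi"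
  "expands (%t. g' (c t)) (fps_X ^ k * P')" "fps_nth P' 0 = Q' xi" by blast
 thus ?case using expands_add[OF P(1,3)] by (intro exI[of _ "P + P'"]) (simp add: distrib_left)
qed

lemma fps_X_factor:
 fixes F :: "'k::field fps"
 assumes "fps_nth F 0 = 0" shows "F = fps_X * fps_shift 1 F" proof (rule fps_ext)
 fix n show "fps_nth F n = fps_nth (fps_X * fps_shift 1 F) n" using assms by (cases n) auto
qed

section \<open>The tangent space of the automorphism group\<close>

context fd_lie_superalgebra
begin

lemma basis_induct [consumes 1, case_names zero basis add]:
 assumes x: "x : V" and P: "P 0" "!!c b. b : B ==> P (sc c b)"
  "!!x y. x : V ==> y : V ==> P x ==> P y ==> P (x + y)"
 shows "P x" proof -
 have "x : span B" using x B(3) by simp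
 hence "x : V & P x" by (induction rule: span_induct_alt) (use P B_V in auto)
 thus ?thesis ..
qed

lemma crd_zeroD: "x : V ==> (!!c. c : B ==> crd c x = 0) ==> x = 0" using crd_sum[of x] by simp

lemma crd_0: "crd b 0 = 0" using crd_scale[of 0 b 0] by simp

section \<open>Linear equations of the space of derivations\<close>

definition fun_on_endo :: "(('a => 'a) => 'k) => bool" where
 "fun_on_endo f \<longleftrightarrow> (ALL Z:endo. ALL W:endo. f (%x. Z x + W x) = f Z + f W)
  & (ALL c. ALL Z:endo. f (%x. sc c (Z x)) = c * f Z)"

lemma endo_closed: "Z : endo ==> W : endo ==> (%x. Z x + W x) : endo" "Z : endo ==> (%x. sc c (Z x)) : endo"
 unfolding endo_def by (auto simp: lin_addT lin_scaleT)

text \<open>A vector \<open>W\<close> on which \<open>dl a\<close> is nonzero and the other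
  functionals vanish fixes the coefficient of \<open>dl a\<close>; subtracting this term reduces to
  the smaller set. Without such a vector, \<open>dl a\<close> may receive the coefficient
  zero.\<close>

lemma functional_factor:
 assumes "finite A" and "!!a. a : A ==> fun_on_endo (dl a)" and "fun_on_endo l" and "!!Z. Z : endo ==> (ALL a:A. dl a Z = 0) ==> l Z = 0"
 shows "EX mu. ALL Z:endo. l Z = (SUM a:A. mu a * dl a Z)" using assms proof (induction A arbitrary: l rule: finite_induct)
 case (insert a A)
 show ?case proof (cases "EX W:endo. (ALL a:A. dl a W = 0) & dl a W ~= 0")
  case False
  have "l Z = 0" if "Z : endo" "ALL a:A. dl a Z = 0" for Z using insert.prems(3)[OF that(1)] that False by blast
  from insert.IH[OF insert.prems(1,2) this] obtain mu where "ALL Z:endo. l Z = (SUM a:A. mu a * dl a Z)" by blast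
  hence "ALL Z:endo. l Z = (SUM x:insert a A. (mu(a := 0)) x * dl x Z)" using insert.hyps by (auto intro!: sum.cong)
  thus ?thesis by blast
 next
  case True
  then obtain W where W: "W : endo" "ALL a:A. dl a W = 0" "dl a W ~= 0" by blast
  define r where "r = l W / dl a W"
  define l' where "l' Z = l Z - r * dl a Z" for Z
  note fa = insert.prems(1)[of a, simplified, unfolded fun_on_endo_def]
  note fl = insert.prems(2)[unfolded fun_on_endo_def]
  have l': "fun_on_endo l'" using fa fl unfolding fun_on_endo_def l'_def by (auto simp: algebra_simps)
  have "l' Z = 0" if Z: "Z : endo" "ALL a:A. dl a Z = 0" for Z proof -
   define q where "q = - dl a Z / dl a W"
   let ?U = "%x. Z x + sc q (W x)"
   have qW: "(%x. sc q (W x)) : endo" using endo_closed(2)[OF W(1)] .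
   have eq: "f ?U = f Z + q * f W" if "fun_on_endo f" for f using that Z(1) W(1) qW unfolding fun_on_endo_def by simp
   have "dl b ?U = 0" if "b : insert a A" for b using that eq[OF insert.prems(1)[OF that]] Z(2) W(2,3) unfolding q_def by auto
   hence "l ?U = 0" using insert.prems(3) endo_closed(1)[OF Z(1) qW] by blast
   hence "l Z + q * l W = 0" using eq[OF insert.prems(2)] by simp
   thus ?thesis unfolding l'_def r_def q_def using W(3) by (simp add: field_simps)
  qed
  then obtain mu where mu: "ALL Z:endo. l' Z = (SUM a:A. mu a * dl a Z)" using insert.IH[of l'] insert.prems(1) l' by auto
  have "l Z = (SUM x:insert a A. (mu(a := r)) x * dl x Z)" if "Z : endo" for Z proof -
   have "(SUM x:A. (mu(a := r)) x * dl x Z) = (SUM x:A. mu x * dl x Z)" using insert.hyps by (intro sum.cong) auto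
   thus ?thesis using insert.hyps mu that unfolding l'_def by (simp add: algebra_simps)
  qed
  thus ?thesis by blast
 qed
qed auto

text \<open>The linear equations that single out even derivations among endomorphisms: coordinates
  of the failure, on basis vectors, of the Leibniz rule and of commutation with
  \<open>pr\<close>.\<close>

definition defect :: "('a \<times> 'a \<times> 'a) + ('a \<times> 'a) => ('a => 'a) => 'k" where
 "defect a Z = (case a of Inl (b, b', c) => crd c (Z (br b b') - br (Z b) b' - br b (Z b'))
  | Inr (b, c) => crd c (Z (pr b) - pr (Z b)))"

definition "defects = (B \<times> B \<times> B) <+> (B \<times> B)"

lemma defects_V:
 assumes "lin Z"
 shows "b : V ==> b' : V ==> Z (br b b') - br (Z b) b' - br b (Z b') : V" "b : V ==> Z (pr b) - pr (Z b) : V"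
 using linD(1)[OF assms] br_V pr_V by auto

lemma defect_functional:
 assumes "a : defects" shows "fun_on_endo (defect a)" proof -
 have eqs: "Z : endo ==> lin Z" for Z unfolding endo_def by auto
 consider b b' c where "a = Inl (b, b', c)" "b : B" "b' : B" "c : B" | b c where "a = Inr (b, c)" "b : B" "c : B"
  using assms unfolding defects_def by auto
 thus ?thesis proof cases
  case 1
  note bV = B_V[OF 1(2)] B_V[OF 1(3)]
  have "(Z (br b b') + W (br b b')) - br (Z b + W b) b' - br b (Z b' + W b')
   = (Z (br b b') - br (Z b) b' - br b (Z b')) + (W (br b b') - br (W b) b' - br b (W b'))" if "lin Z" "lin W" for Z W
   using that linD(1) bV by (simp add: brkt_add_left brkt_add_right)
  note e1 = this
  have "sc r (Z (br b b')) - br (sc r (Z b)) b' - br b (sc r (Z b')) = sc r (Z (br b b') - br (Z b) b' - br b (Z b'))" if "lin Z" for Z r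
   using that linD(1) bV by (simp add: brkt_scal_left brkt_scal_right scale_right_diff_distrib)
  note e2 = this
  show ?thesis unfolding fun_on_endo_def 1(1) defect_def sum.case prod.case proof (intro conjI ballI allI, goal_cases)
   case (1 Z W)
   thus ?case unfolding e1[OF eqs[OF 1(1)] eqs[OF 1(2)]] by (intro crd_add defects_V(1) bV eqs)
  next
   case (2 r Z)
   thus ?case unfolding e2[OF eqs[OF 2]] by (intro crd_scale defects_V(1) bV eqs)
  qed
 next
  case 2
  note bV = B_V[OF 2(2)]
  have "(Z (pr b) + W (pr b)) - pr (Z b + W b) = (Z (pr b) - pr (Z b)) + (W (pr b) - pr (W b))"
   if "lin Z" "lin W" for Z W using that linD(1) bV by (simp add: linD(2)[OF pr_lin])
  note e1 = this
  have "sc r (Z (pr b)) - pr (sc r (Z b)) = sc r (Z (pr b) - pr (Z b))" if "lin Z" for Z r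
   using that linD(1) bV by (simp add: linD(3)[OF pr_lin] scale_right_diff_distrib)
  note e2 = this
  show ?thesis unfolding fun_on_endo_def 2(1) defect_def sum.case prod.case proof (intro conjI ballI allI, goal_cases)
   case (1 Z W)
   thus ?case unfolding e1[OF eqs[OF 1(1)] eqs[OF 1(2)]] by (intro crd_add defects_V(2) bV eqs)
  next
   case (2 r Z)
   thus ?case unfolding e2[OF eqs[OF 2]] by (intro crd_scale defects_V(2) bV eqs)
  qed
 qed
qed

lemma defect_dset:
 assumes Z: "Z : endo" and d: "!!a. a : defects ==> defect a Z = 0"
 shows "Z : dset" proof -
 have l: "lin Z" using Z unfolding endo_def by auto
 have 1: "Z (br b b') - br (Z b) b' - br b (Z b') = 0" if "b : B" "b' : B" for b b'
  using d[of "Inl (b, b', _)"] that defects_V(1)[OF l B_V B_V] by (intro crd_zeroD) (auto simp: defects_def defect_def)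
 have 2: "Z (pr b) - pr (Z b) = 0" if "b : B" for b
  using d[of "Inr (b, _)"] that defects_V(2)[OF l B_V] by (intro crd_zeroD) (auto simp: defects_def defect_def)
 have "Z (br x y) = br (Z x) y + br x (Z y)" if "x : V" "y : V" for x y using that proof (induction x arbitrary: y rule: basis_induct)
  case zero
  thus ?case using lin_0[OF l] linD(1)[OF l] by (simp add: br_0_left)
 next
  case (basis c b)
  note bV = B_V[OF basis(1)]
  show ?case using basis.prems proof (induction y rule: basis_induct)
   case zero
   thus ?case using lin_0[OF l] linD(1)[OF l] bV by (simp add: br_0_right)
  next
   case (basis c' b')
   note b'V = B_V[OF basis(1)]
   have "Z (br b b') = br (Z b) b' + br b (Z b')" using 1[OF `b : B` basis(1)] by (simp add: algebra_simps)
   thus ?case using bV b'V br_V linD(1)[OF l] by (simp add: brkt_scal_left brkt_scal_right linD(3)[OF l] scale_right_distrib)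
  next
   case (add y z)
   thus ?case using bV br_V linD[OF l] by (simp add: brkt_add_right)
  qed
 next
  case (add x z)
  thus ?case using br_V linD[OF l] by (simp add: brkt_add_left)
 qed
 moreover have "Z (pr x) = pr (Z x)" if "x : V" for x using that proof (induction x rule: basis_induct)
  case zero
  thus ?case using lin_0[OF l] lin_0[OF pr_lin] by simp
 next
  case (basis c b)
  thus ?case using 2[OF basis] B_V[OF basis] linD[OF l] linD[OF pr_lin] by simp
 next
  case (add x y)
  thus ?case using linD[OF l] linD[OF pr_lin] by simp
 qed
 ultimately show ?thesis using Z l unfolding dset_def der_def even_def endo_def by auto
qed

end

context fd_lie_superalgebra
begin

interpretation AG: group "Aut L" by (rule group_Aut)

lemma fun_on_endo_sum:
 assumes f: "fun_on_endo f" and Z: "!!i. i : I ==> Z i : endo"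
 shows "f (%x. SUM i:I. sc (c i) (Z i x)) = (SUM i:I. c i * f (Z i))" proof -
 have z: "(%x. 0) : endo" unfolding endo_def by (auto simp: lin_zeroT)
 have fs: "f (%x. sc c (W x)) = c * f W" if "W : endo" for c W using f that unfolding fun_on_endo_def by simp
 have f0: "f (%x. 0) = 0" using fs[OF z, of 0] by simp
 have "(%x. SUM i:I. sc (c i) (Z i x)) : endo & f (%x. SUM i:I. sc (c i) (Z i x)) = (SUM i:I. c i * f (Z i))" using Z
 proof (induction I rule: infinite_finite_induct)
  case (insert i I)
  have e: "(%x. sc (c i) (Z i x)) : endo" using insert.prems endo_closed(2) by simp
  have "f (%x. sc (c i) (Z i x) + (SUM i:I. sc (c i) (Z i x))) = c i * f (Z i) + (SUM i:I. c i * f (Z i))"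
   using insert f e unfolding fun_on_endo_def by simp
  thus ?case using insert endo_closed(1)[OF e] by simp
 qed (use z f0 in auto)
 thus ?thesis ..
qed

lemma emat_endo: "b : B ==> c : B ==> emat b c : endo"
 unfolding endo_def emat_def lin_def ext0_def using B_V by (auto simp: crd_add crd_scale scale_left_distrib)

lemma fun_on_endo_expand:
 assumes f: "fun_on_endo f" and Z: "Z : endo"
 shows "f Z = (SUM (b,c):B\<times>B. crd c (Z b) * f (emat b c))" proof -
 have "Z = (%x. SUM i:B\<times>B. sc (crd (snd i) (Z (fst i))) (emat (fst i) (snd i) x))"
  by (subst endo_expand[OF Z]) (auto simp: fun_eq_iff sum_fun_apply split_beta)
 hence "f Z = f (%x. SUM i:B\<times>B. sc (crd (snd i) (Z (fst i))) (emat (fst i) (snd i) x))" by simp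
 also have "... = (SUM i:B\<times>B. crd (snd i) (Z (fst i)) * f (emat (fst i) (snd i)))"
  by (rule fun_on_endo_sum[OF f]) (auto intro: emat_endo)
 finally show ?thesis by (simp add: split_beta)
qed

text \<open>The dual functionals are coordinates in a basis of the whole function space extending
  \<open>D\<close>, so that they also apply to displacements, which need not be derivations.\<close>

lemma dual_basis:
 "EX D ka. finite D & D <= dset & (ALL X:D. fun_on_endo (ka X))
  & (ALL X:D. ALL Y:D. ka X Y = (if X = Y then 1 else 0))
  & (ALL Z:dset. ALL x. Z x = (SUM X:D. sc (ka X Z) (X x)))" proof -
 obtain D where D: "D <= dset" "fv.independent D" "dset <= fv.span D" using fv.maximal_independent_subset by blast
 have fin: "finite D" using endo_indep_finite[OF D(2)] D(1) dset_endo by auto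
 define E where "E = fv.extend_basis D"
 have E: "fv.independent E" "fv.span E = UNIV" "D <= E"
  unfolding E_def using fv.independent_extend_basis[OF D(2)] fv.span_extend_basis[OF D(2)]
   fv.extend_basis_superset[OF D(2)] by auto
 define ka where "ka X Z = fv.representation E Z X" for X Z
 have "fun_on_endo (ka X)" for X unfolding fun_on_endo_def ka_def
  using fv.representation_add[OF E(1)] fv.representation_scale[OF E(1)] E(2) by (auto simp: plus_fun_def)
 moreover have "ka X Y = (if X = Y then 1 else 0)" if "X : D" "Y : D" for X Y
  unfolding ka_def using fv.representation_basis[OF E(1), of Y] E(3) that by auto
 moreover have "Z x = (SUM X:D. sc (ka X Z) (X x))" if Z: "Z : dset" for Z x proof -
  have "Z : fv.span D" using Z D(3) by auto
  hence "ka X Z = fv.representation D Z X" for X unfolding ka_def using fv.representation_extend[OF E(1) _ E(3)] by simp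
  moreover have "Z = (SUM X:D. (%x. sc (fv.representation D Z X) (X x)))"
   using fv.sum_representation_eq[OF D(2) `Z : fv.span D` fin] by simp
  hence "Z x = (SUM X:D. (%x. sc (fv.representation D Z X) (X x))) x" by simp
  ultimately show ?thesis by (simp add: sum_fun_apply)
 qed
 ultimately show ?thesis by (intro exI[of _ D] exI[of _ ka] conjI ballI allI fin D(1))
qed

text \<open>The displacement of \<open>ph\<close> from \<open>x0\<close>, moved to the identity by
  right translation: \<open>ph\<close> after the inverse of \<open>x0\<close>, minus the identity.
  Its coordinates along the derivations serve as local coordinates at \<open>x0\<close>.\<close>

definition disp :: "('a => 'a) => ('a => 'a) => 'a => 'a" where
 "disp x0 ph = ext0 (%x. ret ph ((ginv x0) x) - x)"

definition mreg :: "('a => 'a) => (('a => 'a) => 'k) set" where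
 "mreg x0 = {f : reg. f x0 = 0}"

lemma mreg_ideal: "ideal_in reg (mreg x0)" unfolding ideal_in_def mreg_def using subrngD[OF reg_subring] by auto

context
 fixes x0 assumes x0: "x0 : G"
begin

abbreviation "pow2 k f \<equiv> in_ipow reg (mreg x0) k f"

lemma inv_x0: "ginv x0 : G" "x : V ==> (ginv x0) x : V" using AG.inv_closed[OF x0] G_V[OF AG.inv_closed[OF x0]] by blast+

lemma disp_endo: "disp x0 ph : endo" proof -
 have "lin (%x. ret ph ((ginv x0) x) - x)" by (rule lin_diffT[OF lin_comp[OF G_lin[OF ret_G] G_lin[OF inv_x0(1)]] lin_idT])
 from lin_cong[OF this, of "disp x0 ph"] show ?thesis unfolding endo_def by (auto simp: disp_def ext0_def)
qed

lemma disp_V: "x : V ==> disp x0 ph x : V" using disp_endo linD(1) unfolding endo_def by blast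

lemma disp_eq: "x : V ==> disp x0 ph (x0 x) = ret ph x - x0 x" unfolding disp_def using Aut_inv(1)[OF x0] G_V[OF x0] by (simp add: ext0_def)

lemma disp_x0: "disp x0 x0 = (%x. 0)" unfolding disp_def ext0_def using Aut_inv(2)[OF x0] by (auto simp: ret_id x0)

lemma disp_mreg: "b : V ==> (%ph. crd c (disp x0 ph b)) : mreg x0" proof -
 assume b: "b : V"
 have "(%ph. crd c (disp x0 ph b)) = (%ph. crd c (ret ph ((ginv x0) b)) + - crd c b)"
  unfolding disp_def using b inv_x0 G_V[OF ret_G] by (simp add: ext0_def crd_diff)
 moreover have "... : reg" using reg_coord[OF crd_functional inv_x0(2)[OF b]] by (intro reg_add reg_const)
 ultimately have "(%ph. crd c (disp x0 ph b)) : reg" by (simp only:)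
 thus ?thesis unfolding mreg_def by (simp add: disp_x0 crd_0)
qed

lemma functional_mreg:
 assumes "fun_on_endo f" shows "(%ph. f (disp x0 ph)) : mreg x0" proof -
 have "(%ph. f (disp x0 ph)) = (%ph. SUM i:B\<times>B. f (emat (fst i) (snd i)) * crd (snd i) (disp x0 ph (fst i)))"
  by (subst fun_on_endo_expand[OF assms disp_endo]) (simp add: split_beta mult.commute)
 also have "... = (SUM i:B\<times>B. (%_. f (emat (fst i) (snd i))) * (%ph. crd (snd i) (disp x0 ph (fst i))))"
  by (simp add: fun_eq_iff sum_fun_apply)
 also have "... : mreg x0" by (intro ideal_in_sum[OF mreg_ideal] ideal_inD(4)[OF mreg_ideal] reg_const disp_mreg) (auto simp: B_V)
 finally show ?thesis .
qed

text \<open>If the identity plus \<open>Z\<close> respects the bracket, the Leibniz defect of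
  \<open>Z\<close> equals the bracket of two values of \<open>Z\<close> and so is quadratic in the
  displacement; the parity defect is zero.\<close>

lemma defect_square:
 assumes a: "a : defects" shows "pow2 2 (%ph. defect a (disp x0 ph))" proof -
 consider b b' c where "a = Inl (b, b', c)" "b : B" "b' : B" "c : B" | b c where "a = Inr (b, c)" "b : B" "c : B"
  using a unfolding defects_def by auto
 thus ?thesis proof cases
  case 1
  have bV: "b : V" "b' : V" using 1 B_V by auto
  have "defect a (disp x0 ph) = (SUM d:B. SUM e:B. crd c (br d e) * (crd d (disp x0 ph b) * crd e (disp x0 ph b')))" for ph proof -
   define Z where "Z = disp x0 ph"
   define ps where "ps x = ret ph ((ginv x0) x)" for x
   have ps: "aut ps" unfolding ps_def by (rule aut_comp[OF G_aut[OF ret_G] G_aut[OF inv_x0(1)]])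
   have Z: "Z x = ps x - x" if "x : V" for x using that unfolding Z_def disp_def ps_def by (simp add: ext0_def)
   have ZV: "Z x : V" if "x : V" for x unfolding Z_def using disp_V that .
   have psV: "ps x : V" if "x : V" for x using linD(1)[OF autD(1)[OF ps] that] .
   have "Z (br b b') - br (Z b) b' - br b (Z b') = br (Z b) (Z b')"
    using bV br_V psV by (simp add: Z autD(3)[OF ps] br_diff_left br_diff_right algebra_simps)
   hence "defect a Z = crd c (br (Z b) (Z b'))" unfolding defect_def 1 by simp
   also have "br (Z b) (Z b') = br (SUM d:B. sc (crd d (Z b)) d) (SUM e:B. sc (crd e (Z b')) e)" using crd_sum ZV bV by simp
   also have "... = (SUM d:B. br (sc (crd d (Z b)) d) (SUM e:B. sc (crd e (Z b')) e))" using B_V by (intro br_sum_left V_sum) auto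
   also have "... = (SUM d:B. SUM e:B. br (sc (crd d (Z b)) d) (sc (crd e (Z b')) e))"
    using B_V by (intro sum.cong refl br_sum_right) auto
   also have "... = (SUM d:B. SUM e:B. sc (crd d (Z b) * crd e (Z b')) (br d e))"
    using B_V by (intro sum.cong refl) (simp add: brkt_scal_left brkt_scal_right mult.commute br_V)
   also have "crd c ... = (SUM d:B. SUM e:B. crd c (sc (crd d (Z b) * crd e (Z b')) (br d e)))"
    using B_V br_V by (simp add: crd_sum' V_sum)
   also have "... = (SUM d:B. SUM e:B. crd c (br d e) * (crd d (Z b) * crd e (Z b')))"
    using B_V br_V by (intro sum.cong refl) (simp add: crd_scale)
   finally show ?thesis unfolding Z_def .
  qed
  hence eq: "(%ph. defect a (disp x0 ph)) = (SUM d:B. SUM e:B. (%_. crd c (br d e)) *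
    ((%ph. crd d (disp x0 ph b)) * (%ph. crd e (disp x0 ph b'))))" by (simp add: fun_eq_iff sum_fun_apply)
  have "pow2 2 (SUM d:B. SUM e:B. (%_. crd c (br d e)) *
    ((%ph. crd d (disp x0 ph b)) * (%ph. crd e (disp x0 ph b'))))" using disp_mreg bV reg_const
   by (intro in_ipow_sum[OF reg_subring mreg_ideal] in_ipow_mult_S[OF reg_subring mreg_ideal] in_ipow_2[OF reg_subring mreg_ideal])
  thus ?thesis by (simp only: eq)
 next
  case 2
  have bV: "b : V" using 2 B_V by auto
  have "defect a (disp x0 ph) = 0" for ph proof -
   define ps where "ps x = ret ph ((ginv x0) x)" for x
   have ps: "aut ps" unfolding ps_def by (rule aut_comp[OF G_aut[OF ret_G] G_aut[OF inv_x0(1)]])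
   have "ps (pr b) - pr b - pr (ps b - b) = 0"
    using autD(2)[OF ps] bV linD(1)[OF autD(1)[OF ps]] unfolding even_def by (simp add: lin_diff[OF pr_lin])
   thus ?thesis unfolding 2 defect_def disp_def using bV pr_V by (simp add: ext0_def ps_def crd_0)
  qed
  hence "(%ph. defect a (disp x0 ph)) = 0" by (simp add: fun_eq_iff)
  thus ?thesis using in_ipow_zero[OF reg_subring mreg_ideal] by simp
 qed
qed

context
 fixes D :: "('a => 'a) set" and ka
 assumes D: "finite D" "D <= dset" "ALL X:D. fun_on_endo (ka X)"
  "ALL X:D. ALL Y:D. ka X Y = (if X = Y then 1 else 0)"
  "ALL Z:dset. ALL x. Z x = (SUM X:D. sc (ka X Z) (X x))"
begin

abbreviation (input) "loc X \<equiv> (%ph. ka X (disp x0 ph))"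

lemma loc_mreg: "X : D ==> loc X : mreg x0" using functional_mreg D(3) by blast

text \<open>The local coordinates along derivations span the cotangent space. After they are
  subtracted, a linear function of the displacement vanishes on all derivations, hence is a
  combination of defects, and these lie in the square of the maximal ideal.\<close>

lemma reg_linear_approx:
 assumes "f : reg"
 shows "EX a. pow2 2 (%ph. f ph - f x0 - (SUM X:D. a X * loc X ph))" using assms proof (induction rule: reg_induct)
 case (const c)
 show ?case using in_ipow_zero[OF reg_subring mreg_ideal] by (intro exI[of _ "%_. 0"]) (simp add: zero_fun_def)
next
 case (coord l x)
 define z where "z = x0 x"
 have z: "z : V" unfolding z_def using G_V[OF x0 coord(2)] .
 have ladd: "l (u + v) = l u + l v" "l (sc c u) = c * l u" if "u : V" "v : V" for u v c
  using coord(1) that unfolding functionals_def by auto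
 have lz: "fun_on_endo (%Z. l (Z z))" unfolding fun_on_endo_def endo_def using ladd z linD(1) by auto
 define m where "m Z = l (Z z) - (SUM X:D. l (X z) * ka X Z)" for Z
 have fm: "fun_on_endo m" using lz D(3) unfolding fun_on_endo_def m_def
  by (auto simp: distrib_left sum.distrib sum_distrib_left right_diff_distrib mult_ac)
 have XV: "X z : V" if X: "X : D" for X using linD(1)[OF dset_lin z, of X] X D(2) by auto
 have md: "m Z = 0" if Z: "Z : dset" for Z proof -
  have "l (Z z) = l (SUM X:D. sc (ka X Z) (X z))" using D(5) Z by simp
  also have "... = (SUM X:D. l (sc (ka X Z) (X z)))" by (intro functional_sum[OF coord(1)] V_scale XV)
  also have "... = (SUM X:D. l (X z) * ka X Z)" by (intro sum.cong refl) (simp add: ladd(2)[OF XV V_0] mult.commute)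
  finally show ?thesis unfolding m_def by simp
 qed
 have fd: "finite defects" unfolding defects_def using B(1) by simp
 obtain mu where mu: "!!Z. Z : endo ==> m Z = (SUM a:defects. mu a * defect a Z)"
  using functional_factor[of defects defect m, OF fd defect_functional fm] md defect_dset by auto
 have "l (ret ph x) - l (ret x0 x) - (SUM X:D. l (X z) * loc X ph) = m (disp x0 ph)" for ph proof -
  have "ret ph x = disp x0 ph z + x0 x" unfolding z_def disp_eq[OF coord(2)] by simp
  hence "l (ret ph x) = l (disp x0 ph z) + l (x0 x)" using ladd(1)[OF disp_V[OF z, of ph] G_V[OF x0 coord(2)]] by simp
  thus ?thesis unfolding m_def by (simp add: ret_id x0)
 qed
 hence "(%ph. l (ret ph x) - l (ret x0 x) - (SUM X:D. l (X z) * loc X ph))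
   = (SUM a:defects. (%_. mu a) * (%ph. defect a (disp x0 ph)))" by (simp add: fun_eq_iff sum_fun_apply mu[OF disp_endo])
 moreover have "pow2 2 ..."
  by (intro in_ipow_sum[OF reg_subring mreg_ideal] in_ipow_mult_S[OF reg_subring mreg_ideal] defect_square reg_const)
 ultimately show ?case by (intro exI[of _ "%X. l (X z)"]) simp
next
 case (add f g)
 then obtain a b where ab: "pow2 2 (%ph. f ph - f x0 - (SUM X:D. a X * loc X ph))"
  "pow2 2 (%ph. g ph - g x0 - (SUM X:D. b X * loc X ph))" by blast
 have "(%ph. f ph + g ph - (f x0 + g x0) - (SUM X:D. (a X + b X) * loc X ph))
   = (%ph. f ph - f x0 - (SUM X:D. a X * loc X ph)) + (%ph. g ph - g x0 - (SUM X:D. b X * loc X ph))"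
  by (simp add: fun_eq_iff distrib_right sum.distrib)
 thus ?case using in_ipow.add[OF ab] by (intro exI[of _ "%X. a X + b X"]) simp
next
 case (mult f g)
 then obtain a b where ab: "pow2 2 (%ph. f ph - f x0 - (SUM X:D. a X * loc X ph))"
  "pow2 2 (%ph. g ph - g x0 - (SUM X:D. b X * loc X ph))" by blast
 have m: "(%ph. f ph - f x0) : mreg x0" if "f : reg" for f using that reg_add[OF that reg_const[of "- f x0"]] unfolding mreg_def by simp
 have "(SUM X:D. (g x0 * a X + f x0 * b X) * loc X ph)
   = g x0 * (SUM X:D. a X * loc X ph) + f x0 * (SUM X:D. b X * loc X ph)" for ph
  by (simp add: sum.distrib sum_distrib_left distrib_right mult.assoc)
 hence "(%ph. f ph * g ph - f x0 * g x0 - (SUM X:D. (g x0 * a X + f x0 * b X) * loc X ph))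
   = (%ph. f ph - f x0) * (%ph. g ph - g x0)
    + ((%_. g x0) * (%ph. f ph - f x0 - (SUM X:D. a X * loc X ph))
    + (%_. f x0) * (%ph. g ph - g x0 - (SUM X:D. b X * loc X ph)))" by (simp add: fun_eq_iff algebra_simps)
 moreover have "pow2 2 ..." using ab by (intro in_ipow.add in_ipow_2[OF reg_subring mreg_ideal] m mult.hyps
    in_ipow_mult_S[OF reg_subring mreg_ideal] reg_const)
 ultimately show ?case by (intro exI[of _ "%X. g x0 * a X + f x0 * b X"]) simp
qed

lemma is_form_pow:
 assumes "is_form D (%X. loc X) k g Q" shows "pow2 k g" using assms proof (induction rule: is_form.induct)
 case (zero k)
 thus ?case using in_ipow_zero[OF reg_subring mreg_ideal] by (simp add: zero_fun_def)
next
 case (const c)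
 thus ?case by (intro in_ipow.base reg_const)
next
 case (mult k g Q X c)
 have "pow2 (Suc k) (((%_. c) * g) * loc X)"
  using mult loc_mreg by (intro in_ipow.mult in_ipow_mult_S[OF reg_subring mreg_ideal] reg_const)
 thus ?case by (simp add: times_fun_def)
next
 case (add k g Q g' Q')
 thus ?case using in_ipow.add[of reg "mreg x0" k g g'] by (simp add: plus_fun_def)
qed

text \<open>Modulo the next power, an element of the \<open>k\<close>-th power of the maximal ideal
  is a form of degree \<open>k\<close> in the local coordinates, because each factor may be replaced
  by its linear part.\<close>

lemma leading_form:
 assumes "pow2 k f"
 shows "EX g Q. is_form D (%X. loc X) k g Q & pow2 (Suc k) (f - g)" using assms proof (induction rule: in_ipow.induct)
 case (base a)
 have "(%ph. a ph + - a x0) : mreg x0" using reg_add[OF base reg_const[of "- a x0"]] unfolding mreg_def by simp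
 hence "pow2 1 (a - (%_. a x0))" using in_ipow_1[OF reg_subring mreg_ideal, of "%ph. a ph + - a x0"] by (simp add: fun_diff_def)
 thus ?case using is_form.const[of D "%X. loc X" "a x0"] unfolding One_nat_def by blast
next
 case (mult k a b)
 then obtain g Q where g: "is_form D (%X. loc X) k g Q" "pow2 (Suc k) (a - g)" by blast
 have breg: "b : reg" "b x0 = 0" using mult.hyps(2) unfolding mreg_def by auto
 obtain c where c: "pow2 2 (%ph. b ph - b x0 - (SUM X:D. c X * loc X ph))" using reg_linear_approx[OF breg(1)] by blast
 define s where "s = (%ph. b ph - b x0 - (SUM X:D. c X * loc X ph))"
 have form: "is_form D (%X. loc X) (Suc k) (%ph. SUM X:D. c X * g ph * loc X ph) (%xi. SUM X:D. c X * Q xi * xi X)"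
  by (intro is_form_sum is_form.mult g)
 have "a * b - (%ph. SUM X:D. c X * g ph * loc X ph) = (a - g) * b + g * s"
  unfolding s_def using breg(2) by (simp add: fun_eq_iff sum_distrib_left algebra_simps)
 moreover have "pow2 (Suc (Suc k)) ((a - g) * b)" using in_ipow.mult[OF g(2) mult.hyps(2)] .
 moreover have "pow2 (k + 2) (g * s)" using in_ipow_mult[OF reg_subring mreg_ideal c is_form_pow[OF g(1)]] unfolding s_def .
 ultimately have "pow2 (Suc (Suc k)) (a * b - (%ph. SUM X:D. c X * g ph * loc X ph))"
  using in_ipow.add[of reg "mreg x0" "Suc (Suc k)" "(a - g) * b" "g * s"] by (simp only: add_2_eq_Suc')
 with form show ?case by blast
next
 case (add k a b)
 then obtain g Q g' Q' where g: "is_form D (%X. loc X) k g Q" "pow2 (Suc k) (a - g)"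
  "is_form D (%X. loc X) k g' Q'" "pow2 (Suc k) (b - g')" by blast
 have eq: "a + b - (%ph. g ph + g' ph) = (a - g) + (b - g')" by (simp add: fun_eq_iff)
 have "pow2 (Suc k) (a + b - (%ph. g ph + g' ph))" unfolding eq by (rule in_ipow.add[OF g(2,4)])
 with is_form.add[OF g(1,3)] show ?case by blast
qed

lemma pow_expansion:
 assumes c: "first_order c x0 c1" "!!t. c t : G" "c 0 = x0" and f: "pow2 k f"
 shows "EX P. expands (%t. f (c t)) (fps_X ^ k * P)" using f proof (induction rule: in_ipow.induct)
 case (base a)
 thus ?case using reg_expansion[OF c(1,2) base] by auto
next
 case (mult k a b)
 then obtain P where P: "expands (%t. a (c t)) (fps_X ^ k * P)" by blast
 have b: "b : reg" "b x0 = 0" using mult.hyps(2) unfolding mreg_def by auto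
 obtain F where F: "expands (%t. b (c t)) F" using reg_expansion[OF c(1,2) b(1)] by blast
 have "fps_nth F 0 = 0" using expands_0[OF F] c(3) b(2) by simp
 hence "F = fps_X * fps_shift 1 F" by (rule fps_X_factor)
 hence "expands (%t. (a * b) (c t)) ((fps_X ^ k * P) * (fps_X * fps_shift 1 F))" using expands_mult[OF P F] by simp
 moreover have "(fps_X ^ k * P) * (fps_X * fps_shift 1 F) = fps_X ^ Suc k * (P * fps_shift 1 F)" by (simp add: mult_ac)
 ultimately have "expands (%t. (a * b) (c t)) (fps_X ^ Suc k * (P * fps_shift 1 F))" by (simp only:)
 thus ?case ..
next
 case (add k a b)
 then obtain P P' where "expands (%t. a (c t)) (fps_X ^ k * P)" "expands (%t. b (c t)) (fps_X ^ k * P')" by blast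
 from expands_add[OF this] show ?case by (intro exI[of _ "P + P'"]) (simp add: distrib_left)
qed

text \<open>A leading form of a function vanishing along a curve vanishes in the tangent direction of the curve.\<close>

lemma curves_imp_pow:
 assumes f: "f : reg"
  and curves: "!!X. X : dset ==> EX c. first_order c x0 (%x. X (x0 x)) & (ALL t. c t : G) & c 0 = x0 & (ALL t. f (c t) = 0)"
 shows "pow2 k f" proof (induction k)
 case 0
 thus ?case using f by (rule in_ipow.base)
next
 case (Suc k)
 obtain g Q where g: "is_form D (%X. loc X) k g Q" "pow2 (Suc k) (f - g)" using leading_form[OF Suc] by blast
 \<comment> \<open>Every \<open>xi\<close> is the coordinate vector of a derivation, and the given
   curve in that direction has initial velocity \<open>xi\<close> in the local coordinates.\<close>
 have "Q xi = 0" for xi proof -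
  define X where "X = (%x. SUM Y:D. sc (xi Y) (Y x))"
  have "X = (SUM Y:D. (%x. sc (xi Y) (Y x)))" unfolding X_def by (simp add: fun_eq_iff sum_fun_apply)
  also have "... : dset" using D(2) by (intro fv.subspace_sum[OF subspace_dset] fv.subspace_scale[OF subspace_dset]) auto
  finally have X: "X : dset" .
  have kaX: "ka Y X = xi Y" if Y: "Y : D" for Y proof -
   have fY: "fun_on_endo (ka Y)" using D(3) Y by blast
   have "ka Y X = (SUM Z:D. xi Z * ka Y Z)" unfolding X_def using D(2) dset_endo by (intro fun_on_endo_sum[OF fY]) auto
   also have "... = (SUM Z:D. if Z = Y then xi Z else 0)" using D(4) Y by (intro sum.cong) auto
   also have "... = xi Y" using D(1) Y by simp
   finally show ?thesis .
  qed
  obtain c where c: "first_order c x0 (%x. X (x0 x))" "!!t. c t : G" "c 0 = x0" "!!t. f (c t) = 0" using curves[OF X] by blast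
  have "EX F. expands (%t. loc Y (c t)) (fps_X * F) & fps_nth F 0 = xi Y" if Y: "Y : D" for Y proof -
   have fY: "fun_on_endo (ka Y)" using D(3) Y by blast
   obtain P where P: "!!x b. x : V ==> b : B ==> expands (%t. crd b (c t x)) (P x b) &
    fps_nth (P x b) 0 = crd b (x0 x) & fps_nth (P x b) 1 = crd b (X (x0 x))" using first_orderE[OF c(1)] by blast
   have dexp: "expands (%t. crd e (disp x0 (c t) b)) (P ((ginv x0) b) e + fps_const (- crd e b))"
    "fps_nth (P ((ginv x0) b) e + fps_const (- crd e b)) 1 = crd e (X b)" if "b : B" "e : B" for b e proof -
    have bV: "b : V" using that B_V by auto
    have eq: "crd e (disp x0 (c t) b) = crd e (c t ((ginv x0) b)) + - crd e b" for t
     unfolding disp_def using bV inv_x0 G_V[OF c(2)] by (simp add: ext0_def crd_diff ret_id[OF c(2)])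
    show "expands (%t. crd e (disp x0 (c t) b)) (P ((ginv x0) b) e + fps_const (- crd e b))"
     unfolding eq by (rule expands_add[OF conjunct1[OF P[OF inv_x0(2)[OF bV] that(2)]] expands_const])
    show "fps_nth (P ((ginv x0) b) e + fps_const (- crd e b)) 1 = crd e (X b)"
     using P[OF inv_x0(2)[OF bV] that(2)] Aut_inv(2)[OF x0 bV] by simp
   qed
   define F where "F = (SUM i:B\<times>B. (P ((ginv x0) (fst i)) (snd i) + fps_const (- crd (snd i) (fst i))) * fps_const (ka Y (emat (fst i) (snd i))))"
   have eq: "loc Y (c t) = (SUM i:B\<times>B. crd (snd i) (disp x0 (c t) (fst i)) * ka Y (emat (fst i) (snd i)))" for t
    by (subst fun_on_endo_expand[OF fY disp_endo]) (simp add: split_beta)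
   have F: "expands (%t. loc Y (c t)) F" unfolding eq F_def using dexp(1) by (intro expands_sum expands_mult expands_const) auto
   have F0: "fps_nth F 0 = 0" proof -
    have "loc Y : mreg x0" using loc_mreg[OF Y] .
    thus ?thesis using expands_0[OF F] c(3) unfolding mreg_def by simp
   qed
   have "fps_nth F 1 = (SUM i:B\<times>B. crd (snd i) (X (fst i)) * ka Y (emat (fst i) (snd i)))"
    unfolding F_def fps_sum_nth fps_mult_right_const_nth using dexp(2) by (intro sum.cong) auto
   also have "... = ka Y X" using dset_endo X by (subst fun_on_endo_expand[OF fY]) (auto simp: split_beta)
   finally have F1: "fps_nth F 1 = xi Y" using kaX[OF Y] by simp
   show ?thesis using F F1 fps_X_factor[OF F0] by (intro exI[of _ "fps_shift 1 F"]) simp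
  qed
  then obtain F where F: "!!Y. Y : D ==> expands (%t. loc Y (c t)) (fps_X * F Y) & fps_nth (F Y) 0 = xi Y" by metis
  obtain P where P: "expands (%t. g (c t)) (fps_X ^ k * P)" "fps_nth P 0 = Q xi"
   using is_form_expansion[where c = c and F = F and xi = xi, OF g(1)] F by blast
  obtain P' where P': "expands (%t. (f - g) (c t)) (fps_X ^ Suc k * P')" using pow_expansion[OF c(1,2,3) g(2)] by blast
  \<comment> \<open>Along the curve \<open>f\<close> is zero, \<open>g\<close> starts in order
    \<open>k\<close> with coefficient \<open>Q xi\<close>, and \<open>f - g\<close> has order at
    least \<open>k + 1\<close>.\<close>
  have "expands (%t. g (c t) + (f - g) (c t)) (fps_X ^ k * P + fps_X ^ Suc k * P')" using expands_add[OF P(1) P'] .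
  hence "expands (%t. 0) (fps_X ^ k * (P + fps_X * P'))" using c(4) by (simp add: algebra_simps)
  hence "fps_X ^ k * (P + fps_X * P') = 0" by (rule expands_zero)
  hence "P + fps_X * P' = 0" by simp
  hence "fps_nth (P + fps_X * P') 0 = 0" by simp
  thus ?thesis using P(2) by simp
 qed
 hence "g = (%_. 0)" using is_form_vanish[OF D(1) g(1)] by blast
 hence "f - g = f" by (simp add: fun_eq_iff)
 thus ?case using g(2) by simp
qed

end

text \<open>By Krull each element of \<open>J\<close> is reproduced by multiplication with some
  \<open>a\<close> in the maximal ideal at \<open>x0\<close>. The product of the factors
  \<open>1 - a\<close> over finitely many generators is \<open>1\<close> at \<open>x0\<close> and
  annihilates \<open>J\<close>, so \<open>J\<close> vanishes on a neighbourhood of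
  \<open>x0\<close>.\<close>

theorem curves_imp_locally_zero:
 assumes J: "ideal_in reg J"
  and curves: "!!X. X : dset ==> EX c. first_order c x0 (%x. X (x0 x)) & (ALL t. c t : G) & c 0 = x0 & (ALL f:J. ALL t. f (c t) = 0)"
 shows "EX p:reg. p x0 ~= 0 & (ALL f:J. p * f = 0)" proof -
 obtain D ka where D: "finite D" "D <= dset" "ALL X:D. fun_on_endo (ka X)"
  "ALL X:D. ALL Y:D. ka X Y = (if X = Y then 1 else 0)" "ALL Z:dset. ALL x. Z x = (SUM X:D. sc (ka X Z) (X x))" using dual_basis by blast
 have ann: "EX a:mreg x0. f = a * f" if f: "f : J" for f proof (rule krull_intersection[OF noeth_reg mreg_ideal])
  show freg: "f : reg" using f ideal_inD(1)[OF J] by blast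
  show "pow2 k f" for k by (rule curves_imp_pow[OF D freg]) (use curves f in blast)
 qed
 obtain F where F: "finite F" "F <= J" "J <= gen_ideal reg F" using noethD(2)[OF noeth_reg J] by blast
 obtain a where a: "!!f. f : F ==> a f : mreg x0 & f = a f * f" using ann F(2) by (metis subsetD)
 define p where "p = (PROD f:F. 1 - a f)"
 have preg: "p : reg" unfolding p_def using a subrngD(2,6)[OF reg_subring] by (intro subrng_prod[OF reg_subring]) (auto simp: mreg_def)
 have "p x0 = 1" proof -
  have "(PROD f:F'. 1 - a f) x0 = 1" if "F' <= F" for F' using that a by (induction F' rule: infinite_finite_induct) (auto simp: mreg_def)
  thus ?thesis unfolding p_def by simp
 qed
 moreover have "p * f = 0" if f: "f : J" for f proof -
  have pf: "p * g = 0" if "g : F" for g proof -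
   have "p * g = (PROD f:F - {g}. 1 - a f) * ((1 - a g) * g)" unfolding p_def using F(1) that by (simp add: prod.remove[of F g] mult_ac)
   also have "(1 - a g) * g = 0" using a[OF that] by (simp add: left_diff_distrib)
   finally show ?thesis by (simp only: mult_zero_right)
  qed
  obtain s where "f = (SUM g:F. s g * g)" using F(3) f unfolding gen_ideal_def by blast
  hence "p * f = (SUM g:F. s g * (p * g))" by (simp add: sum_distrib_left mult.left_commute)
  also have "... = (SUM g:F. s g * 0)" by (intro sum.cong refl) (simp only: pf)
  finally show ?thesis by (simp only: mult_zero_right sum.neutral_const)
 qed
 moreover have "p x0 ~= 0" using calculation(1) by simp
 ultimately show ?thesis using preg by (intro bexI[of _ p] conjI ballI)
qed

end

end

section \<open>The Zariski topology\<close>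

context fd_lie_superalgebra
begin

interpretation AG: group "Aut L" by (rule group_Aut)

lemma zariski_open_iff:
 "openin (zariski L) U \<longleftrightarrow> U <= G & (ALL x:U. EX f:reg. f x ~= 0 & (ALL y:G. f y ~= 0 --> y : U))" proof
 assume "openin (zariski L) U"
 hence "generate_topology_on {{f : G. p f ~= 0} | p. p : polyfuns L} U"
  unfolding zariski_def by (simp add: openin_topology_generated_by_iff)
 thus "U <= G & (ALL x:U. EX f:reg. f x ~= 0 & (ALL y:G. f y ~= 0 --> y : U))" proof (induction rule: generate_topology_on.induct)
  case Empty
  thus ?case by simp
 next
  case (Int a b)
  show ?case proof (intro conjI ballI)
   fix x assume x: "x : a \<inter> b"
   then obtain f g where "f : reg" "f x ~= 0" "ALL y:G. f y ~= 0 --> y : a"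
    "g : reg" "g x ~= 0" "ALL y:G. g y ~= 0 --> y : b" using Int.IH by blast
   thus "EX f:reg. f x ~= 0 & (ALL y:G. f y ~= 0 --> y : a \<inter> b)" by (intro bexI[of _ "%ph. f ph * g ph"] reg_mult) auto
  qed (use Int in auto)
 next
  case (UN K)
  show ?case proof (intro conjI ballI)
   show "\<Union>K <= G" using UN.IH by (meson Sup_least)
   fix x assume "x : \<Union>K"
   then obtain k where k: "k : K" "x : k" by (rule UnionE)
   obtain f where "f : reg" "f x ~= 0" "ALL y:G. f y ~= 0 --> y : k" using UN.IH[OF k(1)] k(2) by meson
   thus "EX f:reg. f x ~= 0 & (ALL y:G. f y ~= 0 --> y : \<Union>K)" using k(1) by (meson UnionI)
  qed
 next
  case (Basis s)
  then obtain p where p: "p : polyfuns L" "s = {f : G. p f ~= 0}" by blast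
  have r: "(%ph. p (ret ph)) : reg" unfolding reg_def using p(1) by (rule imageI)
  show ?case unfolding p(2) proof (intro conjI ballI)
   fix x assume "x : {f : G. p f ~= 0}"
   thus "EX f:reg. f x ~= 0 & (ALL y:G. f y ~= 0 --> y : {f : G. p f ~= 0})" by (intro bexI[OF _ r]) (simp add: ret_id)
  qed blast
 qed
next
 assume U: "U <= G & (ALL x:U. EX f:reg. f x ~= 0 & (ALL y:G. f y ~= 0 --> y : U))"
 show "openin (zariski L) U" proof (subst openin_subopen, intro ballI)
  fix x assume x: "x : U"
  then obtain f where f: "f : reg" "f x ~= 0" "ALL y:G. f y ~= 0 --> y : U" using U by blast
  obtain p where p: "p : polyfuns L" "f = (%ph. p (ret ph))" using f(1) unfolding reg_def by blast
  have "openin (zariski L) {f : G. p f ~= 0}" unfolding zariski_def using p(1) by (intro topology_generated_by_Basis) blast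
  moreover have "x : {f : G. p f ~= 0}" using f(2) x U unfolding p(2) by (auto simp: ret_id)
  moreover have "{f : G. p f ~= 0} <= U" using f(3) unfolding p(2) by (auto simp: ret_id)
  ultimately show "EX T. openin (zariski L) T & x : T & T <= U" by (intro exI[of _ "{f : G. p f ~= 0}"] conjI)
 qed
qed

lemma zariski_openE:
 assumes "openin (zariski L) U" "x : U"
 obtains f where "f : reg" "f x ~= 0" "!!y. y : G ==> f y ~= 0 ==> y : U" using assms unfolding zariski_open_iff by meson

lemma topspace_zariski: "topspace (zariski L) = G" proof
 have "openin (zariski L) G" unfolding zariski_open_iff by (intro conjI ballI bexI[OF _ reg_const[of 1]]) auto
 thus "G <= topspace (zariski L)" by (rule openin_subset)
 show "topspace (zariski L) <= G" using openin_topspace[of "zariski L"] unfolding zariski_open_iff by (rule conjunct1)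
qed

lemma reg_translate:
 assumes f: "f : reg" and g: "g : G"
 shows "(%ph. f (g \<cdot> ret ph)) : reg" "(%ph. f (ret ph \<cdot> g)) : reg" proof -
 have m: "g \<cdot> ret ph : G" "ret ph \<cdot> g : G" for ph using AG.m_closed[OF g ret_G] AG.m_closed[OF ret_G g] by auto
 show "(%ph. f (g \<cdot> ret ph)) : reg" using f proof (induction rule: reg_induct)
  case (coord l x)
  have "(%x. l (g x)) : functionals L" using coord(1) G_lin[OF g] unfolding functionals_def lin_def by auto
  thus ?case using reg_coord[of "%x. l (g x)" x] coord(2) by (simp add: ret_id[OF m(1)] Aut_mult[OF g ret_G])
 qed (auto intro: reg_const reg_add reg_mult)
 show "(%ph. f (ret ph \<cdot> g)) : reg" using f proof (induction rule: reg_induct)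
  case (coord l x)
  thus ?case using reg_coord[OF coord(1) G_V[OF g coord(2)]] by (simp add: ret_id[OF m(2)] Aut_mult[OF ret_G g])
 qed (auto intro: reg_const reg_add reg_mult)
qed

lemma connected_translate:
 assumes C: "connectedin (zariski L) C" and g: "g : G"
 shows "connectedin (zariski L) ((%ph. g \<cdot> ph) ` C)" "connectedin (zariski L) ((%ph. ph \<cdot> g) ` C)" proof -
 have *: "connectedin (zariski L) (h ` C)"
  if h: "!!x. x : G ==> h x : G" and r: "!!f. f : reg ==> EX f':reg. ALL x:G. f' x = f (h x)" for h
 proof (rule connectedin_continuous_map_image[OF _ C])
  show "continuous_map (zariski L) (zariski L) h" unfolding continuous_map topspace_zariski proof (intro conjI allI impI image_subsetI)
   fix U assume U: "openin (zariski L) U"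
   show "openin (zariski L) {x : G. h x : U}" unfolding zariski_open_iff proof (intro conjI ballI)
    fix x assume x: "x : {x : G. h x : U}"
    then obtain f where f: "f : reg" "f (h x) ~= 0" "!!y. y : G ==> f y ~= 0 ==> y : U" using zariski_openE[OF U] by blast
    obtain f' where "f' : reg" "ALL x:G. f' x = f (h x)" using r[OF f(1)] by blast
    thus "EX f:reg. f x ~= 0 & (ALL y:G. f y ~= 0 --> y : {x : G. h x : U})" using x f h by (intro bexI[of _ f']) auto
   qed auto
  qed (use h in auto)
 qed
 show "connectedin (zariski L) ((%ph. g \<cdot> ph) ` C)"
  by (rule *, rule AG.m_closed[OF g], assumption, rule bexI[OF _ reg_translate(1)[OF _ g]]) (auto simp: ret_id)
 show "connectedin (zariski L) ((%ph. ph \<cdot> g) ` C)"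
  by (rule *, rule AG.m_closed[OF _ g], assumption, rule bexI[OF _ reg_translate(2)[OF _ g]]) (auto simp: ret_id)
qed

section \<open>Irreducibility of images of families\<close>

lemma laur_mult_nonzero:
 fixes a b :: "('i => 'k) => 'k"
 assumes "a : laur I" "b : laur I" "a v ~= 0" "b w ~= 0"
 shows "EX u. a u ~= 0 & b u ~= 0" proof (rule ccontr)
 assume "\<not> ?thesis"
 hence "a * b = 0" by (auto simp: fun_eq_iff)
 hence "a = 0 | b = 0" using laur_domain assms(1,2) unfolding domain_set_def by blast
 thus False using assms(3,4) by (auto simp: fun_eq_iff)
qed

text \<open>The image of a family is irreducible, since regular functions pull back to Laurent
  polynomials and these form a domain.\<close>

lemma fam_mult_nonzero:
 assumes Ps: "regfam I Ps" "!!v. Ps v : G" and f: "f : reg" "f (Ps v) ~= 0" and g: "g : reg" "g (Ps w) ~= 0"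
 obtains u where "f (Ps u) ~= 0" "g (Ps u) ~= 0" proof -
 have "EX u. (%v. f (Ps v)) u ~= 0 & (%v. g (Ps v)) u ~= 0"
  by (rule laur_mult_nonzero[where v = v and w = w]) (rule regfam_reg[OF Ps f(1)], rule regfam_reg[OF Ps g(1)], fact+)
 thus ?thesis using that by (elim exE conjE)
qed

lemma connected_range:
 assumes Ps: "regfam I Ps" "!!v. Ps v : G"
 shows "connectedin (zariski L) (range Ps)" unfolding connectedin topspace_zariski proof (intro conjI notI)
 show "range Ps <= G" using Ps(2) by auto
 assume "EX E1 E2. openin (zariski L) E1 & openin (zariski L) E2 & range Ps <= E1 \<union> E2 &
  E1 \<inter> E2 \<inter> range Ps = {} & E1 \<inter> range Ps ~= {} & E2 \<inter> range Ps ~= {}"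
 then obtain E1 E2 v w where E: "openin (zariski L) E1" "openin (zariski L) E2" "E1 \<inter> E2 \<inter> range Ps = {}"
  "Ps v : E1" "Ps w : E2" by blast
 obtain f where f: "f : reg" "f (Ps v) ~= 0" "!!y. y : G ==> f y ~= 0 ==> y : E1" using zariski_openE[OF E(1,4)] by blast
 obtain g where g: "g : reg" "g (Ps w) ~= 0" "!!y. y : G ==> g y ~= 0 ==> y : E2" using zariski_openE[OF E(2,5)] by blast
 obtain u where u: "f (Ps u) ~= 0" "g (Ps u) ~= 0" by (rule fam_mult_nonzero[OF Ps f(1,2) g(1,2)])
 have "Ps u : E1" "Ps u : E2" using f(3)[OF Ps(2) u(1)] g(3)[OF Ps(2) u(2)] .
 hence "Ps u : E1 \<inter> E2 \<inter> range Ps" by (intro IntI rangeI)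
 thus False unfolding E(3) by (rule emptyE)
qed

section \<open>Families with surjective differential\<close>

text \<open>The differential at \<open>v0\<close> reaches every even derivation, with velocities
  moved to the identity by right translation. The condition is put on the resulting curve of
  automorphisms, not on the parameter path \<open>gm\<close>.\<close>

definition submersive :: "'i set => (('i => 'k) => 'a => 'a) => ('i => 'k) => bool" where
 "submersive I Ps v0 \<longleftrightarrow> finite I & regfam I Ps & (ALL v. Ps v : G) &
  (ALL X:dset. EX gm. gm 0 = v0 & first_order (%t. Ps (gm t)) (Ps v0) (%x. X (Ps v0 x)))"

definition relations :: "(('i => 'k) => 'a => 'a) => (('a => 'a) => 'k) set" where
 "relations Ps = {f:reg. ALL v. f (Ps v) = 0}"

lemma submersiveD:
 assumes "submersive I Ps v0"
 shows "finite I" "regfam I Ps" "Ps v : G" and "X : dset ==> EX gm. gm 0 = v0 & first_order (%t. Ps (gm t)) (Ps v0) (%x. X (Ps v0 x))"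
 using assms unfolding submersive_def by simp_all

lemma relations_ideal: "ideal_in reg (relations Ps)" unfolding ideal_in_def relations_def using subrngD[OF reg_subring] by auto

lemma submersive_locally_zero:
 assumes Ps: "submersive I Ps v0"
 shows "EX p:reg. p (Ps v0) ~= 0 & (ALL f:relations Ps. p * f = 0)"
proof (rule curves_imp_locally_zero[OF submersiveD(3)[OF Ps] relations_ideal])
 fix X assume X: "X : dset"
 obtain gm where gm: "gm 0 = v0" "first_order (%t. Ps (gm t)) (Ps v0) (%x. X (Ps v0 x))" using submersiveD(4)[OF Ps X] by (elim exE conjE)
 have "ALL f:relations Ps. ALL t. f (Ps (gm t)) = 0" unfolding relations_def by simp
 thus "EX c. first_order c (Ps v0) (%x. X (Ps v0 x)) & (ALL t. c t : G) & c 0 = Ps v0 & (ALL f:relations Ps. ALL t. f (c t) = 0)"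
  using gm submersiveD(3)[OF Ps] by (intro exI[of _ "%t. Ps (gm t)"]) simp
qed

lemma reg_separates:
 assumes "ph : G" "ps : G" "!!f. f : reg ==> f ph = f ps" shows "ph = ps" proof (rule G_eqI[OF assms(1,2)])
 fix x assume x: "x : V"
 have "crd c (ph x) = crd c (ps x)" for c using assms(3)[OF reg_coord[OF crd_functional x, of c]] by (simp add: ret_id assms(1,2))
 thus "ph x = ps x" by (subst crd_sum[OF G_V[OF assms(1) x], symmetric], subst crd_sum[OF G_V[OF assms(2) x], symmetric]) simp
qed

text \<open>Chevalley: a homomorphism from the ring of the closure of the image extends to the Laurent polynomials.\<close>

lemma submersive_open_image:
 fixes Ps :: "('i => 'k) => 'a => 'a"
 assumes Ps: "submersive I Ps v0"
 shows "EX w:reg. (EX v. w (Ps v) ~= 0) & (ALL x:G. w x ~= 0 --> x : range Ps)" proof -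
 have I: "finite I" and fam: "regfam I Ps" and PG: "!!v. Ps v : G" using submersiveD[OF Ps] by simp_all
 obtain p where p: "p : reg" "p (Ps v0) ~= 0" "!!f. f : relations Ps ==> p * f = 0" using submersive_locally_zero[OF Ps] by meson
 obtain bs where bs: "laur I = adjs (range (%c _. c)) bs"
  "set bs = (%i (v :: 'i => 'k). unz (v i)) ` I \<union> (%i v. 1 / unz (v i)) ` I" using laur_adjs[OF I] by blast
 \<comment> \<open>Regular functions restricted to the family and written as functions of the
   parameters: the coordinate ring of the closure of the image.\<close>
 define R where "R = (%f v. f (Ps v)) ` reg"
 have RL: "R <= laur I" unfolding R_def using regfam_reg[OF fam PG] by blast
 have KR: "range (%c _. c) <= R" proof
  fix k :: "('i => 'k) => 'k" assume "k : range (%c _. c)"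
  then obtain c where "k = (%_. c)" by blast
  thus "k : R" unfolding R_def using reg_const[of c] by (intro image_eqI[of _ _ "%_. c"]) auto
 qed
 have R: "subrng R" unfolding subrng_def proof (intro conjI ballI)
  show "0 : R" "1 : R" using KR by (auto simp: zero_fun_def one_fun_def)
  fix a b assume "a : R" "b : R"
  then obtain f g where fg: "f : reg" "g : reg" "a = (%v. f (Ps v))" "b = (%v. g (Ps v))" unfolding R_def by blast
  show "a + b : R" "a * b : R" "- a : R" unfolding R_def fg(3,4)
   by (intro image_eqI[OF _ subrngD(3)[OF reg_subring fg(1,2)]], simp add: fun_eq_iff,
     intro image_eqI[OF _ subrngD(4)[OF reg_subring fg(1,2)]], simp add: fun_eq_iff,
     intro image_eqI[OF _ subrngD(5)[OF reg_subring fg(1)]], simp add: fun_eq_iff)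
 qed
 have RB: "adjs R bs = laur I" proof
  show "adjs R bs <= laur I" using RL bs(2) by (intro adjs_least[OF laur_subring]) (auto intro: laur.var laur.inv)
  show "laur I <= adjs R bs" unfolding bs(1) using KR adjs_base[OF R, of bs] adjs_gen[OF R]
   by (intro adjs_least[OF subring_adjs[OF R]]) blast+
 qed
 have "(1 :: ('i => 'k) => 'k) ~= 0" by simp
 then obtain r where r: "r : R" "r ~= 0" "!!ph :: (('i => 'k) => 'k) => 'k. ring_hom_on R ph ==> ph r ~= 0 ==>
   EX ph'. ring_hom_on (laur I) ph' & (ALL a:R. ph' a = ph a)"
  using hom_extend_adjs[OF R, of bs 1] laur_domain subrngD(2)[OF laur_subring] unfolding RB by blast
 obtain q where q: "q : reg" "r = (%v. q (Ps v))" using r(1) unfolding R_def by blast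
 obtain v1 where v1: "q (Ps v1) ~= 0" using r(2) unfolding q(2) by (auto simp: fun_eq_iff)
 have "x : range Ps" if x: "x : G" "p x * q x ~= 0" for x proof -
  \<comment> \<open>Evaluation at \<open>x\<close> descends to \<open>R\<close>: a relation is
    annihilated by \<open>p\<close>, and \<open>p\<close> is nonzero at \<open>x\<close>.\<close>
  have wd: "f x = g x" if "f : reg" "g : reg" "(%v. f (Ps v)) = (%v. g (Ps v))" for f g proof -
   have "f - g : relations Ps" using that subrngD(6)[OF reg_subring] unfolding relations_def by (auto dest: fun_cong)
   hence "(p * (f - g)) x = 0" using p(3) by simp
   thus ?thesis using x(2) by simp
  qed
  define ph where "ph h = (SOME f. f : reg & h = (%v. f (Ps v))) x" for h
  have val: "ph (%v. f (Ps v)) = f x" if f: "f : reg" for f proof -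
   define g where "g = (SOME g. g : reg & (%v. f (Ps v)) = (%v. g (Ps v)))"
   have "g : reg & (%v. f (Ps v)) = (%v. g (Ps v))" unfolding g_def by (rule someI[of _ f]) (use f in auto)
   hence "g x = f x" using wd[OF f, of g] by simp
   thus ?thesis unfolding ph_def g_def .
  qed
  have "ring_hom_on R ph" unfolding ring_hom_on_def proof (intro conjI ballI)
   show "ph 1 = 1" using val[OF reg_const[of 1]] by (simp add: one_fun_def)
   fix a b assume "a : R" "b : R"
   then obtain f g where fg: "f : reg" "g : reg" "a = (%v. f (Ps v))" "b = (%v. g (Ps v))" unfolding R_def by blast
   show "ph (a + b) = ph a + ph b"
    using val[OF reg_add[OF fg(1,2)]] val[OF fg(1)] val[OF fg(2)] unfolding fg(3,4) by (simp add: plus_fun_def)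
   show "ph (a * b) = ph a * ph b"
    using val[OF reg_mult[OF fg(1,2)]] val[OF fg(1)] val[OF fg(2)] unfolding fg(3,4) by (simp add: times_fun_def)
  qed
  moreover have "ph r ~= 0" using val[OF q(1)] x(2) unfolding q(2) by simp
  ultimately obtain ph' where ph': "ring_hom_on (laur I) ph'" "!!a. a : R ==> ph' a = ph a" using r(3) by blast
  \<comment> \<open>The preimage of \<open>x\<close> is read off from the extended homomorphism; its
    coordinates are nonzero because the coordinate functions are units of the Laurent ring.\<close>
  define v where "v i = ph' (%v. unz (v i))" for i
  have vnz: "v i * ph' (%v. 1 / unz (v i)) = 1" if "i : I" for i proof -
   have "(%v. unz (v i)) * (%v. 1 / unz (v i)) = (1 :: ('i => 'k) => 'k)" by (simp add: fun_eq_iff unz)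
   thus ?thesis using ring_hom_onD(3)[OF ph'(1) laur.var[OF that] laur.inv[OF that]] ring_hom_onD(1)[OF ph'(1)] unfolding v_def by simp
  qed
  have ev: "ph' P = P v" if "P : laur I" for P using that proof (induction rule: laur.induct)
   case (const c)
   have "(%_. c) : R" using KR by blast
   thus ?case using ph'(2) val[OF reg_const[of c]] by simp
  next
   case (var i)
   have "v i ~= 0" using vnz[OF var] by auto
   hence "unz (v i) = v i" by (rule unz(3))
   thus ?case unfolding v_def by (rule sym)
  next
   case (inv i)
   have "v i ~= 0" using vnz[OF inv] by auto
   hence "ph' (%v. 1 / unz (v i)) = 1 / v i" "unz (v i) = v i" using vnz[OF inv] unz(3) by (simp_all add: field_simps)
   thus ?case by simp
  next
   case (add P Q)
   thus ?case using ring_hom_onD(2)[OF ph'(1) add.hyps] by (simp add: plus_fun_def)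
  next
   case (mult P Q)
   thus ?case using ring_hom_onD(3)[OF ph'(1) mult.hyps] by (simp add: times_fun_def)
  qed
  have "f x = f (Ps v)" if f: "f : reg" for f proof -
   have "(%v. f (Ps v)) : R" unfolding R_def using f by blast
   thus ?thesis using ph'(2) val[OF f] ev RL by (metis subsetD)
  qed
  hence "x = Ps v" using reg_separates[OF x(1) PG] by blast
  thus ?thesis by blast
 qed
 moreover obtain u where "p (Ps u) ~= 0" "q (Ps u) ~= 0" by (rule fam_mult_nonzero[OF fam PG p(1,2) q(1) v1])
 ultimately show ?thesis using reg_mult[OF p(1) q(1)] by (intro bexI[of _ "%ph. p ph * q ph"]) auto
qed

text \<open>A function not killed by \<open>p\<close> is nonzero somewhere on the family, whose
  image is irreducible; hence the principal open set of \<open>p\<close> is an irreducible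
  neighbourhood of the base point.\<close>

lemma submersive_irreducible:
 assumes Ps: "submersive I Ps v0"
 shows "EX p:reg. p (Ps v0) ~= 0 & (ALL f:reg. ALL g:reg. p * f ~= 0 --> p * g ~= 0 --> p * f * g ~= 0)" proof -
 have fam: "regfam I Ps" and PG: "!!v. Ps v : G" using submersiveD[OF Ps] by simp_all
 obtain p where p: "p : reg" "p (Ps v0) ~= 0" "!!f. f : relations Ps ==> p * f = 0" using submersive_locally_zero[OF Ps] by meson
 have "p * f * g ~= 0" if fg: "f : reg" "g : reg" "p * f ~= 0" "p * g ~= 0" for f g proof -
  obtain v w where vw: "f (Ps v) ~= 0" "g (Ps w) ~= 0" using fg p(3) unfolding relations_def by blast
  obtain u where u: "p (Ps u) ~= 0" "f (Ps u) ~= 0" by (rule fam_mult_nonzero[OF fam PG p(1,2) fg(1) vw(1)])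
  hence nz: "(%ph. p ph * f ph) (Ps u) ~= 0" by simp
  obtain z where "(%ph. p ph * f ph) (Ps z) ~= 0" "g (Ps z) ~= 0"
   by (rule fam_mult_nonzero[OF fam PG reg_mult[OF p(1) fg(1)] nz fg(2) vw(2)])
  hence "(p * f * g) (Ps z) ~= 0" by simp
  thus ?thesis by (metis zero_fun_apply)
 qed
 thus ?thesis using p(1,2) by blast
qed

text \<open>The closure of the open part of the first image is open, because translates of an irreducible neighbourhood cover the group.\<close>

theorem families_meet:
 assumes base: "submersive I0 Ps0 v0" and Ps: "submersive I Ps v" and Ps': "submersive I' Ps' v'"
  and C: "connectedin (zariski L) C" "Ps u : C" "Ps' u' : C"
 shows "range Ps \<inter> range Ps' ~= {}" proof -
 obtain w a where w: "w : reg" "w (Ps a) ~= 0" "!!x. x : G ==> w x ~= 0 ==> x : range Ps" using submersive_open_image[OF Ps] by blast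
 obtain w' a' where w': "w' : reg" "w' (Ps' a') ~= 0" "!!x. x : G ==> w' x ~= 0 ==> x : range Ps'"
  using submersive_open_image[OF Ps'] by blast
 define b where "b = Ps0 v0"
 obtain p where p: "p : reg" "p b ~= 0" "!!f g. f : reg ==> g : reg ==> p * f ~= 0 ==> p * g ~= 0 ==> p * f * g ~= 0"
  using submersive_irreducible[OF base] unfolding b_def by blast
 have PG: "Ps0 v : G" "Ps z : G" "Ps' z' : G" for v z z' by (rule submersiveD(3)[OF base], rule submersiveD(3)[OF Ps], rule submersiveD(3)[OF Ps'])
 have bG: "b : G" unfolding b_def using PG by blast
 \<comment> \<open>The closure of the set where \<open>w\<close> is nonzero, expressed through
   principal neighbourhoods.\<close>
 define Z where "Z = {y:G. ALL f:reg. f y ~= 0 --> (EX x:G. w x ~= 0 & f x ~= 0)}"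
 have Zopen: "openin (zariski L) Z" unfolding zariski_open_iff proof (intro conjI ballI)
  fix y assume y: "y : Z"
  hence yG: "y : G" unfolding Z_def by auto
  \<comment> \<open>Left translation by \<open>h\<close> moves \<open>y\<close> to the base point
    \<open>b\<close>, so that \<open>q\<close> cuts out an irreducible neighbourhood of
    \<open>y\<close>.\<close>
  define h where "h = b \<cdot> ginv y"
  have hG: "h : G" "ginv h : G" unfolding h_def using bG yG by auto
  define q where "q ph = p (h \<cdot> ret ph)" for ph
  have q: "q : reg" unfolding q_def[abs_def] by (rule reg_translate(1)[OF p(1) hG(1)])
  have "h \<cdot> y = b" unfolding h_def using bG yG by (simp add: AG.m_assoc)
  hence qy: "q y ~= 0" unfolding q_def using p(2) yG by (simp add: ret_id)
  have irr: "EX x:G. q x ~= 0 & f x ~= 0 & g x ~= 0"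
   if f: "f : reg" "x1 : G" "q x1 ~= 0" "f x1 ~= 0" and g: "g : reg" "x2 : G" "q x2 ~= 0" "g x2 ~= 0" for f g x1 x2 proof -
   define f' where "f' ph = f (ginv h \<cdot> ret ph)" for ph
   define g' where "g' ph = g (ginv h \<cdot> ret ph)" for ph
   have reg': "f' : reg" "g' : reg" unfolding f'_def[abs_def] g'_def[abs_def]
    using reg_translate(1)[OF f(1) hG(2)] reg_translate(1)[OF g(1) hG(2)] by auto
   have backward: "ginv h \<cdot> (h \<cdot> x) = x" if "x : G" for x using that hG by (simp add: AG.m_assoc[symmetric])
   have forward: "h \<cdot> (ginv h \<cdot> x) = x" if "x : G" for x using that hG by (simp add: AG.m_assoc[symmetric])
   have "(p * f') (h \<cdot> x1) ~= 0" using f hG AG.m_closed[OF hG(1) f(2)] backward[OF f(2)] by (simp add: f'_def q_def ret_id)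
   hence 1: "p * f' ~= 0" by (metis zero_fun_apply)
   have "(p * g') (h \<cdot> x2) ~= 0" using g hG AG.m_closed[OF hG(1) g(2)] backward[OF g(2)] by (simp add: g'_def q_def ret_id)
   hence 2: "p * g' ~= 0" by (metis zero_fun_apply)
   have "p * f' * g' ~= 0" using p(3)[OF reg' 1 2] .
   then obtain z where z: "p z ~= 0" "f' z ~= 0" "g' z ~= 0" by (auto simp: fun_eq_iff)
   define x where "x = ginv h \<cdot> ret z"
   have xG: "x : G" unfolding x_def using AG.m_closed[OF hG(2) ret_G] .
   obtain p0 where "p = (%ph. p0 (ret ph))" using p(1) unfolding reg_def by blast
   hence "p (ret z) = p z" by (simp add: ret_id ret_G)
   hence "q x ~= 0" unfolding q_def using z(1) forward[OF ret_G] ret_id[OF xG] unfolding x_def by simp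
   thus ?thesis using xG z(2,3) unfolding f'_def g'_def x_def by blast
  qed
  \<comment> \<open>This neighbourhood meets the open set of \<open>w\<close>. By irreducibility
    each of its nonempty open parts does too, so the whole neighbourhood lies in
    \<open>Z\<close>.\<close>
  obtain x1 where x1: "x1 : G" "w x1 ~= 0" "q x1 ~= 0" using y q qy unfolding Z_def by blast
  show "EX f:reg. f y ~= 0 & (ALL z:G. f z ~= 0 --> z : Z)" proof (intro bexI[OF _ q] conjI qy ballI impI)
   fix z assume z: "z : G" "q z ~= 0"
   show "z : Z" unfolding Z_def using z irr[OF _ z(1,2) _ w(1) x1(1,3,2)] by blast
  qed
 qed (auto simp: Z_def)
 have Zclosed: "openin (zariski L) (G - Z)" unfolding zariski_open_iff proof (intro conjI ballI)
  fix y assume y: "y : G - Z"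
  then obtain f where f: "f : reg" "f y ~= 0" "ALL x:G. w x ~= 0 --> f x = 0" unfolding Z_def by blast
  thus "EX f:reg. f y ~= 0 & (ALL z:G. f z ~= 0 --> z : G - Z)" unfolding Z_def by (intro bexI[of _ f]) auto
 qed auto
 have clopen: "D <= Z" if D: "connectedin (zariski L) D" "d : D" "d : Z" for D d proof (rule ccontr)
  assume "\<not> D <= Z"
  moreover have "D <= G" using connectedin_subset_topspace[OF D(1)] topspace_zariski by simp
  ultimately have "Z \<inter> (G - Z) \<inter> D = {}" "Z \<inter> D ~= {}" "(G - Z) \<inter> D ~= {}" "D <= Z \<union> (G - Z)"
   using D(2,3) by auto
  thus False using D(1) Zopen Zclosed unfolding connectedin by blast
 qed
 have "Ps a : Z" unfolding Z_def using PG w(2) by blast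
 hence "range Ps <= Z" by (intro clopen[OF connected_range[OF submersiveD(2,3)[OF Ps]], of "Ps a"]) auto
 hence "C <= Z" using clopen[OF C(1,2)] by (meson rangeI subsetD)
 hence "Ps' u' : Z" using C(3) by blast
 hence "range Ps' <= Z" by (intro clopen[OF connected_range[OF submersiveD(2,3)[OF Ps']], of "Ps' u'"]) auto
 hence "Ps' a' : Z" by blast
 then obtain x where "x : G" "w x ~= 0" "w' x ~= 0" using w'(1,2) unfolding Z_def by blast
 thus ?thesis using w(3) w'(3) by blast
qed

end

section \<open>One-parameter groups\<close>

lemma expansion_unz_powi:
 fixes w :: "'k::field_char_0"
 shows "EX F. expands (%t. unz (1 + t * w) powi n) F & fps_nth F 0 = 1 & fps_nth F 1 = of_int n * w" proof -
 let ?r = "[:1, w:]"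
 have r: "poly ?r t = 1 + t * w" for t by simp
 have r0: "fps_nth (fps_of_poly ?r) 0 = 1" "fps_nth (fps_of_poly ?r) 1 = w" by (simp_all add: coeff_pCons)
 have 1: "expands (%t. unz (1 + t * w)) (fps_of_poly ?r)" unfolding expands_def
 proof (rule exI[of _ "?r * ?r"], rule exI[of _ ?r], intro conjI allI)
  fix t show "unz (1 + t * w) * poly ?r t = poly (?r * ?r) t" unfolding poly_mult r by (rule unz_mult(1))
 qed (auto simp: fps_of_poly_mult)
 have ir: "inverse (fps_of_poly ?r) * fps_of_poly ?r = 1" by (rule inverse_mult_eq_1) (simp add: r0)
 hence i: "inverse (fps_of_poly ?r) * fps_of_poly (?r * ?r) = fps_of_poly ?r" unfolding fps_of_poly_mult mult.assoc[symmetric] ir by simp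
 have 2: "expands (%t. 1 / unz (1 + t * w)) (inverse (fps_of_poly ?r))" unfolding expands_def
 proof (rule exI[of _ ?r], rule exI[of _ "?r * ?r"], intro conjI allI)
  fix t show "1 / unz (1 + t * w) * poly (?r * ?r) t = poly ?r t" unfolding poly_mult r by (rule unz_mult(2))
 qed (use i in simp_all)
 have j: "fps_nth (inverse (fps_of_poly ?r)) 0 = 1" "fps_nth (inverse (fps_of_poly ?r)) 1 = - w" proof -
  show *: "fps_nth (inverse (fps_of_poly ?r)) 0 = 1" by (simp add: r0)
  have "fps_nth (inverse (fps_of_poly ?r) * fps_of_poly ?r) 1 = 0" unfolding ir by simp
  thus "fps_nth (inverse (fps_of_poly ?r)) 1 = - w" unfolding fps_mult_nth_1 r0 * by (simp add: eq_neg_iff_add_eq_0 add.commute)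
 qed
 show ?thesis proof (cases "n >= 0")
  case True
  hence "unz (1 + t * w) powi n = unz (1 + t * w) ^ nat n" for t by (simp add: power_int_def)
  moreover have "fps_nth (fps_of_poly ?r ^ nat n) 1 = of_int n * w" unfolding fps_power_first_eq[OF r0(1)] r0(2) using True by simp
  moreover have "fps_nth (fps_of_poly ?r ^ nat n) 0 = 1" unfolding fps_power_zeroth r0(1) by simp
  ultimately show ?thesis using expands_power[OF 1, of "nat n"] by auto
 next
  case False
  hence "unz (1 + t * w) powi n = (1 / unz (1 + t * w)) ^ nat (- n)" for t by (simp add: power_int_def inverse_eq_divide)
  moreover have "fps_nth (inverse (fps_of_poly ?r) ^ nat (- n)) 1 = of_int n * w"
   unfolding fps_power_first_eq[OF j(1)] j(2) using False by simp
  moreover have "fps_nth (inverse (fps_of_poly ?r) ^ nat (- n)) 0 = 1" unfolding fps_power_zeroth j(1) by simp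
  ultimately show ?thesis using expands_power[OF 2, of "nat (- n)"] by auto
 qed
qed

context fd_lie_superalgebra
begin

interpretation AG: group "Aut L" by (rule group_Aut)

lemma first_orderD: "first_order c c0 c1 ==> lin c0" "first_order c c0 c1 ==> lin c1" unfolding first_order_def by auto

lemma first_order_tor:
 assumes H: "intss H"
 shows "first_order (%t. tor H (unz (1 + t * w))) (%x. x) (%x. sc w (H x))"
  and "first_order (%t. tor H (1 / unz (1 + t * w))) (%x. x) (%x. sc (- w) (H x))" proof -
 note T = intssD(2)[OF H]
 have *: "first_order (%t x. SUM mu:eigs H. sc (unz (1 + t * w) powi (e * toint mu)) (gp H mu x)) (%x. x) (%x. sc (of_int e * w) (H x))" for e
 proof -
  obtain F where F: "!!n. expands (%t. unz (1 + t * w) powi n) (F n) & fps_nth (F n) 0 = 1 & fps_nth (F n) 1 = of_int n * w"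
   using expansion_unz_powi[of w] by metis
  have "first_order (%t x. SUM mu:eigs H. sc (unz (1 + t * w) powi (e * toint mu)) (gp H mu x))
   (%x. SUM mu:eigs H. sc (fps_nth (F (e * toint mu)) 0) (gp H mu x))
   (%x. SUM mu:eigs H. sc (fps_nth (F (e * toint mu)) 1) (gp H mu x) + sc (fps_nth (F (e * toint mu)) 0) 0)"
   by (rule first_order_sum, rule first_order_scale) (use F in blast, rule first_order_const[OF gp_lin[OF T]])
  thus ?thesis proof (rule first_order_cong)
   fix x assume x: "x : V"
   show "x = (SUM mu:eigs H. sc (fps_nth (F (e * toint mu)) 0) (gp H mu x))" using F gp_sum[OF T x] by simp
   have "sc (of_int e * w) (H x) = sc (of_int e * w) (H (SUM mu:eigs H. gp H mu x))" using gp_sum[OF T x] by simp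
   also have "... = (SUM mu:eigs H. sc (of_int e * w) (H (gp H mu x)))" unfolding lin_sum[OF T gp_V[OF T x]] scale_sum_right ..
   also have "... = (SUM mu:eigs H. sc (fps_nth (F (e * toint mu)) 1) (gp H mu x) + sc (fps_nth (F (e * toint mu)) 0) 0)"
   proof (rule sum.cong[OF refl])
    fix mu
    have g: "gp H mu x : gen H mu" using gp_gen[OF T x] .
    show "sc (of_int e * w) (H (gp H mu x)) = sc (fps_nth (F (e * toint mu)) 1) (gp H mu x) + sc (fps_nth (F (e * toint mu)) 0) 0"
     using intss_gen[OF H g] F by (auto simp: mult_ac)
   qed
   finally show "sc (of_int e * w) (H x) = (SUM mu:eigs H. sc (fps_nth (F (e * toint mu)) 1) (gp H mu x) + sc (fps_nth (F (e * toint mu)) 0) 0)" .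
  qed simp
 qed
 show "first_order (%t. tor H (unz (1 + t * w))) (%x. x) (%x. sc w (H x))"
  using *[of 1] by (rule first_order_cong) (simp_all add: tor_def fcalc_def)
 show "first_order (%t. tor H (1 / unz (1 + t * w))) (%x. x) (%x. sc (- w) (H x))" using *[of "-1"] by (rule first_order_cong)
   (simp_all add: tor_def fcalc_def power_int_minus power_int_one_over inverse_eq_divide)
qed

lemma regfam_tor:
 assumes H: "intss H" and i: "i : I"
 shows "regfam I (%v. tor H (unz (v i)))" "regfam I (%v. tor H (1 / unz (v i)))" proof -
 have *: "regfam I (%v x. SUM mu:eigs H. sc (unz (v i) powi (e * toint mu)) (gp H mu x))" for e
  by (rule regfam_sum, rule regfam_scale[OF laur_powi[OF i]], rule regfam_const[OF gp_lin[OF intssD(2)[OF H]]])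
 show "regfam I (%v. tor H (unz (v i)))" using *[of 1] by (rule regfam_cong) (simp add: tor_def fcalc_def)
 show "regfam I (%v. tor H (1 / unz (v i)))" using *[of "-1"] by (rule regfam_cong)
   (simp add: tor_def fcalc_def power_int_minus power_int_one_over inverse_eq_divide)
qed

text \<open>The exponent \<open>card B\<close> suffices for nilpotency. The two extra terms
  guarantee that the constant and the linear term are always present, as the computation of
  velocities requires.\<close>

definition "xp X = expo (card B + 2) X"

lemma xp_nilp: "lin X ==> nilp X ==> x : V ==> (X ^^ (card B + 2)) x = 0" using funpow_vanish[OF _ nilp_bound, of X x "card B + 2"] by simp

lemma nilp_scale:
 assumes X: "lin X" "nilp X" shows "nilp (%x. sc c (X x))" proof (rule nilpI[OF lin_scaleT[OF X(1)]])
 fix x assume x: "x : V"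
 have "((%x. sc c (X x)) ^^ n) x = sc (c ^ n) ((X ^^ n) x)" for n
  by (induction n) (simp_all add: linD(3)[OF X(1) linD(1)[OF lin_funpow[OF X(1)] x]] mult_ac)
 thus "EX n. ((%x. sc c (X x)) ^^ n) x = 0" using nilp_bound[OF X x] by (intro exI[of _ "card B"]) simp
qed

lemma regfam_xp: "regfam I Te ==> regfam I (%v. xp (Te v))" unfolding xp_def expo_def
 by (rule regfam_sum, rule regfam_scale[OF laur.const], rule regfam_funpow)

lemma first_order_funpow:
 assumes c: "first_order c (%x. 0) c1"
 shows "first_order (%t. c t ^^ i) (%x. if i = 0 then x else 0) (%x. if i = 1 then c1 x else 0)" proof (induction i)
 case 0
 show ?case using first_order_const[OF lin_idT] by (rule first_order_cong) simp_all
next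
 case (Suc i)
 show ?case using first_order_comp[OF c Suc] by (rule first_order_cong) (auto simp: lin_0[OF first_orderD(2)[OF c]])
qed

lemma first_order_xp:
 assumes c: "first_order c (%x. 0) c1"
 shows "first_order (%t. xp (c t)) (%x. x) c1" proof -
 let ?N = "card B + 2"
 have "first_order (%t x. SUM i<?N. sc (1 / fact i) ((c t ^^ i) x))
  (%x. SUM i<?N. sc (fps_nth (fps_const (1 / fact i)) 0) (if i = 0 then x else 0))
  (%x. SUM i<?N. sc (fps_nth (fps_const (1 / fact i)) 1) (if i = 0 then x else 0) + sc (fps_nth (fps_const (1 / fact i)) 0) (if i = 1 then c1 x else 0))"
  by (rule first_order_sum, rule first_order_scale[OF expands_const first_order_funpow[OF c]])
 thus ?thesis proof (rule first_order_cong)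
  fix x
  have "(SUM i<?N. sc (fps_nth (fps_const (1 / fact i)) 0) (if i = 0 then x else 0)) = (SUM i<?N. if i = 0 then x else 0)"
   by (intro sum.cong) auto
  thus "x = (SUM i<?N. sc (fps_nth (fps_const (1 / fact i)) 0) (if i = 0 then x else 0))" by simp
  have "(SUM i<?N. sc (fps_nth (fps_const (1 / fact i)) 1) (if i = 0 then x else 0) + sc (fps_nth (fps_const (1 / fact i)) 0) (if i = 1 then c1 x else 0))
   = (SUM i<?N. if i = 1 then c1 x else 0)" by (intro sum.cong) auto
  thus "c1 x = (SUM i<?N. sc (fps_nth (fps_const (1 / fact i)) 1) (if i = 0 then x else 0) + sc (fps_nth (fps_const (1 / fact i)) 0) (if i = 1 then c1 x else 0))"
   by simp
 qed (simp add: xp_def expo_def)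
qed

section \<open>One-parameter groups of integrable derivations\<close>

definition "integr X \<longleftrightarrow> der X & (intss X | nilp X)"

lemma integr_lin: "integr X ==> lin X" unfolding integr_def by (blast dest: derD(1))

text \<open>The parameter is multiplicative for tori and enters as \<open>a - 1\<close> for
  nilpotent derivations, so that \<open>a = 1\<close> is the identity in both cases and all
  parameters can range over nonzero scalars.\<close>

definition flow :: "('a => 'a) => 'k => 'a => 'a" where
 "flow X a = (if intss X then tor X a else xp (%x. sc (a - 1) (X x)))"

definition flow_inv :: "('a => 'a) => 'k => 'a => 'a" where
 "flow_inv X a = (if intss X then tor X (1 / a) else xp (%x. sc (1 - a) (X x)))"

lemma flow_aut:
 assumes X: "integr X" and a: "a ~= 0" shows "aut (flow X a)" "aut (flow_inv X a)" proof -
 have *: "aut (xp (%x. sc c (X x)))" if "\<not> intss X" for c proof -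
  have X': "der X" "lin X" "nilp X" using X that integr_lin unfolding integr_def by auto
  show ?thesis unfolding xp_def by (rule expo_aut[OF der_scale[OF X'(1)] xp_nilp[OF lin_scaleT[OF X'(2)] nilp_scale[OF X'(2,3)]]]) auto
 qed
 show "aut (flow X a)" "aut (flow_inv X a)" using a by (auto simp: flow_def flow_inv_def tor_aut *)
qed

lemma flow_inverse:
 assumes X: "integr X" and a: "a ~= 0" and x: "x : V"
 shows "flow X a (flow_inv X a x) = x" "flow_inv X a (flow X a x) = x" proof -
 have *: "xp (%x. sc c (X x)) (xp (%x. sc (- c) (X x)) x) = x" if "\<not> intss X" for c proof -
  have X': "der X" "lin X" "nilp X" using X that integr_lin unfolding integr_def by auto
  show ?thesis unfolding xp_def
   using expo_inverse[OF lin_scaleT[OF X'(2)] xp_nilp[OF lin_scaleT[OF X'(2)] nilp_scale[OF X'(2,3)]] x, of c] by simp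
 qed
 show "flow X a (flow_inv X a x) = x" "flow_inv X a (flow X a x) = x"
  using *[of "a - 1"] *[of "1 - a"] a x by (auto simp: flow_def flow_inv_def tor_mult tor_1)
qed

lemma xp_zero: "xp (%x. 0) x = x" proof -
 have "xp (%x. 0) x = (SUM i<card B + 2. if i = 0 then x else 0)"
  unfolding xp_def expo_def by (intro sum.cong refl) (auto simp: gr0_conv_Suc)
 thus ?thesis by simp
qed

lemma flow_1: "x : V ==> flow X 1 x = x" "x : V ==> flow_inv X 1 x = x" using xp_zero by (auto simp: flow_def flow_inv_def tor_1)

lemma first_order_flow:
 assumes X: "integr X"
 shows "first_order (%t. flow X (unz (1 + t * w))) (%x. x) (%x. sc w (X x))"
  and "first_order (%t. flow_inv X (unz (1 + t * w))) (%x. x) (%x. sc (- w) (X x))" proof -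
 obtain F where F: "expands (%t. unz (1 + t * w) powi 1) F" "fps_nth F 0 = 1" "fps_nth F 1 = of_int 1 * w"
  using expansion_unz_powi[of w 1] by blast
 have ex: "expands (%t. e * (unz (1 + t * w) + (- 1))) (fps_const e * (F + fps_const (- 1)))" for e
  using expands_mult[OF expands_const[of e] expands_add[OF F(1) expands_const[of "- 1"]]] by (simp only: power_int_1_right)
 have fo: "first_order (%t x. sc (e * (unz (1 + t * w) + - 1)) (X x)) (%x. 0) (%x. sc (e * w) (X x))" for e
  using first_order_scale[OF ex[of e] first_order_const[OF integr_lin[OF X]]] by (rule first_order_cong) (use F(2,3) in simp_all)
 from first_order_xp[OF fo[of 1]] first_order_xp[OF fo[of "-1"]]
 show "first_order (%t. flow X (unz (1 + t * w))) (%x. x) (%x. sc w (X x))"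
  "first_order (%t. flow_inv X (unz (1 + t * w))) (%x. x) (%x. sc (- w) (X x))"
  using first_order_tor[of X w] by (cases "intss X"; simp add: flow_def[abs_def] flow_inv_def[abs_def])+
qed

lemma regfam_flow:
 assumes X: "integr X" and i: "i : I"
 shows "regfam I (%v. flow X (unz (v i)))" "regfam I (%v. flow_inv X (unz (v i)))" proof -
 have p: "(%v. unz (v i) - 1) : laur I" "(%v. 1 - unz (v i)) : laur I" using laur.add[OF laur.var[OF i] laur.const[of "-1"]]
   laur.add[OF laur.const[of 1] laur.mult[OF laur.const[of "-1"] laur.var[OF i]]] by simp_all
 show "regfam I (%v. flow X (unz (v i)))" "regfam I (%v. flow_inv X (unz (v i)))"
  using regfam_tor[OF _ i, of X] regfam_xp[OF regfam_scale[OF p(1) regfam_const[OF integr_lin[OF X]]]]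
   regfam_xp[OF regfam_scale[OF p(2) regfam_const[OF integr_lin[OF X]]]]
  by (cases "intss X"; simp add: flow_def[abs_def] flow_inv_def[abs_def])+
qed

section \<open>Products of one-parameter groups\<close>

primrec flows :: "(('a => 'a) \<times> 'k) list => 'a => 'a" where
 "flows [] x = x"
| "flows (Xa # l) x = flow (fst Xa) (snd Xa) (flows l x)"

primrec flows_inv :: "(('a => 'a) \<times> 'k) list => 'a => 'a" where
 "flows_inv [] x = x"
| "flows_inv (Xa # l) x = flows_inv l (flow_inv (fst Xa) (snd Xa) x)"

lemma flows_aut:
 assumes "!!X a. (X, a) : set l ==> integr X & a ~= 0"
 shows "aut (flows l)" "aut (flows_inv l)" "x : V ==> flows l (flows_inv l x) = x" "x : V ==> flows_inv l (flows l x) = x" proof -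
 have "aut (flows l) & aut (flows_inv l) & (ALL x:V. flows l (flows_inv l x) = x & flows_inv l (flows l x) = x)" using assms
 proof (induction l)
  case Nil
  show ?case by (auto intro: aut_cong[OF aut_id])
 next
  case (Cons Xa l)
  obtain X a where Xa: "Xa = (X, a)" by (cases Xa)
  have h: "integr X" "a ~= 0" using Cons.prems[of X a] Xa by auto
  have IH: "aut (flows l)" "aut (flows_inv l)" "!!x. x : V ==> flows l (flows_inv l x) = x"
   "!!x. x : V ==> flows_inv l (flows l x) = x" using Cons by auto
  note f = flow_aut[OF h]
  have V: "x : V ==> flow_inv X a x : V" "x : V ==> flows l x : V" for x
   using linD(1)[OF autD(1)[OF f(2)]] linD(1)[OF autD(1)[OF IH(1)]] by auto
  have "aut (flows (Xa # l))" by (rule aut_cong[OF aut_comp[OF f(1) IH(1)]]) (simp add: Xa)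
  moreover have "aut (flows_inv (Xa # l))" by (rule aut_cong[OF aut_comp[OF IH(2) f(2)]]) (simp add: Xa)
  moreover have "ALL x:V. flows (Xa # l) (flows_inv (Xa # l) x) = x & flows_inv (Xa # l) (flows (Xa # l) x) = x"
   by (simp add: Xa IH V flow_inverse[OF h])
  ultimately show ?case by (intro conjI)
 qed
 thus "aut (flows l)" "aut (flows_inv l)" "x : V ==> flows l (flows_inv l x) = x" "x : V ==> flows_inv l (flows l x) = x" by auto
qed

lemma regfam_flows:
 assumes "!!X. X : set l ==> integr X & i X : I"
 shows "regfam I (%v. flows (map (%X. (X, unz (v (i X)))) l))" "regfam I (%v. flows_inv (map (%X. (X, unz (v (i X)))) l))" proof -
 have "regfam I (%v. flows (map (%X. (X, unz (v (i X)))) l)) & regfam I (%v. flows_inv (map (%X. (X, unz (v (i X)))) l))" using assms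
 proof (induction l)
  case Nil
  show ?case by (auto intro: regfam_cong[OF regfam_const[OF lin_idT]])
 next
  case (Cons X l)
  hence h: "integr X" "i X : I" and IH: "regfam I (%v. flows (map (%X. (X, unz (v (i X)))) l))"
   "regfam I (%v. flows_inv (map (%X. (X, unz (v (i X)))) l))" by auto
  show ?case by (intro conjI) (rule regfam_cong[OF regfam_comp[OF regfam_flow(1)[OF h] IH(1)]], simp,
    rule regfam_cong[OF regfam_comp[OF IH(2) regfam_flow(2)[OF h]]], simp)
 qed
 thus "regfam I (%v. flows (map (%X. (X, unz (v (i X)))) l))" "regfam I (%v. flows_inv (map (%X. (X, unz (v (i X)))) l))" by auto
qed

lemma first_order_flows:
 assumes "!!X. X : set l ==> integr X"
 shows "first_order (%t. flows (map (%X. (X, unz (1 + t * w X))) l)) (%x. x) (%x. SUM X<-l. sc (w X) (X x))"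
  "first_order (%t. flows_inv (map (%X. (X, unz (1 + t * w X))) l)) (%x. x) (%x. - (SUM X<-l. sc (w X) (X x)))" proof -
 have "first_order (%t. flows (map (%X. (X, unz (1 + t * w X))) l)) (%x. x) (%x. SUM X<-l. sc (w X) (X x)) &
  first_order (%t. flows_inv (map (%X. (X, unz (1 + t * w X))) l)) (%x. x) (%x. - (SUM X<-l. sc (w X) (X x)))" using assms
 proof (induction l)
  case Nil
  show ?case by (intro conjI; rule first_order_cong[OF first_order_const[OF lin_idT]]) simp_all
 next
  case (Cons X l)
  let ?f = "%t. flows (map (%X. (X, unz (1 + t * w X))) l)"
  let ?g = "%t. flows_inv (map (%X. (X, unz (1 + t * w X))) l)"
  have h: "integr X" and IH: "first_order ?f (%x. x) (%x. SUM X<-l. sc (w X) (X x))"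
   "first_order ?g (%x. x) (%x. - (SUM X<-l. sc (w X) (X x)))" using Cons by auto
  have "first_order (%t. flows (map (%X. (X, unz (1 + t * w X))) (X # l))) (%x. x) (%x. SUM X<-X # l. sc (w X) (X x))"
   using first_order_comp[OF first_order_flow(1)[OF h, of "w X"] IH(1)] by (rule first_order_cong) simp_all
  moreover have "first_order (%t. flows_inv (map (%X. (X, unz (1 + t * w X))) (X # l))) (%x. x) (%x. - (SUM X<-X # l. sc (w X) (X x)))"
   using first_order_comp[OF IH(2) first_order_flow(2)[OF h, of "w X"]] by (rule first_order_cong) simp_all
  ultimately show ?case ..
 qed
 thus "first_order (%t. flows (map (%X. (X, unz (1 + t * w X))) l)) (%x. x) (%x. SUM X<-l. sc (w X) (X x))"
  "first_order (%t. flows_inv (map (%X. (X, unz (1 + t * w X))) l)) (%x. x) (%x. - (SUM X<-l. sc (w X) (X x)))" by auto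
qed

end

section \<open>Operators of finite order\<close>

text \<open>The components are averages of the iterates of \<open>A\<close> against powers of the
  root of unity, a discrete Fourier transform. The abstract form serves the algebra, its homogeneous
  parts, and the space of derivations under conjugation.\<close>

lemma (in vector_space) finite_order_decomp:
 assumes m: "m >= 1" "of_nat m ~= (0 :: 'a)" and om: "om ^ m = 1" "!!j. 0 < j ==> j < m ==> om ^ j ~= 1"
  and S: "subspace S" and A: "!!x. x : S ==> A x : S" "!!x y. x : S ==> y : S ==> A (x + y) = A x + A y"
   "!!c x. x : S ==> A (scale c x) = scale c (A x)" "!!x. x : S ==> (A ^^ m) x = x" and x: "x : S"
 shows "EX y. (ALL j. y j : S & A (y j) = scale (om ^ j) (y j)) & x = (SUM j<m. y j)" proof -
 define f where "f j i = scale (inverse om ^ (j * i)) ((A ^^ i) x)" for j i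
 define y where "y j = scale (1 / of_nat m) (SUM i<m. f j i)" for j
 have nz: "om ~= 0" using om(1) m(1) by (cases "om = 0") (auto simp: power_0_left)
 have pS: "(A ^^ i) x : S" for i by (induction i) (auto simp: x A)
 have fS: "f j i : S" for i j unfolding f_def using pS S subspace_scale by blast
 have sumS: "(SUM i:J. f j i) : S" for j J using fS S by (intro subspace_sum) auto
 have A0: "A 0 = 0" using A(3)[OF x, of 0] by simp
 have Asum: "A (SUM i<n. f j i) = (SUM i<n. A (f j i))" for j n by (induction n) (simp_all add: A0 A(2) sumS fS)
 have fm: "f j m = f j 0" for j unfolding f_def using A(4)[OF x] om(1) by (simp add: power_inverse power_mult[of _ m, unfolded mult.commute[of m]])
 have "A (y j) = scale (om ^ j) (y j)" for j proof -
  have "A (f j i) = scale (om ^ j) (f j (Suc i))" for i unfolding f_def A(3)[OF pS] using nz by (simp add: power_add power_inverse)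
  hence "A (y j) = scale (om ^ j) (scale (1 / of_nat m) (SUM i<m. f j (Suc i)))"
   unfolding y_def A(3)[OF sumS] Asum by (simp add: scale_sum_right[symmetric] mult.commute)
  also have "(SUM i<m. f j (Suc i)) = (SUM i<m. f j i)"
   using sum.lessThan_Suc_shift[of "f j" m] sum.lessThan_Suc[of "f j" m] fm[of j] by (simp add: add.commute)
  finally show ?thesis unfolding y_def .
 qed
 moreover have "y j : S" for j unfolding y_def using sumS S subspace_scale by blast
 moreover have "x = (SUM j<m. y j)" proof -
  have o: "(SUM j<m. inverse om ^ (j * i)) = (if i = 0 then of_nat m else 0)" if "i < m" for i proof (cases "i = 0")
   case False
   have "inverse om ^ i ~= 1" using om(2)[of i] False that by (simp add: power_inverse)
   moreover have "(inverse om ^ i) ^ m = 1" using om(1) by (simp add: power_inverse power_mult[symmetric] mult.commute[of i], simp add: power_mult)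
   ultimately have "(SUM j<m. (inverse om ^ i) ^ j) = 0" using geometric_sum[of "inverse om ^ i" m] by simp
   thus ?thesis using False by (simp add: power_mult[symmetric] mult.commute)
  qed simp
  have "(SUM j<m. y j) = scale (1 / of_nat m) (SUM j<m. SUM i<m. f j i)" unfolding y_def by (simp add: scale_sum_right)
  also have "(SUM j<m. SUM i<m. f j i) = (SUM i<m. scale (SUM j<m. inverse om ^ (j * i)) ((A ^^ i) x))"
   unfolding f_def scale_sum_left by (rule sum.swap)
  also have "... = (SUM i<m. if i = 0 then scale (of_nat m) x else 0)" by (intro sum.cong refl) (auto simp: o)
  also have "... = scale (of_nat m) x" using m(1) by simp
  finally show ?thesis using m(2) by simp
 qed
 ultimately show ?thesis by blast
qed

lemma rootsD:
 assumes "compatible_roots ze" "m >= 1"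
 shows "ze m ^ m = 1" "0 < j ==> j < m ==> ze m ^ j ~= 1" "l >= 1 ==> ze (l * m) ^ l = ze m" "ze m ~= 0" proof -
 show 1: "ze m ^ m = 1" using assms unfolding compatible_roots_def by blast
 show "ze m ~= 0" using 1 assms(2) by (auto simp: power_0_left)
qed (use assms in \<open>auto simp: compatible_roots_def\<close>)

lemma primitive_powi_eq_1:
 assumes ze: "compatible_roots ze" "m >= 1" and 1: "ze m powi n = 1" shows "int m dvd n" proof -
 note r = rootsD[OF ze]
 have "n = int m * (n div int m) + int (nat (n mod int m))" using ze(2) by simp
 hence "ze m powi n = (ze m powi int m) powi (n div int m) * ze m powi int (nat (n mod int m))"
  using r(4) by (metis power_int_add power_int_mult)
 hence "ze m powi int (nat (n mod int m)) = 1" using 1 r(1) by (simp only: power_int_of_nat power_int_1_left mult_1)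
 hence "ze m ^ nat (n mod int m) = 1" by (simp only: power_int_of_nat)
 moreover have "nat (n mod int m) < m" using ze(2) by (simp add: nat_less_iff)
 ultimately have "nat (n mod int m) = 0" using r(2) by (metis gr0I)
 moreover have "0 <= n mod int m" using ze(2) by (intro pos_mod_sign) simp
 ultimately have "n mod int m = 0" by linarith
 thus ?thesis by (simp add: dvd_eq_mod_eq_0)
qed

context fd_lie_superalgebra
begin

interpretation AG: group "Aut L" by (rule group_Aut)

text \<open>When \<open>c\<close> separates the weights of \<open>H\<close>, the eigenspaces of
  \<open>tor H c\<close> are the weight spaces, so a map commuting with this torus element preserves
  each weight space.\<close>

lemma tor_eigen:
 assumes H: "intss H" and X: "lin X" and comm: "comm X (tor H c)"
  and inj: "!!a b. of_int a : eigs H ==> of_int b : eigs H ==> c powi a = c powi b ==> a = b"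
 shows "comm X H" proof -
 note T = intssD(2)[OF H]
 have HX: "H (X x) = X (H x)" if x: "x : wt H n" for x n proof (cases "x = 0")
  case True
  thus ?thesis using lin_0[OF T] lin_0[OF X] by simp
 next
  case False
  have xV: "x : V" using wt_V[OF x] .
  have XV: "X x : V" using linD(1)[OF X xV] .
  have n: "of_int n : eigs H" unfolding eigs_def using wt_gen[OF T x] False by blast
  define y where "y mu = sc (c powi toint mu - c powi n) (gp H mu (X x))" for mu
  have "tor H c (X x) = X (tor H c x)" using comm xV unfolding comm_def by simp
  also have "... = sc (c powi n) (X x)" unfolding tor_wt[OF T x] linD(3)[OF X xV] ..
  also have "... = sc (c powi n) (SUM mu:eigs H. gp H mu (X x))" unfolding gp_sum[OF T XV] ..
  finally have "(SUM mu:eigs H. y mu) = 0"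
   unfolding y_def tor_def fcalc_def by (simp add: scale_left_diff_distrib sum_subtractf scale_sum_right)
  hence y0: "y mu = 0" if "mu : eigs H" for mu
   using gen_indep[OF T finite_eigs[OF T], of y] that gen_scale[OF T gp_gen[OF T XV]] unfolding y_def by blast
  have "H (gp H mu (X x)) = sc (of_int n) (gp H mu (X x))" if mu: "mu : eigs H" for mu proof (cases "gp H mu (X x) = 0")
   case True
   thus ?thesis using lin_0[OF T] by simp
  next
   case F: False
   note g = intss_gen[OF H gp_gen[OF T XV, of mu]]
   obtain a where a: "mu = of_int a" using g(2) F by blast
   have "c powi a = c powi n" using y0[OF mu] F unfolding y_def a by simp
   hence "a = n" using inj mu n a by blast
   thus ?thesis using g(1) a by simp
  qed
  hence "H (SUM mu:eigs H. gp H mu (X x)) = sc (of_int n) (SUM mu:eigs H. gp H mu (X x))"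
   unfolding lin_sum[OF T gp_V[OF T XV]] by (simp add: scale_sum_right)
  hence "H (X x) = sc (of_int n) (X x)" unfolding gp_sum[OF T XV] .
  thus ?thesis using x linD(3)[OF X xV] unfolding wt_def by simp
 qed
 show ?thesis unfolding comm_def proof
  fix x assume "x : V"
  with H show "X (H x) = H (X x)" proof (induction rule: intss_induct)
   case (wt n x)
   thus ?case using HX by simp
  next
   case (add x y)
   thus ?case by (simp add: linD[OF T] linD[OF X])
  qed
 qed
qed

lemma comp_tor_funpow:
 assumes s: "lin s" and H: "intss H" and comm: "comm H s" and x: "x : V"
 shows "((%x. s (tor H a x)) ^^ k) x = (s ^^ k) (tor H (a ^ k) x)" proof (induction k)
 case 0
 thus ?case using tor_1[OF H x] by simp
next
 case (Suc k)
 note T = intssD(2)[OF H]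
 have c: "comm (tor H a) (s ^^ k)" proof -
  have "s (H z) = H (s z)" if "z : V" for z using comm that unfolding comm_def by simp
  hence "tor H a (s z) = s (tor H a z)" if "z : V" for z using tor_commute[OF T s _ that] by blast
  hence "tor H a ((s ^^ k) z) = (s ^^ k) (tor H a z)" if "z : V" for z
   using that by (induction k) (auto simp: linD(1)[OF lin_funpow[OF s]])
  thus ?thesis unfolding comm_def by blast
 qed
 have z: "tor H (a ^ k) x : V" using linD(1)[OF tor_lin[OF T] x] .
 have "((%x. s (tor H a x)) ^^ Suc k) x = s (tor H a ((s ^^ k) (tor H (a ^ k) x)))" using Suc by simp
 also have "... = s ((s ^^ k) (tor H a (tor H (a ^ k) x)))" using c z unfolding comm_def by simp
 also have "... = (s ^^ Suc k) (tor H (a ^ Suc k) x)" using tor_mult[OF H x, of a "a ^ k"] by simp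
 finally show ?case .
qed

text \<open>The \<open>m\<close>-th power of the modified element is a torus element that separates
  the weights of \<open>H\<close>. A linear map commuting with the modified element therefore
  commutes with \<open>H\<close>, hence with the torus factor, hence with \<open>s\<close>.\<close>

lemma regular_torsion_element:
 assumes s: "lin s" "!!x. x : V ==> (s ^^ m) x = x" "m >= 1" and H: "intss H" "comm H s" and ze: "compatible_roots ze"
 shows "EX M>=1. (ALL x:V. ((%x. s (tor H (ze M) x)) ^^ M) x = x) &
  (ALL X. lin X --> comm X (%x. s (tor H (ze M) x)) --> comm X s & comm X H)" proof -
 note T = intssD(2)[OF H(1)]
 define b where "b = (SUM mu:eigs H. \<bar>toint mu\<bar>)"
 \<comment> \<open>Weights differ by at most \<open>2 * b\<close>, so a root of unity of order
   \<open>M'\<close> separates them; the factor \<open>m\<close> in \<open>M\<close> disappears on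
   passing to the \<open>m\<close>-th power.\<close>
 define M' where "M' = nat (2 * b) + 1"
 define M where "M = m * M'"
 have M: "M' >= 1" "M >= 1" unfolding M_def M'_def using s(3) by auto
 have b0: "b >= 0" unfolding b_def by (intro sum_nonneg) auto
 have bound: "\<bar>n\<bar> <= b" if "of_int n : eigs H" for n
  using member_le_sum[OF that, of "%mu. \<bar>toint mu\<bar>"] finite_eigs[OF T] unfolding b_def by simp
 note r = rootsD[OF ze]
 have pm: "ze M ^ m = ze M'" unfolding M_def using r(3)[OF M(1) s(3)] .
 let ?x = "%x. s (tor H (ze M) x)"
 have "(?x ^^ M) x = x" if x: "x : V" for x proof -
  have "((s ^^ m) ^^ k) z = z" if "z : V" for k z using that by (induction k) (auto simp: s(2))
  hence "(s ^^ M) x = x" using x unfolding M_def funpow_mult[symmetric] by blast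
  thus ?thesis unfolding comp_tor_funpow[OF s(1) H x] r(1)[OF M(2)] tor_1[OF H(1) x] .
 qed
 moreover have "comm X s & comm X H" if X: "lin X" "comm X ?x" for X proof -
  have Xp: "X ((?x ^^ k) z) = (?x ^^ k) (X z)" if "z : V" for k z proof (induction k)
   case (Suc k)
   have "(?x ^^ k) z : V" using that linD(1)[OF lin_funpow[OF lin_comp[OF s(1) tor_lin[OF T]]]] by blast
   thus ?case using Suc X(2) unfolding comm_def by simp
  qed simp
  have "X (tor H (ze M') z) = tor H (ze M') (X z)" if z: "z : V" for z
   using Xp[OF z, of m] comp_tor_funpow[OF s(1) H z, where a = "ze M" and k = m] comp_tor_funpow[OF s(1) H linD(1)[OF X(1) z], where a = "ze M" and k = m] z
   unfolding pm by (simp add: s(2) linD(1)[OF X(1)] linD(1)[OF tor_lin[OF T]])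
  hence c: "comm X (tor H (ze M'))" unfolding comm_def by blast
  have XH: "comm X H" proof (rule tor_eigen[OF H(1) X(1) c])
   fix a c assume ac: "of_int a : eigs H" "of_int c : eigs H" "ze M' powi a = ze M' powi c"
   have "ze M' powi (a - c) = 1" using ac(3) r(4)[OF M(1)] by (simp add: power_int_diff)
   hence "int M' dvd a - c" by (rule primitive_powi_eq_1[OF ze M(1)])
   moreover have "\<bar>a - c\<bar> < int M'" unfolding M'_def using bound[OF ac(1)] bound[OF ac(2)] b0 by simp
   ultimately show "a = c" using zdvd_imp_le[of "int M'" "\<bar>a - c\<bar>"] by (cases "a = c") auto
  qed
  have "X (s z) = s (X z)" if z: "z : V" for z proof -
   define w where "w = tor H (1 / ze M) z"
   have w: "w : V" "tor H (ze M) w = z"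
    unfolding w_def using linD(1)[OF tor_lin[OF T] z] tor_mult[OF H(1) z] tor_1[OF H(1) z] r(4)[OF M(2)] by auto
   have "X (s (tor H (ze M) w)) = s (tor H (ze M) (X w))" using X(2) w(1) unfolding comm_def by blast
   also have "tor H (ze M) (X w) = X (tor H (ze M) w)"
    by (rule tor_commute[OF T X(1) _ w(1)]) (use XH in \<open>simp add: comm_def\<close>)
   finally show ?thesis using w(2) by simp
  qed
  thus ?thesis using XH unfolding comm_def by blast
 qed
 ultimately show ?thesis using M(2) by blast
qed

text \<open>Conjugation by \<open>x0\<close> has finite order on derivations, so each derivation is
  a fixed one plus an element of the image of one minus conjugation. The latter part is tangent to
  the conjugation orbit, the former to the centraliser.\<close>

lemma tangent_decomp:
 fixes ze :: "nat => 'k"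
 assumes x0: "aut x0" "!!x. x : V ==> (x0 ^^ M) x = x" "M >= 1" and ze: "compatible_roots ze" and X: "X : dset"
 shows "EX D:dset. EX Z:dset. comm Z x0 & (ALL x:V. X (x0 x) = D (x0 x) - x0 (D x) + x0 (Z x))" proof -
 note T = autD(1)[OF x0(1)]
 define x1 where "x1 = x0 ^^ (M - 1)"
 have x1: "x0 (x1 x) = x" "x1 (x0 x) = x" "x1 x : V" if x: "x : V" for x proof -
  have M: "M = Suc (M - 1)" using x0(3) by simp
  show "x0 (x1 x) = x" using x0(2)[OF x] unfolding x1_def by (subst (asm) M) simp
  show "x1 (x0 x) = x" using x0(2)[OF x] unfolding x1_def by (subst (asm) M) (simp add: funpow_swap1)
  show "x1 x : V" unfolding x1_def using linD(1)[OF lin_funpow[OF T] x] .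
 qed
 have a1: "aut x1" unfolding x1_def proof (induction "M - 1")
  case (Suc k)
  have "aut (x0 ^^ k)" for k proof (induction k)
   case (Suc k)
   show ?case by (rule aut_cong[OF aut_comp[OF x0(1) Suc]]) simp
  qed (auto intro: aut_cong[OF aut_id])
  thus ?case .
 qed (auto intro: aut_cong[OF aut_id])
 note T1 = autD(1)[OF a1]
 define A where "A X = ext0 (%x. x0 (X (x1 x)))" for X
 have Alin: "lin (%x. x0 (X (x1 x)))" if "X : dset" for X by (rule lin_comp[OF T lin_comp[OF dset_lin[OF that] T1]])
 have Ader: "A X : dset" if X: "X : dset" for X unfolding A_def proof (rule ext0_dset)
  note dX = dset_der[OF X]
  have "even (%x. x0 (X (x1 x)))" by (rule even_comp[OF T lin_comp[OF derD(1)[OF dX] T1] autD(2)[OF x0(1)]])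
    (rule even_comp[OF derD(1)[OF dX] T1 derD(2)[OF dX] autD(2)[OF a1]])
  moreover have "x0 (X (x1 (br x y))) = br (x0 (X (x1 x))) y + br x (x0 (X (x1 y)))" if xy: "x : V" "y : V" for x y proof -
   have V: "x1 x : V" "x1 y : V" "X (x1 x) : V" "X (x1 y) : V" using x1(3) xy linD(1)[OF derD(1)[OF dX]] by auto
   show ?thesis unfolding autD(3)[OF a1 xy] derD(3)[OF dX V(1,2)] linD(2)[OF T br_V[OF V(3,2)] br_V[OF V(1,4)]]
     autD(3)[OF x0(1) V(3,2)] autD(3)[OF x0(1) V(1,4)] x1(1)[OF xy(1)] x1(1)[OF xy(2)] ..
  qed
  ultimately show "der (%x. x0 (X (x1 x)))" unfolding der_def using Alin[OF X] by blast
 qed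
 have Apow: "((A ^^ k) X) x = (x0 ^^ k) (X ((x1 ^^ k) x)) & (A ^^ k) X : dset" if X: "X : dset" and x: "x : V" for X x k using x
 proof (induction k arbitrary: x)
  case (Suc k)
  thus ?case using Ader by (simp add: A_def ext0_eq x1(3) funpow_swap1)
 qed (simp add: X)
 have AM: "(A ^^ M) X = X" if X: "X : dset" for X proof (rule fun_eqI0)
  show "(A ^^ M) X : endo" "X : endo" using Apow[OF X V_0, of M] X dset_endo by blast+
  fix x assume x: "x : V"
  have "(x1 ^^ k) x : V & (x0 ^^ k) ((x1 ^^ k) x) = x" for k proof (induction k)
   case (Suc k)
   have "(x0 ^^ Suc k) ((x1 ^^ Suc k) x) = (x0 ^^ k) (x0 (x1 ((x1 ^^ k) x)))" by (simp add: funpow_swap1)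
   thus ?case using Suc x1(1,3) by simp
  qed (simp add: x)
  from this[of M] have "(x1 ^^ M) x = x" using x0(2)[of "(x1 ^^ M) x"] by simp
  thus "((A ^^ M) X) x = X x" using Apow[OF X x, of M] x0(2)[OF linD(1)[OF dset_lin[OF X] x]] by simp
 qed
 have Aadd: "A (X + Y) = A X + A Y" and Ascale: "A (%x. sc c (X x)) = (%x. sc c (A X x))" if XY: "X : dset" "Y : dset" for X Y c proof -
  have "X (x1 x) : V" "Y (x1 x) : V" if "x : V" for x using linD(1)[OF dset_lin] XY x1(3)[OF that] by auto
  thus "A (X + Y) = A X + A Y" "A (%x. sc c (X x)) = (%x. sc c (A X x))" unfolding A_def ext0_def by (auto simp: fun_eq_iff linD[OF T])
 qed
 note r = rootsD[OF ze x0(3)]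
 have "EX y. (ALL j. y j : dset & A (y j) = (%x. sc (ze M ^ j) (y j x))) & X = (SUM j<M. y j)"
  using x0(3) by (intro fv.finite_order_decomp[OF x0(3) _ r(1,2) subspace_dset Ader Aadd Ascale AM X]) auto
 then obtain y where y: "!!j. y j : dset" "!!j. A (y j) = (%x. sc (ze M ^ j) (y j x))" "X = (SUM j<M. y j)" by blast
 have yx: "x0 (y j x) = sc (ze M ^ j) (y j (x0 x))" if x: "x : V" for j x proof -
  have "A (y j) (x0 x) = x0 (y j x)" unfolding A_def using x linD(1)[OF T] x1(2) by (simp add: ext0_eq)
  thus ?thesis unfolding y(2) by simp
 qed
 \<comment> \<open>On the component with eigenvalue \<open>ze M ^ j\<close>, one minus conjugation
   is the scalar \<open>1 - ze M ^ j\<close>, which is inverted for \<open>j\<close> different from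
   \<open>0\<close>.\<close>
 define D where "D = (SUM j:{1..<M}. (%x. sc (1 / (1 - ze M ^ j)) (y j x)))"
 have D: "D : dset" unfolding D_def using y(1) subspace_dset by (intro fv.subspace_sum fv.subspace_scale) auto
 show ?thesis proof (rule bexI[OF _ D], rule bexI[OF _ y(1)[of 0]], intro conjI ballI)
  show "comm (y 0) x0" unfolding comm_def using yx[of _ 0] by simp
  fix x assume x: "x : V"
  have xV: "x0 x : V" using linD(1)[OF T x] .
  have yV: "y j z : V" if "z : V" for z j using linD(1)[OF dset_lin[OF y(1)] that] .
  have "D (x0 x) - x0 (D x) = (SUM j:{1..<M}. sc (1 / (1 - ze M ^ j)) (y j (x0 x)) - sc (1 / (1 - ze M ^ j)) (x0 (y j x)))"
   unfolding D_def sum_fun_apply sum_subtractf using x yV by (subst lin_sum[OF T]) (auto simp: linD(3)[OF T])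
  also have "... = (SUM j:{1..<M}. y j (x0 x))" proof (rule sum.cong[OF refl])
   fix j assume "j : {1..<M}"
   hence ne: "ze M ^ j ~= 1" using r(2)[of j] by auto
   have "sc (1 / (1 - ze M ^ j)) (y j (x0 x)) - sc (1 / (1 - ze M ^ j)) (x0 (y j x))
    = sc (1 / (1 - ze M ^ j) - 1 / (1 - ze M ^ j) * ze M ^ j) (y j (x0 x))" unfolding yx[OF x] scale_left_diff_distrib by simp
   also have "1 / (1 - ze M ^ j) - 1 / (1 - ze M ^ j) * ze M ^ j = 1" using ne by (simp add: field_simps)
   finally show "sc (1 / (1 - ze M ^ j)) (y j (x0 x)) - sc (1 / (1 - ze M ^ j)) (x0 (y j x)) = y j (x0 x)" by simp
  qed
  also have "... + x0 (y 0 x) = X (x0 x)" proof -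
   have "{..<M} = insert 0 {1..<M}" using x0(3) by auto
   hence "X (x0 x) = y 0 (x0 x) + (SUM j:{1..<M}. y j (x0 x))" unfolding y(3) sum_fun_apply by simp
   thus ?thesis using yx[OF x, of 0] by (simp add: add.commute)
  qed
  finally show "X (x0 x) = D (x0 x) - x0 (D x) + x0 (y 0 x)" by simp
 qed
qed

end

section \<open>A submersive family through a given element of finite order\<close>

context fd_lie_superalgebra
begin

interpretation AG: group "Aut L" by (rule group_Aut)

text \<open>Up to conjugation by \<open>g\<close>, the element \<open>x\<close> is \<open>s\<close>
  times torus elements and a unipotent element, all commuting with each other and with
  \<open>s\<close>. The list \<open>l\<close> records the tori with their parameters.\<close>

definition toral :: "('a => 'a) => ('a => 'a) => bool" where
 "toral s x \<longleftrightarrow> (EX g:G. EX l n. (ALL (Y,a):set l. intss Y & comm Y s & a ~= 0 & comm n Y & (ALL (Y',_):set l. comm Y Y'))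
  & lin n & nilp n & comm n s & (ALL z:V. x (g z) = g (s (flows l (xp n z)))))"

lemma finite_spanning_set:
 assumes "S <= endo"
 obtains F where "finite F" "F <= S"
  "!!X. X : fv.span S ==> EX a. ALL x. X x = (SUM Y:F. sc (a Y) (Y x))" proof -
 obtain F where F: "F <= S" "fv.independent F" "S <= fv.span F" using fv.maximal_independent_subset[of S] by blast
 have fin: "finite F" using endo_indep_finite[OF F(2)] F(1) assms by blast
 moreover have "EX a. ALL x. X x = (SUM Y:F. sc (a Y) (Y x))" if "X : fv.span S" for X proof -
  have "X : fv.span F" using that fv.span_mono[OF F(3)] fv.span_span by blast
  then obtain a where "X = (SUM Y:F. (%x. sc (a Y) (Y x)))" using fv.span_finite[OF fin] by blast
  thus ?thesis by (auto simp: sum_fun_apply)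
 qed
 ultimately show ?thesis using F(1) that by blast
qed

lemma flows_1:
 assumes "!!X. X : set l ==> integr X & c X = 1" "x : V"
 shows "flows (map (%X. (X, c X)) l) x = x" "flows_inv (map (%X. (X, c X)) l) x = x" using assms by (induction l) (auto simp: flow_1)

lemma unz_1 [simp]: "unz 1 = 1" unfolding unz_def by simp

text \<open>Conjugating flows produce the image of one minus conjugation, and the toral and
  nilpotent flows of the centraliser produce its fixed part, so by \<open>tangent_decomp\<close> the
  differential is surjective at the regular element. The given \<open>s\<close> is another member of
  the same family.\<close>

theorem submersive_family:
 assumes s: "s : G" "!!x. x : V ==> (s ^^ m) x = x" "m >= 1" and ze: "compatible_roots (ze :: nat => 'k)"
 shows "EX I (Ps :: (nat \<times> ('a => 'a) => 'k) => 'a => 'a) v0. submersive I Ps v0 & s : range Ps & (ALL v. toral s (Ps v))" proof -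
 note S = G_lin[OF s(1)]
 obtain H where Hd: "H : dset" and H': "intss H & comm H s & (ALL Y:cen s H. intss Y --> (ALL X:cen s H. comm X Y))"
  using maximal_torus[OF S] by (rule bexE)
 have H: "H : dset" "intss H" "comm H s" using Hd H' by simp_all
 have central: "comm X Y" if "Y : cen s H" "intss Y" "X : cen s H" for X Y using H' that by simp
 note T = intssD(2)[OF H(2)]
 obtain F where F: "finite F" "F <= {X:dset. intss X | nilp X}" and Fspan: "!!X. X : dset ==> EX a. ALL x. X x = (SUM Y:F. sc (a Y) (Y x))"
 proof (rule finite_spanning_set[of "{X:dset. intss X | nilp X}"])
  show "{X:dset. intss X | nilp X} <= endo" using dset_endo by (rule subset_trans[rotated]) simp
 qed (use subsetD[OF dset_span] in simp)
 obtain C where C: "finite C" "C <= {Y:cen s H. intss Y} \<union> {X:cen s H. nilp X}"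
  and Cspan: "!!X. X : cen s H ==> EX a. ALL x. X x = (SUM Y:C. sc (a Y) (Y x))"
 proof (rule finite_spanning_set[of "{Y:cen s H. intss Y} \<union> {X:cen s H. nilp X}"])
  show "{Y:cen s H. intss Y} \<union> {X:cen s H. nilp X} <= endo" using dset_endo by (rule subset_trans[rotated]) (auto simp: cen_def)
 qed (use subsetD[OF cen_span[OF S T]] in simp)
 define N where "N = {X:C. \<not> intss X}"
 obtain lF where lF: "set lF = F" "distinct lF" using finite_distinct_list[OF F(1)] by blast
 obtain lT where lT: "set lT = C - N" "distinct lT" using finite_distinct_list[of "C - N"] C(1) by blast
 have Fint: "integr X" if "X : F" for X using that F(2) unfolding integr_def by (auto dest: dset_der)
 have Tint: "intss X" "X : cen s H" "integr X" if "X : C - N" for X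
  using that C(2) unfolding integr_def N_def cen_def by (auto dest: dset_der)
 have Nint: "nilp X" "X : cen s H" "lin X" if "X : N" for X using that C(2) unfolding N_def cen_def by (auto dest: dset_lin)
 have finN: "finite N" unfolding N_def using C(1) by simp
 obtain M where M: "M >= 1" "!!x. x : V ==> ((%x. s (tor H (ze M) x)) ^^ M) x = x"
  "!!X. lin X ==> comm X (%x. s (tor H (ze M) x)) ==> comm X s & comm X H" using regular_torsion_element[OF S s(2,3) H(2,3) ze] by blast
 note r = rootsD[OF ze M(1)]
 define x0 where "x0 = (%x. s (tor H (ze M) x))"
 have x0: "aut x0" unfolding x0_def by (rule aut_comp[OF G_aut[OF s(1)] tor_aut[OF H(2) r(4)]])
 \<comment> \<open>The tags are \<open>0\<close> for conjugating flows, \<open>1\<close> for tori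
   and \<open>2\<close> for nilpotent directions of the centraliser, and \<open>3\<close> for the
   distinguished torus \<open>H\<close>.\<close>
 define I where "I = {(3,H)} \<union> {0::nat} \<times> F \<union> {1} \<times> (C - N) \<union> {2} \<times> N"
 have I: "finite I" unfolding I_def using F(1) C(1) finN by simp
 define n where "n v = (%x. SUM Y:N. sc (unz (v (2::nat,Y)) + - 1) (Y x))" for v
 define fF where "fF v = flows (map (%X. (X, unz (v (0::nat,X)))) lF)" for v
 define iF where "iF v = flows_inv (map (%X. (X, unz (v (0::nat,X)))) lF)" for v
 define fT where "fT v = flows (map (%X. (X, unz (v (1::nat,X)))) lT)" for v
 define Ph where "Ph v = (%x. fF v (s (tor H (unz (v (3,H))) (fT v (xp (n v) (iF v x))))))" for v
 define Ps where "Ps v = restrict (Ph v) V" for v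
 have nilsub: "fv.subspace {X:cen s H. nilp X}" by (rule nilp_subspace[OF S T central])
 have n: "n v : cen s H" "nilp (n v)" "lin (n v)" for v proof -
  have "n v = (SUM Y:N. (%x. sc (unz (v (2,Y)) + - 1) (Y x)))" unfolding n_def by (auto simp: fun_eq_iff sum_fun_apply)
  also have "... : {X:cen s H. nilp X}" using Nint by (intro fv.subspace_sum[OF nilsub] fv.subspace_scale[OF nilsub]) auto
  finally show "n v : cen s H" "nilp (n v)" by auto
  thus "lin (n v)" unfolding cen_def by (auto dest: dset_lin)
 qed
 have okF: "integr X & a ~= 0" if "(X, a) : set (map (%X. (X, unz (v (0,X)))) lF)" for X a v using that Fint lF(1) unz(1) by auto
 have okT: "integr X & a ~= 0" if "(X, a) : set (map (%X. (X, unz (v (1,X)))) lT)" for X a v using that Tint(3) lT(1) unz(1) by auto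
 have aut: "aut (fF v)" "aut (iF v)" "aut (fT v)" "aut (xp (n v))" "aut (tor H (unz (v (3,H))))" for v proof -
  show "aut (fF v)" "aut (iF v)" unfolding fF_def iF_def by (rule flows_aut(1,2)[OF okF], assumption)+
  show "aut (fT v)" unfolding fT_def by (rule flows_aut(1)[OF okT])
  have "n v : dset" using n(1)[of v] unfolding cen_def by simp
  thus "aut (xp (n v))" unfolding xp_def using xp_nilp[OF n(3,2)] by (intro expo_aut dset_der) auto
  show "aut (tor H (unz (v (3,H))))" by (rule tor_aut[OF H(2) unz(1)])
 qed
 have FiF: "fF v (iF v x) = x" "iF v (fF v x) = x" if "x : V" for v x
  unfolding fF_def iF_def by (rule flows_aut(3,4)[OF okF that], assumption)+
 have Phaut: "aut (Ph v)" for v unfolding Ph_def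
  by (rule aut_comp[OF aut(1) aut_comp[OF G_aut[OF s(1)] aut_comp[OF aut(5) aut_comp[OF aut(3) aut_comp[OF aut(4,2)]]]]])
 have PsG: "Ps v : G" for v unfolding Ps_def by (rule restrict_G[OF Phaut])
 have fam: "regfam I Ps" proof (rule regfam_cong[of I Ph])
  have 1: "regfam I fF" "regfam I iF" unfolding fF_def[abs_def] iF_def[abs_def]
   using regfam_flows[of lF "%X. (0, X)" I] Fint lF(1) unfolding I_def by auto
  have 2: "regfam I fT" unfolding fT_def[abs_def] using regfam_flows(1)[of lT "%X. (1, X)" I] Tint(3) lT(1) unfolding I_def by auto
  have 3: "regfam I (%v. tor H (unz (v (3,H))))" by (rule regfam_tor[OF H(2)]) (simp add: I_def)
  have 4: "regfam I (%v. xp (n v))" unfolding n_def proof (rule regfam_xp, rule regfam_sum)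
   fix Y assume Y: "Y : N"
   have "(2, Y) : I" using Y unfolding I_def by simp
   from laur.add[OF laur.var[OF this] laur.const[of "- 1"]]
   show "regfam I (%v x. sc (unz (v (2,Y)) + - 1) (Y x))" by (rule regfam_scale[OF _ regfam_const[OF Nint(3)[OF Y]]])
  qed
  show "regfam I Ph" unfolding Ph_def[abs_def]
   by (rule regfam_comp[OF 1(1) regfam_comp[OF regfam_const[OF S] regfam_comp[OF 3 regfam_comp[OF 2 regfam_comp[OF 4 1(2)]]]]])
 qed (simp add: Ps_def)
 have at1: "Ph v x = s (tor H (unz (v (3,H))) x)" if v: "!!i Y. i ~= 3 ==> v (i,Y) = 1" and x: "x : V" for v x proof -
  have "n v = (%x. 0)" unfolding n_def using v by simp
  moreover have "integr X & unz (v (0,X)) = 1" if "X : set lF" for X using that Fint lF(1) v by auto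
  note oF = flows_1[OF this]
  have "integr X & unz (v (1,X)) = 1" if "X : set lT" for X using that Tint(3) lT(1) v by auto
  note oT = flows_1(1)[OF this]
  have "iF v x = x" "fT v x = x" unfolding iF_def fT_def using oF(2) oT x by blast+
  moreover have "fF v y = y" if "y : V" for y unfolding fF_def using oF(1) that by blast
  moreover have "s (tor H (unz (v (3,H))) x) : V" using x linD(1)[OF S] linD(1)[OF tor_lin[OF T]] by blast
  ultimately show ?thesis unfolding Ph_def by (simp add: xp_zero)
 qed
 define v0 :: "nat \<times> ('a => 'a) => 'k" where "v0 p = (if p = (3,H) then ze M else 1)" for p
 have Psv0: "Ps v0 x = x0 x" if "x : V" for x using at1[of v0 x] that unz(3)[OF r(4)] unfolding Ps_def v0_def x0_def by auto
 have sub: "submersive I Ps v0" unfolding submersive_def proof (intro conjI I fam allI PsG ballI)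
  fix X assume X: "X : dset"
  obtain D Z where DZ: "D : dset" "Z : dset" "comm Z x0" "!!x. x : V ==> X (x0 x) = D (x0 x) - x0 (D x) + x0 (Z x)" proof -
   have "EX D:dset. EX Z:dset. comm Z x0 & (ALL x:V. X (x0 x) = D (x0 x) - x0 (D x) + x0 (Z x))"
    by (rule tangent_decomp[OF x0 _ M(1) ze X]) (use M(2) in \<open>simp add: x0_def\<close>)
   thus ?thesis using that by (elim bexE conjE) simp
  qed
  have Z: "Z : cen s H" unfolding cen_def using DZ(2) M(3)[OF dset_lin[OF DZ(2)] DZ(3)[unfolded x0_def]] by simp
  obtain d where d: "!!x. D x = (SUM Y:F. sc (d Y) (Y x))" using Fspan[OF DZ(1)] by (elim exE) simp
  obtain z where z: "!!x. Z x = (SUM Y:C. sc (z Y) (Y x))" using Cspan[OF Z] by (elim exE) simp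
  \<comment> \<open>The coordinates \<open>d\<close> and \<open>z\<close> of the two parts of
    \<open>X\<close> serve as speeds, while the parameter of \<open>H\<close> stays fixed.\<close>
  define gm where "gm t p = (if p = (3,H) then ze M else 1 + t * (if fst p = 0 then d (snd p) else z (snd p)))" for t and p :: "nat \<times> ('a => 'a)"
  define W where "W x = (SUM Y:C - N. sc (z Y) (Y x))" for x
  define U where "U x = (SUM Y:N. sc (z Y) (Y x))" for x
  have ZWU: "Z x = W x + U x" for x proof -
   have "N <= C" unfolding N_def by blast
   thus ?thesis unfolding z W_def U_def by (rule sum.subset_diff[OF _ C(1)])
  qed
  have eF: "fF (gm t) = flows (map (%X. (X, unz (1 + t * d X))) lF)"
   "iF (gm t) = flows_inv (map (%X. (X, unz (1 + t * d X))) lF)" for t unfolding fF_def iF_def gm_def by simp_all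
  have eT: "fT (gm t) = flows (map (%X. (X, unz (1 + t * z X))) lT)" for t unfolding fT_def gm_def by simp
  have sF: "(SUM X<-lF. sc (d X) (X x)) = D x" for x unfolding sum_list_distinct_conv_sum_set[OF lF(2)] lF(1) by (rule d[symmetric])
  have sT: "(SUM X<-lT. sc (z X) (X x)) = W x" for x unfolding sum_list_distinct_conv_sum_set[OF lT(2)] lT(1) W_def ..
  have 1: "first_order (%t. fF (gm t)) (%x. x) D" "first_order (%t. iF (gm t)) (%x. x) (%x. - D x)"
   using first_order_flows[where l = lF and w = d] Fint unfolding eF sF lF(1) by blast+
  have 2: "first_order (%t. fT (gm t)) (%x. x) W"
   using first_order_flows(1)[where l = lT and w = z] Tint(3) unfolding eT sT lT(1) by blast
  have 3: "first_order (%t. xp (n (gm t))) (%x. x) U" proof (rule first_order_xp)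
   obtain P where P: "!!w :: 'k. expands (%t. unz (1 + t * w) powi 1) (P w) & fps_nth (P w) 0 = 1 & fps_nth (P w) 1 = of_int 1 * w"
    using expansion_unz_powi[where n = 1] by metis
   have ex: "expands (%t. unz (1 + t * w) + (- 1)) (P w + fps_const (- 1))" for w
    using expands_add[OF conjunct1[OF P[of w]] expands_const[of "- 1"]] by (simp only: power_int_1_right)
   have "first_order (%t x. SUM Y:N. sc (unz (1 + t * z Y) + - 1) (Y x))
     (%x. SUM Y:N. sc (fps_nth (P (z Y) + fps_const (- 1)) 0) (Y x))
     (%x. SUM Y:N. sc (fps_nth (P (z Y) + fps_const (- 1)) 1) (Y x) + sc (fps_nth (P (z Y) + fps_const (- 1)) 0) 0)"
    by (rule first_order_sum, rule first_order_scale[OF ex first_order_const[OF Nint(3)]])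
   thus "first_order (%t. n (gm t)) (%x. 0) U" by (rule first_order_cong) (use P in \<open>simp_all add: n_def gm_def U_def\<close>)
  qed
  have "ze M ~= 0" by (rule r(4))
  hence 4: "tor H (unz (gm t (3,H))) = tor H (ze M)" for t unfolding gm_def by (simp add: unz(3))
  have "first_order (%t. Ps (gm t)) (Ps v0) (%x. X (Ps v0 x))"
   using first_order_comp[OF 1(1) first_order_comp[OF first_order_const[OF autD(1)[OF x0]]
    first_order_comp[OF 2 first_order_comp[OF 3 1(2)]]]] proof (rule first_order_cong)
   fix t x assume x: "x : V"
   show "Ps (gm t) x = fF (gm t) (x0 (fT (gm t) (xp (n (gm t)) (iF (gm t) x))))" unfolding Ps_def Ph_def 4 x0_def using x by simp
  next
   fix x assume x: "x : V"
   have V: "D x : V" "Z x : V" using x linD(1)[OF dset_lin] DZ(1,2) by auto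
   show "Ps v0 x = x0 x" using Psv0[OF x] .
   have e: "W x + (U x + - D x) = Z x - D x" unfolding ZWU by simp
   show "X (Ps v0 x) = D (x0 x) + (0 + x0 (W x + (U x + - D x)))"
    unfolding Psv0[OF x] DZ(4)[OF x] e lin_diff[OF autD(1)[OF x0] V(2,1)] by simp
  qed
  moreover have "gm 0 = v0" unfolding gm_def v0_def by auto
  ultimately show "EX gm. gm 0 = v0 & first_order (%t. Ps (gm t)) (Ps v0) (%x. X (Ps v0 x))" by blast
 qed
 moreover have "s : range Ps" proof -
  have "s = Ps (%_. 1)" by (rule G_eqI[OF s(1) PsG]) (simp add: Ps_def at1 tor_1[OF H(2)])
  thus ?thesis by blast
 qed
 moreover have "toral s (Ps v)" for v unfolding toral_def
 proof (intro bexI[OF _ restrict_G[OF aut(1)[of v]]] exI[of _ "n v"] exI[of _ "(H, unz (v (3,H))) # map (%X. (X, unz (v (1,X)))) lT"] conjI ballI)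
  let ?l = "(H, unz (v (3,H))) # map (%X. (X, unz (v (1,X)))) lT"
  have l: "intss Y & Y : cen s H & a ~= 0" if "(Y, a) : set ?l" for Y a
   using that Tint(1,2) lT(1) H unfolding cen_def comm_def by (auto simp: unz(1))
  show "case p of (Y, a) => intss Y & comm Y s & a ~= 0 & comm (n v) Y & (ALL (Y',_):set ?l. comm Y Y')" if "p : set ?l" for p proof -
   obtain Y a where p: "p = (Y, a)" by (cases p)
   have Y: "intss Y" "Y : cen s H" "a ~= 0" using l that unfolding p by auto
   have "comm Y Y'" if "(Y', b) : set ?l" for Y' b using central[of Y' Y] l[OF that] Y by blast
   thus ?thesis using Y central[OF Y(2,1) n(1)[of v]] unfolding p cen_def by auto
  qed
  show "comm (n v) s" using n(1)[of v] unfolding cen_def by blast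
  fix z assume z: "z : V"
  have gz: "fF v z : V" using linD(1)[OF autD(1)[OF aut(1)] z] .
  have w: "s (tor H (unz (v (3,H))) (fT v (xp (n v) z))) : V"
   by (rule linD(1)[OF S linD(1)[OF autD(1)[OF aut(5)] linD(1)[OF autD(1)[OF aut(3)] linD(1)[OF autD(1)[OF aut(4)] z]]]])
  have l: "flows ?l y = tor H (unz (v (3,H))) (fT v y)" for y using H(2) by (simp add: flow_def fT_def)
  show "Ps v (restrict (fF v) V z) = restrict (fF v) V (s (flows ?l (xp (n v) z)))"
   unfolding l Ps_def restrict_apply'[OF z] restrict_apply'[OF gz] restrict_apply'[OF w] unfolding Ph_def FiF(2)[OF z] ..
 qed (rule n)+
 ultimately show ?thesis by blast
qed

end

section \<open>Retraction onto roots of unity\<close>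

definition torsion :: "'k::field => bool" where
 "torsion z \<longleftrightarrow> (EX n>0. z ^ n = 1)"

text \<open>A homomorphism from a group \<open>A\<close> of nonzero scalars to the roots of unity
  that is the identity on them. The domain grows by adjoining finitely many scalars, so a retraction
  of the whole multiplicative group is never formed.\<close>

definition retraction_on :: "'k::field set => ('k => 'k) => bool" where
 "retraction_on A te \<longleftrightarrow> 0 ~: A & (ALL z. torsion z --> z : A & te z = z) & (ALL x:A. inverse x : A & torsion (te x))
  & (ALL x:A. ALL y:A. x * y : A & te (x * y) = te x * te y)"

lemma torsion_mult: assumes "torsion x" "torsion y" shows "torsion (x * y)" proof -
 obtain m n where mn: "m > 0" "x ^ m = 1" "n > 0" "y ^ n = 1" using assms unfolding torsion_def by blast
 have "x ^ (m * n) = 1" unfolding power_mult mn(2) by simp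
 moreover have "y ^ (m * n) = 1" unfolding mult.commute[of m] power_mult mn(4) by simp
 ultimately show ?thesis unfolding torsion_def using mn by (intro exI[of _ "m * n"]) (simp add: power_mult_distrib)
qed

lemma torsion_1: "torsion 1" unfolding torsion_def by (intro exI[of _ 1]) simp

lemma torsion_nonzero: "torsion x ==> x ~= 0" unfolding torsion_def by (auto simp: power_0_left)

lemma torsion_powi: assumes "torsion x" shows "torsion (x powi k)" proof -
 obtain n where n: "n > 0" "x ^ n = 1" using assms unfolding torsion_def by blast
 have "(x powi k) ^ n = (x ^ n) powi k" unfolding power_int_of_nat[symmetric] power_int_mult[symmetric] by (simp only: mult.commute)
 thus ?thesis unfolding torsion_def using n by (intro exI[of _ n]) simp
qed

lemma retraction_onD:
 assumes "retraction_on A te"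
 shows "0 ~: A" "torsion z ==> z : A" "torsion z ==> te z = z" "x : A ==> inverse x : A" "x : A ==> torsion (te x)"
  "x : A ==> y : A ==> x * y : A" "x : A ==> y : A ==> te (x * y) = te x * te y" using assms unfolding retraction_on_def by auto

lemma retraction_on_powi:
 assumes A: "retraction_on A te" and x: "x : A"
 shows "x powi k : A" "te (x powi k) = te x powi k" proof -
 note D = retraction_onD[OF A]
 have p: "y ^ n : A & te (y ^ n) = te y ^ n" if "y : A" for y n using that by (induction n) (auto simp: D torsion_1)
 have "te (inverse x * x) = te (inverse x) * te x" using D(7)[OF D(4)[OF x] x] .
 moreover have "inverse x * x = 1" using x D(1) by (metis left_inverse)
 ultimately have "te (inverse x) * te x = 1" using D(3)[OF torsion_1] by simp
 hence i: "te (inverse x) = inverse (te x)" using inverse_unique[of "te x" "te (inverse x)"] by (simp add: mult.commute)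
 show "x powi k : A" "te (x powi k) = te x powi k"
  using p[OF x, of "nat k"] p[OF D(4)[OF x], of "nat (- k)"] unfolding power_int_def i by auto
qed

text \<open>Roots of unity form a divisible group. With \<open>n\<close> the least positive exponent
  for which \<open>c ^ n\<close> lies in \<open>A\<close>, the value \<open>t\<close> on
  \<open>c\<close> is an \<open>n\<close>-th root of the value on \<open>c ^ n\<close>; if no such
  exponent exists, \<open>t = 1\<close> serves.\<close>

lemma retraction_extend:
 fixes c :: "'k::alg_closed_field"
 assumes A: "retraction_on A te" and c: "c ~= 0"
 shows "EX A' te'. retraction_on A' te' & A <= A' & c : A'" proof -
 note D = retraction_onD[OF A]
 note P = retraction_on_powi[OF A]
 have one: "1 : A" "te 1 = 1" using D(2,3)[OF torsion_1] by auto
 have "EX t. torsion t & (ALL k. c powi k : A --> te (c powi k) = t powi k)" proof (cases "EX n>0. c ^ n : A")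
  case False
  have k0: "k = 0" if k: "c powi k : A" for k proof (rule ccontr)
   assume "k ~= 0"
   moreover have "c ^ nat \<bar>k\<bar> : A" using k D(4)[OF k] by (cases "k >= 0") (auto simp: power_int_def power_inverse)
   ultimately show False using False by (metis zero_less_abs_iff zero_less_nat_eq)
  qed
  show ?thesis proof (intro exI[of _ 1] conjI allI impI torsion_1)
   fix k assume "c powi k : A"
   hence "k = 0" by (rule k0)
   thus "te (c powi k) = 1 powi k" using one by simp
  qed
 next
  case True
  define n where "n = (LEAST n. n > 0 & c ^ n : A)"
  have n: "n > 0" "c ^ n : A" unfolding n_def using True by (metis (mono_tags, lifting) LeastI)+
  have min: "\<not> (0 < i & c ^ i : A)" if "i < n" for i using that not_less_Least unfolding n_def by blast
  obtain t where t: "t ^ n = te (c ^ n)" using nth_root_exists[OF n(1)] by blast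
  have "torsion t" proof -
   obtain m where m: "m > 0" "(t ^ n) ^ m = 1" using D(5)[OF n(2)] unfolding t torsion_def by blast
   thus ?thesis unfolding torsion_def using n(1) m by (intro exI[of _ "n * m"]) (simp add: power_mult)
  qed
  moreover have "te (c powi k) = t powi k" if k: "c powi k : A" for k proof -
   define q where "q = k div int n"
   define r where "r = nat (k mod int n)"
   have kq: "k = int n * q + int r" unfolding q_def r_def using n(1) by simp
   have "c powi k = (c ^ n) powi q * c ^ r" unfolding kq using c by (simp add: power_int_add power_int_mult)
   hence "c ^ r = c powi k * inverse ((c ^ n) powi q)" using c by simp
   also have "... : A" using k P(1)[OF n(2)] D(4,6) by blast
   finally have "c ^ r : A" .
   moreover have "r < n" unfolding r_def using n(1) by (simp add: nat_less_iff)
   ultimately have "r = 0" using min[of r] by simp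
   hence k: "k = int n * q" using kq by simp
   have "t powi k = te (c ^ n) powi q" unfolding k power_int_mult t[symmetric] by simp
   also have "... = te ((c ^ n) powi q)" using P(2)[OF n(2)] by simp
   also have "(c ^ n) powi q = c powi k" unfolding k power_int_mult by simp
   finally show ?thesis by simp
  qed
  ultimately show ?thesis by blast
 qed
 then obtain t where t: "torsion t" "!!k. c powi k : A ==> te (c powi k) = t powi k" by blast
 have t0: "t ~= 0" using torsion_nonzero[OF t(1)] .
 define A' where "A' = {a * c powi k | a k. a : A}"
 define te' where "te' z = (SOME w. EX a:A. EX k. z = a * c powi k & w = te a * t powi k)" for z
 \<comment> \<open>Two representations of one element differ by a power of \<open>c\<close> lying in
   \<open>A\<close>, and on such powers \<open>te\<close> agrees with the powers of
   \<open>t\<close>.\<close>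
 have val: "te' (a * c powi k) = te a * t powi k" if a: "a : A" for a k proof -
  have "EX a':A. EX k'. a * c powi k = a' * c powi k' & te' (a * c powi k) = te a' * t powi k'"
   unfolding te'_def by (rule someI_ex) (use a in blast)
  then obtain a' k' where a': "a' : A" "a * c powi k = a' * c powi k'" "te' (a * c powi k) = te a' * t powi k'" by blast
  have nz: "a ~= 0" "a' ~= 0" using a a'(1) D(1) by auto
  have "c powi (k' - k) = a * inverse a'" using a'(2) nz c by (simp add: power_int_diff field_simps)
  moreover have "a * inverse a' : A" using a a'(1) D(4,6) by blast
  ultimately have m: "te (a * inverse a') = t powi (k' - k)" using t(2) by metis
  have "a = (a * inverse a') * a'" using nz by simp
  hence "te a = te (a * inverse a') * te a'" using D(7)[OF `a * inverse a' : A` a'(1)] by metis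
  thus ?thesis unfolding a'(3) m using t0 by (simp add: power_int_diff)
 qed
 have "retraction_on A' te'" unfolding retraction_on_def proof (intro conjI allI impI ballI)
  show "0 ~: A'" unfolding A'_def using D(1) c by auto
  fix z :: 'k assume z: "torsion z"
  have "z = z * c powi 0" by simp
  thus "z : A'" unfolding A'_def using D(2)[OF z] by blast
  show "te' z = z" using val[OF D(2)[OF z], of 0] D(3)[OF z] by simp
 next
  fix x assume "x : A'"
  then obtain a k where x: "a : A" "x = a * c powi k" unfolding A'_def by blast
  have "inverse x = inverse a * c powi (- k)" unfolding x(2) by (simp add: power_int_minus)
  thus "inverse x : A'" unfolding A'_def using D(4)[OF x(1)] by blast
  show "torsion (te' x)" unfolding x(2) val[OF x(1)] using D(5)[OF x(1)] t(1) torsion_mult torsion_powi by blast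
  fix y assume "y : A'"
  then obtain b j where y: "b : A" "y = b * c powi j" unfolding A'_def by blast
  have xy: "x * y = (a * b) * c powi (k + j)" unfolding x y using c by (simp add: power_int_add mult_ac)
  thus "x * y : A'" unfolding A'_def using D(6)[OF x(1) y(1)] by blast
  show "te' (x * y) = te' x * te' y"
   unfolding xy val[OF D(6)[OF x(1) y(1)]] unfolding x(2) y(2) val[OF x(1)] val[OF y(1)] D(7)[OF x(1) y(1)]
   using t0 by (simp add: power_int_add mult_ac)
 qed
 moreover have "A <= A'" proof
  fix a assume "a : A"
  moreover have "a = a * c powi 0" by simp
  ultimately show "a : A'" unfolding A'_def by blast
 qed
 moreover have "c : A'" proof -
  have "c = 1 * c powi 1" by simp
  thus ?thesis unfolding A'_def using one(1) by blast
 qed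
 ultimately show ?thesis by blast
qed

lemma retraction_exists:
 fixes S :: "'k::alg_closed_field set"
 assumes "finite S" "0 ~: S" shows "EX A te. retraction_on A te & S <= A" using assms proof (induction S)
 case empty
 have "retraction_on {z. torsion z} (%z. z)" unfolding retraction_on_def using torsion_nonzero torsion_mult torsion_powi[of _ "-1"] by auto
 thus ?case by blast
next
 case (insert c S)
 then obtain A te where A: "retraction_on A te" "S <= A" by auto
 then obtain A' te' where "retraction_on A' te'" "A <= A'" "c : A'" using retraction_extend[OF A(1), of c] insert.prems by auto
 thus ?case using A(2) by blast
qed

lemma torsion_power_of_root:
 fixes ze :: "nat => 'k::field"
 assumes ze: "compatible_roots ze" and n: "n >= 1" and z: "z ^ n = 1"
 shows "EX j. z = ze n ^ j" proof -
 note r = rootsD[OF ze n]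
 let ?p = "monom 1 n - 1 :: 'k poly"
 have "poly ?p 0 ~= 0" using n by (simp add: poly_monom power_0_left)
 hence p: "?p ~= 0" by auto
 have deg: "degree ?p <= n" by (rule degree_diff_le) (auto simp: degree_monom_le)
 have roots: "{x. poly ?p x = 0} = {x. x ^ n = 1}" by (auto simp: poly_monom)
 have fin: "finite {x::'k. x ^ n = 1}" using poly_roots_finite[OF p] unfolding roots .
 have card: "card {x::'k. x ^ n = 1} <= n" using card_poly_roots_bound[OF p] deg unfolding roots by simp
 have inj: "inj_on (%j. ze n ^ j) {..<n}" proof (rule linorder_inj_onI)
  fix i j assume ij: "i < j" "j : {..<n}"
  show "ze n ^ i ~= ze n ^ j" proof
   assume "ze n ^ i = ze n ^ j"
   also have "... = ze n ^ i * ze n ^ (j - i)" using ij by (simp add: power_add[symmetric])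
   finally have "ze n ^ (j - i) = 1" using r(4) by simp
   thus False using r(2)[of "j - i"] ij less_imp_diff_less[of j n i] by simp
  qed
 qed auto
 have sub: "(%j. ze n ^ j) ` {..<n} <= {x. x ^ n = 1}" proof (rule image_subsetI)
  fix j
  have "(ze n ^ j) ^ n = (ze n ^ n) ^ j" unfolding power_mult[symmetric] by (simp only: mult.commute)
  thus "ze n ^ j : {x. x ^ n = 1}" using r(1) by simp
 qed
 have "card ((%j. ze n ^ j) ` {..<n}) = n" using card_image[OF inj] by simp
 hence "(%j. ze n ^ j) ` {..<n} = {x. x ^ n = 1}" using card_subset_eq[OF fin sub] card card_mono[OF fin sub] by simp
 thus ?thesis using z by blast
qed

lemma torsion_common_root:
 fixes ze :: "nat => 'k::field"
 assumes ze: "compatible_roots ze" and S: "finite S" "!!z. z : S ==> torsion z"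
 shows "EX N>=1. ALL z:S. EX j. z = ze N ^ j" using S proof (induction S)
 case empty
 show ?case by (intro exI[of _ 1]) auto
next
 case (insert z S)
 then obtain N where N: "N >= 1" "ALL z:S. EX j. z = ze N ^ j" by auto
 obtain n where n: "n >= 1" "z ^ n = 1" using insert.prems[of z] unfolding torsion_def by (auto simp: Suc_le_eq)
 obtain j where j: "z = ze n ^ j" using torsion_power_of_root[OF ze n] by blast
 have 1: "ze (N * n) ^ N = ze n" using rootsD(3)[OF ze n(1) N(1)] .
 have 2: "ze (N * n) ^ n = ze N" using rootsD(3)[OF ze N(1) n(1)] by (simp add: mult.commute)
 show ?case proof (rule exI[of _ "N * n"], intro conjI ballI)
  show "N * n >= 1" using N(1) n(1) by simp
  fix y assume "y : insert z S"
  thus "EX j. y = ze (N * n) ^ j" proof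
   assume "y = z"
   thus ?thesis unfolding j 1[symmetric] power_mult[symmetric] by blast
  next
   assume "y : S"
   then obtain i where "y = ze N ^ i" using N(2) by blast
   thus ?thesis unfolding 2[symmetric] power_mult[symmetric] by blast
  qed
 qed
qed

section \<open>Finite order elements of one component\<close>

context fd_lie_superalgebra
begin

interpretation AG: group "Aut L" by (rule group_Aut)

definition joint :: "('a => 'a) => 'k => ('a => 'a) set => (('a => 'a) => int) => 'a set" where
 "joint s nu S ka = {z:V. s z = sc nu z & (ALL Y:S. Y z = sc (of_int (ka Y)) z)}"

lemma joint_lin:
 assumes "lin T" "comm T s" "!!Y. Y : S ==> comm T Y" "z : joint s nu S ka"
 shows "T z : joint s nu S ka" using assms(2-4) linD[OF assms(1)] unfolding joint_def comm_def by force

lemma joint_span: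
 assumes s: "lin s" "!!x. x : V ==> (s ^^ m) x = x" "m >= 1" and ze: "compatible_roots (ze :: nat => 'k)"
  and S: "finite S" "!!Y. Y : S ==> intss Y" "!!Y. Y : S ==> comm Y s" "!!Y Y'. Y : S ==> Y' : S ==> comm Y Y'"
 shows "V <= span (UN nu:{nu. nu ^ m = 1}. UN ka. joint s nu S ka)" using S proof (induction S)
 case empty
 show ?case proof
  fix x assume x: "x : V"
  note r = rootsD[OF ze s(3)]
  have "EX y. (ALL j. y j : V & s (y j) = sc (ze m ^ j) (y j)) & x = (SUM j<m. y j)"
   using s(3) by (intro finite_order_decomp[OF s(3) _ r(1,2) subspace_V linD(1-3)[OF s(1)] s(2) x]) auto
  then obtain y where y: "!!j. y j : V" "!!j. s (y j) = sc (ze m ^ j) (y j)" "x = (SUM j<m. y j)" by blast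
  have "(ze m ^ j) ^ m = (ze m ^ m) ^ j" for j unfolding power_mult[symmetric] by (simp only: mult.commute)
  hence 1: "(ze m ^ j) ^ m = 1" for j using r(1) by simp
  have "y j : (UN nu:{nu. nu ^ m = 1}. UN ka. joint s nu {} ka)" for j using y 1 unfolding joint_def by blast
  thus "x : span (UN nu:{nu. nu ^ m = 1}. UN ka. joint s nu {} ka)" unfolding y(3) by (intro span_sum span_base)
 qed
next
 case (insert Y S)
 let ?J = "%S. UN nu:{nu. nu ^ m = 1}. UN ka. joint s nu S ka"
 have Y: "intss Y" "lin Y" using insert.prems(1)[of Y] intssD by auto
 have "?J S <= span (?J (insert Y S))" proof
  fix z assume "z : ?J S"
  then obtain nu ka where z: "nu ^ m = 1" "z : joint s nu S ka" by blast
  have zV: "z : V" using z(2) unfolding joint_def by blast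
  have "gp Y mu z : span (?J (insert Y S))" for mu proof (cases "gp Y mu z = 0")
   case True
   thus ?thesis using span_zero by simp
  next
   case False
   have c: "gp Y mu (T x) = T (gp Y mu x)" if "lin T" "comm Y T" "x : V" for T x
    by (rule gp_commute[OF Y(2) that(1) _ that(3)]) (use that(2) in \<open>simp add: comm_def\<close>)
   have g: "gp Y mu z : joint s nu S ka" using c s(1) insert.prems(2)[of Y] insert.prems(1,3) intssD(2)
    by (intro joint_lin[OF gp_lin[OF Y(2)] _ _ z(2)]) (auto simp: comm_def)
   obtain n where n: "mu = of_int n" using intss_gen(2)[OF Y(1) gp_gen[OF Y(2) zV, of mu]] False by blast
   have "gp Y mu z : joint s nu (insert Y S) (ka(Y := n))"
    using g intss_gen(1)[OF Y(1) gp_gen[OF Y(2) zV, of mu]] insert.hyps n unfolding joint_def by auto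
   thus ?thesis using z(1) by (intro span_base) blast
  qed
  hence "(SUM mu:eigs Y. gp Y mu z) : span (?J (insert Y S))" by (intro span_sum)
  thus "z : span (?J (insert Y S))" unfolding gp_sum[OF Y(2) zV] .
 qed
 hence "span (?J S) <= span (?J (insert Y S))" by (metis span_mono span_span)
 moreover have "V <= span (?J S)" using insert by auto
 ultimately show ?case by (rule subset_trans[rotated])
qed

text \<open>The sum of \<open>b\<close> times \<open>Y\<close> over the list. It lets one torus with
  one parameter replace several tori whose parameters are powers of a common root of unity.\<close>

lemma combined_torus:
 assumes "!!Y b. (Y, b) : set l ==> intss Y" "!!Y b Y' b'. (Y, b) : set l ==> (Y', b') : set l ==> comm Y Y'"
 shows "EX H. intss H & (ALL T. lin T --> (ALL (Y,b):set l. comm T Y) --> comm T H)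
  & (ALL z:V. ALL ka. (ALL (Y,b):set l. Y z = sc (of_int (ka Y)) z) --> H z = sc (of_int (SUM (Y,b)<-l. b * ka Y)) z)" using assms
proof (induction l)
 case Nil
 show ?case using intss_zero by (intro exI[of _ "%x. 0"]) (auto simp: comm_def lin_0)
next
 case (Cons Yb l)
 obtain Y b where Yb: "Yb = (Y, b)" by (cases Yb)
 have "EX H. intss H & (ALL T. lin T --> (ALL (Y,b):set l. comm T Y) --> comm T H)
  & (ALL z:V. ALL ka. (ALL (Y,b):set l. Y z = sc (of_int (ka Y)) z) --> H z = sc (of_int (SUM (Y,b)<-l. b * ka Y)) z)"
  by (rule Cons.IH) (use Cons.prems in \<open>simp, fastforce\<close>)+
 then obtain H where H': "intss H & (ALL T. lin T --> (ALL (Y,b):set l. comm T Y) --> comm T H)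
  & (ALL z:V. ALL ka. (ALL (Y,b):set l. Y z = sc (of_int (ka Y)) z) --> H z = sc (of_int (SUM (Y,b)<-l. b * ka Y)) z)" by (rule exE)
 have H: "intss H" using H' by simp
 have Hc: "comm T H" if "lin T" "ALL (Y,b):set l. comm T Y" for T using H' that by simp
 have Hz: "H z = sc (of_int (SUM (Y,b)<-l. b * ka Y)) z" if "z : V" "ALL (Y,b):set l. Y z = sc (of_int (ka Y)) z" for z ka
  using H' that by simp
 have Y: "intss Y" using Cons.prems(1)[of Y b] Yb by simp
 have YH: "comm Y H" by (rule Hc[OF intssD(2)[OF Y]]) (use Cons.prems(2)[of Y b] Yb in auto)
 let ?H = "%x. sc (of_int 1) (H x) + sc (of_int b) (Y x)"
 show ?case proof (intro exI[of _ ?H] conjI allI impI ballI)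
  show "intss ?H" by (rule intss_comb[OF H Y]) (use YH in \<open>simp add: comm_def\<close>)
  fix T assume T: "lin T" "ALL (Y,b):set (Yb # l). comm T Y"
  hence 1: "comm T H" "comm T Y" using Hc[OF T(1)] unfolding Yb by auto
  show "comm T ?H" unfolding comm_def proof
   fix x assume x: "x : V"
   have "H x : V" "Y x : V" using linD(1)[OF intssD(2)[OF H] x] linD(1)[OF intssD(2)[OF Y] x] by auto
   thus "T (?H x) = ?H (T x)" using 1 x unfolding comm_def by (simp add: linD[OF T(1)])
  qed
 next
  fix z ka assume z: "z : V" "ALL (Y,b):set (Yb # l). Y z = sc (of_int (ka Y)) z"
  hence "H z = sc (of_int (SUM (Y,b)<-l. b * ka Y)) z" "Y z = sc (of_int (ka Y)) z" using Hz[OF z(1), of ka] unfolding Yb by auto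
  thus "?H z = sc (of_int (SUM (Y,b)<-Yb # l. b * ka Y)) z" by (simp add: Yb scale_left_distrib add.commute)
 qed
qed

lemma flows_joint:
 assumes "!!Y a. (Y, a) : set l ==> intss Y" "z : joint s nu S ka" "fst ` set l <= S"
 shows "flows l z = sc (PROD (Y,a)<-l. a powi ka Y) z" using assms proof (induction l)
 case (Cons Ya l)
 obtain Y a where Ya: "Ya = (Y, a)" by (cases Ya)
 have Y: "intss Y" "z : wt Y (ka Y)" "z : V" using Cons.prems(1)[of Y a] Cons.prems(2,3) unfolding Ya joint_def wt_def by auto
 have "flows l z = sc (PROD (Y,a)<-l. a powi ka Y) z" by (rule Cons.IH) (use Cons.prems in auto)
 thus ?case using Y(1) tor_wt[OF intssD(2)[OF Y(1)] Y(2), of a] linD(3)[OF tor_lin[OF intssD(2)[OF Y(1)]] Y(3)]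
  by (simp add: Ya flow_def mult.commute)
qed simp

lemma comm_expo:
 assumes S: "lin S" and n: "lin n" and c: "comm n S" shows "comm (expo N n) S" unfolding comm_def proof
 fix x assume x: "x : V"
 have p: "(n ^^ i) (S x) = S ((n ^^ i) x)" for i using c x linD(1)[OF lin_funpow[OF n] x] unfolding comm_def by (induction i) auto
 have V: "(n ^^ i) x : V" for i using linD(1)[OF lin_funpow[OF n] x] .
 show "expo N n (S x) = S (expo N n x)" unfolding expo_def p lin_sum[OF S V_scale[OF V]] linD(3)[OF S V] ..
qed

text \<open>The difference is \<open>n\<close> times a polynomial in \<open>n\<close>, and the two
  factors commute; hence its powers contain powers of \<open>n\<close>.\<close>

lemma xp_unipotent:
 assumes n: "lin n" "nilp n" shows "nilp (%x. xp n x - x)" proof (rule nilpI)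
 let ?p = "%x. SUM i<card B + 1. sc (1 / fact (Suc i)) ((n ^^ i) x)"
 have lp: "lin ?p" by (rule lin_sumT, rule lin_scaleT, rule lin_funpow[OF n(1)])
 have V: "(n ^^ i) x : V" if "x : V" for i x using linD(1)[OF lin_funpow[OF n(1)] that] .
 have eq: "xp n x - x = n (?p x)" if x: "x : V" for x proof -
  have N: "card B + 2 = Suc (card B + 1)" by simp
  have "xp n x = x + (SUM i<card B + 1. sc (1 / fact (Suc i)) (n ((n ^^ i) x)))"
   unfolding xp_def expo_def N sum.lessThan_Suc_shift by simp
  also have "(SUM i<card B + 1. sc (1 / fact (Suc i)) (n ((n ^^ i) x))) = n (?p x)"
   unfolding lin_sum[OF n(1) V_scale[OF V[OF x]]] linD(3)[OF n(1) V[OF x]] ..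
  finally show ?thesis by simp
 qed
 have pn: "?p (n x) = n (?p x)" if x: "x : V" for x
  unfolding lin_sum[OF n(1) V_scale[OF V[OF x]]] linD(3)[OF n(1) V[OF x]] by (simp add: funpow_swap1)
 show "lin (%x. xp n x - x)" unfolding xp_def by (rule lin_diffT[OF lin_expo[OF n(1)] lin_idT])
 fix x assume x: "x : V"
 have pk: "(?p ^^ k) (n y) = n ((?p ^^ k) y)" if y: "y : V" for y k proof (induction k)
  case (Suc k)
  show ?case unfolding funpow.simps comp_apply Suc by (rule pn[OF linD(1)[OF lin_funpow[OF lp] y]])
 qed simp
 have "((%x. xp n x - x) ^^ k) x = (?p ^^ k) ((n ^^ k) x)" for k proof (induction k)
  case (Suc k)
  have V': "(?p ^^ k) ((n ^^ k) x) : V" using linD(1)[OF lin_funpow[OF lp] V[OF x]] .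
  have "((%x. xp n x - x) ^^ Suc k) x = n (?p ((?p ^^ k) ((n ^^ k) x)))" unfolding funpow.simps comp_apply Suc by (rule eq[OF V'])
  also have "... = ?p (n ((?p ^^ k) ((n ^^ k) x)))" using pn[OF V'] by (rule sym)
  also have "... = (?p ^^ Suc k) ((n ^^ Suc k) x)" unfolding funpow.simps comp_apply pk[OF V[OF x]] ..
  finally show ?case .
 qed simp
 from this[of "card B"] show "EX k. ((%x. xp n x - x) ^^ k) x = 0" unfolding nilp_bound[OF n x] lin_0[OF lin_funpow[OF lp]] by (rule exI)
qed

text \<open>The calculus sees eigenvalues only. On a joint eigenspace the unipotent factor does not
  change them, the eigenvalue of \<open>s\<close> is a root of unity and is fixed by
  \<open>te\<close>, and the torus parameters are replaced by powers of one root of unity. The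
  result is conjugate, by the same \<open>g\<close>, to \<open>s\<close> times a single torus
  element of finite order.\<close>

lemma toral_fcalc:
 fixes ze :: "nat => 'k"
 assumes s: "s : G" "!!x. x : V ==> (s ^^ m) x = x" "m >= 1" and ze: "compatible_roots ze" and x: "x : G" "toral s x"
 shows "EX S. finite S & 0 ~: S & (ALL A te N. retraction_on A te --> S <= A --> N >= 1 --> (ALL a:S. EX j. te a = ze N ^ j) -->
  (EX g:G. EX H. intss H & comm H s & (ALL z:V. fcalc x te (g z) = g (s (tor H (ze N) z)))))" proof -
 note T = G_lin[OF s(1)]
 note X = G_lin[OF x(1)]
 obtain g l n where g: "g : G" and l: "ALL (Y,a):set l. intss Y & comm Y s & a ~= 0 & comm n Y & (ALL (Y',_):set l. comm Y Y')"
  and n: "lin n" "nilp n" "comm n s" and xg: "ALL z:V. x (g z) = g (s (flows l (xp n z)))"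
  using x(2) unfolding toral_def by (elim bexE exE conjE)
 note GL = G_lin[OF g]
 have lY: "intss Y" "comm Y s" "a ~= 0" "comm n Y" if "(Y, a) : set l" for Y a using l that by auto
 have lYY: "comm Y Y'" if "(Y, a) : set l" "(Y', a') : set l" for Y a Y' a' using l that by fastforce
 have LF: "lin (flows l)" by (rule autD(1)[OF flows_aut(1)]) (use lY in \<open>auto simp: integr_def dest: intssD\<close>)
 have LX: "lin (xp n)" unfolding xp_def by (rule lin_expo[OF n(1)])
 show ?thesis proof (intro exI[of _ "snd ` set l"] conjI allI impI)
  show "0 ~: snd ` set l" using lY(3) by auto
  fix A te N assume te: "retraction_on A te" and lA: "snd ` set l <= A" and N: "N >= 1" and j: "ALL a:snd ` set l. EX j. te a = ze N ^ j"
  note D = retraction_onD[OF te]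
  obtain e where e: "!!a. a : snd ` set l ==> te a = ze N ^ e a" using j by metis
  \<comment> \<open>The exponents of the retracted parameters become the integer coefficients of the
    combined torus \<open>H\<close>.\<close>
  define l' where "l' = map (%(Y,a). (Y, int (e a))) l"
  have l': "EX a. (Y, a) : set l" if "(Y, b) : set l'" for Y b using that unfolding l'_def by auto
  have "EX H. intss H & (ALL T. lin T --> (ALL (Y,b):set l'. comm T Y) --> comm T H)
   & (ALL z:V. ALL ka. (ALL (Y,b):set l'. Y z = sc (of_int (ka Y)) z) --> H z = sc (of_int (SUM (Y,b)<-l'. b * ka Y)) z)"
   by (rule combined_torus) (use l' lY(1) lYY in meson)+
  then obtain H where H': "intss H & (ALL T. lin T --> (ALL (Y,b):set l'. comm T Y) --> comm T H)
   & (ALL z:V. ALL ka. (ALL (Y,b):set l'. Y z = sc (of_int (ka Y)) z) --> H z = sc (of_int (SUM (Y,b)<-l'. b * ka Y)) z)" by (rule exE)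
  have H: "intss H" using H' by simp
  have sl': "ALL (Y,b):set l'. comm s Y" using l' lY(2) comm_sym by fast
  have "comm s H" using H' T sl' by simp
  hence Hs: "comm H s" by (rule iffD1[OF comm_sym])
  have TH: "lin (tor H (ze N))" by (rule tor_lin[OF intssD(2)[OF H]])
  have joint: "fcalc x te (g z) = g (s (tor H (ze N) z))" if z: "nu ^ m = 1" "z : joint s nu (fst ` set l) ka" for nu ka z proof -
   let ?E = "joint s nu (fst ` set l) ka"
   have tl: "torsion nu" unfolding torsion_def using z(1) s(3) by (intro exI[of _ m]) auto
   have EV: "w : V" "s w = sc nu w" if "w : ?E" for w using that unfolding joint_def by auto
   define mu where "mu = nu * (PROD (Y,a)<-l. a powi ka Y)"
   let ?r = "%x. xp n x - x"
   have rE: "?r w : ?E" "xp n w : ?E" if w: "w : ?E" for w proof -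
    have c: "comm (xp n) S" if "comm n S" "lin S" for S unfolding xp_def by (rule comm_expo[OF that(2) n(1) that(1)])
    have Y: "comm n Y" "lin Y" if "Y : fst ` set l" for Y using that lY(1,4) intssD(2) by auto
    show xw: "xp n w : ?E" by (rule joint_lin[OF LX c[OF n(3) T] c[OF Y] w])
    have "xp n w : V" "w : V" using EV(1) w xw by auto
    thus "?r w : ?E" using xw w Y(2) unfolding joint_def by (auto simp: lin_diff[OF T] lin_diff scale_right_diff_distrib)
   qed
   have rk: "(?r ^^ k) z : ?E" for k using z(2) rE(1) by (induction k) auto
   \<comment> \<open>Apart from the scalar \<open>mu\<close> only the unipotent factor acts, so the
     shift is the nilpotent map \<open>?r\<close> up to conjugation and scaling; hence
     \<open>g z\<close> is a generalised eigenvector.\<close>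
   have step: "shift x mu (g w) = sc mu (g (?r w))" if w: "w : ?E" for w proof -
    have wV: "w : V" "xp n w : V" using EV(1) w rE(2)[OF w] by auto
    have "flows l (xp n w) = sc (PROD (Y,a)<-l. a powi ka Y) (xp n w)" by (rule flows_joint[OF lY(1) rE(2)[OF w]]) auto
    hence "x (g w) = g (sc mu (xp n w))" using xg wV EV(2)[OF rE(2)[OF w]] unfolding mu_def by (simp add: linD(3)[OF T] mult.commute)
    thus ?thesis unfolding shift_def using wV by (simp add: linD(3)[OF GL] lin_diff[OF GL] scale_right_diff_distrib)
   qed
   have "(shift x mu ^^ k) (g z) = sc (mu ^ k) (g ((?r ^^ k) z))" for k proof (induction k)
    case (Suc k)
    have "g ((?r ^^ k) z) : V" using EV(1)[OF rk] G_V[OF g] by blast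
    thus ?case using Suc step[OF rk] by (simp add: linD(3)[OF lin_shift[OF X]] mult.commute)
   qed simp
   moreover obtain k where "(?r ^^ k) z = 0" using xp_unipotent[OF n(1,2)] EV(1)[OF z(2)] unfolding nilp_def by blast
   ultimately have "(shift x mu ^^ k) (g z) = 0" using lin_0[OF GL] by simp
   hence "g z : gen x mu" using gen_I[OF G_V[OF g EV(1)[OF z(2)]]] by blast
   hence 1: "fcalc x te (g z) = sc (te mu) (g z)" by (rule fcalc_gen[OF X])
   have "(PROD (Y,a)<-l1. a powi ka Y) : A & te (PROD (Y,a)<-l1. a powi ka Y) = ze N powi (SUM (Y,b)<-map (%(Y,a). (Y, int (e a))) l1. b * ka Y)"
    if "set l1 <= set l" for l1 using that proof (induction l1)
    case Nil
    thus ?case using D(2,3)[OF torsion_1] by simp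
   next
    case (Cons Ya l1)
    obtain Y a where Ya: "Ya = (Y, a)" by (cases Ya)
    have a: "a : A" "te a = ze N ^ e a" using Cons.prems lA e[of a] unfolding Ya by force+
    have "(ze N ^ e a) powi ka Y = ze N powi (int (e a) * ka Y)" unfolding power_int_mult by simp
    thus ?case using Cons retraction_on_powi[OF te a(1), of "ka Y"] a(2) rootsD(4)[OF ze N] D(6,7) by (simp add: Ya power_int_add)
   qed
   from this[of l] have 2: "te mu = nu * ze N powi (SUM (Y,b)<-l'. b * ka Y)"
    unfolding mu_def l'_def using D(7)[OF D(2)[OF tl]] D(3)[OF tl] by simp
   have "H z = sc (of_int (SUM (Y,b)<-l'. b * ka Y)) z" proof -
    have "ALL (Y,b):set l'. Y z = sc (of_int (ka Y)) z" using z(2) unfolding l'_def joint_def by auto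
    thus ?thesis using H' EV(1)[OF z(2)] by simp
   qed
   hence "z : wt H (SUM (Y,b)<-l'. b * ka Y)" using EV(1)[OF z(2)] unfolding wt_def by simp
   hence "tor H (ze N) z = sc (ze N powi (SUM (Y,b)<-l'. b * ka Y)) z" by (rule tor_wt[OF intssD(2)[OF H]])
   thus ?thesis unfolding 1 2 using EV[OF z(2)] by (simp add: linD(3)[OF T] linD(3)[OF GL] mult.commute)
  qed
  show "EX g:G. EX H. intss H & comm H s & (ALL z:V. fcalc x te (g z) = g (s (tor H (ze N) z)))"
  proof (intro bexI[OF _ g] exI[of _ H] conjI ballI H Hs)
   fix z assume z: "z : V"
   let ?J = "UN nu:{nu. nu ^ m = 1}. UN ka. joint s nu (fst ` set l) ka"
   have JV: "?J <= V" unfolding joint_def by auto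
   show "fcalc x te (g z) = g (s (tor H (ze N) z))" proof (rule span_induct_V[of ?J z "%z. fcalc x te (g z) = g (s (tor H (ze N) z))"])
    show "V <= span ?J" by (rule joint_span[OF T s(2,3) ze]) (use lY lYY in auto)
   next
    fix c y assume "y : ?J"
    then obtain nu ka where "nu ^ m = 1" "y : joint s nu (fst ` set l) ka" by blast
    moreover from this(2) have "sc c y : joint s nu (fst ` set l) ka"
     using lY(1) intssD(2) unfolding joint_def by (auto simp: linD(3)[OF T] linD(3) mult.commute)
    ultimately show "sc c y : ?J" by blast
   next
    show "fcalc x te (g 0) = g (s (tor H (ze N) 0))" by (simp add: lin_0[OF GL] lin_0[OF T] lin_0[OF TH] lin_0[OF fcalc_lin[OF X]])
   next
    fix y assume "y : ?J"
    thus "fcalc x te (g y) = g (s (tor H (ze N) y))" using joint by blast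
   next
    fix a b assume "a : V" "b : V"
    thus "fcalc x te (g a) = g (s (tor H (ze N) a)) ==> fcalc x te (g b) = g (s (tor H (ze N) b)) ==>
     fcalc x te (g (a + b)) = g (s (tor H (ze N) (a + b)))" by (simp add: linD[OF GL] linD[OF T] linD[OF TH] linD[OF fcalc_lin[OF X]])
   qed (use JV z in auto)
  qed
 qed simp
qed

text \<open>The two families meet in some \<open>x\<close>. The operator \<open>fcalc x te\<close>
  depends on \<open>x\<close> alone and is computed from each family, with one retraction and one
  order \<open>N\<close> serving the parameters of both.\<close>

theorem conjugate_up_to_torus:
 fixes ze :: "nat => 'k"
 assumes ze: "compatible_roots ze" and s: "s : G" "!!x. x : V ==> (s ^^ m) x = x" "m >= 1"
  and t: "t : G" "!!x. x : V ==> (t ^^ n) x = x" "n >= 1" and C: "connectedin (zariski L) C" "s : C" "t : C"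
 shows "EX g:G. EX H K N. N >= 1 & intss H & comm H s & intss K & comm K t
  & (ALL z:V. g (s (tor H (ze N) z)) = t (tor K (ze N) (g z)))" proof -
 obtain I v0 and Ps :: "(nat \<times> ('a => 'a) => 'k) => 'a => 'a" where Ps: "submersive I Ps v0" "s : range Ps" "ALL v. toral s (Ps v)"
  proof -
  have "EX I (Ps :: (nat \<times> ('a => 'a) => 'k) => 'a => 'a) v0. submersive I Ps v0 & s : range Ps & (ALL v. toral s (Ps v))"
   by (rule submersive_family[OF s ze])
  thus ?thesis using that by (elim exE conjE) simp
 qed
 obtain J w0 and Ph :: "(nat \<times> ('a => 'a) => 'k) => 'a => 'a" where Ph: "submersive J Ph w0" "t : range Ph" "ALL v. toral t (Ph v)"
  proof -
  have "EX I (Ps :: (nat \<times> ('a => 'a) => 'k) => 'a => 'a) v0. submersive I Ps v0 & t : range Ps & (ALL v. toral t (Ps v))"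
   by (rule submersive_family[OF t ze])
  thus ?thesis using that by (elim exE conjE) simp
 qed
 obtain u where u: "s = Ps u" using Ps(2) by (rule rangeE)
 obtain u' where u': "t = Ph u'" using Ph(2) by (rule rangeE)
 have "range Ps \<inter> range Ph ~= {}" by (rule families_meet[OF Ps(1) Ps(1) Ph(1) C(1)]) (use C(2,3) u u' in simp_all)
 then obtain x where "x : range Ps \<inter> range Ph" by (meson ex_in_conv)
 then obtain v v' where x: "x = Ps v" "x = Ph v'" by (elim IntE rangeE)
 have xG: "x : G" unfolding x(1) by (rule submersiveD(3)[OF Ps(1)])
 have ts: "toral s x" "toral t x" using spec[OF Ps(3), of v] spec[OF Ph(3), of v'] unfolding x[symmetric] .
 obtain S where S: "finite S" "0 ~: S" and S': "ALL A te N. retraction_on A te --> S <= A --> N >= 1 --> (ALL a:S. EX j. te a = ze N ^ j) -->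
  (EX g:G. EX H. intss H & comm H s & (ALL z:V. fcalc x te (g z) = g (s (tor H (ze N) z))))" proof -
  have "EX S. finite S & 0 ~: S & (ALL A te N. retraction_on A te --> S <= A --> N >= 1 --> (ALL a:S. EX j. te a = ze N ^ j) -->
   (EX g:G. EX H. intss H & comm H s & (ALL z:V. fcalc x te (g z) = g (s (tor H (ze N) z)))))" by (rule toral_fcalc[OF s ze xG ts(1)])
  thus ?thesis using that by (elim exE conjE) simp
 qed
 obtain U where U: "finite U" "0 ~: U" and U': "ALL A te N. retraction_on A te --> U <= A --> N >= 1 --> (ALL a:U. EX j. te a = ze N ^ j) -->
  (EX g:G. EX H. intss H & comm H t & (ALL z:V. fcalc x te (g z) = g (t (tor H (ze N) z))))" proof -
  have "EX S. finite S & 0 ~: S & (ALL A te N. retraction_on A te --> S <= A --> N >= 1 --> (ALL a:S. EX j. te a = ze N ^ j) -->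
   (EX g:G. EX H. intss H & comm H t & (ALL z:V. fcalc x te (g z) = g (t (tor H (ze N) z)))))" by (rule toral_fcalc[OF t ze xG ts(2)])
  thus ?thesis using that by (elim exE conjE) simp
 qed
 obtain A te where A: "retraction_on A te" "S \<union> U <= A" using retraction_exists[of "S \<union> U"] S U by auto
 have "EX N>=1. ALL z:te ` (S \<union> U). EX j. z = ze N ^ j"
  by (rule torsion_common_root[OF ze]) (use S(1) U(1) A(2) retraction_onD(5)[OF A(1)] in auto)
 then obtain N where N: "N >= 1" "ALL z:te ` (S \<union> U). EX j. z = ze N ^ j" by blast
 have "EX g:G. EX H. intss H & comm H s & (ALL z:V. fcalc x te (g z) = g (s (tor H (ze N) z)))"
  by (rule S'[rule_format, OF A(1)]) (use A(2) N in auto)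
 then obtain g H where g: "g : G" "intss H" "comm H s" "!!z. z : V ==> fcalc x te (g z) = g (s (tor H (ze N) z))"
  by (elim bexE exE conjE) simp
 have "EX g:G. EX H. intss H & comm H t & (ALL z:V. fcalc x te (g z) = g (t (tor H (ze N) z)))"
  by (rule U'[rule_format, OF A(1)]) (use A(2) N in auto)
 then obtain h K where h: "h : G" "intss K" "comm K t" "!!z. z : V ==> fcalc x te (h z) = h (t (tor K (ze N) z))"
  by (elim bexE exE conjE) simp
 let ?g = "ginv h \<cdot> g"
 have hi: "ginv h : G" using h(1) by simp
 show ?thesis proof (rule bexI[of _ ?g], rule exI[of _ H], rule exI[of _ K], rule exI[of _ N], intro conjI ballI N(1) g(2,3) h(2,3))
  show "?g : G" using hi g(1) by simp
  fix z assume z: "z : V"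
  have gz: "?g y = (ginv h) (g y)" if "y : V" for y using Aut_mult[OF hi g(1) that] .
  have V: "s (tor H (ze N) z) : V" using G_V[OF s(1) linD(1)[OF tor_lin[OF intssD(2)[OF g(2)]] z]] .
  have gzV: "?g z : V" unfolding gz[OF z] using G_V[OF hi G_V[OF g(1) z]] .
  have W: "t (tor K (ze N) (?g z)) : V" using G_V[OF t(1) linD(1)[OF tor_lin[OF intssD(2)[OF h(2)]] gzV]] .
  have e: "h (?g z) = g z" unfolding gz[OF z] by (rule Aut_inv(2)[OF h(1) G_V[OF g(1) z]])
  have "?g (s (tor H (ze N) z)) = (ginv h) (g (s (tor H (ze N) z)))" by (rule gz[OF V])
  also have "g (s (tor H (ze N) z)) = h (t (tor K (ze N) (?g z)))" unfolding g(4)[OF z, symmetric] e[symmetric] by (rule h(4)[OF gzV])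
  also have "(ginv h) (h (t (tor K (ze N) (?g z)))) = t (tor K (ze N) (?g z))" by (rule Aut_inv(1)[OF h(1) W])
  finally show "?g (s (tor H (ze N) z)) = t (tor K (ze N) (?g z))" .
 qed
qed

end

section \<open>The group of components\<close>

context fd_lie_superalgebra
begin

interpretation AG: group "Aut L" by (rule group_Aut)

abbreviation "conn \<equiv> connected_component_of (zariski L)"

lemma conn_G: "conn x y ==> x : G & y : G" using connected_component_in_topspace[of "zariski L" x y] topspace_zariski by blast

lemma conn_translate:
 assumes xy: "conn x y" and g: "g : G"
 shows "conn (g \<cdot> x) (g \<cdot> y)" "conn (x \<cdot> g) (y \<cdot> g)" proof -
 obtain C where C: "connectedin (zariski L) C" "x : C" "y : C" using xy unfolding connected_component_of_def by blast
 show "conn (g \<cdot> x) (g \<cdot> y)"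
  unfolding connected_component_of_def using connected_translate(1)[OF C(1) g] C(2,3) by (intro exI conjI) auto
 show "conn (x \<cdot> g) (y \<cdot> g)"
  unfolding connected_component_of_def using connected_translate(2)[OF C(1) g] C(2,3) by (intro exI conjI) auto
qed

lemma Aut0_iff: "x : Aut0 L \<longleftrightarrow> conn gone x" unfolding Aut0_def by simp

lemma conn_refl: "x : G ==> conn x x" by (simp add: connected_component_of_refl topspace_zariski)

text \<open>Continuity of translations is enough: closure under inverses follows by translating a
  connected set through the unit and \<open>x\<close> by the inverse of \<open>x\<close>.\<close>

lemma normal_Aut0: "Aut0 L \<lhd> Aut L" unfolding AG.normal_inv_iff proof (intro conjI ballI)
 show "subgroup (Aut0 L) (Aut L)" proof
  show "Aut0 L <= G" unfolding subset_iff Aut0_iff using conn_G by blast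
  show "gone : Aut0 L" unfolding Aut0_iff by (rule conn_refl) simp
 next
  fix x y assume "x : Aut0 L" "y : Aut0 L"
  hence xy: "conn gone x" "conn gone y" unfolding Aut0_iff .
  hence G: "x : G" "y : G" using conn_G by blast+
  have "conn (gone \<cdot> y) (x \<cdot> y)" using conn_translate(2)[OF xy(1) G(2)] .
  hence "conn y (x \<cdot> y)" using G(2) by simp
  thus "x \<cdot> y : Aut0 L" unfolding Aut0_iff using xy(2) connected_component_of_trans by metis
 next
  fix x assume "x : Aut0 L"
  hence x: "conn gone x" unfolding Aut0_iff .
  hence G: "x : G" using conn_G by blast
  have "conn (ginv x \<cdot> gone) (ginv x \<cdot> x)" using G by (intro conn_translate(1)[OF x]) simp
  hence "conn (ginv x) gone" using G by simp
  thus "ginv x : Aut0 L" unfolding Aut0_iff by (simp only: connected_component_of_sym)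
 qed
next
 fix g h assume g: "g : G" and "h : Aut0 L"
 hence h: "conn gone h" unfolding Aut0_iff by simp
 hence hG: "h : G" using conn_G by blast
 have "conn (g \<cdot> gone \<cdot> ginv g) (g \<cdot> h \<cdot> ginv g)"
  using g by (intro conn_translate(2)[OF conn_translate(1)[OF h]]) auto
 thus "g \<cdot> h \<cdot> ginv g : Aut0 L" unfolding Aut0_iff using g by simp
qed

lemma comp_class_eq_iff:
 assumes x: "x : G" and y: "y : G"
 shows "comp_class L x = comp_class L y \<longleftrightarrow> conn x y" proof
 note sub = normal_imp_subgroup[OF normal_Aut0]
 assume "comp_class L x = comp_class L y"
 hence "x : Aut0 L #>\<^bsub>Aut L\<^esub> y" unfolding comp_class_def using AG.rcos_self[OF x sub] by simp
 then obtain a where a: "a : Aut0 L" "x = a \<cdot> y" unfolding r_coset_def by blast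
 have "conn (gone \<cdot> y) (a \<cdot> y)" using a(1) y unfolding Aut0_iff by (rule conn_translate(2))
 hence "conn y x" using y a(2) by simp
 thus "conn x y" by (simp only: connected_component_of_sym)
next
 note sub = normal_imp_subgroup[OF normal_Aut0]
 assume "conn x y"
 hence "conn (x \<cdot> ginv x) (y \<cdot> ginv x)" using x by (intro conn_translate(2)) auto
 hence a: "y \<cdot> ginv x : Aut0 L" unfolding Aut0_iff using x by simp
 have "(y \<cdot> ginv x) \<cdot> x = y" using x y by (simp add: AG.m_assoc)
 hence "y : Aut0 L #>\<^bsub>Aut L\<^esub> x" unfolding r_coset_def using a by (auto intro!: bexI[OF _ a])
 thus "comp_class L x = comp_class L y" unfolding comp_class_def by (rule AG.repr_independence[OF _ x sub])
qed

lemma comp_hom: "group_hom (Aut L) (comp_group L) (comp_class L)" proof -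
 have "comp_class L = (%a. Aut0 L #>\<^bsub>Aut L\<^esub> a)" unfolding comp_class_def by simp
 hence "comp_class L : hom (Aut L) (comp_group L)" unfolding comp_group_def using normal.r_coset_hom_Mod[OF normal_Aut0] by simp
 moreover have "group (comp_group L)" unfolding comp_group_def by (rule normal.factorgroup_is_group[OF normal_Aut0])
 ultimately show ?thesis by (intro group_hom.intro group_hom_axioms.intro AG.is_group)
qed

lemma conjugate_comp_iff:
 assumes s: "s : G" and t: "t : G"
 shows "conjugate_in (comp_group L) (comp_class L s) (comp_class L t)
  \<longleftrightarrow> (EX h:G. conn s (h \<cdot> t \<cdot> ginv h))" proof -
 interpret CH: group_hom "Aut L" "comp_group L" "comp_class L" by (rule comp_hom)
 have "carrier (comp_group L) = comp_class L ` G" unfolding comp_group_def FactGroup_def RCOSETS_def comp_class_def by auto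
 moreover have "comp_class L s = comp_class L h \<otimes>\<^bsub>comp_group L\<^esub> comp_class L t \<otimes>\<^bsub>comp_group L\<^esub> inv\<^bsub>comp_group L\<^esub> comp_class L h
  \<longleftrightarrow> conn s (h \<cdot> t \<cdot> ginv h)" if h: "h : G" for h proof -
  have "comp_class L h \<otimes>\<^bsub>comp_group L\<^esub> comp_class L t \<otimes>\<^bsub>comp_group L\<^esub> inv\<^bsub>comp_group L\<^esub> comp_class L h
   = comp_class L (h \<cdot> t \<cdot> ginv h)" using h t by simp
  thus ?thesis using comp_class_eq_iff[OF s, of "h \<cdot> t \<cdot> ginv h"] h t by simp
 qed
 ultimately show ?thesis unfolding conjugate_in_def by simp
qed

lemma inv_comp_class: "t : G ==> inv\<^bsub>comp_group L\<^esub> comp_class L t = comp_class L (ginv t)"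
 using group_hom.hom_inv[OF comp_hom] by simp

lemma Aut_pow: "s : G ==> x : V ==> (s [^]\<^bsub>Aut L\<^esub> (n::nat)) x = (s ^^ n) x" proof (induction n arbitrary: x)
 case 0
 thus ?case using Aut_one by simp
next
 case (Suc n)
 thus ?case using Aut_mult[of "s [^]\<^bsub>Aut L\<^esub> n" s x] G_V by (simp add: funpow_swap1)
qed

end

abbreviation "lk == Poly_Mapping.lookup"
abbreviation "sg == Poly_Mapping.single"
abbreviation "ks == Poly_Mapping.keys"

section \<open>Evaluation of loops\<close>

lemma laurent_poly:
 fixes c :: "int => 'k::field"
 assumes "finite S"
 obtains M p where "!!a. a ~= 0 ==> poly p a = a ^ M * (SUM i:S. c i * a powi i)" "!!i. i : S ==> EX n. coeff p n = c i" proof -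
 define M where "M = nat (SUM i:S. \<bar>i\<bar>)"
 have M: "i + int M >= 0" if "i : S" for i using member_le_sum[OF that, of "%i. \<bar>i\<bar>"] assms unfolding M_def by auto
 define p where "p = (SUM i:S. monom (c i) (nat (i + int M)))"
 have 1: "poly p a = a ^ M * (SUM i:S. c i * a powi i)" if a: "a ~= 0" for a proof -
  have "c i * a ^ nat (i + int M) = a ^ M * (c i * a powi i)" if i: "i : S" for i proof -
   have "a ^ nat (i + int M) = a powi (i + int M)" using M[OF i] by (simp add: power_int_def)
   thus ?thesis using a by (simp add: power_int_add mult_ac)
  qed
  thus ?thesis unfolding p_def poly_sum poly_monom sum_distrib_left by (rule sum.cong[OF refl])
 qed
 have 2: "coeff p (nat (i + int M)) = c i" if i: "i : S" for i proof -
  have "coeff p (nat (i + int M)) = (SUM j:S. if j = i then c j else 0)"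
   unfolding p_def coeff_sum coeff_monom using M i by (intro sum.cong refl) (auto simp: nat_eq_iff)
  thus ?thesis using i assms by simp
 qed
 show ?thesis using that 1 2 by blast
qed

lemma laurent_zero:
 fixes c :: "int => 'k::field_char_0"
 assumes S: "finite S" and 0: "!!a. a ~= 0 ==> (SUM i:S. c i * a powi i) = 0" and i: "i : S"
 shows "c i = 0" proof -
 obtain M p where p: "!!a. a ~= 0 ==> poly p a = a ^ M * (SUM i:S. c i * a powi i)" "!!i. i : S ==> EX n. coeff p n = c i"
  by (rule laurent_poly[OF S, of c]) blast
 have "poly (pCons 0 p) t = 0" for t using p(1)[of t] 0[of t] by (cases "t = 0") auto
 hence "pCons 0 p = 0" by (rule poly_zero_fun)
 thus ?thesis using p(2)[OF i] by auto
qed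

text \<open>Units of the ring of Laurent polynomials are monomials: after removal of the factor at
  \<open>0\<close> the numerator has no root, so it is constant.\<close>

lemma laurent_nonvanishing:
 fixes c :: "int => 'k::{alg_closed_field,field_char_0}"
 assumes S: "finite S" and nz: "!!a. a ~= 0 ==> (SUM i:S. c i * a powi i) ~= 0"
 shows "EX al r. al ~= 0 & (ALL a. a ~= 0 --> (SUM i:S. c i * a powi i) = al * a powi r)" proof -
 obtain M p where p: "!!a. a ~= 0 ==> poly p a = a ^ M * (SUM i:S. c i * a powi i)" by (rule laurent_poly[OF S, of c]) blast
 have "p ~= 0" using p[of 1] nz[of 1] by auto
 then obtain q where q: "p = [:- 0, 1:] ^ Polynomial.order 0 p * q" "\<not> [:- 0, 1:] dvd q" using order_decomp by blast
 have "poly q a ~= 0" for a proof (cases "a = 0")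
  case True
  thus ?thesis using q(2) by (metis poly_eq_0_iff_dvd)
 next
  case False
  hence "poly p a ~= 0" using p[of a] nz[of a] by simp
  thus ?thesis using q(1) by (metis mult_zero_right poly_mult)
 qed
 hence "degree q = 0" using alg_closed_imp_poly_has_root[of q] by blast
 then obtain al where al: "q = [:al:]" by (rule degree_eq_zeroE)
 have "(SUM i:S. c i * a powi i) = al * a powi (int (Polynomial.order 0 p) - int M)" if a: "a ~= 0" for a proof -
  have "a ^ M * (SUM i:S. c i * a powi i) = a ^ Polynomial.order 0 p * al"
   using p[OF a] by (subst (asm) q(1)) (simp add: al poly_power mult.commute)
  thus ?thesis using a by (simp add: power_int_diff field_simps)
 qed
 moreover have "al ~= 0" using `!!a. poly q a ~= 0`[of 0] al by simp
 ultimately show ?thesis by blast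
qed

context fd_lie_superalgebra
begin

definition VL :: "(int \<Rightarrow>\<^sub>0 'a) set" where
 "VL = {u. ALL i. lk u i : V}"

text \<open>The homomorphism that substitutes the scalar \<open>a\<close> for the loop
  variable.\<close>

definition ev :: "'k => (int \<Rightarrow>\<^sub>0 'a) => 'a" where
 "ev a u = (SUM i:ks u. sc (a powi i) (lk u i))"

abbreviation "smul c \<equiv> Poly_Mapping.map (sc c)"

definition lbr :: "(int \<Rightarrow>\<^sub>0 'a) => (int \<Rightarrow>\<^sub>0 'a) => int \<Rightarrow>\<^sub>0 'a" where
 "lbr u v = (SUM i:ks u. SUM j:ks v.
  sg (i + j) (br (lk u i) (lk v j)))"

lemma VL_lookup: "u : VL ==> lk u i : V" unfolding VL_def by simp

lemma lookup_smul: "lk (smul c u) i = sc c (lk u i)" by (simp add: Poly_Mapping.map.rep_eq when_def)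

lemma VL_add: "u : VL ==> v : VL ==> u + v : VL" unfolding VL_def by (simp add: lookup_add)

lemma VL_smul: "u : VL ==> smul c u : VL" unfolding VL_def by (simp add: lookup_smul)

lemma VL_single: "x : V ==> sg i x : VL" unfolding VL_def by (simp add: lookup_single when_def)

lemma VL_zero: "0 : VL" unfolding VL_def by simp

lemma VL_sum: "(!!i. i : I ==> u i : VL) ==> sum u I : VL" by (induction I rule: infinite_finite_induct) (auto simp: VL_zero VL_add)

lemma VL_lbr: "u : VL ==> v : VL ==> lbr u v : VL" unfolding lbr_def by (intro VL_sum VL_single br_V VL_lookup)

lemma ev_superset:
 assumes "finite S" "ks u <= S"
 shows "ev a u = (SUM i:S. sc (a powi i) (lk u i))" unfolding ev_def using assms by (intro sum.mono_neutral_left) (auto simp: in_keys_iff)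

lemma ev_V: "u : VL ==> ev a u : V" unfolding ev_def by (intro V_sum V_scale VL_lookup)

lemma ev_0: "ev a 0 = 0" unfolding ev_def by simp

lemma ev_add: "ev a (u + v) = ev a u + ev a v" proof -
 let ?S = "ks u \<union> ks v"
 have "ev a (u + v) = (SUM i:?S. sc (a powi i) (lk (u + v) i))" by (rule ev_superset) (auto dest: set_mp[OF Poly_Mapping.keys_add])
 also have "... = ev a u + ev a v" using ev_superset[of ?S u a] ev_superset[of ?S v a]
  by (simp add: lookup_add scale_right_distrib sum.distrib)
 finally show ?thesis .
qed

lemma ev_sum: "ev a (sum u I) = (SUM i:I. ev a (u i))" by (induction I rule: infinite_finite_induct) (auto simp: ev_0 ev_add)

lemma ev_smul: "ev a (smul c u) = sc c (ev a u)" proof -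
 have "ev a (smul c u) = (SUM i:ks u. sc (a powi i) (lk (smul c u) i))" by (rule ev_superset) (auto simp: in_keys_iff lookup_smul)
 thus ?thesis unfolding ev_def lookup_smul by (simp add: scale_sum_right mult.commute)
qed

lemma ev_single: "ev a (sg i x) = sc (a powi i) x" unfolding ev_def by (cases "x = 0") simp_all

text \<open>Coordinates of loops are Laurent polynomials and hence determined by their values at
  nonzero scalars. Identities between loops are checked in this way below.\<close>

lemma ev_inj:
 assumes u: "u : VL" and v: "v : VL" and eq: "!!a. a ~= 0 ==> ev a u = ev a v"
 shows "u = v" proof (rule poly_mapping_eqI)
 fix k
 let ?S = "insert k (ks u \<union> ks v)"
 note uV = VL_lookup[OF u] and vV = VL_lookup[OF v]
 have "crd b (lk u k) - crd b (lk v k) = 0" for b proof (rule laurent_zero[of ?S])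
  fix a :: 'k assume a: "a ~= 0"
  have crd: "crd b (ev a w) = (SUM i:?S. crd b (lk w i) * a powi i)" if w: "w : VL" "ks w <= ?S" for w
   using ev_superset[of ?S w a] w by (simp add: crd_sum' crd_scale VL_lookup crd_add V_sum mult.commute)
  have "crd b (ev a u) = crd b (ev a v)" using eq[OF a] by simp
  hence "(SUM i:?S. crd b (lk u i) * a powi i) = (SUM i:?S. crd b (lk v i) * a powi i)"
   using crd[OF u] crd[OF v] by (metis (no_types, lifting) Un_upper1 Un_upper2 subset_insertI2)
  thus "(SUM i:?S. (crd b (lk u i) - crd b (lk v i)) * a powi i) = 0" by (simp only: left_diff_distrib sum_subtractf) simp
 qed auto
 hence "crd b (lk u k) = crd b (lk v k)" for b by simp
 thus "lk u k = lk v k" by (subst crd_sum[OF uV, symmetric], subst crd_sum[OF vV, symmetric]) simp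
qed

lemma ev_lbr:
 assumes u: "u : VL" and v: "v : VL" and a: "a ~= 0"
 shows "ev a (lbr u v) = br (ev a u) (ev a v)" proof -
 note uV = VL_lookup[OF u] and vV = VL_lookup[OF v]
 have "br (ev a u) (ev a v) = (SUM i:ks u. br (sc (a powi i) (lk u i)) (ev a v))"
  unfolding ev_def[of a u] by (rule lin_sum[OF br_lin_left[OF ev_V[OF v]] V_scale[OF uV]])
 also have "... = (SUM i:ks u. SUM j:ks v.
   br (sc (a powi i) (lk u i)) (sc (a powi j) (lk v j)))"
  unfolding ev_def[of a v] lin_sum[OF br_lin_right[OF V_scale[OF uV]] V_scale[OF vV]] ..
 also have "... = ev a (lbr u v)" unfolding lbr_def ev_sum ev_single using a uV vV
  by (simp add: brkt_scal_left brkt_scal_right power_int_add mult.commute)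
 finally show ?thesis by simp
qed

section \<open>Loop algebras\<close>

abbreviation "loop ze s m \<equiv> loop_algebra ze L s m"
abbreviation "loops ze s m \<equiv> carrier (loop ze s m)"

lemma loop_simps:
 shows loop_scal: "scal (loop ze s m) c = smul c" and loop_brkt: "brkt (loop ze s m) = lbr"
  and loop_carrier: "u : loops ze s m \<longleftrightarrow> (ALL i. lk u i : eigen ze L s m i)"
  and loop_part: "u : part (loop ze s m) p \<longleftrightarrow> u : loops ze s m & (ALL i. lk u i : part L p)"
 unfolding loop_algebra_def lbr_def[abs_def] by auto

lemma eigen_iff: "x : eigen ze L s m i \<longleftrightarrow> x : V & s x = sc (ze m powi i) x" unfolding eigen_def by simp

lemma loop_VL: "u : loops ze s m ==> u : VL" unfolding loop_carrier VL_def eigen_iff by simp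

lemma eigen_0: "lin s ==> 0 : eigen ze L s m i" unfolding eigen_iff by (simp add: lin_0)

lemma loop_add: "lin s ==> u : loops ze s m ==> v : loops ze s m ==> u + v : loops ze s m"
 unfolding loop_carrier eigen_iff by (simp add: lookup_add linD scale_right_distrib)

lemma loop_smul: "lin s ==> u : loops ze s m ==> smul c u : loops ze s m"
 unfolding loop_carrier eigen_iff by (simp add: lookup_smul linD mult.commute)

lemma loop_zero: "lin s ==> 0 : loops ze s m" unfolding loop_carrier by (simp add: eigen_0)

lemma loop_sum: "lin s ==> (!!i. i : I ==> u i : loops ze s m) ==> sum u I : loops ze s m"
 by (induction I rule: infinite_finite_induct) (auto simp: loop_zero loop_add)

lemma loop_single: "lin s ==> x : eigen ze L s m i ==> sg i x : loops ze s m"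
 unfolding loop_carrier by (simp add: lookup_single when_def eigen_0)

lemma loop_lbr:
 assumes s: "s : G" and ze: "ze m ~= 0" and u: "u : loops ze s m" and v: "v : loops ze s m"
 shows "lbr u v : loops ze s m" unfolding lbr_def proof (intro loop_sum[OF G_lin[OF s]] loop_single[OF G_lin[OF s]])
 fix i j
 have "lk u i : eigen ze L s m i" "lk v j : eigen ze L s m j" using u v unfolding loop_carrier by auto
 thus "br (lk u i) (lk v j) : eigen ze L s m (i + j)" unfolding eigen_iff using autD(3)[OF G_aut[OF s]] ze br_V
  by (simp add: brkt_scal_left brkt_scal_right power_int_add mult.commute)
qed

lemma part_sum_lookup:
 assumes "!!i k. i : I ==> lk (u i) k : part L p"
 shows "lk (sum u I) k : part L p" unfolding lookup_sum using assms subspace_part by (intro subspace_sum) auto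

lemma part_single: "x : part L p ==> lk (sg i x) k : part L p" using subspace_0[OF subspace_part] by (simp add: lookup_single when_def)

end

section \<open>Isomorphisms\<close>

lemma sa_isomorphic_trans: "sa_isomorphic L M ==> sa_isomorphic M N ==> sa_isomorphic L N" proof -
 assume "sa_isomorphic L M" "sa_isomorphic M N"
 then obtain f g where f: "f : sa_iso L M" and g: "g : sa_iso M N" unfolding sa_isomorphic_def by blast
 have fc: "f x : carrier M" if "x : carrier L" for x using f that unfolding sa_iso_def by (auto dest: bij_betwE)
 have "(%x. g (f x)) : sa_iso L N" unfolding sa_iso_def proof (intro CollectI conjI ballI allI)
  show "bij_betw (%x. g (f x)) (carrier L) (carrier N)"
   using f g bij_betw_trans[of f "carrier L" "carrier M" g "carrier N"] unfolding sa_iso_def comp_def by blast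
  show "(%x. g (f x)) ` part L p = part N p" for p using f g unfolding sa_iso_def by (auto simp: image_image[symmetric])
 qed (use f g fc in \<open>simp_all add: sa_iso_def\<close>)
 thus ?thesis unfolding sa_isomorphic_def by blast
qed

lemma sa_iso_inv:
 assumes f: "f : sa_iso L M" and cl: "!!x y. x : carrier L ==> y : carrier L ==> x + y : carrier L"
   "!!c x. x : carrier L ==> scal L c x : carrier L"
   "!!x y. x : carrier L ==> y : carrier L ==> brkt L x y : carrier L"
   "!!p. part L p <= carrier L"
 shows "inv_into (carrier L) f : sa_iso M L" proof -
 let ?g = "inv_into (carrier L) f"
 have b: "bij_betw f (carrier L) (carrier M)" using f unfolding sa_iso_def by blast
 have inj: "inj_on f (carrier L)" and im: "f ` carrier L = carrier M" using b unfolding bij_betw_def by auto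
 have g: "?g y : carrier L" "f (?g y) = y" if "y : carrier M" for y
  using that im inv_into_into[of y f "carrier L"] f_inv_into_f[of y f "carrier L"] by auto
 have gI: "?g y = x" if "x : carrier L" "f x = y" for x y using that inv_into_f_f[OF inj] by blast
 show "?g : sa_iso M L" unfolding sa_iso_def proof (intro CollectI conjI ballI allI)
  show "bij_betw ?g (carrier M) (carrier L)" by (rule bij_betw_inv_into[OF b])
  show "?g ` part M p = part L p" for p proof -
   have "part M p = f ` part L p" using f unfolding sa_iso_def by blast
   thus ?thesis using inv_into_f_f[OF inj] cl(4)[of p] by (force simp: image_image)
  qed
  fix x y assume x: "x : carrier M"
  show "?g (scal M c x) = scal L c (?g x)" for c using f g[OF x] by (intro gI cl) (auto simp: sa_iso_def)
  assume y: "y : carrier M"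
  show "?g (x + y) = ?g x + ?g y" "?g (brkt M x y) = brkt L (?g x) (?g y)"
   using f g[OF x] g[OF y] by (auto intro!: gI cl simp: sa_iso_def)
 qed
qed

section \<open>Isomorphisms between loop algebras\<close>

context fd_lie_superalgebra
begin

interpretation AG: group "Aut L" by (rule group_Aut)

lemma ex_root_powi:
 fixes b :: 'k assumes "b ~= 0" "e ~= 0" shows "EX a. a ~= 0 & a powi e = b" proof (cases "e > 0")
 case True
 obtain a where a: "a ^ nat e = b" using nth_root_exists[of "nat e" b] True by auto
 hence "a powi e = b" "a ~= 0" using True assms(1) by (auto simp: power_int_def power_0_left)
 thus ?thesis by blast
next
 case False
 obtain a where a: "a ^ nat (- e) = inverse b" using nth_root_exists[of "nat (- e)" "inverse b"] False assms(2) by auto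
 hence "a powi e = b" "a ~= 0" using False assms by (auto simp: power_int_def power_inverse power_0_left)
 thus ?thesis by blast
qed

lemma gp_part:
 assumes H: "der H" and x: "x : part L p" shows "gp H mu x : part L p" proof (rule even_part[OF gp_lin[OF derD(1)[OF H]] _ x])
 show "even (gp H mu)" unfolding even_def using gp_commute[OF derD(1)[OF H] pr_lin] derD(2)[OF H] unfolding even_def by simp
qed

text \<open>The map sends \<open>x\<close> at degree \<open>i\<close>, with \<open>x\<close> of
  weight \<open>n\<close> for \<open>H\<close>, to \<open>g x\<close> at degree
  \<open>e * i + c * n\<close>. After evaluation it is \<open>g\<close> composed with a torus
  element depending on the point, so brackets are preserved pointwise. Change of period uses
  \<open>e\<close> as the factor of the period, inversion uses \<open>e = - 1\<close>, and twisting
  by a torus uses \<open>c\<close>.\<close>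

theorem loop_iso:
 fixes ze :: "nat => 'k" and e c :: int
 assumes s: "s : G" and s': "s' : G" and g: "g : G" and H: "intss H" "comm H s"
  and r: "lin r" "comm r H" "!!z. z : V ==> s' (g z) = g (r z)" and e: "e ~= 0" and ze: "ze m ~= 0" "ze m' ~= 0"
  and fwd: "!!i n x. x : wt H n ==> s x = sc (ze m powi i) x ==> r x = sc (ze m' powi (e * i + c * n)) x"
  and bwd: "!!k n x. x : wt H n ==> x ~= 0 ==> r x = sc (ze m' powi k) x ==> EX i. e * i + c * n = k & s x = sc (ze m powi i) x"
 shows "sa_isomorphic (loop ze s m) (loop ze s' m')" proof -
 let ?A = "loop ze s m" and ?B = "loop ze s' m'"
 note T = intssD(2)[OF H(1)] and S = G_lin[OF s] and S' = G_lin[OF s'] and GL = G_lin[OF g]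
 define P where "P a z = g (tor H (a powi c) z)" for a z
 have Paut: "aut (P a)" if "a ~= 0" for a unfolding P_def using aut_comp[OF G_aut[OF g] tor_aut[OF H(1)]] that by simp
 have Plin: "lin (P a)" for a unfolding P_def using lin_comp[OF GL tor_lin[OF T]] .
 have gpwt: "gp H mu x : wt H (toint mu)" if x: "x : V" for mu x proof -
  note gg = intss_gen[OF H(1) gp_gen[OF T x, of mu]]
  have "H (gp H mu x) = sc (of_int (toint mu)) (gp H mu x)" proof (cases "gp H mu x = 0")
   case True
   thus ?thesis using lin_0[OF T] by simp
  next
   case False
   then obtain n where "mu = of_int n" using gg(2) by blast
   thus ?thesis using gg(1) by simp
  qed
  thus ?thesis unfolding wt_def using gp_V[OF T x] by simp
 qed
 have Pgp: "P a (gp H mu x) = sc (a powi (c * toint mu)) (g (gp H mu x))" if x: "x : V" for a mu x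
  unfolding P_def tor_wt[OF T gpwt[OF x]] linD(3)[OF GL gp_V[OF T x]] by (simp add: power_int_mult)
 have Psum: "P a x = (SUM mu:eigs H. sc (a powi (c * toint mu)) (g (gp H mu x)))" if x: "x : V" for a x proof -
  have "P a x = P a (SUM mu:eigs H. gp H mu x)" unfolding gp_sum[OF T x] ..
  thus ?thesis unfolding lin_sum[OF Plin gp_V[OF T x]] Pgp[OF x] .
 qed
 have gpc: "gp H mu (R x) = R (gp H mu x)" if "lin R" "comm H R" "x : V" for R x mu
  by (rule gp_commute[OF T that(1) _ that(3)]) (use that(2) in \<open>simp add: comm_def\<close>)
 \<comment> \<open>Prescribing the evaluation at every nonzero point determines \<open>w\<close> and
   reduces the homomorphism property to that of \<open>P a\<close>.\<close>
 define rel where "rel u w \<longleftrightarrow> (ALL a. a ~= 0 --> ev a w = P a (ev (a powi e) u)) & (ALL p. u : part ?A p --> w : part ?B p)" for u w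
 have ex1: "EX w:carrier ?B. rel u w" if u: "u : carrier ?A" for u proof -
  have uV: "lk u i : V" and us: "s (lk u i) = sc (ze m powi i) (lk u i)" for i using u unfolding loop_carrier eigen_iff by auto
  define w where "w = (SUM i:ks u. SUM mu:eigs H.
   sg (e * i + c * toint mu) (g (gp H mu (lk u i))))"
  have "g (gp H mu (lk u i)) : eigen ze L s' m' (e * i + c * toint mu)" for i mu proof -
   let ?x = "gp H mu (lk u i)"
   have xV: "?x : V" using gp_V[OF T uV] .
   have "s ?x = sc (ze m powi i) ?x" unfolding gpc[OF S H(2) uV, symmetric] us linD(3)[OF gp_lin[OF T] uV] ..
   hence "r ?x = sc (ze m' powi (e * i + c * toint mu)) ?x" by (rule fwd[OF gpwt[OF uV]])
   hence "s' (g ?x) = sc (ze m' powi (e * i + c * toint mu)) (g ?x)" unfolding r(3)[OF xV] by (simp only: linD(3)[OF GL xV])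
   thus ?thesis unfolding eigen_iff using G_V[OF g xV] by simp
  qed
  hence wB: "w : carrier ?B" unfolding w_def by (intro loop_sum[OF S'] loop_single[OF S'])
  have "ev a w = P a (ev (a powi e) u)" if a: "a ~= 0" for a proof -
   have "P a (ev (a powi e) u) = (SUM i:ks u. sc ((a powi e) powi i) (P a (lk u i)))"
    unfolding ev_def lin_sum[OF Plin V_scale[OF uV]] linD(3)[OF Plin uV] ..
   also have "... = ev a w" unfolding w_def ev_sum ev_single Psum[OF uV] scale_sum_right scale_scale
    using a by (simp add: power_int_mult[symmetric] power_int_add)
   finally show ?thesis by simp
  qed
  moreover have "w : part ?B p" if "u : part ?A p" for p unfolding loop_part proof (intro conjI allI wB)
   have "lk u i : part L p" for i using that unfolding loop_part by blast
   thus "lk w k : part L p" for k unfolding w_def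
    by (intro part_sum_lookup part_single even_part[OF autD(1,2)[OF G_aut[OF g]]] gp_part[OF intssD(1)[OF H(1)]])
  qed
  ultimately show ?thesis unfolding rel_def using wB by blast
 qed
 have ex2: "EX u:carrier ?A. (ALL a. a ~= 0 --> ev a w = P a (ev (a powi e) u)) & (ALL p. w : part ?B p --> u : part ?A p)"
  if w: "w : carrier ?B" for w proof -
  let ?g = "ginv g"
  have gi: "?g : G" using g by simp
  have wV: "lk w k : V" and ws: "s' (lk w k) = sc (ze m' powi k) (lk w k)" for k using w unfolding loop_carrier eigen_iff by auto
  define y where "y k = ?g (lk w k)" for k
  have yV: "y k : V" and gy: "g (y k) = lk w k" for k unfolding y_def using G_V[OF gi wV] Aut_inv(2)[OF g wV] by auto
  have ry: "r (y k) = sc (ze m' powi k) (y k)" for k proof -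
   have "r (y k) = ?g (g (r (y k)))" using Aut_inv(1)[OF g linD(1)[OF r(1) yV]] by simp
   also have "g (r (y k)) = sc (ze m' powi k) (lk w k)" unfolding r(3)[OF yV, symmetric] gy ws ..
   also have "?g ... = sc (ze m' powi k) (y k)" unfolding y_def linD(3)[OF G_lin[OF gi] wV] ..
   finally show ?thesis .
  qed
  \<comment> \<open>A zero component may be placed in any degree, hence the implication.\<close>
  have ex: "EX i. gp H mu (y k) ~= 0 --> e * i + c * toint mu = k & s (gp H mu (y k)) = sc (ze m powi i) (gp H mu (y k))" for k mu
  proof (cases "gp H mu (y k) = 0")
   case False
   have "r (gp H mu (y k)) = sc (ze m' powi k) (gp H mu (y k))"
    unfolding gpc[OF r(1) iffD1[OF comm_sym r(2)] yV, symmetric] ry linD(3)[OF gp_lin[OF T] yV] ..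
   from bwd[OF gpwt[OF yV] False this] show ?thesis by blast
  qed simp
  define io where "io k mu = (SOME i. gp H mu (y k) ~= 0 --> e * i + c * toint mu = k & s (gp H mu (y k)) = sc (ze m powi i) (gp H mu (y k)))" for k mu
  have io: "e * io k mu + c * toint mu = k & s (gp H mu (y k)) = sc (ze m powi io k mu) (gp H mu (y k))" if "gp H mu (y k) ~= 0" for k mu
   using someI_ex[OF ex[of mu k]] that unfolding io_def by simp
  define u where "u = (SUM k:ks w. SUM mu:eigs H. sg (io k mu) (gp H mu (y k)))"
  have "gp H mu (y k) : eigen ze L s m (io k mu)" for k mu
   using io[of mu k] gp_V[OF T yV] eigen_0[OF S] unfolding eigen_iff by (cases "gp H mu (y k) = 0") auto
  hence uA: "u : carrier ?A" unfolding u_def by (intro loop_sum[OF S] loop_single[OF S])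
  have "ev a w = P a (ev (a powi e) u)" if a: "a ~= 0" for a proof -
   note gV = gp_V[OF T yV]
   have "P a (ev (a powi e) u) = (SUM k:ks w. SUM mu:eigs H. sc ((a powi e) powi io k mu) (P a (gp H mu (y k))))"
    unfolding u_def ev_sum ev_single lin_sum[OF Plin V_sum[OF V_scale[OF gV]]] lin_sum[OF Plin V_scale[OF gV]] linD(3)[OF Plin gV] ..
   also have "... = (SUM k:ks w. sc (a powi k) (lk w k))" proof (rule sum.cong[OF refl])
    fix k
    have "sc ((a powi e) powi io k mu) (P a (gp H mu (y k))) = sc (a powi k) (g (gp H mu (y k)))" for mu
    proof (cases "gp H mu (y k) = 0")
     case True
     thus ?thesis using lin_0[OF Plin] lin_0[OF GL] by simp
    next
     case False
     have "(a powi e) powi io k mu * a powi (c * toint mu) = a powi k"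
      using io[OF False] a by (simp add: power_int_mult[symmetric] power_int_add[symmetric])
     thus ?thesis unfolding Pgp[OF yV] by simp
    qed
    hence "(SUM mu:eigs H. sc ((a powi e) powi io k mu) (P a (gp H mu (y k)))) = sc (a powi k) (SUM mu:eigs H. g (gp H mu (y k)))"
     by (simp add: scale_sum_right)
    also have "(SUM mu:eigs H. g (gp H mu (y k))) = lk w k" unfolding lin_sum[OF GL gV, symmetric] gp_sum[OF T yV] gy ..
    finally show "(SUM mu:eigs H. sc ((a powi e) powi io k mu) (P a (gp H mu (y k)))) = sc (a powi k) (lk w k)" .
   qed
   finally show ?thesis unfolding ev_def[of a w] by simp
  qed
  moreover have "u : part ?A p" if "w : part ?B p" for p unfolding loop_part proof (intro conjI allI uA)
   have "lk w k : part L p" for k using that unfolding loop_part by blast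
   hence "y k : part L p" for k unfolding y_def by (intro even_part[OF autD(1,2)[OF G_aut[OF gi]]])
   thus "lk u k : part L p" for k unfolding u_def by (intro part_sum_lookup part_single gp_part[OF intssD(1)[OF H(1)]])
  qed
  ultimately show ?thesis using uA by blast
 qed
 define f where "f u = (SOME w. w : carrier ?B & rel u w)" for u
 have f: "f u : carrier ?B & rel u (f u)" if "u : carrier ?A" for u unfolding f_def by (rule someI_ex) (use ex1[OF that] in blast)
 have fB: "f u : carrier ?B" and fev: "a ~= 0 ==> ev a (f u) = P a (ev (a powi e) u)"
  and fpart: "u : part ?A p ==> f u : part ?B p" if "u : carrier ?A" for u a p using f[OF that] unfolding rel_def by auto
 have eqI: "f u = w" if "u : carrier ?A" "w : carrier ?B" "!!a. a ~= 0 ==> ev a w = P a (ev (a powi e) u)" for u w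
  by (rule ev_inj[OF loop_VL[OF fB[OF that(1)]] loop_VL[OF that(2)]]) (simp add: fev[OF that(1)] that(3))
 have inj: "inj_on f (carrier ?A)" proof (rule inj_onI)
  fix u v assume uv: "u : carrier ?A" "v : carrier ?A" "f u = f v"
  show "u = v" proof (rule ev_inj[OF loop_VL[OF uv(1)] loop_VL[OF uv(2)]])
   \<comment> \<open>Every nonzero scalar has the form \<open>a powi e\<close>, so all evaluations
     are reached.\<close>
   fix b :: 'k assume "b ~= 0"
   then obtain a where a: "a ~= 0" "a powi e = b" using ex_root_powi e by blast
   have "P a (ev b u) = P a (ev b v)" using fev[OF uv(1) a(1)] fev[OF uv(2) a(1)] uv(3) a(2) by simp
   thus "ev b u = ev b v" using autD(4)[OF Paut[OF a(1)]] ev_V[OF loop_VL[OF uv(1)]] ev_V[OF loop_VL[OF uv(2)]]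
    unfolding bij_betw_def by (meson inj_onD)
  qed
 qed
 have "f : sa_iso ?A ?B" unfolding sa_iso_def loop_scal loop_brkt proof (intro CollectI conjI ballI allI)
  show "bij_betw f (carrier ?A) (carrier ?B)" unfolding bij_betw_def proof (intro conjI inj equalityI subsetI image_subsetI)
   fix w assume w: "w : carrier ?B"
   obtain u where "u : carrier ?A" "ALL a. a ~= 0 --> ev a w = P a (ev (a powi e) u)" using ex2[OF w] by blast
   thus "w : f ` carrier ?A" using eqI[OF _ w, of u] by (intro image_eqI[of _ _ u]) auto
  qed (use fB in auto)
  show "f ` part ?A p = part ?B p" for p proof
   show "f ` part ?A p <= part ?B p" proof (rule image_subsetI)
    fix u assume u: "u : part ?A p"
    hence "u : carrier ?A" unfolding loop_part by blast
    thus "f u : part ?B p" using u by (rule fpart)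
   qed
   show "part ?B p <= f ` part ?A p" proof
    fix w assume wp: "w : part ?B p"
    hence w: "w : carrier ?B" unfolding loop_part by blast
    obtain u where "u : carrier ?A" "ALL a. a ~= 0 --> ev a w = P a (ev (a powi e) u)" "u : part ?A p" using ex2[OF w] wp by blast
    thus "w : f ` part ?A p" using eqI[OF _ w, of u] by (intro image_eqI[of _ _ u]) auto
   qed
  qed
  fix u assume u: "u : carrier ?A"
  note uV = ev_V[OF loop_VL[OF u]]
  show "f (smul k u) = smul k (f u)" for k by (rule eqI[OF loop_smul[OF S u] loop_smul[OF S' fB[OF u]]])
    (simp add: ev_smul fev[OF u] linD(3)[OF Plin uV])
  fix v assume v: "v : carrier ?A"
  note vV = ev_V[OF loop_VL[OF v]]
  show "f (u + v) = f u + f v" by (rule eqI[OF loop_add[OF S u v] loop_add[OF S' fB[OF u] fB[OF v]]])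
    (simp add: ev_add fev[OF u] fev[OF v] linD(2)[OF Plin uV vV])
  show "f (lbr u v) = lbr (f u) (f v)"
  proof (rule eqI[OF loop_lbr[of s ze m u v, OF s ze(1) u v] loop_lbr[of s' ze m' "f u" "f v", OF s' ze(2) fB[OF u] fB[OF v]]])
   fix a :: 'k assume a: "a ~= 0"
   hence ae: "a powi e ~= 0" by simp
   show "ev a (lbr (f u) (f v)) = P a (ev (a powi e) (lbr u v))"
    unfolding ev_lbr[OF loop_VL[OF fB[OF u]] loop_VL[OF fB[OF v]] a] ev_lbr[OF loop_VL[OF u] loop_VL[OF v] ae]
     fev[OF u a] fev[OF v a] autD(3)[OF Paut[OF a] uV vV] ..
  qed
 qed
 thus ?thesis unfolding sa_isomorphic_def by blast
qed

lemma loop_iso_inv: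
 fixes ze :: "nat => 'k"
 assumes "s : G" "ze m ~= 0" "f : sa_iso (loop ze s m) M"
 shows "inv_into (loops ze s m) f : sa_iso M (loop ze s m)" using assms(3) proof (rule sa_iso_inv)
 note S = G_lin[OF assms(1)]
 fix x y assume "x : loops ze s m" "y : loops ze s m"
 thus "x + y : loops ze s m" "brkt (loop ze s m) x y : loops ze s m"
  unfolding loop_brkt using loop_add[OF S] loop_lbr[where ze = ze and m = m, OF assms(1,2)] by blast+
qed (use loop_smul[OF G_lin[OF assms(1)]] in \<open>auto simp: loop_scal loop_part\<close>)

lemma loop_iso_sym:
 fixes ze :: "nat => 'k"
 assumes "s : G" "ze m ~= 0" "sa_isomorphic (loop ze s m) M" shows "sa_isomorphic M (loop ze s m)"
 using assms(3) loop_iso_inv[where ze = ze and m = m, OF assms(1,2)] unfolding sa_isomorphic_def by blast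

section \<open>Change of period, conjugation and twisting by a torus\<close>

lemma comm_zero: "lin s ==> comm (%x. 0) s" "lin s ==> comm s (%x. 0)" unfolding comm_def by (auto simp: lin_0)

text \<open>Degrees are multiplied by \<open>l\<close>. Conversely \<open>s\<close> has order
  dividing \<open>m\<close>, so nonzero eigenvectors for the longer period occur only in degrees
  divisible by \<open>l\<close>.\<close>

lemma loop_period:
 fixes ze :: "nat => 'k"
 assumes ze: "compatible_roots ze" and s: "s : G" "!!x. x : V ==> (s ^^ m) x = x" "m >= 1" and l: "l >= 1"
 shows "sa_isomorphic (loop ze s m) (loop ze s (l * m))"
proof (rule loop_iso[where g = "gone" and H = "%x. 0" and r = s and e = "int l" and c = 0])
 note S = G_lin[OF s(1)]
 have lm: "l * m >= 1" using l s(3) by simp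
 note r = rootsD[OF ze s(3)] and r' = rootsD[OF ze lm]
 show "comm (%x. 0) s" "comm s (%x. 0)" by (rule comm_zero[OF S])+
 show "s (gone z) = gone (s z)" if "z : V" for z using that by (simp add: Aut_one G_V[OF s(1)])
 have e: "ze (l * m) powi (int l * i) = ze m powi i" for i unfolding power_int_mult power_int_of_nat r(3)[OF l] ..
 show "s x = sc (ze (l * m) powi (int l * i + 0 * n)) x" if "s x = sc (ze m powi i) x" for i n x using that e by simp
 show "EX i. int l * i + 0 * n = k & s x = sc (ze m powi i) x" if x: "x : wt (%x. 0) n" "x ~= 0" "s x = sc (ze (l * m) powi k) x" for k n x
 proof -
  have xV: "x : V" using wt_V[OF x(1)] .
  have "(s ^^ j) x = sc ((ze (l * m) powi k) ^ j) x" for j by (induction j) (use x(3) xV in \<open>auto simp: linD(3)[OF S]\<close>)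
  from this[of m] have "sc ((ze (l * m) powi k) ^ m - 1) x = 0" using s(2)[OF xV] by (simp add: scale_left_diff_distrib)
  hence "(ze (l * m) powi k) ^ m = 1" using x(2) by simp
  hence "ze (l * m) powi (k * int m) = 1" by (simp add: power_int_mult)
  hence "int (l * m) dvd k * int m" by (rule primitive_powi_eq_1[OF ze lm])
  hence "int l dvd k" using s(3) by simp
  then obtain i where i: "k = int l * i" by blast
  thus ?thesis using x(3) e[of i] by auto
 qed
qed (use s l intss_zero G_lin[OF s(1)] rootsD(4)[OF ze] in auto)

lemma loop_conj:
 fixes ze :: "nat => 'k"
 assumes ze: "ze m ~= 0" and s: "s : G" and h: "h : G" and t: "t : G"
  and ts: "t = h \<cdot> s \<cdot> ginv h | t = h \<cdot> ginv s \<cdot> ginv h"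
 shows "sa_isomorphic (loop ze s m) (loop ze t m)" proof -
 have hi: "ginv h : G" "ginv s : G" using h s by auto
 have th: "t (h z) = h (r z)" if r: "r : G" "t = h \<cdot> r \<cdot> ginv h" and z: "z : V" for r z
  using z h r hi by (simp add: Aut_mult Aut_inv G_V)
 show ?thesis using ts proof
  assume t': "t = h \<cdot> s \<cdot> ginv h"
  show ?thesis by (rule loop_iso[where g = h and H = "%x. 0" and r = s and e = 1 and c = 0])
    (use s h t ze intss_zero G_lin comm_zero th[OF s t'] in auto)
 next
  assume t': "t = h \<cdot> ginv s \<cdot> ginv h"
  let ?r = "ginv s"
  have inv: "q x = sc (ze m powi (- i)) x" if "x : V" "p : G" "q : G" "q (p x) = x" "p x = sc (ze m powi i) x" for p q x i proof -
   have "x = sc (ze m powi i) (q x)" using that linD(3)[OF G_lin[OF that(3)] that(1)] by metis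
   hence "sc (ze m powi (- i)) x = sc (ze m powi (- i) * ze m powi i) (q x)" by (metis scale_scale)
   thus ?thesis using ze by (simp add: power_int_minus)
  qed
  show ?thesis proof (rule loop_iso[where g = h and H = "%x. 0" and r = ?r and e = "- 1" and c = 0])
   show "?r x = sc (ze m powi (- 1 * i + 0 * n)) x" if "x : wt (%x. 0) n" "s x = sc (ze m powi i) x" for i n x
    using inv[OF wt_V[OF that(1)] s hi(2) _ that(2)] Aut_inv(1)[OF s wt_V[OF that(1)]] by simp
   show "EX i. - 1 * i + 0 * n = k & s x = sc (ze m powi i) x" if "x : wt (%x. 0) n" "?r x = sc (ze m powi k) x" for k n x
    using inv[OF wt_V[OF that(1)] hi(2) s _ that(2)] Aut_inv(2)[OF s wt_V[OF that(1)]] by (intro exI[of _ "- k"]) simp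
  qed (use s h t ze hi intss_zero G_lin comm_zero th[OF hi(2) t'] in auto)
 qed
qed

text \<open>The root of order \<open>N\<close> is the \<open>l\<close>-th power of the root of order
  \<open>l * N\<close>, so the torus element acts on weight \<open>n\<close> like a shift of the
  degree by \<open>l * n\<close>.\<close>

lemma loop_twist:
 fixes ze :: "nat => 'k"
 assumes ze: "compatible_roots ze" and s: "s : G" "t : G" "g : G" and H: "intss H" "comm H s"
  and N: "N >= 1" "l >= 1" and t: "!!z. z : V ==> t (g z) = g (s (tor H (ze N) z))"
 shows "sa_isomorphic (loop ze s (l * N)) (loop ze t (l * N))"
proof (rule loop_iso[where g = g and H = H and r = "%z. s (tor H (ze N) z)" and e = 1 and c = "int l"])
 note S = G_lin[OF s(1)] and T = intssD(2)[OF H(1)]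
 have lN: "l * N >= 1" using N by simp
 note r = rootsD[OF ze N(1)] and r' = rootsD[OF ze lN]
 show "lin (%z. s (tor H (ze N) z))" by (rule lin_comp[OF S tor_lin[OF T]])
 show "comm (%z. s (tor H (ze N) z)) H"
  using H(2) tor_commute[OF T T, where a = "ze N"] linD(1)[OF tor_lin[OF T]] unfolding comm_def by simp
 have e: "ze N powi n = ze (l * N) powi (int l * n)" for n unfolding power_int_mult power_int_of_nat r(3)[OF N(2)] ..
 have tx: "s (tor H (ze N) x) = sc (ze (l * N) powi (int l * n)) (s x)" if "x : wt H n" for x n
  unfolding tor_wt[OF T that] e linD(3)[OF S wt_V[OF that]] ..
 show "s (tor H (ze N) x) = sc (ze (l * N) powi (1 * i + int l * n)) x" if "x : wt H n" "s x = sc (ze (l * N) powi i) x" for i n x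
  unfolding tx[OF that(1)] that(2) using r'(4) by (simp add: power_int_add mult.commute)
 show "EX i. 1 * i + int l * n = k & s x = sc (ze (l * N) powi i) x" if "x : wt H n" "s (tor H (ze N) x) = sc (ze (l * N) powi k) x" for k n x
 proof -
  have "sc (ze (l * N) powi (- (int l * n))) (sc (ze (l * N) powi (int l * n)) (s x)) = sc (ze (l * N) powi (- (int l * n))) (sc (ze (l * N) powi k) x)"
   using that(2) unfolding tx[OF that(1)] by simp
  hence "s x = sc (ze (l * N) powi (k - int l * n)) x"
   unfolding scale_scale using r'(4) by (simp add: power_int_minus power_int_diff field_simps)
  thus ?thesis by (intro exI[of _ "k - int l * n"]) simp
 qed
qed (use s H t rootsD(4)[OF ze] N in auto)

text \<open>Tori twist \<open>s\<close> and \<open>t'\<close> into conjugate elements without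
  changing the loop algebras; the isomorphisms are chained at the common period
  \<open>m * n * N\<close>.\<close>

theorem conn_imp_loop_iso:
 fixes ze :: "nat => 'k"
 assumes ze: "compatible_roots ze" and s: "s : G" "!!x. x : V ==> (s ^^ m) x = x" "m >= 1"
  and t: "t : G" "!!x. x : V ==> (t ^^ n) x = x" "n >= 1"
  and h: "h : G" and t': "t' = h \<cdot> t \<cdot> ginv h | t' = h \<cdot> ginv t \<cdot> ginv h" and conn: "conn s t'"
 shows "sa_isomorphic (loop ze s m) (loop ze t n)" proof -
 have t'G: "t' : G" using conn_G[OF conn] by blast
 have hi: "ginv h : G" "ginv t : G" using h t(1) by auto
 have invn: "((ginv t) ^^ n) x = x" if x: "x : V" for x proof -
  have "((ginv t) ^^ k) ((t ^^ k) y) = y" if "y : V" for k y using that proof (induction k arbitrary: y)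
   case (Suc k)
   thus ?case using Suc.IH[OF G_V[OF t(1) Suc.prems]] Aut_inv(1)[OF t(1) Suc.prems] by (simp add: funpow_swap1[of t])
  qed simp
  from this[OF x, of n] show ?thesis unfolding t(2)[OF x] .
 qed
 obtain q where q: "q : G" "t' = h \<cdot> q \<cdot> ginv h" "!!x. x : V ==> (q ^^ n) x = x" using t' t(1,2) hi(2) invn by blast
 have t'n: "(t' ^^ n) x = x" if x: "x : V" for x proof -
  have "(t' ^^ k) (h y) = h ((q ^^ k) y)" if y: "y : V" for k y proof (induction k)
   case (Suc k)
   have "(q ^^ k) y : V" using linD(1)[OF lin_funpow[OF G_lin[OF q(1)]] y] .
   thus ?case using Suc h q(1) hi(1) by (simp add: q(2) Aut_mult Aut_inv G_V)
  qed simp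
  from this[OF G_V[OF hi(1) x], of n] show ?thesis unfolding q(3)[OF G_V[OF hi(1) x]] Aut_inv(2)[OF h x] .
 qed
 obtain C where C: "connectedin (zariski L) C" "s : C" "t' : C" using conn unfolding connected_component_of_def by blast
 have "EX g:G. EX H K N. N >= 1 & intss H & comm H s & intss K & comm K t'
  & (ALL z:V. g (s (tor H (ze N) z)) = t' (tor K (ze N) (g z)))" by (rule conjugate_up_to_torus[OF ze s t'G t'n t(3) C])
 then obtain g H K N where g: "g : G" and N: "N >= 1" and H: "intss H" "comm H s" and K: "intss K" "comm K t'"
  and gz: "!!z. z : V ==> g (s (tor H (ze N) z)) = t' (tor K (ze N) (g z))" by (elim bexE exE conjE) simp
 \<comment> \<open>The twist of \<open>t'\<close>; it is reached from \<open>s\<close> through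
   \<open>g\<close> and from \<open>t'\<close> through the identity.\<close>
 define u where "u = restrict (%z. t' (tor K (ze N) z)) V"
 have zN: "ze N ~= 0" using rootsD(4)[OF ze N] .
 have uG: "u : G" unfolding u_def by (rule restrict_G[OF aut_comp[OF G_aut[OF t'G] tor_aut[OF K(1) zN]]])
 let ?M = "m * n * N"
 have M: "?M >= 1" using s(3) t(3) N by simp
 have "sa_isomorphic (loop ze s m) (loop ze s (n * N * m))" using loop_period[OF ze s, of "n * N"] t(3) N by simp
 moreover have "sa_isomorphic (loop ze s ?M) (loop ze u ?M)"
  by (rule loop_twist[OF ze s(1) uG g H N]) (use s(3) t(3) in \<open>simp_all add: u_def G_V[OF g] gz\<close>)
 moreover have "sa_isomorphic (loop ze u ?M) (loop ze t' ?M)" proof (rule loop_iso_sym[where ze = ze, OF t'G rootsD(4)[OF ze M]])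
  show "sa_isomorphic (loop ze t' ?M) (loop ze u ?M)" by (rule loop_twist[OF ze t'G uG _ K N, where g = "gone"])
    (use s(3) t(3) in \<open>simp_all add: u_def Aut_one G_V[OF t'G] linD(1)[OF tor_lin[OF intssD(2)[OF K(1)]]]\<close>)
 qed
 moreover have "sa_isomorphic (loop ze t' ?M) (loop ze t ?M)" by (rule loop_iso_sym[where ze = ze, OF t(1) rootsD(4)[OF ze M]])
   (rule loop_conj[where ze = ze, OF rootsD(4)[OF ze M] t(1) h t'G t'])
 moreover have "sa_isomorphic (loop ze t (m * N * n)) (loop ze t n)" by (rule loop_iso_sym[where ze = ze, OF t(1) rootsD(4)[OF ze t(3)]])
   (rule loop_period[OF ze t], use s(3) N in \<open>simp_all\<close>)
 moreover have "n * N * m = ?M" "m * N * n = ?M" by (simp_all add: mult_ac)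
 ultimately show ?thesis by (metis sa_isomorphic_trans)
qed

end

section \<open>The centroid of a loop algebra\<close>

context fd_lie_superalgebra
begin

interpretation AG: group "Aut L" by (rule group_Aut)

lemma graded_idealI:
 assumes I: "subspace I" "I <= V" "!!x. x : I ==> pr x : I"
  and br: "!!x y. x : V ==> y : I ==> br x y : I" "!!x y. x : V ==> y : I ==> br y x : I"
 shows "graded_ideal I" unfolding graded_ideal_def proof (intro conjI ballI I(1))
 show "I = {x + y |x y. x : I \<inter> part L 0 & y : I \<inter> part L 1}" proof
  show "I <= {x + y |x y. x : I \<inter> part L 0 & y : I \<inter> part L 1}" proof
   fix x assume x: "x : I"
   hence "x = pr x + (x - pr x)" "pr x : I \<inter> part L 0" "x - pr x : I \<inter> part L 1"
    using pr_ex[of x] I subspace_diff[OF I(1) x] by auto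
   thus "x : {x + y |x y. x : I \<inter> part L 0 & y : I \<inter> part L 1}" by blast
  qed
 qed (use subspace_add[OF I(1)] in auto)
qed (use br in auto)

lemma part_disjoint: "x : part L p ==> x : part L (1 + p) ==> x = 0" using part_Int by (cases p) auto

lemma V_part_induct:
 assumes x: "x : V" and P: "!!p x. x : part L p ==> P x" "!!x y. x : V ==> y : V ==> P x ==> P y ==> P (x + y)"
 shows "P x" proof -
 have "P (pr x + (x - pr x))" using pr_ex[OF x] part_V by (intro P(2) P(1)[of _ 0] P(1)[of _ 1]) blast+
 thus ?thesis by simp
qed

section \<open>Consequences of simplicity: trivial centre and Schur's lemma\<close>

context
 assumes simple: "simple_lie_superalgebra L"
begin

lemma ideal_cases: "graded_ideal I ==> I = {0} | I = V" by (rule simple_lie_superalgebra.simple[OF simple])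

lemma V_nonzero: "EX x:V. x ~= 0" using simple_lie_superalgebra.nonabelian[OF simple] br_V by blast

text \<open>The centre is a graded ideal: the even and odd parts of a central element have opposite
  brackets with a homogeneous element, but these brackets differ in parity, so both vanish. Since
  the algebra is not abelian, simplicity makes the centre zero.\<close>

lemma centre_zero:
 assumes x: "x : V" "!!y. y : V ==> br x y = 0" "!!y. y : V ==> br y x = 0"
 shows "x = 0" proof -
 define Z where "Z = {x:V. ALL y:V. br x y = 0 & br y x = 0}"
 have "graded_ideal Z" proof (rule graded_idealI)
  show "subspace Z" unfolding Z_def by (intro subspaceI) (auto simp: brkt_add_left brkt_add_right brkt_scal_left brkt_scal_right
    lin_0[OF br_lin_left] lin_0[OF br_lin_right])
  show "Z <= V" unfolding Z_def by blast
  fix x assume x: "x : Z"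
  hence xV: "x : V" unfolding Z_def by blast
  have 1: "pr x : part L 0" "x - pr x : part L 1" "x = pr x + (x - pr x)" using pr_ex[OF xV] by auto
  have V: "pr x : V" "x - pr x : V" using 1 part_V by blast+
  have "br (pr x) y = 0 & br y (pr x) = 0" if "y : V" for y using that proof (rule V_part_induct)
   fix p y assume y: "y : part L p"
   hence yV: "y : V" using part_V by blast
   have "br x y = 0" "br y x = 0" using x yV unfolding Z_def by auto
   hence "br (pr x) y + br (x - pr x) y = 0" "br y (pr x) + br y (x - pr x) = 0"
    using brkt_add_left[OF V yV] brkt_add_right[OF yV V] by auto
   hence "br (pr x) y = - br (x - pr x) y" "br y (pr x) = - br y (x - pr x)" by (simp_all add: eq_neg_iff_add_eq_0)
   moreover have "br (pr x) y : part L p" "br y (pr x) : part L p"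
    using brkt_part[OF 1(1) y] brkt_part[OF y 1(1)] by (simp_all only: add_0 add_0_right)
   moreover have "br (x - pr x) y : part L (1 + p)" "br y (x - pr x) : part L (1 + p)"
    using brkt_part[OF 1(2) y] brkt_part[OF y 1(2)] by (simp_all only: add.commute[of p 1])
   ultimately show "br (pr x) y = 0 & br y (pr x) = 0"
    using part_disjoint[of "br (pr x) y" p] part_disjoint[of "br y (pr x)" p] subspace_neg[OF subspace_part] by metis
  qed (use V in \<open>simp add: brkt_add_left brkt_add_right\<close>)
  thus "pr x : Z" unfolding Z_def using V by blast
 next
  fix x y assume "x : V" "y : Z"
  thus "br x y : Z" "br y x : Z" unfolding Z_def by (auto simp: lin_0[OF br_lin_left] lin_0[OF br_lin_right])
 qed
 hence "Z = {0} | Z = V" by (rule ideal_cases)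
 moreover have "Z ~= V" using simple_lie_superalgebra.nonabelian[OF simple] unfolding Z_def by blast
 ultimately show ?thesis using x unfolding Z_def by blast
qed

text \<open>An eigenspace of an even map commuting with all multiplications is a graded ideal. It is
  nonzero, as the last nonzero iterate of a generalised eigenvector shows, hence it is
  everything.\<close>

lemma schur:
 assumes c: "lin c" "even c" "!!x y. x : V ==> y : V ==> c (br x y) = br (c x) y" "!!x y. x : V ==> y : V ==> c (br x y) = br x (c y)"
 shows "EX gm. ALL x:V. c x = sc gm x" proof -
 obtain x0 where x0: "x0 : V" "x0 ~= 0" using V_nonzero by blast
 obtain mu where mu: "gp c mu x0 ~= 0" using gp_sum[OF c(1) x0(1)] x0(2) by (metis sum.neutral)
 define y where "y = gp c mu x0"
 have y: "y : V" "y ~= 0" "EX n. (shift c mu ^^ n) y = 0" using mu gp_gen[OF c(1) x0(1), of mu] unfolding y_def gen_def by auto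
 define n where "n = (LEAST n. (shift c mu ^^ n) y = 0)"
 have n: "(shift c mu ^^ n) y = 0" unfolding n_def using y(3) by (rule LeastI_ex)
 hence "n ~= 0" using y(2) by (cases n) auto
 then obtain k where k: "n = Suc k" by (cases n) auto
 define z where "z = (shift c mu ^^ k) y"
 have z: "z ~= 0" unfolding z_def using not_less_Least[of k "%n. (shift c mu ^^ n) y = 0"] k unfolding n_def by auto
 have zV: "z : V" unfolding z_def using linD(1)[OF lin_funpow[OF lin_shift[OF c(1)]] y(1)] .
 have cz: "c z = sc mu z" using n unfolding k z_def shift_def by simp
 define E where "E = {x:V. c x = sc mu x}"
 have "graded_ideal E" proof (rule graded_idealI)
  show "subspace E" unfolding E_def by (intro subspaceI) (auto simp: linD[OF c(1)] lin_0[OF c(1)] scale_right_distrib mult.commute)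
  show "pr x : E" if "x : E" for x using that c(2) linD(3)[OF pr_lin] unfolding E_def even_def by (auto simp: pr_V)
  show "br x y : E" if "x : V" "y : E" for x y using that br_V unfolding E_def by (auto simp: c(4) brkt_scal_right)
  show "br y x : E" if "x : V" "y : E" for x y using that br_V unfolding E_def by (auto simp: c(3) brkt_scal_left)
 qed (auto simp: E_def)
 hence "E = V" using ideal_cases[of E] z zV cz unfolding E_def by blast
 thus ?thesis unfolding E_def by blast
qed

end

lemma eigen_decomp:
 fixes ze :: "nat => 'k"
 assumes s: "s : G" "!!x. x : V ==> (s ^^ m) x = x" "m >= 1" and ze: "compatible_roots ze" and x: "x : part L p"
 shows "EX y. (ALL j. y j : part L p & y j : eigen ze L s m (int j)) & x = (SUM j<m. y j)" proof -
 note r = rootsD[OF ze s(3)] and S = G_lin[OF s(1)]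
 have "EX y. (ALL j. y j : part L p & s (y j) = sc (ze m ^ j) (y j)) & x = (SUM j<m. y j)"
  using s(3) part_V by (intro finite_order_decomp[OF s(3) _ r(1,2) subspace_part even_part[OF autD(1,2)[OF G_aut[OF s(1)]]] linD(2)[OF S part_V part_V] linD(3)[OF S part_V] s(2)[OF part_V] x]) auto
 thus ?thesis unfolding eigen_iff using part_V by auto
qed

lemma ev_part:
 assumes "u : part (loop ze s m) p" shows "ev a u : part L p"
 unfolding ev_def using assms subspace_scale[OF subspace_part] unfolding loop_part by (intro subspace_sum[OF subspace_part]) auto

text \<open>The eigencomponents of \<open>x\<close> are put in their own degrees, each with a factor
  that compensates for the power of \<open>a\<close>.\<close>

lemma ev_surj_part:
 fixes ze :: "nat => 'k"
 assumes s: "s : G" "!!x. x : V ==> (s ^^ m) x = x" "m >= 1" and ze: "compatible_roots ze" and x: "x : part L p" and a: "a ~= 0"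
 shows "EX u:part (loop ze s m) p. ev a u = x" proof -
 note S = G_lin[OF s(1)]
 obtain y where y: "!!j. y j : part L p" "!!j. y j : eigen ze L s m (int j)" "x = (SUM j<m. y j)" using eigen_decomp[OF s ze x] by blast
 define u where "u = (SUM j<m. sg (int j) (sc (inverse (a ^ j)) (y j)))"
 have "sc (inverse (a ^ j)) (y j) : eigen ze L s m (int j)" for j
  using y(2)[of j] unfolding eigen_iff by (simp add: linD(3)[OF S] mult.commute)
 hence uc: "u : loops ze s m" unfolding u_def by (intro loop_sum[OF S] loop_single[OF S])
 have "u : part (loop ze s m) p" unfolding loop_part proof (intro conjI allI uc)
  show "lk u i : part L p" for i unfolding u_def using y(1) subspace_scale[OF subspace_part] by (intro part_sum_lookup part_single) blast
 qed
 moreover have "ev a u = x" unfolding u_def y(3) ev_sum ev_single using a by simp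
 ultimately show ?thesis by blast
qed

lemma ev_surj:
 fixes ze :: "nat => 'k"
 assumes s: "s : G" "!!x. x : V ==> (s ^^ m) x = x" "m >= 1" and ze: "compatible_roots ze" and x: "x : V" and a: "a ~= 0"
 shows "EX u:loops ze s m. ev a u = x" using x proof (rule V_part_induct)
 show "EX u:loops ze s m. ev a u = x" if x: "x : part L p" for p x proof -
  have "EX u:part (loop ze s m) p. ev a u = x" by (rule ev_surj_part[OF s ze x a])
  then obtain u where "u : part (loop ze s m) p" "ev a u = x" by (rule bexE)
  thus ?thesis unfolding loop_part by (intro bexI[of _ u]) simp_all
 qed
 show "EX u:loops ze s m. ev a u = x + y" if xy: "EX u:loops ze s m. ev a u = x" "EX u:loops ze s m. ev a u = y" for x y proof -
  obtain u v where "u : loops ze s m" "ev a u = x" "v : loops ze s m" "ev a v = y" using xy by blast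
  thus ?thesis using loop_add[OF G_lin[OF s(1)], of u ze m v] by (intro bexI[of _ "u + v"]) (simp_all add: ev_add)
 qed
qed

lemma ex_eigenvector:
 fixes ze :: "nat => 'k"
 assumes simple: "simple_lie_superalgebra L" and s: "s : G" "!!x. x : V ==> (s ^^ m) x = x" "m >= 1" and ze: "compatible_roots ze"
 shows "EX i x. x : eigen ze L s m i & x ~= 0" proof -
 obtain x where x: "x : V" "x ~= 0" using V_nonzero[OF simple] by blast
 have "EX u:loops ze s m. ev 1 u = x" by (rule ev_surj[OF s ze x(1)]) auto
 then obtain u where u: "u : loops ze s m" "ev 1 u = x" by blast
 hence "u ~= 0" using x(2) ev_0 by auto
 then obtain i where "lk u i ~= 0" by (metis poly_mapping_eqI lookup_zero)
 thus ?thesis using u(1) unfolding loop_carrier by blast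
qed

text \<open>Such a map descends to each evaluation: if \<open>u\<close> vanishes at
  \<open>a\<close>, then \<open>C u\<close> evaluated at \<open>a\<close> has zero bracket with
  everything, and the centre is trivial. By Schur's lemma it becomes a scalar there, nonzero because
  \<open>C\<close> is onto. Up to a monomial factor this scalar is a Laurent polynomial in
  \<open>a\<close> without zeros, hence a monomial.\<close>

theorem centroid_monomial:
 fixes ze :: "nat => 'k"
 assumes simple: "simple_lie_superalgebra L" and s: "s : G" "!!x. x : V ==> (s ^^ m) x = x" "m >= 1" and ze: "compatible_roots ze"
  and C: "!!u. u : loops ze s m ==> C u : loops ze s m"
   "!!u v. u : loops ze s m ==> v : loops ze s m ==> C (u + v) = C u + C v"
   "!!c u. u : loops ze s m ==> C (smul c u) = smul c (C u)"
   "!!p u. u : part (loop ze s m) p ==> C u : part (loop ze s m) p"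
   "!!u v. u : loops ze s m ==> v : loops ze s m ==> C (lbr u v) = lbr (C u) v"
   "!!u v. u : loops ze s m ==> v : loops ze s m ==> C (lbr u v) = lbr u (C v)"
   "!!v. v : loops ze s m ==> EX u:loops ze s m. C u = v"
 shows "EX al r. al ~= 0 & (ALL u:loops ze s m. ALL a. a ~= 0 --> ev a (C u) = sc (al * a powi r) (ev a u))" proof -
 let ?A = "loop ze s m"
 note S = G_lin[OF s(1)]
 have evV: "ev a u : V" if "u : carrier ?A" for a u using ev_V[OF loop_VL[OF that]] .
 have evbr: "ev a (lbr u v) = br (ev a u) (ev a v)" if "u : carrier ?A" "v : carrier ?A" "a ~= 0" for a u v
  using ev_lbr[OF loop_VL[OF that(1)] loop_VL[OF that(2)] that(3)] .
 have br_0: "br 0 y = 0" "br y 0 = 0" if "y : V" for y using lin_0[OF br_lin_left[OF that]] lin_0[OF br_lin_right[OF that]] by auto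
 have lbrc: "lbr u v : carrier ?A" if "u : carrier ?A" "v : carrier ?A" for u v
  using loop_lbr[where ze = ze and m = m, OF s(1) rootsD(4)[OF ze s(3)] that] .
 have "EX gm. ALL u:carrier ?A. ev a (C u) = sc gm (ev a u)" if a: "a ~= 0" for a proof -
  have ker: "ev a (C u) = 0" if u: "u : carrier ?A" "ev a u = 0" for u proof (rule centre_zero[OF simple evV[OF C(1)[OF u(1)]]])
   fix y assume "y : V"
   then obtain v where v: "v : carrier ?A" "ev a v = y" using ev_surj[OF s ze _ a] by blast
   have "br (ev a (C u)) y = br (ev a u) (ev a (C v))"
    using evbr[OF C(1)[OF u(1)] v(1) a] evbr[OF u(1) C(1)[OF v(1)] a] C(5)[OF u(1) v(1)] C(6)[OF u(1) v(1)] v(2) by metis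
   thus "br (ev a (C u)) y = 0" using u(2) br_0(1)[OF evV[OF C(1)[OF v(1)]]] by simp
   have "br y (ev a (C u)) = br (ev a (C v)) (ev a u)"
    using evbr[OF v(1) C(1)[OF u(1)] a] evbr[OF C(1)[OF v(1)] u(1) a] C(5)[OF v(1) u(1)] C(6)[OF v(1) u(1)] v(2) by metis
   thus "br y (ev a (C u)) = 0" using u(2) br_0(2)[OF evV[OF C(1)[OF v(1)]]] by simp
  qed
  have wd: "ev a (C u) = ev a (C v)" if uv: "u : carrier ?A" "v : carrier ?A" "ev a u = ev a v" for u v proof -
   have n: "smul (- 1) v : carrier ?A" using loop_smul[OF S uv(2)] .
   have "ev a (u + smul (- 1) v) = 0" unfolding ev_add ev_smul using uv(3) by simp
   hence "ev a (C (u + smul (- 1) v)) = 0" using ker loop_add[OF S uv(1) n] by blast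
   thus ?thesis unfolding C(2)[OF uv(1) n] C(3)[OF uv(2)] ev_add ev_smul by simp
  qed
  define c where "c x = ev a (C (SOME u. u : carrier ?A & ev a u = x))" for x
  have c: "c (ev a u) = ev a (C u)" if u: "u : carrier ?A" for u proof -
   have "(SOME v. v : carrier ?A & ev a v = ev a u) : carrier ?A & ev a (SOME v. v : carrier ?A & ev a v = ev a u) = ev a u"
    by (rule someI[of _ u]) (use u in simp)
   thus ?thesis unfolding c_def by (intro wd u) auto
  qed
  have ex: "EX u:carrier ?A. x = ev a u" if "x : V" for x using ev_surj[OF s ze that a] by blast
  have lc: "lin c" unfolding lin_def proof (intro conjI ballI allI)
   fix x assume "x : V"
   then obtain u where u: "u : carrier ?A" "x = ev a u" using ex by blast
   show "c x : V" unfolding u(2) c[OF u(1)] using evV C(1) u(1) by blast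
   show "c (sc k x) = sc k (c x)" for k unfolding u(2) c[OF u(1)] ev_smul[symmetric] c[OF loop_smul[OF S u(1)]] C(3)[OF u(1)] ..
   fix y assume "y : V"
   then obtain v where v: "v : carrier ?A" "y = ev a v" using ex by blast
   show "c (x + y) = c x + c y"
    unfolding u(2) v(2) c[OF u(1)] c[OF v(1)] ev_add[symmetric] c[OF loop_add[OF S u(1) v(1)]] C(2)[OF u(1) v(1)] ..
  qed
  have evc: "even c" proof (rule evenI[OF lc])
   fix p x assume "x : part L p"
   then obtain u where u: "u : part ?A p" "ev a u = x" using ev_surj_part[OF s ze _ a] by blast
   hence "u : carrier ?A" unfolding loop_part by blast
   thus "c x : part L p" using c[of u] u ev_part[OF C(4)[OF u(1)]] by simp
  qed
  have "c (br x y) = br (c x) y & c (br x y) = br x (c y)" if xy: "x : V" "y : V" for x y proof -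
   obtain u v where u: "u : carrier ?A" "x = ev a u" and v: "v : carrier ?A" "y = ev a v" using ex[OF xy(1)] ex[OF xy(2)] by blast
   have "c (br x y) = ev a (C (lbr u v))" unfolding u(2) v(2) evbr[OF u(1) v(1) a, symmetric] by (rule c[OF lbrc[OF u(1) v(1)]])
   thus ?thesis
    using evbr[OF C(1)[OF u(1)] v(1) a] evbr[OF u(1) C(1)[OF v(1)] a] C(5)[OF u(1) v(1)] C(6)[OF u(1) v(1)] c[OF u(1)] c[OF v(1)] u(2) v(2)
    by metis
  qed
  hence "EX gm. ALL x:V. c x = sc gm x" using schur[OF simple lc evc] by blast
  thus ?thesis using c evV by metis
 qed
 then obtain gm where gm: "!!a u. a ~= 0 ==> u : carrier ?A ==> ev a (C u) = sc (gm a) (ev a u)" by metis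
 have gmnz: "gm a ~= 0" if a: "a ~= 0" for a proof
  assume 0: "gm a = 0"
  obtain x where x: "x : V" "x ~= 0" using V_nonzero[OF simple] by blast
  obtain v where v: "v : carrier ?A" "ev a v = x" using ev_surj[OF s ze x(1) a] by blast
  obtain u where "u : carrier ?A" "C u = v" using C(7)[OF v(1)] by blast
  hence "x = 0" using gm[OF a, of u] 0 v(2) by simp
  thus False using x(2) by simp
 qed
 obtain i x where x: "x : eigen ze L s m i" "x ~= 0" using ex_eigenvector[OF simple s ze] by blast
 have xV: "x : V" using x(1) unfolding eigen_iff by blast
 obtain b where b: "crd b x ~= 0" using crd_sum[OF xV] x(2) by (metis (no_types, lifting) scale_zero_left sum.neutral)
 define u where "u = sg i x"
 have u: "u : carrier ?A" unfolding u_def using loop_single[OF S x(1)] .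
 \<comment> \<open>On a loop with the single term \<open>x\<close> at degree \<open>i\<close>, a
   coordinate of \<open>C u\<close> exhibits the scalar \<open>gm a\<close> as a Laurent polynomial,
   up to a constant and the factor \<open>a powi i\<close>.\<close>
 define La where "La a = (SUM j:ks (C u). crd b (lk (C u) j) * a powi j)" for a
 have La: "La a = gm a * a powi i * crd b x" if a: "a ~= 0" for a proof -
  note CV = VL_lookup[OF loop_VL[OF C(1)[OF u]]]
  have "crd b (ev a (C u)) = La a" unfolding ev_def La_def crd_sum'[OF V_scale[OF CV]] crd_scale[OF CV] by (simp add: mult.commute)
  moreover have "crd b (ev a (C u)) = gm a * a powi i * crd b x"
   unfolding gm[OF a u] unfolding u_def ev_single using xV by (simp add: crd_scale)
  ultimately show ?thesis by simp
 qed
 have "EX al r. al ~= 0 & (ALL a. a ~= 0 --> La a = al * a powi r)" unfolding La_def proof (rule laurent_nonvanishing)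
  fix a :: 'k assume a: "a ~= 0"
  have "La a ~= 0" unfolding La[OF a] using gmnz[OF a] a b by simp
  thus "(SUM j:ks (C u). crd b (lk (C u) j) * a powi j) ~= 0" unfolding La_def .
 qed simp
 then obtain al r where al: "al ~= 0" "!!a. a ~= 0 ==> La a = al * a powi r" by blast
 have "gm a = (al / crd b x) * a powi (r - i)" if a: "a ~= 0" for a
  using La[OF a] al(2)[OF a] a b by (simp add: power_int_diff field_simps)
 thus ?thesis using gm al(1) b by (intro exI[of _ "al / crd b x"] exI[of _ "r - i"]) auto
qed

end

section \<open>Isomorphic loop algebras\<close>

context fd_lie_superalgebra
begin

interpretation AG: group "Aut L" by (rule group_Aut)

text \<open>Multiplication by the \<open>k\<close>-th power of the loop variable. For
  \<open>k\<close> divisible by the period it preserves the loop algebra and belongs to its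
  centroid.\<close>

definition Sh :: "int => (int \<Rightarrow>\<^sub>0 'a) => int \<Rightarrow>\<^sub>0 'a" where
 "Sh k u = (SUM i:ks u. sg (i + k) (lk u i))"

lemma ev_Sh: "a ~= 0 ==> ev a (Sh k u) = sc (a powi k) (ev a u)"
 unfolding Sh_def ev_sum ev_single unfolding ev_def by (simp add: scale_sum_right power_int_add mult.commute)

lemma VL_Sh: "u : VL ==> Sh k u : VL" unfolding Sh_def by (intro VL_sum VL_single VL_lookup)

lemma Sh_single: "x : V ==> Sh k (sg i x) = sg (i + k) x"
 by (rule ev_inj[OF VL_Sh[OF VL_single] VL_single]) (simp_all add: ev_Sh ev_single power_int_add mult.commute)

lemma Sh_Sh: "u : VL ==> Sh j (Sh k u) = Sh (j + k) u" by (rule ev_inj[OF VL_Sh[OF VL_Sh] VL_Sh]) (simp_all add: ev_Sh power_int_add)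

lemma Sh_0: "u : VL ==> Sh 0 u = u" by (rule ev_inj[OF VL_Sh]) (simp_all add: ev_Sh)

lemma Sh_add: "u : VL ==> v : VL ==> Sh k (u + v) = Sh k u + Sh k v"
 by (rule ev_inj[OF VL_Sh[OF VL_add] VL_add[OF VL_Sh VL_Sh]]) (simp_all add: ev_Sh ev_add scale_right_distrib)

lemma Sh_smul: "u : VL ==> Sh k (smul c u) = smul c (Sh k u)"
 by (rule ev_inj[OF VL_Sh[OF VL_smul] VL_smul[OF VL_Sh]]) (simp_all add: ev_Sh ev_smul mult.commute)

lemma Sh_lbr:
 assumes u: "u : VL" and v: "v : VL"
 shows "Sh k (lbr u v) = lbr (Sh k u) v" "Sh k (lbr u v) = lbr u (Sh k v)" using ev_V[OF u] ev_V[OF v]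
 by (auto intro!: ev_inj VL_Sh VL_lbr u v simp: ev_Sh ev_lbr u v VL_Sh brkt_scal_left brkt_scal_right)

lemma loop_Sh:
 assumes s: "lin s" and ze: "ze m ~= 0" "ze m ^ m = 1" and k: "int m dvd k"
 shows "u : loops ze s m ==> Sh k u : loops ze s m" "u : part (loop ze s m) p ==> Sh k u : part (loop ze s m) p" proof -
 obtain q where q: "k = int m * q" using k by blast
 have "ze m powi k = 1" unfolding q power_int_mult power_int_of_nat ze(2) by simp
 hence e: "ze m powi (i + k) = ze m powi i" for i using ze(1) by (simp add: power_int_add)
 show c: "Sh k u : loops ze s m" if "u : loops ze s m" for u unfolding Sh_def using that unfolding loop_carrier[of u] eigen_iff
  by (intro loop_sum[OF s] loop_single[OF s]) (simp add: eigen_iff e)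
 show "Sh k u : part (loop ze s m) p" if u: "u : part (loop ze s m) p" unfolding loop_part proof (intro conjI allI)
  show "Sh k u : loops ze s m" using u unfolding loop_part by (intro c) blast
  show "lk (Sh k u) i : part L p" for i unfolding Sh_def using u unfolding loop_part by (intro part_sum_lookup part_single) blast
 qed
qed

lemma sa_isoD:
 assumes "f : sa_iso (loop ze s m) (loop ze' t n)"
 shows "u : loops ze s m ==> f u : loops ze' t n"
  "u : loops ze s m ==> v : loops ze s m ==> f (u + v) = f u + f v"
  "u : loops ze s m ==> f (smul c u) = smul c (f u)"
  "u : loops ze s m ==> v : loops ze s m ==> f (lbr u v) = lbr (f u) (f v)"
  "u : part (loop ze s m) p ==> f u : part (loop ze' t n) p" proof -
 have *: "bij_betw f (loops ze s m) (loops ze' t n)" "f ` part (loop ze s m) p = part (loop ze' t n) p"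
  using assms unfolding sa_iso_def by blast+
 show "u : loops ze s m ==> f u : loops ze' t n" using *(1) by (meson bij_betwE)
 show "u : part (loop ze s m) p ==> f u : part (loop ze' t n) p" using *(2) by blast
qed (use assms in \<open>simp_all add: sa_iso_def loop_scal loop_brkt\<close>)

text \<open>Multiplication by the \<open>m\<close>-th power of the variable, transported through the
  isomorphism, is again in the centroid and so is monomial; its degree is divisible by
  \<open>m\<close> because it must preserve the eigenvalues of \<open>s\<close>.\<close>

lemma shift_conjugate:
 fixes ze :: "nat => 'k"
 assumes simple: "simple_lie_superalgebra L" and ze: "compatible_roots ze" and m: "m >= 1"
  and s: "s : G" "!!x. x : V ==> (s ^^ m) x = x" and t: "t : G"
  and f: "f : sa_iso (loop ze s m) (loop ze t m)" and g: "g : sa_iso (loop ze t m) (loop ze s m)"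
  and gf: "!!u. u : loops ze s m ==> g (f u) = u" and fg: "!!w. w : loops ze t m ==> f (g w) = w"
 shows "EX al q. al ~= 0 & (ALL u:loops ze s m. Sh (int m) (f u) = smul al (f (Sh (int m * q) u)))" proof -
 let ?A = "loop ze s m" and ?B = "loop ze t m"
 note r = rootsD[OF ze m] and S = G_lin[OF s(1)] and T = G_lin[OF t]
 note F = sa_isoD[OF f] and K = sa_isoD[OF g]
 have ShB: "Sh (int m * k) w : carrier ?B" "w : part ?B p ==> Sh (int m * k) w : part ?B p" if "w : carrier ?B" for w k p
  using loop_Sh[where ze = ze and m = m and k = "int m * k", OF T r(4,1)] that by auto
 have ShB1: "Sh (int m) w : carrier ?B" if "w : carrier ?B" for w using ShB(1)[OF that, of 1] by simp
 define C where "C u = g (Sh (int m) (f u))" for u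
 have "EX al r. al ~= 0 & (ALL u:carrier ?A. ALL a. a ~= 0 --> ev a (C u) = sc (al * a powi r) (ev a u))"
 proof (rule centroid_monomial[OF simple s m ze])
  fix u assume u: "u : carrier ?A"
  note fu = F(1)[OF u] and fuV = loop_VL[OF F(1)[OF u]]
  show "C u : carrier ?A" unfolding C_def by (rule K(1)[OF ShB1[OF fu]])
  show "C (smul c u) = smul c (C u)" for c unfolding C_def F(3)[OF u] Sh_smul[OF fuV] K(3)[OF ShB1[OF fu]] ..
  show "EX v:carrier ?A. C v = u" proof
   have S': "Sh (- int m) (f u) : carrier ?B" using ShB(1)[OF fu, of "- 1"] by simp
   show "g (Sh (- int m) (f u)) : carrier ?A" by (rule K(1)[OF S'])
   show "C (g (Sh (- int m) (f u))) = u" unfolding C_def fg[OF S'] Sh_Sh[OF fuV] by (simp add: Sh_0[OF fuV] gf[OF u])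
  qed
  fix v assume v: "v : carrier ?A"
  note fv = F(1)[OF v] and fvV = loop_VL[OF F(1)[OF v]]
  show "C (u + v) = C u + C v" unfolding C_def F(2)[OF u v] Sh_add[OF fuV fvV] K(2)[OF ShB1[OF fu] ShB1[OF fv]] ..
  show "C (lbr u v) = lbr (C u) v" unfolding C_def F(4)[OF u v] Sh_lbr(1)[OF fuV fvV] K(4)[OF ShB1[OF fu] fv] gf[OF v] ..
  show "C (lbr u v) = lbr u (C v)" unfolding C_def F(4)[OF u v] Sh_lbr(2)[OF fuV fvV] K(4)[OF fu ShB1[OF fv]] gf[OF u] ..
 next
  fix p u assume u: "u : part ?A p"
  hence "f u : part ?B p" by (rule F(5))
  hence "Sh (int m) (f u) : part ?B p" using ShB(2)[of "f u" p 1] unfolding loop_part by simp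
  thus "C u : part ?A p" unfolding C_def by (rule K(5))
 qed auto
 then obtain al rh where al: "al ~= 0" "!!u a. u : carrier ?A ==> a ~= 0 ==> ev a (C u) = sc (al * a powi rh) (ev a u)" by blast
 have Cc: "C u : carrier ?A" if "u : carrier ?A" for u unfolding C_def by (rule K(1)[OF ShB1[OF F(1)[OF that]]])
 have C: "C u = smul al (Sh rh u)" if u: "u : carrier ?A" for u
  by (rule ev_inj[OF loop_VL[OF Cc[OF u]] VL_smul[OF VL_Sh[OF loop_VL[OF u]]]]) (simp add: al(2)[OF u] ev_smul ev_Sh)
 obtain i x where x: "x : eigen ze L s m i" "x ~= 0" proof -
  have "EX i x. x : eigen ze L s m i & x ~= 0" by (rule ex_eigenvector[OF simple s m ze])
  thus ?thesis using that by (elim exE conjE)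
 qed
 have xV: "x : V" "s x = sc (ze m powi i) x" using x(1) unfolding eigen_iff by auto
 have "C (sg i x) : carrier ?A" by (rule Cc[OF loop_single[OF S x(1)]])
 hence "smul al (sg (i + rh) x) : carrier ?A" unfolding C[OF loop_single[OF S x(1)]] Sh_single[OF xV(1)] .
 hence "sc al x : eigen ze L s m (i + rh)" unfolding loop_carrier by (metis lookup_smul lookup_single_eq)
 hence "sc al (s x) = sc al (sc (ze m powi (i + rh)) x)" unfolding eigen_iff linD(3)[OF S xV(1)] by (simp add: mult.commute)
 hence "sc (ze m powi i) x = sc (ze m powi (i + rh)) x" using al(1) xV(2) by (simp add: scale_cancel_left)
 hence "ze m powi i = ze m powi i * ze m powi rh" using x(2) r(4) by (simp add: scale_cancel_right power_int_add)
 hence "ze m powi rh = 1" using r(4) by simp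
 hence "int m dvd rh" by (rule primitive_powi_eq_1[OF ze m])
 then obtain q where q: "rh = int m * q" by blast
 have "Sh (int m) (f u) = smul al (f (Sh (int m * q) u))" if u: "u : carrier ?A" for u proof -
  have S': "Sh (int m * q) u : carrier ?A" by (rule loop_Sh(1)[where ze = ze and m = m, OF S r(4,1) _ u]) simp
  have "Sh (int m) (f u) = f (C u)" unfolding C_def fg[OF ShB1[OF F(1)[OF u]]] ..
  also have "... = smul al (f (Sh (int m * q) u))" unfolding C[OF u] q F(3)[OF S'] ..
  finally show ?thesis .
 qed
 thus ?thesis using al(1) by blast
qed

lemma powi_eqD:
 assumes "!!a::'k. a ~= 0 ==> a powi i = ka * a powi j" shows "i = j" proof (rule ccontr)
 assume ij: "i ~= j"
 have "(if i = i then 1 else - ka) = 0" proof (rule laurent_zero[of "{i, j}" "%k. if k = i then 1 else - ka"])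
  fix a :: 'k assume "a ~= 0"
  thus "(SUM k:{i, j}. (if k = i then 1 else - ka) * a powi k) = 0" using ij assms by auto
 qed auto
 thus False by simp
qed

text \<open>Transport in both directions gives exponents with product \<open>1\<close>. The
  isomorphism thus acts on the \<open>m\<close>-th power of the variable by an automorphism of the
  punctured line, and the sign \<open>ep\<close> is the origin of the alternative between an element
  and its inverse.\<close>

lemma iso_shift:
 fixes ze :: "nat => 'k"
 assumes simple: "simple_lie_superalgebra L" and ze: "compatible_roots ze" and m: "m >= 1"
  and s: "s : G" "!!x. x : V ==> (s ^^ m) x = x" and t: "t : G" "!!x. x : V ==> (t ^^ m) x = x"
  and f: "f : sa_iso (loop ze s m) (loop ze t m)"
 shows "EX bt ep. bt ~= 0 & (ep = 1 | ep = - 1) & (ALL u:loops ze s m. ALL a k. a ~= 0 -->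
  ev a (f (Sh (int m * k) u)) = sc ((bt * a powi (int m * ep)) powi k) (ev a (f u)))" proof -
 let ?A = "loop ze s m" and ?B = "loop ze t m"
 note r = rootsD[OF ze m] and S = G_lin[OF s(1)] and T = G_lin[OF t(1)]
 define g where "g = inv_into (carrier ?A) f"
 have g: "g : sa_iso ?B ?A" unfolding g_def by (rule loop_iso_inv[where ze = ze and m = m, OF s(1) r(4) f])
 have b: "bij_betw f (carrier ?A) (carrier ?B)" using f unfolding sa_iso_def by blast
 have gf: "g (f u) = u" if "u : carrier ?A" for u unfolding g_def using bij_betw_inv_into_left[OF b that] .
 have fg: "f (g w) = w" if "w : carrier ?B" for w unfolding g_def using bij_betw_inv_into_right[OF b that] .
 note F = sa_isoD[OF f] and K = sa_isoD[OF g]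
 have "EX al q. al ~= 0 & (ALL u:carrier ?A. Sh (int m) (f u) = smul al (f (Sh (int m * q) u)))"
  by (rule shift_conjugate[OF simple ze m s t(1) f g gf fg])
 then obtain al q where al: "al ~= 0" "!!u. u : carrier ?A ==> Sh (int m) (f u) = smul al (f (Sh (int m * q) u))" by blast
 have "EX al q. al ~= 0 & (ALL u:carrier ?B. Sh (int m) (g u) = smul al (g (Sh (int m * q) u)))"
  by (rule shift_conjugate[OF simple ze m t s(1) g f fg gf])
 then obtain bt q' where bt: "bt ~= 0" "!!u. u : carrier ?B ==> Sh (int m) (g u) = smul bt (g (Sh (int m * q') u))" by blast
 have ShA: "Sh (int m * k) u : carrier ?A" if "u : carrier ?A" for u k
  by (rule loop_Sh(1)[where ze = ze and m = m, OF S r(4,1) _ that]) simp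
 have ShB: "Sh (int m * k) u : carrier ?B" if "u : carrier ?B" for u k
  by (rule loop_Sh(1)[where ze = ze and m = m, OF T r(4,1) _ that]) simp
 have evf: "ev a (f (Sh (int m * k) u)) = sc ((bt * a powi (int m * q')) powi k) (ev a (f u))"
  if u: "u : carrier ?A" and a: "a ~= 0" for u a k proof -
  define c where "c = bt * a powi (int m * q')"
  have c: "c ~= 0" unfolding c_def using a bt(1) by simp
  have 1: "ev a (f (Sh (int m) v)) = sc c (ev a (f v))" if v: "v : carrier ?A" for v proof -
   note fv = F(1)[OF v]
   have "Sh (int m) v = smul bt (g (Sh (int m * q') (f v)))" using bt(2)[OF fv] unfolding gf[OF v] .
   thus ?thesis using F(3)[OF K(1)[OF ShB[OF fv]]] fg[OF ShB[OF fv]] a unfolding c_def by (simp add: ev_smul ev_Sh)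
  qed
  have 2: "ev a (f (Sh (int m * int n) v)) = sc (c ^ n) (ev a (f v))" if v: "v : carrier ?A" for v n proof (induction n)
   case (Suc n)
   have "Sh (int m * int (Suc n)) v = Sh (int m) (Sh (int m * int n) v)" unfolding Sh_Sh[OF loop_VL[OF v]] by (simp add: algebra_simps)
   thus ?case using 1[OF ShA[OF v, of "int n"]] Suc by simp
  qed (simp add: Sh_0[OF loop_VL[OF v]])
  have "ev a (f (Sh (int m * k) u)) = sc (c powi k) (ev a (f u))" proof (cases "k >= 0")
   case True
   thus ?thesis using 2[OF u, of "nat k"] by (simp add: power_int_def)
  next
   case False
   have "Sh (int m * int (nat (- k))) (Sh (int m * k) u) = u"
    using False Sh_0[OF loop_VL[OF u]] unfolding Sh_Sh[OF loop_VL[OF u]] by simp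
   hence "ev a (f u) = sc (c ^ nat (- k)) (ev a (f (Sh (int m * k) u)))" using 2[OF ShA[OF u], of "nat (- k)" k] by simp
   thus ?thesis using False c by (simp add: power_int_def power_inverse)
  qed
  thus ?thesis unfolding c_def .
 qed
 obtain i y where y: "y : eigen ze L t m i" "y ~= 0" proof -
  have "EX i x. x : eigen ze L t m i & x ~= 0" by (rule ex_eigenvector[OF simple t m ze])
  thus ?thesis using that by (elim exE conjE)
 qed
 define w where "w = sg i y"
 have w: "w : carrier ?B" unfolding w_def by (rule loop_single[OF T y(1)])
 have evw: "ev a w ~= 0" if "a ~= 0" for a unfolding w_def ev_single using that y(2) by simp
 define u where "u = g w"
 have u: "u : carrier ?A" "f u = w" unfolding u_def using K(1)[OF w] fg[OF w] by auto
 \<comment> \<open>Composing the two transports on a loop that is nonzero at every point equates two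
   powers of \<open>a\<close> up to a constant.\<close>
 have "int m = int m * q' * q" proof (rule powi_eqD)
  fix a :: 'k assume a: "a ~= 0"
  have "sc (a powi int m) (ev a w) = ev a (Sh (int m) (f u))" unfolding u(2) ev_Sh[OF a] ..
  also have "... = sc (al * bt powi q * a powi (int m * q' * q)) (ev a w)"
   unfolding al(2)[OF u(1)] ev_smul evf[OF u(1) a] unfolding u(2) by (simp only: power_int_mult_distrib power_int_mult[symmetric] scale_scale mult.assoc)
  finally show "a powi int m = al * bt powi q * a powi (int m * q' * q)" using evw[OF a] by (simp only: scale_cancel_right) simp
 qed
 hence "q' * q = 1" using m by simp
 hence "q' = 1 | q' = - 1" by (metis zmult_eq_1_iff)
 thus ?thesis using bt(1) evf by (intro exI[of _ bt] exI[of _ q']) simp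
qed

end

context fd_lie_superalgebra
begin

interpretation AG: group "Aut L" by (rule group_Aut)

lemma gp_eigen:
 fixes ze :: "nat => 'k"
 assumes s: "s : G" "!!x. x : V ==> (s ^^ m) x = x" "m >= 1" and ze: "compatible_roots ze" and x: "x : V"
 shows "s (gp s mu x) = sc mu (gp s mu x)" using x proof (rule V_part_induct)
 note S = G_lin[OF s(1)]
 fix p x assume x: "x : part L p"
 have "EX y. (ALL j. y j : part L p & y j : eigen ze L s m (int j)) & x = (SUM j<m. y j)" by (rule eigen_decomp[OF s ze x])
 then obtain y where y: "!!j. y j : eigen ze L s m (int j)" "x = (SUM j<m. y j)" by blast
 have yV: "y j : V" and sy: "s (y j) = sc (ze m powi int j) (y j)" for j using y(1)[of j] unfolding eigen_iff by auto
 have g: "gp s mu (y j) = (if mu = ze m powi int j then y j else 0)" for j by (rule gp_on_gen[OF S gen_eigen[OF S yV sy]])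
 show "s (gp s mu x) = sc mu (gp s mu x)" unfolding y(2) lin_sum[OF gp_lin[OF S] yV] lin_sum[OF S gp_V[OF S yV]] scale_sum_right
  by (rule sum.cong[OF refl]) (auto simp: g sy lin_0[OF S])
next
 note S = G_lin[OF s(1)]
 fix x y assume "x : V" "y : V" "s (gp s mu x) = sc mu (gp s mu x)" "s (gp s mu y) = sc mu (gp s mu y)"
 thus "s (gp s mu (x + y)) = sc mu (gp s mu (x + y))" by (simp add: linD[OF gp_lin[OF S]] linD[OF S] gp_V[OF S] scale_right_distrib)
qed

lemma loop_expand:
 assumes "lin s" "u : loops ze s m"
 shows "u = (SUM i:ks u. sg i (lk u i))"
 by (rule ev_inj[OF loop_VL[OF assms(2)] VL_sum[OF VL_single[OF VL_lookup[OF loop_VL[OF assms(2)]]]]])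
  (simp add: ev_sum ev_single ev_def[of _ u])

text \<open>Membership in the loop algebra is an equivariance condition: rotating the point by the
  root of unity has the effect of \<open>s\<close>.\<close>

lemma ev_rotate:
 assumes s: "lin s" and ze: "ze m ~= 0" and u: "u : loops ze s m" and a: "a ~= 0"
 shows "ev (ze m * a) u = s (ev a u)" proof -
 have uV: "lk u i : V" and us: "s (lk u i) = sc (ze m powi i) (lk u i)" for i using u unfolding loop_carrier eigen_iff by auto
 show ?thesis unfolding ev_def lin_sum[OF s V_scale[OF uV]] linD(3)[OF s uV] us by (simp add: power_int_mult_distrib mult.commute)
qed

text \<open>The points \<open>a\<close> and \<open>b a\<close> are matched so that multiplication by
  the \<open>m\<close>-th power of the variable has the same effect at \<open>a\<close> before
  \<open>f\<close> and at \<open>b a\<close> after it. This makes the value of \<open>f u\<close> at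
  \<open>b a\<close> depend on the value of \<open>u\<close> at \<open>a\<close> alone, and the
  resulting map is \<open>ph a\<close>.\<close>

theorem loop_iso_imp_conn:
 fixes ze :: "nat => 'k"
 assumes simple: "simple_lie_superalgebra L" and ze: "compatible_roots ze" and m: "m >= 1"
  and s: "s : G" "!!x. x : V ==> (s ^^ m) x = x" and t: "t : G" "!!x. x : V ==> (t ^^ m) x = x"
  and iso: "sa_isomorphic (loop ze s m) (loop ze t m)"
 shows "EX h:G. conn s (h \<cdot> t \<cdot> ginv h) | conn s (h \<cdot> ginv t \<cdot> ginv h)" proof -
 let ?A = "loop ze s m" and ?B = "loop ze t m"
 note r = rootsD[OF ze m] and S = G_lin[OF s(1)] and T = G_lin[OF t(1)]
 obtain f where f: "f : sa_iso ?A ?B" using iso unfolding sa_isomorphic_def by blast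
 note F = sa_isoD[OF f]
 have "EX bt ep. bt ~= 0 & (ep = 1 | ep = - 1) & (ALL u:carrier ?A. ALL a k. a ~= 0 -->
  ev a (f (Sh (int m * k) u)) = sc ((bt * a powi (int m * ep)) powi k) (ev a (f u)))" by (rule iso_shift[OF simple ze m s t f])
 then obtain bt and ep :: int where bt: "bt ~= 0" and ep: "ep = 1 | ep = - 1"
  and fS: "!!u a k. u : carrier ?A ==> a ~= 0 ==> ev a (f (Sh (int m * k) u)) = sc ((bt * a powi (int m * ep)) powi k) (ev a (f u))" by blast
 \<comment> \<open>The constant \<open>ka\<close> is chosen to absorb \<open>bt\<close>, so that the
   scalar by which the shift acts after \<open>f\<close> becomes exactly the \<open>m\<close>-th
   power of \<open>a\<close>.\<close>
 obtain ka where ka: "ka ~= 0" "ka powi (int m * ep) = 1 / bt" using ex_root_powi[of "1 / bt" "int m * ep"] bt ep m by auto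
 define b where "b a = ka * a powi ep" for a
 have b0: "b a ~= 0" if "a ~= 0" for a unfolding b_def using ka(1) that by simp
 have bm: "bt * b a powi (int m * ep) = a powi int m" if a: "a ~= 0" for a proof -
  have "b a powi (int m * ep) = 1 / bt * (a powi ep) powi (int m * ep)" unfolding b_def power_int_mult_distrib ka(2) ..
  also have "(a powi ep) powi (int m * ep) = a powi int m" using ep by (auto simp: power_int_mult[symmetric])
  finally show ?thesis using bt by simp
 qed
 define ps where "ps a u = ev (b a) (f u)" for a u
 have psV: "ps a u : V" if "u : carrier ?A" for a u unfolding ps_def by (rule ev_V[OF loop_VL[OF F(1)[OF that]]])
 have psadd: "ps a (u + v) = ps a u + ps a v" and pssmul: "ps a (smul c u) = sc c (ps a u)" if "u : carrier ?A" "v : carrier ?A" for a c u v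
  unfolding ps_def F(2)[OF that] F(3)[OF that(1)] ev_add ev_smul by simp_all
 have ps0: "ps a 0 = 0" for a using psadd[OF loop_zero[OF S] loop_zero[OF S], of a] by simp
 have pssum: "ps a (sum u I) = (SUM i:I. ps a (u i))" if "!!i. i : I ==> u i : carrier ?A" for a I and u :: "int => _" using that
 proof (induction I rule: infinite_finite_induct)
  case (insert i I)
  thus ?case using psadd[of "u i" "sum u I" a] loop_sum[OF S, of I u ze m] by simp
 qed (simp_all add: ps0)
 have psS: "ps a (Sh (int m * k) u) = sc (a powi (int m * k)) (ps a u)" if "u : carrier ?A" "a ~= 0" for u a k
  unfolding ps_def fS[OF that(1) b0[OF that(2)]] bm[OF that(2)] by (simp only: power_int_mult)
 \<comment> \<open>Each eigencomponent is lifted to its degree between \<open>0\<close> and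
   \<open>m - 1\<close>; \<open>phev\<close> shows that any other lift of the vector gives the same
   value.\<close>
 define e where "e j x = sg (int j) (gp s (ze m ^ j) x)" for j x
 have eA: "e j x : carrier ?A" if "x : V" for j x unfolding e_def proof (rule loop_single[OF S])
  have "s (gp s (ze m ^ j) x) = sc (ze m ^ j) (gp s (ze m ^ j) x)" by (rule gp_eigen[OF s m ze that])
  thus "gp s (ze m ^ j) x : eigen ze L s m (int j)" unfolding eigen_iff using gp_V[OF S that] by simp
 qed
 define ph where "ph a x = (SUM j<m. sc (inverse (a ^ j)) (ps a (e j x)))" for a x
 have phlin: "lin (ph a)" for a unfolding ph_def proof (rule lin_sumT, rule lin_scaleT)
  fix j
  have "e j (x + y) = e j x + e j y" "e j (sc c x) = smul c (e j x)" if "x : V" "y : V" for x y c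
   unfolding e_def using that linD(2,3)[OF gp_lin[OF S]]
   by (auto intro!: poly_mapping_eqI simp: lookup_add lookup_smul lookup_single when_def)
  thus "lin (%x. ps a (e j x))" unfolding lin_def using psV[OF eA] psadd[OF eA eA] pssmul[OF eA eA] by simp
 qed
 have phev: "ph a (ev a u) = ps a u" if u: "u : carrier ?A" and a: "a ~= 0" for a u proof -
  have ue: "lk u i : eigen ze L s m i" for i using u unfolding loop_carrier by blast
  have uV: "lk u i : V" and us: "s (lk u i) = sc (ze m powi i) (lk u i)" for i using ue unfolding eigen_iff by auto
  have 1: "sc (a powi i) (ph a (lk u i)) = ps a (sg i (lk u i))" for i proof -
   let ?x = "lk u i"
   define j0 where "j0 = nat (i mod int m)"
   define k where "k = i div int m"
   have m0: "0 < int m" using m by simp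
   have j0: "i = int j0 + int m * k" "j0 < m" unfolding j0_def k_def using m0 by (simp_all add: nat_less_iff)
   have z: "ze m powi i = ze m ^ j0" proof -
    have "ze m powi (int m * k) = 1" unfolding power_int_mult power_int_of_nat r(1) by simp
    thus ?thesis unfolding j0(1) using r(4) by (simp add: power_int_add)
   qed
   have g: "gp s (ze m ^ j) ?x = (if j = j0 then ?x else 0)" if "j < m" for j proof -
    have "gp s (ze m ^ j) ?x = (if ze m ^ j = ze m powi i then ?x else 0)" by (rule gp_on_gen[OF S gen_eigen[OF S uV us]])
    moreover have "j = j0" if eq: "ze m ^ j = ze m ^ j0" proof -
     have "ze m powi (int j - int j0) = 1" using eq r(4) by (simp add: power_int_diff)
     hence "int m dvd int j - int j0" by (rule primitive_powi_eq_1[OF ze m])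
     thus ?thesis using `j < m` j0(2) zdvd_imp_le[of "int m" "\<bar>int j - int j0\<bar>"] by (cases "j = j0") auto
    qed
    ultimately show ?thesis unfolding z by auto
   qed
   have xA: "sg (int j0) ?x : carrier ?A" by (rule loop_single[OF S]) (use ue[of i] z in \<open>simp add: eigen_iff\<close>)
   have "ph a ?x = (SUM j<m. if j = j0 then sc (inverse (a ^ j0)) (ps a (sg (int j0) ?x)) else 0)"
    unfolding ph_def e_def by (intro sum.cong refl) (auto simp: g ps0)
   hence 2: "ph a ?x = sc (inverse (a ^ j0)) (ps a (sg (int j0) ?x))" using j0(2) by simp
   have "sg i ?x = Sh (int m * k) (sg (int j0) ?x)" unfolding Sh_single[OF uV] using j0(1) by simp
   hence "ps a (sg i ?x) = sc (a powi (int m * k)) (ps a (sg (int j0) ?x))" using psS[OF xA a] by simp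
   moreover have "a powi i * inverse (a ^ j0) = a powi (int m * k)" unfolding j0(1) using a by (simp add: power_int_add)
   ultimately show ?thesis unfolding 2 by simp
  qed
  have "ph a (ev a u) = (SUM i:ks u. ps a (sg i (lk u i)))" unfolding ev_def lin_sum[OF phlin V_scale[OF uV]] linD(3)[OF phlin uV] 1 ..
  also have "... = ps a (SUM i:ks u. sg i (lk u i))" by (rule pssum[symmetric]) (rule loop_single[OF S ue])
  finally show ?thesis unfolding loop_expand[OF S u, symmetric] .
 qed
 have surjA: "EX u:carrier ?A. ev a u = x" if "x : V" "a ~= 0" for x a by (rule ev_surj[OF s m ze that])
 have surjB: "EX u:carrier ?B. ev a u = x" if "x : V" "a ~= 0" for x a by (rule ev_surj[OF t m ze that])
 have phbr: "ph a (br x y) = br (ph a x) (ph a y)" if a: "a ~= 0" and xy: "x : V" "y : V" for a x y proof -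
  obtain u where u: "u : carrier ?A" "ev a u = x" using surjA[OF xy(1) a] by blast
  obtain v where v: "v : carrier ?A" "ev a v = y" using surjA[OF xy(2) a] by blast
  have l: "lbr u v : carrier ?A" by (rule loop_lbr[where ze = ze and m = m, OF s(1) r(4) u(1) v(1)])
  have "ph a (br x y) = ps a (lbr u v)" unfolding phev[OF l a, symmetric] ev_lbr[OF loop_VL[OF u(1)] loop_VL[OF v(1)] a] u(2) v(2) ..
  also have "... = br (ps a u) (ps a v)"
   unfolding ps_def F(4)[OF u(1) v(1)] ev_lbr[OF loop_VL[OF F(1)[OF u(1)]] loop_VL[OF F(1)[OF v(1)]] b0[OF a]] ..
  finally show ?thesis unfolding phev[OF u(1) a, symmetric] phev[OF v(1) a, symmetric] u(2) v(2) .
 qed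
 have pheven: "even (ph a)" if a: "a ~= 0" for a proof (rule evenI[OF phlin])
  fix p x assume x: "x : part L p"
  have "EX u:part ?A p. ev a u = x" by (rule ev_surj_part[OF s m ze x a])
  then obtain u where u: "u : part ?A p" "ev a u = x" by blast
  hence "u : carrier ?A" unfolding loop_part by blast
  thus "ph a x : part L p" using phev[OF _ a, of u] u(2) ev_part[OF F(5)[OF u(1)]] unfolding ps_def by simp
 qed
 have phsurj: "EX x:V. ph a x = y" if a: "a ~= 0" and y: "y : V" for a y proof -
  obtain w where w: "w : carrier ?B" "ev (b a) w = y" using surjB[OF y b0[OF a]] by blast
  have "w : f ` carrier ?A" using f w(1) unfolding sa_iso_def bij_betw_def by blast
  then obtain u where u: "u : carrier ?A" "w = f u" by blast
  hence "ph a (ev a u) = y" using phev[OF u(1) a] w(2) unfolding ps_def by simp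
  thus ?thesis using ev_V[OF loop_VL[OF u(1)]] by blast
 qed
 have phker: "x = 0" if a: "a ~= 0" and x: "x : V" "ph a x = 0" for a x proof -
  define K where "K = {x:V. ph a x = 0}"
  have "graded_ideal K" proof (rule graded_idealI)
   show "subspace K" unfolding K_def by (intro subspaceI) (auto simp: linD[OF phlin] lin_0[OF phlin])
   show "pr x : K" if "x : K" for x using that pheven[OF a] pr_V lin_0[OF pr_lin] unfolding K_def even_def by auto
   show "br x y : K" "br y x : K" if "x : V" "y : K" for x y
    using that br_V linD(1)[OF phlin] lin_0[OF br_lin_left] lin_0[OF br_lin_right] unfolding K_def by (auto simp: phbr[OF a])
  qed (auto simp: K_def)
  hence "K = {0} | K = V" by (rule ideal_cases[OF simple])
  moreover have "K ~= V" proof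
   assume KV: "K = V"
   obtain y where y: "y : V" "y ~= 0" using V_nonzero[OF simple] by blast
   obtain z where "z : V" "ph a z = y" using phsurj[OF a y(1)] by blast
   thus False using KV y(2) unfolding K_def by auto
  qed
  ultimately show ?thesis using x unfolding K_def by blast
 qed
 have phaut: "aut (ph a)" if a: "a ~= 0" for a unfolding aut_def proof (intro conjI ballI phlin pheven[OF a] phbr[OF a])
  have "inj_on (ph a) V" proof (rule inj_onI)
   fix x y assume xy: "x : V" "y : V" "ph a x = ph a y"
   hence "ph a (x - y) = 0" by (simp add: lin_diff[OF phlin])
   hence "x - y = 0" by (rule phker[OF a V_diff[OF xy(1,2)]])
   thus "x = y" by simp
  qed
  moreover have "ph a ` V = V" proof (intro equalityI image_subsetI subsetI linD(1)[OF phlin])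
   fix y assume "y : V"
   then obtain x where "x : V" "ph a x = y" using phsurj[OF a] by (meson bexE)
   thus "y : ph a ` V" by (intro image_eqI[of _ _ x]) simp_all
  qed
  ultimately show "bij_betw (ph a) V V" unfolding bij_betw_def by (rule conjI)
 qed
 \<comment> \<open>For \<open>ep = - 1\<close> the matching inverts the point, so rotation by the
   root of unity becomes the opposite rotation and \<open>t\<close> is replaced by its
   inverse.\<close>
 define Q where "Q = (if ep = 1 then t else ginv t)"
 have QG: "Q : G" unfolding Q_def using t(1) by simp
 have inter: "ph (ze m) (s x) = Q (ph 1 x)" if x: "x : V" for x proof -
  obtain u where u: "u : carrier ?A" "ev 1 u = x" using surjA[OF x, of 1] by auto
  note fu = F(1)[OF u(1)]
  have "s x = ev (ze m) u" using ev_rotate[where ze = ze and m = m, OF S r(4) u(1), of 1] u(2) by simp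
  hence 1: "ph (ze m) (s x) = ev (b (ze m)) (f u)" using phev[OF u(1) r(4)] unfolding ps_def by simp
  have 2: "ph 1 x = ev (b 1) (f u)" using phev[OF u(1), of 1] u(2) unfolding ps_def by simp
  have V: "ev (b (ze m)) (f u) : V" by (rule ev_V[OF loop_VL[OF fu]])
  show ?thesis proof (cases "ep = 1")
   case True
   have "b (ze m) = ze m * b 1" unfolding b_def True by simp
   hence "ev (b (ze m)) (f u) = t (ev (b 1) (f u))" using ev_rotate[where ze = ze and m = m, OF T r(4) fu b0, of 1] by simp
   thus ?thesis unfolding 1 2 Q_def using True by simp
  next
   case False
   hence "b 1 = ze m * b (ze m)" unfolding b_def using ep r(4) by (simp add: power_int_minus)
   hence "ev (b 1) (f u) = t (ev (b (ze m)) (f u))" using ev_rotate[where ze = ze and m = m, OF T r(4) fu b0[OF r(4)]] by simp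
   thus ?thesis unfolding 1 2 Q_def using False Aut_inv(1)[OF t(1) V] by simp
  qed
 qed
 define Ph where "Ph v = restrict (ph (unz (v ()))) V" for v :: "unit => 'k"
 have PhG: "Ph v : G" for v unfolding Ph_def by (rule restrict_G[OF phaut[OF unz(1)]])
 have fam: "regfam UNIV Ph" proof (rule regfam_cong[of _ "%v. ph (unz (v ()))"])
  show "regfam UNIV (%v. ph (unz (v ())))" unfolding regfam_def proof (intro conjI allI ballI phlin)
   fix x c assume x: "x : V"
   note fV = VL_lookup[OF loop_VL[OF F(1)[OF eA[OF x]]]]
   have "crd c (ph a x) = (SUM j<m. SUM i:ks (f (e j x)).
     ka powi i * crd c (lk (f (e j x)) i) * a powi (ep * i - int j))" if a: "a ~= 0" for a
    unfolding ph_def ps_def ev_def crd_sum'[OF V_scale[OF V_sum[OF V_scale[OF fV]]]] crd_scale[OF V_sum[OF V_scale[OF fV]]]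
     crd_sum'[OF V_scale[OF fV]] crd_scale[OF fV] sum_distrib_left b_def
    using a by (intro sum.cong refl) (simp add: power_int_mult_distrib power_int_mult[symmetric] power_int_diff divide_inverse mult_ac)
   hence "(%v::unit => 'k. crd c (ph (unz (v ())) x)) = (%v. SUM j<m. SUM i:ks (f (e j x)).
     ka powi i * crd c (lk (f (e j x)) i) * unz (v ()) powi (ep * i - int j))" using unz(1) by blast
   also have "... : laur UNIV" by (intro laur_sum laur.mult laur.const laur_powi) simp
   finally show "(%v::unit => 'k. crd c (ph (unz (v ())) x)) : laur UNIV" .
  qed
 qed (simp add: Ph_def)
 define X where "X = Ph (%_. ze m)"
 define Y where "Y = Ph (%_. 1)"
 have XG: "X : G" and YG: "Y : G" unfolding X_def Y_def using PhG by auto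
 have "connectedin (zariski L) (range Ph)" by (rule connected_range[OF fam PhG])
 hence "conn Y X" unfolding connected_component_of_def X_def Y_def by blast
 hence "conn (Y \<cdot> s) (X \<cdot> s)" using s(1) by (rule conn_translate(2))
 moreover have "X \<cdot> s = Q \<cdot> Y" proof (rule G_eqI)
  fix x assume x: "x : V"
  thus "(X \<cdot> s) x = (Q \<cdot> Y) x" using inter[OF x] unfolding Aut_mult[OF XG s(1) x] Aut_mult[OF QG YG x]
   by (simp add: X_def Y_def Ph_def G_V[OF s(1)] unz(3)[OF r(4)])
 qed (use XG YG QG s(1) in auto)
 ultimately have "conn (Y \<cdot> s) (Q \<cdot> Y)" by simp
 hence "conn (ginv Y \<cdot> (Y \<cdot> s)) (ginv Y \<cdot> (Q \<cdot> Y))" using YG by (intro conn_translate(1)) auto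
 hence "conn s (ginv Y \<cdot> Q \<cdot> ginv (ginv Y))" using YG QG s(1) by (simp add: AG.m_assoc[symmetric])
 thus ?thesis using YG unfolding Q_def by (intro bexI[of _ "ginv Y"]) (auto split: if_splits)
qed

end

theorem theorem4:
  fixes \<gg> :: "('k::{alg_closed_field, field_char_0}, 'a::ab_group_add) superalgebra"
    and \<zeta> :: "nat \<Rightarrow> 'k" and \<sigma>1 \<sigma>2 :: "'a \<Rightarrow> 'a" and m1 m2 :: nat
  assumes "simple_lie_superalgebra \<gg>" and "lie_superalgebra.finite_dim \<gg>"
    and "compatible_roots \<zeta>"
    and "\<sigma>1 \<in> carrier (Aut \<gg>)" and "m1 \<ge> 1" and "\<sigma>1 [^]\<^bsub>Aut \<gg>\<^esub> m1 = \<one>\<^bsub>Aut \<gg>\<^esub>"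
    and "\<sigma>2 \<in> carrier (Aut \<gg>)" and "m2 \<ge> 1" and "\<sigma>2 [^]\<^bsub>Aut \<gg>\<^esub> m2 = \<one>\<^bsub>Aut \<gg>\<^esub>"
  shows "sa_isomorphic (loop_algebra \<zeta> \<gg> \<sigma>1 m1) (loop_algebra \<zeta> \<gg> \<sigma>2 m2)
    \<longleftrightarrow> conjugate_in (comp_group \<gg>) (comp_class \<gg> \<sigma>1) (comp_class \<gg> \<sigma>2)
      \<or> conjugate_in (comp_group \<gg>) (comp_class \<gg> \<sigma>1) (inv\<^bsub>comp_group \<gg>\<^esub> comp_class \<gg> \<sigma>2)"
proof -
  interpret lie_superalgebra \<gg> using assms(1) unfolding simple_lie_superalgebra_def by blast
  interpret fd_lie_superalgebra \<gg> by unfold_locales (rule assms(2))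
  interpret AG: group "Aut \<gg>" by (rule group_Aut)
  note \<zeta> = assms(3)
  have period: "(s ^^ m) x = x" if "s \<in> G" "s [^]\<^bsub>Aut \<gg>\<^esub> m = \<one>\<^bsub>Aut \<gg>\<^esub>" "x \<in> V" for s x and m :: nat
    using Aut_pow[OF that(1,3), of m] Aut_one[OF that(3)] unfolding that(2) by simp
  have s1: "\<sigma>1 \<in> G" "\<And>x. x \<in> V \<Longrightarrow> (\<sigma>1 ^^ m1) x = x" "m1 \<ge> 1" using assms(4,5) period[OF assms(4,6)] by auto
  have s2: "\<sigma>2 \<in> G" "\<And>x. x \<in> V \<Longrightarrow> (\<sigma>2 ^^ m2) x = x" "m2 \<ge> 1" using assms(7,8) period[OF assms(7,9)] by auto
  let ?c = "\<lambda>h t. h \<otimes>\<^bsub>Aut \<gg>\<^esub> t \<otimes>\<^bsub>Aut \<gg>\<^esub> inv\<^bsub>Aut \<gg>\<^esub> h"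
  let ?inv = "inv\<^bsub>Aut \<gg>\<^esub> \<sigma>2"
  have "sa_isomorphic (loop \<zeta> \<sigma>1 m1) (loop \<zeta> \<sigma>2 m2) \<longleftrightarrow> (\<exists>h\<in>G. conn \<sigma>1 (?c h \<sigma>2) \<or> conn \<sigma>1 (?c h ?inv))"
  proof
    assume iso: "sa_isomorphic (loop \<zeta> \<sigma>1 m1) (loop \<zeta> \<sigma>2 m2)"
    \<comment> \<open>Both loop algebras are first brought to the common period
      \<open>m1 * m2\<close>, so that one root of unity rotates both.\<close>
    have "sa_isomorphic (loop \<zeta> \<sigma>1 m1) (loop \<zeta> \<sigma>1 (m2 * m1))" by (rule loop_period[OF \<zeta> s1 s2(3)])
    then have 1: "sa_isomorphic (loop \<zeta> \<sigma>1 (m2 * m1)) (loop \<zeta> \<sigma>1 m1)"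
      by (rule loop_iso_sym[where ze = \<zeta>, OF s1(1) rootsD(4)[OF \<zeta> s1(3)]])
    have 2: "sa_isomorphic (loop \<zeta> \<sigma>2 m2) (loop \<zeta> \<sigma>2 (m1 * m2))" by (rule loop_period[OF \<zeta> s2 s1(3)])
    have iso': "sa_isomorphic (loop \<zeta> \<sigma>1 (m1 * m2)) (loop \<zeta> \<sigma>2 (m1 * m2))"
      using sa_isomorphic_trans[OF sa_isomorphic_trans[OF 1 iso] 2] by (simp only: mult.commute[of m2])
    have pow: "((f ^^ a) ^^ b) x = x" if "\<And>x. x \<in> V \<Longrightarrow> (f ^^ a) x = x" "x \<in> V" for f x and a b :: nat
      using that by (induction b) auto
    have p1: "(\<sigma>1 ^^ (m1 * m2)) x = x" if "x \<in> V" for x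
      unfolding funpow_mult[symmetric] by (rule pow[OF s1(2) that])
    have p2: "(\<sigma>2 ^^ (m1 * m2)) x = x" if "x \<in> V" for x
      unfolding mult.commute[of m1] funpow_mult[symmetric] by (rule pow[OF s2(2) that])
    have "m1 * m2 \<ge> 1" using s1(3) s2(3) by simp
    then show "\<exists>h\<in>G. conn \<sigma>1 (?c h \<sigma>2) \<or> conn \<sigma>1 (?c h ?inv)"
      by (rule loop_iso_imp_conn[OF assms(1) \<zeta> _ s1(1) p1 s2(1) p2 iso'])
  next
    assume "\<exists>h\<in>G. conn \<sigma>1 (?c h \<sigma>2) \<or> conn \<sigma>1 (?c h ?inv)"
    then obtain h t where h: "h \<in> G" "t = ?c h \<sigma>2 \<or> t = ?c h ?inv" "conn \<sigma>1 t" by blast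
    show "sa_isomorphic (loop \<zeta> \<sigma>1 m1) (loop \<zeta> \<sigma>2 m2)" by (rule conn_imp_loop_iso[OF \<zeta> s1 s2 h])
  qed
  then show ?thesis
    unfolding inv_comp_class[OF s2(1)] conjugate_comp_iff[OF s1(1) s2(1)] conjugate_comp_iff[OF s1(1) AG.inv_closed[OF s2(1)]]
    by blast
qed

end
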